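(* Let $S=\{(\varrho(t),J(t)):t\in\mathbb{R}\}$ be a QHD-trajectory generated by a bounded energy solution $\psi$ of the Schrödinger equation $i\psi_t=-\frac12\Delta\psi+V(x)\psi$ on $\mathbb{R}^d_x\times\mathbb{R}_t$, i.e. $\varrho=|\psi|^2$, $J=\mathrm{Im}(\bar\psi\nabla\psi)$, and suppose $\psi\in C(\mathbb{R}^d_x\times\mathbb{R}_t)$. Suppose that for some $T\in\mathbb{R}$ the number $N$ of connected components of $$\Omega:=\{(x,t)\in\mathbb{R}^{d+1}:\varrho(x,t)\neq0\}\subseteq\mathbb{R}^{d+1}$$ is smaller than the number $N_T$ (possibly $\infty$) of connected components of $$\Lambda_T:=\{x\in\mathbb{R}^d:\varrho(x,T)\neq0\}\subseteq\mathbb{R}^d,$$ and that all connected components (of $\Omega$ in $\mathbb{R}^{d+1}$ and of $\Lambda_T$ in $\mathbb{R}^d$) have locally finite perimeter. Then $S$ is not trajectory-unique.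
   Context: Standing assumption: the real potential $V$ is in $C^{1,1}_{loc}(\mathbb{R}^d)$ and bounded from below, and such that $H:=-\frac12\Delta+V$ is essentially self-adjoint on $L^2(\mathbb{R}^d)$. A bounded energy solution of the Schrödinger equation is $\psi\in C(\mathbb{R}_t;L^2(\mathbb{R}^d_x))$ given by the unitary evolution generated by (the closure of) $H$ from a datum in $L^2(\mathbb{R}^d)$ whose energy $\frac12\int|\nabla\psi|^2dx+\int V|\psi|^2dx$ is finite (it is then constant in time, so that $\psi\in L^\infty(\mathbb{R}_t;H^1(\mathbb{R}^d_x))$). The QHD system is $$\varrho_t+\mathrm{div}J=0,\qquad J_t+\mathrm{div}\Big[\frac{J\otimes J}{\varrho}\Big]+\varrho\nabla V-\frac12\varrho\nabla\Big(\frac{\Delta\sqrt\varrho}{\sqrt\varrho}\Big)=0,$$ in the sense of distributions. Its solutions considered here are Schrödinger-generated: a solution-curve (QHD-trajectory) is a curve $\{(\varrho(t),J(t)):t\in\mathbb{R}\}$ in $C(\mathbb{R}_t;L^1(\mathbb{R}^d))\times\big(L^\infty(\mathbb{R}_t;L^1(\mathbb{R}^d))^d\cap C(\mathbb{R}_t;\mathcal{D}'(\mathbb{R}^d_x))^d\big)$ of the form $\varrho=|\psi|^2$, $J=\mathrm{Im}(\bar\psi\nabla\psi)$ with $\psi$ a bounded energy solution of the Schrödinger equation (such a pair is known to satisfy the QHD system in the sense of distributions). A solution-curve $\{(\varrho(t),J(t)):t\in\mathbb{R}\}$ is called trajectory-unique if for every other such solution-curve $\{(\sigma(t),I(t)):t\in\mathbb{R}\}$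 one has either $(\varrho,J)(t)\neq(\sigma,I)(t)$ for all $t\in\mathbb{R}$, or $(\varrho,J)(t)=(\sigma,I)(t)$ for all $t\in\mathbb{R}$. *)

theory Defs
  imports "HOL-Analysis.Analysis"
begin

section \<open>Differentiability classes and test functions\<close>

text \<open>Space is an arbitrary Euclidean space \<open>'a\<close>, so that the dimension is \<open>d = DIM('a) \<ge> 1\<close>;
  space-time is \<open>'a \<times> real\<close> with its Euclidean product structure.\<close>

definition partial :: "'a::euclidean_space \<Rightarrow> ('a \<Rightarrow> 'b::real_normed_vector) \<Rightarrow> 'a \<Rightarrow> 'b"
  where "partial b f x = frechet_derivative f (at x) b"

fun Ck :: "nat \<Rightarrow> ('a::euclidean_space \<Rightarrow> 'b::real_normed_vector) \<Rightarrow> bool"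
  where
    "Ck 0 f \<longleftrightarrow> continuous_on UNIV f"
  | "Ck (Suc k) f \<longleftrightarrow> (\<forall>x. f differentiable (at x)) \<and> (\<forall>b\<in>Basis. Ck k (partial b f))"

definition test_function :: "('a::euclidean_space \<Rightarrow> 'b::real_normed_vector) \<Rightarrow> bool"
  where "test_function \<phi> \<longleftrightarrow> (\<forall>k. Ck k \<phi>) \<and> compact (closure {x. \<phi> x \<noteq> 0})"

definition laplacian :: "('a::euclidean_space \<Rightarrow> 'b::real_normed_vector) \<Rightarrow> 'a \<Rightarrow> 'b"
  where "laplacian f x = (\<Sum>b\<in>Basis. partial b (partial b f) x)"

definition divergence :: "('a::euclidean_space \<Rightarrow> 'a) \<Rightarrow> 'a \<Rightarrow> real"
  where "divergence f x = (\<Sum>b\<in>Basis. partial b f x \<bullet> b)"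

definition C11_loc :: "('a::euclidean_space \<Rightarrow> real) \<Rightarrow> bool"
  where "C11_loc V \<longleftrightarrow>
    (\<exists>g. (\<forall>x. GDERIV V x :> g x) \<and> (\<forall>K. compact K \<longrightarrow> (\<exists>L. L-lipschitz_on K g)))"

section \<open>The Hilbert space of square-integrable functions and unbounded operators on it\<close>

text \<open>Elements of \<open>L\<^sup>2\<close> are represented by Borel functions; equality in \<open>L\<^sup>2\<close> is
  equality almost everywhere.\<close>

definition L2 :: "('a::euclidean_space \<Rightarrow> complex) set"
  where "L2 = {f. f \<in> borel_measurable lborel \<and> integrable lborel (\<lambda>x. (cmod (f x))\<^sup>2)}"

definition l2_inner :: "('a::euclidean_space \<Rightarrow> complex) \<Rightarrow> ('a \<Rightarrow> complex) \<Rightarrow> complex"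
  where "l2_inner f g = (LINT x|lborel. cnj (f x) * g x)"

definition l2_norm :: "('a::euclidean_space \<Rightarrow> complex) \<Rightarrow> real"
  where "l2_norm f = sqrt (LINT x|lborel. (cmod (f x))\<^sup>2)"

text \<open>An unbounded operator \<open>A\<close> is represented by its graph, the set of pairs \<open>(u, A u)\<close>.
  The closure and the adjoint are saturated under almost-everywhere equality in both
  components, so equality of such graphs as sets is equality of the operators on \<open>L\<^sup>2\<close>.\<close>

type_synonym 'a op_graph = "(('a \<Rightarrow> complex) \<times> ('a \<Rightarrow> complex)) set"

definition op_closure :: "'a::euclidean_space op_graph \<Rightarrow> 'a op_graph"
  where "op_closure A = {(u, w). u \<in> L2 \<and> w \<in> L2 \<and>
    (\<exists>p q. (\<forall>n::nat. (p n, q n) \<in> A)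
      \<and> (\<lambda>n. l2_norm (\<lambda>x. p n x - u x)) \<longlonglongrightarrow> 0
      \<and> (\<lambda>n. l2_norm (\<lambda>x. q n x - w x)) \<longlonglongrightarrow> 0)}"

definition op_adjoint :: "'a::euclidean_space op_graph \<Rightarrow> 'a op_graph"
  where "op_adjoint A = {(u, w). u \<in> L2 \<and> w \<in> L2 \<and>
    (\<forall>(f, h)\<in>A. l2_inner h u = l2_inner f w)}"

definition essentially_self_adjoint :: "'a::euclidean_space op_graph \<Rightarrow> bool"
  where "essentially_self_adjoint A \<longleftrightarrow> op_adjoint (op_closure A) = op_closure A"

definition hamiltonian :: "('a::euclidean_space \<Rightarrow> real) \<Rightarrow> 'a op_graph"
  where "hamiltonian V =
    {(\<phi>, \<lambda>x. - (1/2) * laplacian \<phi> x + complex_of_real (V x) * \<phi> x) | \<phi>. test_function \<phi>}"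

definition unitary_group :: "(real \<Rightarrow> ('a::euclidean_space \<Rightarrow> complex) \<Rightarrow> 'a \<Rightarrow> complex) \<Rightarrow> bool"
  where "unitary_group U \<longleftrightarrow>
    (\<forall>t. \<forall>f\<in>L2. U t f \<in> L2)
    \<and> (\<forall>t. \<forall>f\<in>L2. \<forall>g\<in>L2. \<forall>a c.
        AE x in lborel. U t (\<lambda>y. a * f y + c * g y) x = a * U t f x + c * U t g x)
    \<and> (\<forall>t. \<forall>f\<in>L2. \<forall>g\<in>L2. l2_inner (U t f) (U t g) = l2_inner f g)
    \<and> (\<forall>f\<in>L2. AE x in lborel. U 0 f x = f x)
    \<and> (\<forall>s t. \<forall>f\<in>L2. AE x in lborel. U (s + t) f x = U s (U t f) x)
    \<and> (\<forall>f\<in>L2. ((\<lambda>t. l2_norm (\<lambda>x. U t f x - f x)) \<longlongrightarrow> 0) (at 0))"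

text \<open>The self-adjoint operator \<open>A\<close> with \<open>U t = exp (- \<i> t A)\<close>, i.e. \<open>A u = \<i> (d/dt) U t u\<close>
  at \<open>t = 0\<close>, its domain being the set of all \<open>u\<close> for which this derivative exists in \<open>L\<^sup>2\<close>.\<close>

definition generator :: "(real \<Rightarrow> ('a::euclidean_space \<Rightarrow> complex) \<Rightarrow> 'a \<Rightarrow> complex) \<Rightarrow> 'a op_graph"
  where "generator U = {(u, w). u \<in> L2 \<and> w \<in> L2 \<and>
    ((\<lambda>h. l2_norm (\<lambda>x. \<i> * ((U h u x - u x) / complex_of_real h) - w x)) \<longlongrightarrow> 0) (at 0)}"

section \<open>Bounded energy solutions\<close>

text \<open>\<open>G b\<close> is the weak partial derivative of \<open>u\<close> in the direction of the basis vector \<open>b\<close>;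
  \<open>u \<in> H\<^sup>1\<close> iff some \<open>G\<close> satisfies this predicate.\<close>

definition H1_gradient :: "('a::euclidean_space \<Rightarrow> complex) \<Rightarrow> ('a \<Rightarrow> 'a \<Rightarrow> complex) \<Rightarrow> bool"
  where "H1_gradient u G \<longleftrightarrow> u \<in> L2 \<and>
    (\<forall>b\<in>Basis. G b \<in> L2 \<and>
      (\<forall>\<phi>. test_function \<phi> \<longrightarrow>
        (LINT x|lborel. u x * partial b \<phi> x) = - (LINT x|lborel. G b x * \<phi> x)))"

text \<open>For \<open>u \<in> L\<^sup>2\<close> and \<open>V\<close> bounded from below, both terms of the energy are well defined in
  \<open>(-\<infinity>, \<infinity>]\<close>, so their sum is finite iff both terms are.\<close>

definition finite_energy :: "('a::euclidean_space \<Rightarrow> real) \<Rightarrow> ('a \<Rightarrow> complex) \<Rightarrow> bool"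
  where "finite_energy V u \<longleftrightarrow>
    (\<exists>G. H1_gradient u G) \<and> integrable lborel (\<lambda>x. V x * (cmod (u x))\<^sup>2)"

definition bounded_energy_solution ::
    "('a::euclidean_space \<Rightarrow> real) \<Rightarrow> (real \<Rightarrow> 'a \<Rightarrow> complex) \<Rightarrow> bool"
  where "bounded_energy_solution V \<psi> \<longleftrightarrow>
    (\<exists>U u\<^sub>0. unitary_group U \<and> generator U = op_closure (hamiltonian V)
      \<and> u\<^sub>0 \<in> L2 \<and> finite_energy V u\<^sub>0
      \<and> (\<forall>t. \<psi> t \<in> L2 \<and> (AE x in lborel. \<psi> t x = U t u\<^sub>0 x)))"

section \<open>QHD-trajectories\<close>

text \<open>\<open>j = Im (cnj u * \<nabla>u)\<close> almost everywhere, with the weak gradient of \<open>u\<close>.\<close>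

definition is_current :: "('a::euclidean_space \<Rightarrow> complex) \<Rightarrow> ('a \<Rightarrow> 'a) \<Rightarrow> bool"
  where "is_current u j \<longleftrightarrow> j \<in> borel_measurable lborel \<and>
    (\<exists>G. H1_gradient u G
      \<and> (AE x in lborel. j x = (\<Sum>b\<in>Basis. Im (cnj (u x) * G b x) *\<^sub>R b)))"

definition continuous_into_L1 :: "(real \<Rightarrow> 'a::euclidean_space \<Rightarrow> real) \<Rightarrow> bool"
  where "continuous_into_L1 F \<longleftrightarrow> (\<forall>t. integrable lborel (F t)) \<and>
    (\<forall>t. ((\<lambda>s. LINT x|lborel. \<bar>F s x - F t x\<bar>) \<longlongrightarrow> 0) (at t))"

text \<open>\<open>F \<in> L\<^sup>\<infinity>(\<real>; L\<^sup>1)\<close>: strongly (Bochner) measurable and essentially bounded.\<close>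

definition bounded_into_L1 ::
    "(real \<Rightarrow> 'a::euclidean_space \<Rightarrow> 'b::euclidean_space) \<Rightarrow> bool"
  where "bounded_into_L1 F \<longleftrightarrow> (AE t in lborel. integrable lborel (F t))
    \<and> (\<exists>s. (\<forall>n::nat. simple_function lborel (s n) \<and> (\<forall>t. integrable lborel (s n t)))
        \<and> (AE t in lborel. (\<lambda>n. LINT x|lborel. norm (s n t x - F t x)) \<longlonglongrightarrow> 0))
    \<and> (\<exists>C. AE t in lborel. (LINT x|lborel. norm (F t x)) \<le> C)"

definition continuous_into_distributions ::
    "(real \<Rightarrow> 'a::euclidean_space \<Rightarrow> 'b::euclidean_space) \<Rightarrow> bool"
  where "continuous_into_distributions F \<longleftrightarrow>
    (\<forall>\<phi> :: 'a \<Rightarrow> real. test_function \<phi> \<longrightarrow>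
      (\<forall>t. integrable lborel (\<lambda>x. \<phi> x *\<^sub>R F t x))
      \<and> continuous_on UNIV (\<lambda>t. LINT x|lborel. \<phi> x *\<^sub>R F t x))"

definition qhd_trajectory_of ::
    "('a::euclidean_space \<Rightarrow> real) \<Rightarrow> (real \<Rightarrow> 'a \<Rightarrow> complex)
      \<Rightarrow> (real \<Rightarrow> 'a \<Rightarrow> real) \<Rightarrow> (real \<Rightarrow> 'a \<Rightarrow> 'a) \<Rightarrow> bool"
  where "qhd_trajectory_of V \<psi> \<rho> J \<longleftrightarrow>
    bounded_energy_solution V \<psi>
    \<and> continuous_into_L1 \<rho> \<and> bounded_into_L1 J \<and> continuous_into_distributions J
    \<and> (\<forall>t. (AE x in lborel. \<rho> t x = (cmod (\<psi> t x))\<^sup>2) \<and> is_current (\<psi> t) (J t))"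

definition qhd_trajectory ::
    "('a::euclidean_space \<Rightarrow> real) \<Rightarrow> (real \<Rightarrow> 'a \<Rightarrow> real) \<Rightarrow> (real \<Rightarrow> 'a \<Rightarrow> 'a) \<Rightarrow> bool"
  where "qhd_trajectory V \<rho> J \<longleftrightarrow> (\<exists>\<psi>. qhd_trajectory_of V \<psi> \<rho> J)"

definition same_state ::
    "('a::euclidean_space \<Rightarrow> real) \<Rightarrow> ('a \<Rightarrow> 'a) \<Rightarrow> ('a \<Rightarrow> real) \<Rightarrow> ('a \<Rightarrow> 'a) \<Rightarrow> bool"
  where "same_state r j s i \<longleftrightarrow> (AE x in lborel. r x = s x) \<and> (AE x in lborel. j x = i x)"

definition trajectory_unique ::
    "('a::euclidean_space \<Rightarrow> real) \<Rightarrow> (real \<Rightarrow> 'a \<Rightarrow> real) \<Rightarrow> (real \<Rightarrow> 'a \<Rightarrow> 'a) \<Rightarrow> bool"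
  where "trajectory_unique V \<rho> J \<longleftrightarrow>
    (\<forall>\<sigma> I. qhd_trajectory V \<sigma> I \<longrightarrow>
      (\<forall>t. \<not> same_state (\<rho> t) (J t) (\<sigma> t) (I t)) \<or> (\<forall>t. same_state (\<rho> t) (J t) (\<sigma> t) (I t)))"

section \<open>Sets of locally finite perimeter\<close>

definition locally_finite_perimeter :: "'a::euclidean_space set \<Rightarrow> bool"
  where "locally_finite_perimeter E \<longleftrightarrow> E \<in> sets lebesgue \<and>
    (\<forall>K. compact K \<longrightarrow>
      bdd_above {LINT x:E|lebesgue. divergence \<phi> x | \<phi> :: 'a \<Rightarrow> 'a.
        Ck 1 \<phi> \<and> {x. \<phi> x \<noteq> 0} \<subseteq> K \<and> (\<forall>x. norm (\<phi> x) \<le> 1)})"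

end

theory Submission
  imports Defs
begin

text \<open>By counting, two components \<open>C\<close> and \<open>C'\<close> of \<open>\<Lambda>\<^sub>T\<close> lie in the same component \<open>K\<close> of \<open>\<Omega>\<close>. Changing the sign of
  \<open>\<psi>(T)\<close> on \<open>C\<close> alone keeps density and current at time \<open>T\<close>, and the new datum has finite energy because the restriction
  of a continuous \<open>H\<^sup>1\<close> function to a component of its support is again in \<open>H\<^sup>1\<close>. Its evolution generates a second
  trajectory: test functions form a core of the energy form, hence the form domain is invariant under the
  group and the form is conserved. If the two trajectories agreed at all times, the quotient of the two wave functions
  would be locally constant on \<open>\<Omega>\<close>: equal densities and currents make its spatial gradient vanish, and then the
  locality of the Hamiltonian makes its time derivative vanish. So it would be constant on \<open>K\<close>, but at time \<open>T\<close>
  it equals \<open>-1\<close> on \<open>C\<close> and \<open>1\<close> on \<open>C'\<close>.\<close>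

section \<open>Square-integrable functions\<close>

text \<open>The wave function of the second trajectory is known only as a class in \<open>L2\<close>
  for each time, without continuity in space-time. Hence the quotient is only ever shown to be
  constant almost everywhere on small balls, and a time derivative is available only after pairing
  with a test function, where the group can be moved onto the smooth factor. For the restriction to
  a component, the cut-off acts on the values of \<open>\<psi>\<close> and not on space: small
  values are suppressed near every zero of a continuous function, and the indicator jumps only at
  zeros. Conservation of the form is immediate on the domain of the generator, where the form is an
  inner product with the operator. The datum with the changed sign is only known to have finite
  energy, which is why density in the form norm, and not merely in \<open>L2\<close>, is required.
  The potential is shifted by a constant so as to be at least 1, and then the form controls the
  \<open>L2\<close> norm.\<close>

lemma L2_D:
  assumes "f \<in> L2"
  shows "f \<in> borel_measurable borel" "integrable lborel (\<lambda>x. (cmod (f x))\<^sup>2)"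
  using assms by (auto simp: L2_def)

lemma l2_norm_nonneg [simp]: "0 \<le> l2_norm f"
  by (simp add: l2_norm_def)

lemma l2_norm_power2: "(l2_norm f)\<^sup>2 = (LINT x|lborel. (cmod (f x))\<^sup>2)"
  by (simp add: l2_norm_def)

lemma nn_integral_power2_L2:
  assumes "f \<in> L2"
  shows "(\<integral>\<^sup>+x. ennreal ((cmod (f x))\<^sup>2) \<partial>lborel) = ennreal ((l2_norm f)\<^sup>2)"
  using nn_integral_eq_integral[of lborel "\<lambda>x. (cmod (f x))\<^sup>2"] L2_D(2)[OF assms]
  by (simp add: l2_norm_power2)

text \<open>The extended integral needs no prior integrability, so one inequality yields membership
  and the norm bound together; Fatou, domination and Tonelli arguments end in this form.\<close>

lemma L2_nn_integral_bound:
  assumes f: "f \<in> borel_measurable borel" and C: "0 \<le> C"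
    and le: "(\<integral>\<^sup>+x. ennreal ((cmod (f x))\<^sup>2) \<partial>lborel) \<le> ennreal (C\<^sup>2)"
  shows "f \<in> L2" "l2_norm f \<le> C"
proof -
  have i: "integrable lborel (\<lambda>x. (cmod (f x))\<^sup>2)"
  proof (rule integrableI_bounded)
    show "(\<lambda>x. (cmod (f x))\<^sup>2) \<in> borel_measurable lborel"
      using f by measurable
    show "(\<integral>\<^sup>+x. ennreal (norm ((cmod (f x))\<^sup>2)) \<partial>lborel) < \<infinity>"
      using le by (simp add: order_le_less_trans[OF _ ennreal_less_top])
  qed
  then show m: "f \<in> L2"
    using f by (simp add: L2_def)
  have "ennreal ((l2_norm f)\<^sup>2) \<le> ennreal (C\<^sup>2)"
    using le nn_integral_power2_L2[OF m] by simp
  then have "(l2_norm f)\<^sup>2 \<le> C\<^sup>2"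
    by (rule iffD1[OF ennreal_le_iff[OF zero_le_power2]])
  then show "l2_norm f \<le> C"
    using C by (rule power2_le_imp_le)
qed

lemma L2_dominated:
  assumes g: "g \<in> L2" and f: "f \<in> borel_measurable borel" and C: "0 \<le> C"
    and le: "AE x in lborel. cmod (f x) \<le> C * cmod (g x)"
  shows "f \<in> L2" "l2_norm f \<le> C * l2_norm g"
proof -
  have "(\<integral>\<^sup>+x. ennreal ((cmod (f x))\<^sup>2) \<partial>lborel) \<le> (\<integral>\<^sup>+x. ennreal (C\<^sup>2) * ennreal ((cmod (g x))\<^sup>2) \<partial>lborel)"
    using le
    by (intro nn_integral_mono_AE) (auto simp: ennreal_mult'[symmetric] power_mult_distrib[symmetric] intro!: power_mono)
  also have "\<dots> = ennreal (C\<^sup>2) * ennreal ((l2_norm g)\<^sup>2)"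
    using L2_D[OF g] by (subst nn_integral_cmult) (auto simp: nn_integral_power2_L2[OF g])
  also have "\<dots> = ennreal ((C * l2_norm g)\<^sup>2)"
    by (simp add: ennreal_mult'[symmetric] power_mult_distrib)
  finally have *: "(\<integral>\<^sup>+x. ennreal ((cmod (f x))\<^sup>2) \<partial>lborel) \<le> ennreal ((C * l2_norm g)\<^sup>2)" .
  show "f \<in> L2" "l2_norm f \<le> C * l2_norm g"
    using L2_nn_integral_bound[OF f _ *] C by auto
qed

lemma l2_norm_cong_AE:
  assumes "f \<in> borel_measurable borel" "g \<in> borel_measurable borel" "AE x in lborel. cmod (f x) = cmod (g x)"
  shows "l2_norm f = l2_norm g"
proof -
  have "(LINT x|lborel. (cmod (f x))\<^sup>2) = (LINT x|lborel. (cmod (g x))\<^sup>2)"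
    using assms by (intro integral_cong_AE) auto
  then show ?thesis by (simp add: l2_norm_def)
qed

lemma L2_cong_AE:
  assumes "f \<in> L2" "g \<in> borel_measurable borel" "AE x in lborel. g x = f x"
  shows "g \<in> L2"
proof (rule L2_dominated(1)[OF assms(1,2), of 1])
  show "AE x in lborel. cmod (g x) \<le> 1 * cmod (f x)"
    using assms(3) by eventually_elim simp
qed simp

lemma L2_zero [simp]: "(\<lambda>x. 0) \<in> L2"
  by (simp add: L2_def)

lemma L2_add [intro]:
  assumes "f \<in> L2" "g \<in> L2"
  shows "(\<lambda>x. f x + g x) \<in> L2"
proof -
  have "integrable lborel (\<lambda>x. (cmod (f x + g x))\<^sup>2)"
  proof (rule Bochner_Integration.integrable_bound)
    show "integrable lborel (\<lambda>x. 2 * (cmod (f x))\<^sup>2 + 2 * (cmod (g x))\<^sup>2)"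
      using L2_D(2)[OF assms(1)] L2_D(2)[OF assms(2)] by auto
    show "(\<lambda>x. (cmod (f x + g x))\<^sup>2) \<in> borel_measurable lborel"
      using L2_D(1)[OF assms(1)] L2_D(1)[OF assms(2)] by measurable
    have "(cmod (f x + g x))\<^sup>2 \<le> 2 * (cmod (f x))\<^sup>2 + 2 * (cmod (g x))\<^sup>2" for x
    proof -
      have "(cmod (f x + g x))\<^sup>2 \<le> (cmod (f x) + cmod (g x))\<^sup>2"
        by (intro power_mono norm_triangle_ineq) auto
      also have "\<dots> \<le> 2 * (cmod (f x))\<^sup>2 + 2 * (cmod (g x))\<^sup>2"
        using zero_le_power2[of "cmod (f x) - cmod (g x)"] by (simp add: power2_eq_square algebra_simps)
      finally show ?thesis .
    qed
    then show "AE x in lborel. norm ((cmod (f x + g x))\<^sup>2) \<le> norm (2 * (cmod (f x))\<^sup>2 + 2 * (cmod (g x))\<^sup>2)"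
      by (intro AE_I2) auto
  qed
  then show ?thesis
    using assms by (auto simp: L2_def)
qed

lemma L2_cmult [intro]:
  assumes "f \<in> L2"
  shows "(\<lambda>x. c * f x) \<in> L2"
  using L2_dominated(1)[OF assms, of "\<lambda>x. c * f x" "cmod c"] L2_D(1)[OF assms] by (auto simp: norm_mult)

lemma l2_norm_cmult: "l2_norm (\<lambda>x. c * f x) = cmod c * l2_norm f"
  by (simp add: l2_norm_def norm_mult power_mult_distrib real_sqrt_mult)

lemma L2_uminus [intro]: "f \<in> L2 \<Longrightarrow> (\<lambda>x. - f x) \<in> L2"
  using L2_cmult[of f "-1"] by simp

lemma L2_diff [intro]: "f \<in> L2 \<Longrightarrow> g \<in> L2 \<Longrightarrow> (\<lambda>x. f x - g x) \<in> L2"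
  using L2_add[of f "\<lambda>x. - g x"] L2_uminus[of g] by simp

lemma borel_measurable_cnj [measurable]: "cnj \<in> borel_measurable borel"
  by (intro borel_measurable_continuous_onI continuous_intros)

lemma L2_cnj [intro]: "f \<in> L2 \<Longrightarrow> (\<lambda>x. cnj (f x)) \<in> L2"
  by (rule L2_dominated(1)[of f _ 1]) (auto intro: measurable_compose[OF L2_D(1)])

lemma L2_mult_bounded:
  assumes "f \<in> L2" "c \<in> borel_measurable borel" "\<And>x. cmod (c x) \<le> C"
  shows "(\<lambda>x. c x * f x) \<in> L2" "l2_norm (\<lambda>x. c x * f x) \<le> C * l2_norm f"
proof -
  have C: "0 \<le> C"
    using assms(3)[of undefined] norm_ge_zero order_trans by blast
  have m: "(\<lambda>x. c x * f x) \<in> borel_measurable borel"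
    using assms(2) L2_D(1)[OF assms(1)] by (rule borel_measurable_times)
  have "cmod (c x * f x) \<le> C * cmod (f x)" for x
    unfolding norm_mult by (intro mult_right_mono assms(3) norm_ge_zero)
  then have "AE x in lborel. cmod (c x * f x) \<le> C * cmod (f x)"
    by (intro AE_I2)
  then show "(\<lambda>x. c x * f x) \<in> L2" "l2_norm (\<lambda>x. c x * f x) \<le> C * l2_norm f"
    using L2_dominated[OF assms(1) m C] by auto
qed

section \<open>Products, the Cauchy-Schwarz inequality and the triangle inequality\<close>

lemma L2_norm_mult_integrable:
  assumes "f \<in> L2" "g \<in> L2"
  shows "integrable lborel (\<lambda>x. cmod (f x) * cmod (g x))"
proof (rule Bochner_Integration.integrable_bound)
  show "integrable lborel (\<lambda>x. (cmod (f x))\<^sup>2 + (cmod (g x))\<^sup>2)"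
    using L2_D(2)[OF assms(1)] L2_D(2)[OF assms(2)] by auto
  show "(\<lambda>x. cmod (f x) * cmod (g x)) \<in> borel_measurable lborel"
    using L2_D(1)[OF assms(1)] L2_D(1)[OF assms(2)] by measurable
  have "cmod (f x) * cmod (g x) \<le> (cmod (f x))\<^sup>2 + (cmod (g x))\<^sup>2" for x
    using sum_squares_bound[of "cmod (f x)" "cmod (g x)"] zero_le_power2[of "cmod (f x)"] zero_le_power2[of "cmod (g x)"]
      mult_nonneg_nonneg[OF norm_ge_zero[of "f x"] norm_ge_zero[of "g x"]] by linarith
  then show "AE x in lborel. norm (cmod (f x) * cmod (g x)) \<le> norm ((cmod (f x))\<^sup>2 + (cmod (g x))\<^sup>2)"
    by (intro AE_I2) (auto simp: abs_mult)
qed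

lemma L2_mult_integrable:
  assumes "f \<in> L2" "g \<in> L2"
  shows "integrable lborel (\<lambda>x. f x * g x)"
  using L2_norm_mult_integrable[OF assms]
proof (rule Bochner_Integration.integrable_bound)
  show "(\<lambda>x. f x * g x) \<in> borel_measurable lborel"
    using L2_D(1)[OF assms(1)] L2_D(1)[OF assms(2)] by measurable
qed (auto simp: norm_mult)

lemma L2_cauchy_schwarz_norm:
  assumes "f \<in> L2" "g \<in> L2"
  shows "(LINT x|lborel. cmod (f x) * cmod (g x)) \<le> l2_norm f * l2_norm g"
proof -
  let ?I = "LINT x|lborel. cmod (f x) * cmod (g x)"
  have I: "0 \<le> ?I"
    by (intro Bochner_Integration.integral_nonneg) auto
  have "(\<integral>\<^sup>+x. ennreal (cmod (f x)) * ennreal (cmod (g x)) \<partial>lborel)\<^sup>2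
      \<le> (\<integral>\<^sup>+x. (ennreal (cmod (f x)))\<^sup>2 \<partial>lborel) * (\<integral>\<^sup>+x. (ennreal (cmod (g x)))\<^sup>2 \<partial>lborel)"
    using L2_D(1)[OF assms(1)] L2_D(1)[OF assms(2)] by (intro Cauchy_Schwarz_nn_integral) auto
  also have "(\<integral>\<^sup>+x. ennreal (cmod (f x)) * ennreal (cmod (g x)) \<partial>lborel) = ennreal ?I"
    using nn_integral_eq_integral[OF L2_norm_mult_integrable[OF assms]] by (simp add: ennreal_mult')
  also have "(\<integral>\<^sup>+x. (ennreal (cmod (f x)))\<^sup>2 \<partial>lborel) = ennreal ((l2_norm f)\<^sup>2)"
    using nn_integral_power2_L2[OF assms(1)] by (simp add: ennreal_power)
  also have "(\<integral>\<^sup>+x. (ennreal (cmod (g x)))\<^sup>2 \<partial>lborel) = ennreal ((l2_norm g)\<^sup>2)"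
    using nn_integral_power2_L2[OF assms(2)] by (simp add: ennreal_power)
  also have "ennreal ((l2_norm f)\<^sup>2) * ennreal ((l2_norm g)\<^sup>2) = ennreal ((l2_norm f * l2_norm g)\<^sup>2)"
    by (simp add: ennreal_mult'[symmetric] power_mult_distrib)
  finally have "?I\<^sup>2 \<le> (l2_norm f * l2_norm g)\<^sup>2"
    using I by (simp add: ennreal_power)
  then show ?thesis
    by (rule power2_le_imp_le) auto
qed

lemma L2_cauchy_schwarz:
  assumes "f \<in> L2" "g \<in> L2"
  shows "cmod (LINT x|lborel. f x * g x) \<le> l2_norm f * l2_norm g"
proof -
  have "cmod (LINT x|lborel. f x * g x) \<le> (LINT x|lborel. cmod (f x * g x))"
    by (rule integral_norm_bound)
  also have "\<dots> \<le> l2_norm f * l2_norm g"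
    using L2_cauchy_schwarz_norm[OF assms] by (simp add: norm_mult)
  finally show ?thesis .
qed

lemma l2_norm_cnj [simp]: "l2_norm (\<lambda>x. cnj (f x)) = l2_norm f"
  by (simp add: l2_norm_def)

lemma l2_inner_bound:
  assumes "f \<in> L2" "g \<in> L2"
  shows "cmod (l2_inner f g) \<le> l2_norm f * l2_norm g"
  using L2_cauchy_schwarz[OF L2_cnj[OF assms(1)] assms(2)] by (simp add: l2_inner_def)

lemma l2_norm_triangle:
  assumes "f \<in> L2" "g \<in> L2"
  shows "l2_norm (\<lambda>x. f x + g x) \<le> l2_norm f + l2_norm g"
proof -
  have i: "integrable lborel (\<lambda>x. (cmod (f x))\<^sup>2 + 2 * (cmod (f x) * cmod (g x)) + (cmod (g x))\<^sup>2)"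
    using L2_D(2)[OF assms(1)] L2_D(2)[OF assms(2)] L2_norm_mult_integrable[OF assms] by auto
  have "(l2_norm (\<lambda>x. f x + g x))\<^sup>2 = (LINT x|lborel. (cmod (f x + g x))\<^sup>2)"
    by (simp add: l2_norm_power2)
  also have "\<dots> \<le> (LINT x|lborel. (cmod (f x))\<^sup>2 + 2 * (cmod (f x) * cmod (g x)) + (cmod (g x))\<^sup>2)"
  proof (rule integral_mono)
    show "integrable lborel (\<lambda>x. (cmod (f x + g x))\<^sup>2)"
      using L2_D(2)[OF L2_add[OF assms]] .
    fix x
    have "(cmod (f x + g x))\<^sup>2 \<le> (cmod (f x) + cmod (g x))\<^sup>2"
      by (intro power_mono norm_triangle_ineq) auto
    then show "(cmod (f x + g x))\<^sup>2 \<le> (cmod (f x))\<^sup>2 + 2 * (cmod (f x) * cmod (g x)) + (cmod (g x))\<^sup>2"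
      by (simp add: power2_eq_square algebra_simps)
  qed (rule i)
  also have "\<dots> = (l2_norm f)\<^sup>2 + 2 * (LINT x|lborel. cmod (f x) * cmod (g x)) + (l2_norm g)\<^sup>2"
    using L2_D(2)[OF assms(1)] L2_D(2)[OF assms(2)] L2_norm_mult_integrable[OF assms] by (simp add: l2_norm_power2)
  also have "\<dots> \<le> (l2_norm f + l2_norm g)\<^sup>2"
    using L2_cauchy_schwarz_norm[OF assms] unfolding power2_sum by linarith
  finally show ?thesis
    by (rule power2_le_imp_le) auto
qed

lemma l2_norm_minus_commute: "l2_norm (\<lambda>x. f x - g x) = l2_norm (\<lambda>x. g x - f x)"
  by (simp add: l2_norm_def norm_minus_commute)

lemma l2_norm_triangle_diff:
  assumes "f \<in> L2" "g \<in> L2" "h \<in> L2"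
  shows "l2_norm (\<lambda>x. f x - h x) \<le> l2_norm (\<lambda>x. f x - g x) + l2_norm (\<lambda>x. g x - h x)"
  using l2_norm_triangle[of "\<lambda>x. f x - g x" "\<lambda>x. g x - h x"] assms by auto

lemma l2_norm_le_add:
  assumes "f \<in> L2" "g \<in> L2"
  shows "l2_norm f \<le> l2_norm (\<lambda>x. f x - g x) + l2_norm g"
  using l2_norm_triangle_diff[of f g "\<lambda>x. 0"] assms by auto

lemma l2_norm_eq_0_AE:
  assumes "f \<in> L2" "l2_norm f = 0"
  shows "AE x in lborel. f x = 0"
proof -
  have "(LINT x|lborel. (cmod (f x))\<^sup>2) = 0"
    using assms(2) l2_norm_power2[of f] by simp
  then show ?thesis
    using integral_nonneg_eq_0_iff_AE[of lborel "\<lambda>x. (cmod (f x))\<^sup>2"] L2_D(2)[OF assms(1)] by auto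
qed

lemma l2_inner_diff_right:
  assumes "f \<in> L2" "g \<in> L2" "h \<in> L2"
  shows "l2_inner f (\<lambda>x. g x - h x) = l2_inner f g - l2_inner f h"
  using L2_mult_integrable[OF L2_cnj[OF assms(1)] assms(2)] L2_mult_integrable[OF L2_cnj[OF assms(1)] assms(3)]
  by (simp add: l2_inner_def algebra_simps)

lemma l2_inner_diff_left:
  assumes "f \<in> L2" "g \<in> L2" "h \<in> L2"
  shows "l2_inner (\<lambda>x. f x - g x) h = l2_inner f h - l2_inner g h"
  using L2_mult_integrable[OF L2_cnj[OF assms(1)] assms(3)] L2_mult_integrable[OF L2_cnj[OF assms(2)] assms(3)]
  by (simp add: l2_inner_def algebra_simps)

lemma l2_inner_self: "l2_inner f f = complex_of_real ((l2_norm f)\<^sup>2)"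
proof -
  have "l2_inner f f = (LINT x|lborel. complex_of_real ((cmod (f x))\<^sup>2))"
    unfolding l2_inner_def by (intro Bochner_Integration.integral_cong refl) (simp only: complex_norm_square mult.commute)
  then show ?thesis unfolding l2_norm_power2 integral_complex_of_real .
qed

lemma l2_inner_cong_AE:
  assumes "f \<in> borel_measurable borel" "f' \<in> borel_measurable borel"
    "g \<in> borel_measurable borel" "g' \<in> borel_measurable borel"
    "AE x in lborel. f x = f' x" "AE x in lborel. g x = g' x"
  shows "l2_inner f g = l2_inner f' g'"
  unfolding l2_inner_def
proof (rule integral_cong_AE)
  show "AE x in lborel. cnj (f x) * g x = cnj (f' x) * g' x"
    using assms(5,6) by eventually_elim simp
qed (use assms in measurable)

text \<open>Fatou's lemma for the squared moduli. The limit function is only assumed measurable: its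
  square integrability is part of the conclusion, as the completeness proof requires.\<close>

lemma L2_fatou:
  assumes p: "\<And>n::nat. p n \<in> L2" and b: "\<And>n. l2_norm (p n) \<le> C"
    and u: "u \<in> borel_measurable borel" and lim: "AE x in lborel. (\<lambda>n. p n x) \<longlonglongrightarrow> u x"
  shows "u \<in> L2" "l2_norm u \<le> C"
proof -
  have C: "0 \<le> C"
    using b[of 0] l2_norm_nonneg[of "p 0"] by linarith
  have "(\<integral>\<^sup>+x. ennreal ((cmod (u x))\<^sup>2) \<partial>lborel) = (\<integral>\<^sup>+x. liminf (\<lambda>n. ennreal ((cmod (p n x))\<^sup>2)) \<partial>lborel)"
  proof (rule nn_integral_cong_AE)
    show "AE x in lborel. ennreal ((cmod (u x))\<^sup>2) = liminf (\<lambda>n. ennreal ((cmod (p n x))\<^sup>2))"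
      using lim
    proof eventually_elim
      case (elim x)
      then have "(\<lambda>n. ennreal ((cmod (p n x))\<^sup>2)) \<longlonglongrightarrow> ennreal ((cmod (u x))\<^sup>2)"
        by (intro tendsto_intros) auto
      from lim_imp_Liminf[OF sequentially_bot this] show ?case
        by (rule sym)
    qed
  qed
  also have "\<dots> \<le> liminf (\<lambda>n. \<integral>\<^sup>+x. ennreal ((cmod (p n x))\<^sup>2) \<partial>lborel)"
    using L2_D(1)[OF p] by (intro nn_integral_liminf) auto
  also have "\<dots> = liminf (\<lambda>n. ennreal ((l2_norm (p n))\<^sup>2))"
    by (simp add: nn_integral_power2_L2[OF p])
  also have "\<dots> \<le> ennreal (C\<^sup>2)"
    by (rule Liminf_le) (auto simp: b intro!: always_eventually power_mono)
  finally have *: "(\<integral>\<^sup>+x. ennreal ((cmod (u x))\<^sup>2) \<partial>lborel) \<le> ennreal (C\<^sup>2)" .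
  show "u \<in> L2" "l2_norm u \<le> C"
    using L2_nn_integral_bound[OF u C *] by auto
qed

text \<open>Multiplication by such a weight maps \<open>L2\<close> Cauchy sequences to
  \<open>L1\<close> Cauchy sequences, by Cauchy-Schwarz, and loses no information since the weight
  never vanishes. It is the square root of a positive integrable function, which exists by
  sigma-finiteness.\<close>

lemma exists_positive_L2:
  "\<exists>w :: 'a::euclidean_space \<Rightarrow> complex. w \<in> L2 \<and> (\<forall>x. w x \<noteq> 0)"
proof -
  obtain h :: "'a \<Rightarrow> ennreal" where h: "h \<in> borel_measurable lborel" "integral\<^sup>N lborel h \<noteq> \<infinity>"
    "\<forall>x\<in>space lborel. 0 < h x \<and> h x < \<infinity>"
    using sigma_finite_measure.Ex_finite_integrable_function[OF sigma_finite_lborel] by blast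
  define w where "w = (\<lambda>x. complex_of_real (sqrt (enn2real (h x))))"
  have hw: "ennreal ((cmod (w x))\<^sup>2) = h x" for x
    using h(3) by (simp add: w_def)
  have wm: "w \<in> borel_measurable borel"
    using h(1) unfolding w_def by measurable
  define c where "c = enn2real (integral\<^sup>N lborel h)"
  have le: "(\<integral>\<^sup>+x. ennreal ((cmod (w x))\<^sup>2) \<partial>lborel) \<le> ennreal ((sqrt c)\<^sup>2)"
    using h(2) by (simp add: hw c_def less_top)
  have "0 \<le> sqrt c"
    by (simp add: c_def)
  then have "w \<in> L2"
    by (rule L2_nn_integral_bound(1)[OF wm _ le])
  moreover have "w x \<noteq> 0" for x
    using h(3)[rule_format, of x] by (auto simp: w_def enn2real_eq_0_iff)
  ultimately show ?thesis by blast
qed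

text \<open>Riesz-Fischer: the weighted sequence is Cauchy in \<open>L1\<close>, so a subsequence
  converges almost everywhere. Dividing by the weight gives a candidate limit, and
  \<open>L2_fatou\<close> applied to differences turns the Cauchy estimate into convergence.\<close>

lemma L2_complete:
  fixes p :: "nat \<Rightarrow> 'a::euclidean_space \<Rightarrow> complex"
  assumes p: "\<And>n. p n \<in> L2"
    and cauchy: "\<And>e. e > 0 \<Longrightarrow> \<exists>N. \<forall>m\<ge>N. \<forall>n\<ge>N. l2_norm (\<lambda>x. p m x - p n x) < e"
  shows "\<exists>u\<in>L2. (\<lambda>n. l2_norm (\<lambda>x. p n x - u x)) \<longlonglongrightarrow> 0"
proof -
  obtain w :: "'a \<Rightarrow> complex" where w: "w \<in> L2" "\<And>x. w x \<noteq> 0"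
    using exists_positive_L2 by blast
  define s where "s n x = w x * p n x" for n x
  have si: "integrable lborel (s n)" for n
    unfolding s_def by (rule L2_mult_integrable[OF w(1) p])
  have sc: "\<exists>N. \<forall>i\<ge>N. \<forall>j\<ge>N. LINT x|lborel. norm (s i x - s j x) < e" if e: "e > 0" for e
  proof -
    have "e / (l2_norm w + 1) > 0"
      using e by (simp add: add_nonneg_pos)
    from cauchy[OF this] obtain N where N: "\<And>m n. m \<ge> N \<Longrightarrow> n \<ge> N \<Longrightarrow> l2_norm (\<lambda>x. p m x - p n x) < e / (l2_norm w + 1)"
      by blast
    have "LINT x|lborel. norm (s i x - s j x) < e" if "i \<ge> N" "j \<ge> N" for i j
    proof -
      have "(LINT x|lborel. norm (s i x - s j x)) = (LINT x|lborel. cmod (w x) * cmod (p i x - p j x))"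
        by (simp add: s_def norm_mult[symmetric] algebra_simps)
      also have "\<dots> \<le> l2_norm w * l2_norm (\<lambda>x. p i x - p j x)"
        by (intro L2_cauchy_schwarz_norm w(1) L2_diff p)
      also have "\<dots> \<le> l2_norm w * (e / (l2_norm w + 1))"
        using N[OF that] by (intro mult_left_mono) auto
      also have "\<dots> < e"
      proof -
        have "l2_norm w < l2_norm w + 1" and pos: "0 < l2_norm w + 1"
          using add_nonneg_pos[OF l2_norm_nonneg[of w] zero_less_one] by auto
        then have "l2_norm w * e < (l2_norm w + 1) * e"
          using e by (intro mult_strict_right_mono)
        then show ?thesis
          using pos by (simp only: times_divide_eq_right pos_divide_less_eq mult.commute[of e])
      qed
      finally show ?thesis .
    qed
    then show ?thesis by blast
  qed
  obtain r where r: "strict_mono r" "AE x in lborel. Cauchy (\<lambda>i. s (r i) x)"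
    by (rule cauchy_L1_AE_cauchy_subseq[OF si sc]) blast+
  \<comment> \<open>Where the subsequence diverges \<open>lim\<close> is unspecified; this happens
    on a null set only.\<close>
  define u where "u x = lim (\<lambda>i. p (r i) x)" for x
  have um: "u \<in> borel_measurable borel"
    unfolding u_def using L2_D(1)[OF p] by measurable
  have lim: "AE x in lborel. (\<lambda>i. p (r i) x) \<longlonglongrightarrow> u x"
    using r(2)
  proof eventually_elim
    case (elim x)
    then have "convergent (\<lambda>i. s (r i) x)"
      by (simp add: Cauchy_convergent)
    then have "convergent (\<lambda>i. inverse (w x) * s (r i) x)"
      by (intro convergent_mult convergent_const)
    then have "convergent (\<lambda>i. p (r i) x)"
      using w(2)[of x] by (simp add: s_def mult.assoc[symmetric])
    then show ?case
      by (simp add: u_def convergent_LIMSEQ_iff)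
  qed
  have bound: "(\<lambda>x. p n x - u x) \<in> L2 \<and> l2_norm (\<lambda>x. p n x - u x) \<le> e"
    if N: "\<And>m. m \<ge> N \<Longrightarrow> l2_norm (\<lambda>x. p n x - p m x) \<le> e" for n N e
  proof -
    \<comment> \<open>The shift by \<open>N\<close> places every index \<open>r (i + N)\<close>
      beyond \<open>N\<close>, since \<open>r\<close> grows at least like the identity.\<close>
    have *: "l2_norm (\<lambda>x. p n x - p (r (i + N)) x) \<le> e" for i
      using N[of "r (i + N)"] strict_mono_imp_increasing[OF r(1), of "i + N"] by linarith
    have "AE x in lborel. (\<lambda>i. p n x - p (r (i + N)) x) \<longlonglongrightarrow> p n x - u x"
      using lim
    proof eventually_elim
      case (elim x)
      show ?case
        using LIMSEQ_ignore_initial_segment[OF elim, of N] by (intro tendsto_intros)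
    qed
    then show ?thesis
      using L2_fatou[of "\<lambda>i x. p n x - p (r (i + N)) x" e "\<lambda>x. p n x - u x"] * p um L2_D(1)[OF p]
      by (auto intro!: borel_measurable_diff)
  qed
  have conv: "\<exists>N. \<forall>n\<ge>N. (\<lambda>x. p n x - u x) \<in> L2 \<and> l2_norm (\<lambda>x. p n x - u x) < e" if e: "e > 0" for e
  proof -
    obtain N where N: "\<And>m n. m \<ge> N \<Longrightarrow> n \<ge> N \<Longrightarrow> l2_norm (\<lambda>x. p m x - p n x) < e / 2"
      using cauchy[of "e / 2"] e by (metis half_gt_zero)
    then have "(\<lambda>x. p n x - u x) \<in> L2 \<and> l2_norm (\<lambda>x. p n x - u x) \<le> e / 2" if "n \<ge> N" for n
      by (intro bound[of N]) (use that in \<open>auto intro: less_imp_le\<close>)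
    moreover have "e / 2 < e" using e by simp
    ultimately show ?thesis
      by (meson le_less_trans)
  qed
  have "u \<in> L2"
  proof -
    obtain n where "(\<lambda>x. p n x - u x) \<in> L2"
      using conv[of 1] by auto
    then have "(\<lambda>x. p n x - (p n x - u x)) \<in> L2"
      by (rule L2_diff[OF p])
    then show ?thesis by simp
  qed
  moreover have "(\<lambda>n. l2_norm (\<lambda>x. p n x - u x)) \<longlonglongrightarrow> 0"
    using conv by (simp add: LIMSEQ_def) meson
  ultimately show ?thesis by blast
qed

section \<open>Almost everywhere limits and limits of products\<close>

lemma L2_lim_AE_subseq:
  fixes u :: "'a::euclidean_space \<Rightarrow> complex"
  assumes p: "\<And>n. p n \<in> L2" and u: "u \<in> L2"
    and lim: "(\<lambda>n. l2_norm (\<lambda>x. p n x - u x)) \<longlonglongrightarrow> 0"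
  obtains r where "strict_mono r" "AE x in lborel. (\<lambda>n. p (r n) x) \<longlonglongrightarrow> u x"
proof -
  let ?q = "\<lambda>n x. (cmod (p n x - u x))\<^sup>2"
  have "integrable lborel (?q n)" for n
    using L2_D(2)[OF L2_diff[OF p u]] .
  moreover have "(\<lambda>n. LINT x|lborel. norm (?q n x)) \<longlonglongrightarrow> 0"
    using tendsto_power[OF lim, of 2] by (simp add: l2_norm_power2)
  ultimately obtain r where r: "strict_mono r" "AE x in lborel. (\<lambda>n. ?q (r n) x) \<longlonglongrightarrow> 0"
    using tendsto_L1_AE_subseq[of lborel ?q] by blast
  from r(2) have "AE x in lborel. (\<lambda>n. p (r n) x) \<longlonglongrightarrow> u x"
  proof eventually_elim
    case (elim x)
    then have "(\<lambda>n. sqrt ((cmod (p (r n) x - u x))\<^sup>2)) \<longlonglongrightarrow> sqrt 0"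
      by (intro tendsto_intros)
    then have "(\<lambda>n. cmod (p (r n) x - u x)) \<longlonglongrightarrow> 0"
      by simp
    then show ?case
      using LIM_zero_iff tendsto_norm_zero_iff by blast
  qed
  with r(1) show thesis by (rule that)
qed

lemma L2_lim_unique_AE:
  fixes u v :: "'a::euclidean_space \<Rightarrow> complex"
  assumes "\<And>n. p n \<in> L2" "u \<in> L2" "v \<in> L2"
    "(\<lambda>n. l2_norm (\<lambda>x. p n x - u x)) \<longlonglongrightarrow> 0" "(\<lambda>n. l2_norm (\<lambda>x. p n x - v x)) \<longlonglongrightarrow> 0"
  shows "AE x in lborel. u x = v x"
proof -
  have "(\<lambda>n. l2_norm (\<lambda>x. p n x - u x) + l2_norm (\<lambda>x. p n x - v x)) \<longlonglongrightarrow> 0 + 0"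
    by (intro tendsto_add assms)
  moreover have "l2_norm (\<lambda>x. u x - v x) \<le> l2_norm (\<lambda>x. p n x - u x) + l2_norm (\<lambda>x. p n x - v x)" for n
    using l2_norm_triangle_diff[OF assms(2) assms(1)[of n] assms(3)] by (simp add: l2_norm_minus_commute[of "p n" u])
  ultimately have "l2_norm (\<lambda>x. u x - v x) \<le> 0"
    by (intro LIMSEQ_le_const[where X = "\<lambda>n. l2_norm (\<lambda>x. p n x - u x) + l2_norm (\<lambda>x. p n x - v x)"]) auto
  then have "l2_norm (\<lambda>x. u x - v x) = 0"
    using l2_norm_nonneg[of "\<lambda>x. u x - v x"] by linarith
  then have "AE x in lborel. u x - v x = 0"
    by (intro l2_norm_eq_0_AE L2_diff assms)
  then show ?thesis by simp
qed

lemma tendsto_0_bound: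
  fixes f :: "'i \<Rightarrow> 'b::real_normed_vector"
  assumes "\<And>n. norm (f n) \<le> g n" "(g \<longlongrightarrow> 0) F"
  shows "(f \<longlongrightarrow> 0) F"
  by (rule Lim_null_comparison[OF always_eventually assms(2)]) (simp add: assms(1))

lemma l2_norm_tendsto:
  assumes "\<And>n. p n \<in> L2" "u \<in> L2" "((\<lambda>n. l2_norm (\<lambda>x. p n x - u x)) \<longlongrightarrow> 0) F"
  shows "((\<lambda>n. l2_norm (p n)) \<longlongrightarrow> l2_norm u) F"
proof -
  have "\<bar>l2_norm (p n) - l2_norm u\<bar> \<le> l2_norm (\<lambda>x. p n x - u x)" for n
    using l2_norm_le_add[OF assms(1,2), of n] l2_norm_le_add[OF assms(2,1), of n]
    by (simp add: l2_norm_minus_commute[of u])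
  then have "((\<lambda>n. l2_norm (p n) - l2_norm u) \<longlongrightarrow> 0) F"
    by (intro tendsto_0_bound[OF _ assms(3)]) (simp only: real_norm_def)
  then show ?thesis
    by (rule LIM_zero_cancel)
qed

lemma l2_inner_tendsto:
  assumes "\<And>n. p n \<in> L2" "u \<in> L2" "((\<lambda>n. l2_norm (\<lambda>x. p n x - u x)) \<longlongrightarrow> 0) F"
    and "\<And>n. q n \<in> L2" "v \<in> L2" "((\<lambda>n. l2_norm (\<lambda>x. q n x - v x)) \<longlongrightarrow> 0) F"
  shows "((\<lambda>n. l2_inner (p n) (q n)) \<longlongrightarrow> l2_inner u v) F"
proof -
  have "cmod (l2_inner (p n) (q n) - l2_inner u v)
      \<le> l2_norm (\<lambda>x. p n x - u x) * l2_norm (q n) + l2_norm u * l2_norm (\<lambda>x. q n x - v x)" for n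
  proof -
    have "l2_inner (p n) (q n) - l2_inner u v
        = l2_inner (\<lambda>x. p n x - u x) (q n) + l2_inner u (\<lambda>x. q n x - v x)"
      by (simp add: l2_inner_diff_left l2_inner_diff_right assms)
    then have "cmod (l2_inner (p n) (q n) - l2_inner u v)
        \<le> cmod (l2_inner (\<lambda>x. p n x - u x) (q n)) + cmod (l2_inner u (\<lambda>x. q n x - v x))"
      by (simp add: norm_triangle_ineq)
    also have "\<dots> \<le> l2_norm (\<lambda>x. p n x - u x) * l2_norm (q n) + l2_norm u * l2_norm (\<lambda>x. q n x - v x)"
      by (intro add_mono l2_inner_bound L2_diff assms)
    finally show ?thesis .
  qed
  moreover have "((\<lambda>n. l2_norm (\<lambda>x. p n x - u x) * l2_norm (q n) + l2_norm u * l2_norm (\<lambda>x. q n x - v x))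
      \<longlongrightarrow> 0 * l2_norm v + l2_norm u * 0) F"
    by (intro tendsto_intros assms l2_norm_tendsto)
  ultimately have "((\<lambda>n. l2_inner (p n) (q n) - l2_inner u v) \<longlongrightarrow> 0) F"
    unfolding mult_zero_left mult_zero_right add_0_left by (rule tendsto_0_bound)
  then show ?thesis
    by (rule LIM_zero_cancel)
qed

text \<open>Splits the difference into \<open>c n x * (a n x - a' x)\<close>, small by the uniform
  bound, and \<open>(c n x - c' x) * a' x\<close>, small by dominated convergence with majorant
  \<open>2 * M * cmod (a' x)\<close>. Only one factor converges in norm; bounded pointwise
  convergence suffices for the other.\<close>

lemma L2_bounded_mult_tendsto:
  fixes c :: "nat \<Rightarrow> 'a::euclidean_space \<Rightarrow> complex"
  assumes c: "\<And>n. c n \<in> borel_measurable borel" "c' \<in> borel_measurable borel"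
    and M: "\<And>n x. cmod (c n x) \<le> M"
    and lim: "AE x in lborel. (\<lambda>n. c n x) \<longlonglongrightarrow> c' x"
    and a: "\<And>n. a n \<in> L2" "a' \<in> L2" "(\<lambda>n. l2_norm (\<lambda>x. a n x - a' x)) \<longlonglongrightarrow> 0"
  shows "(\<lambda>x. c' x * a' x) \<in> L2" "(\<lambda>n. l2_norm (\<lambda>x. c n x * a n x - c' x * a' x)) \<longlonglongrightarrow> 0"
proof -
  have M': "AE x in lborel. cmod (c' x) \<le> M"
    using lim
  proof eventually_elim
    case (elim x)
    from tendsto_norm[OF elim] show ?case
      by (rule LIMSEQ_le_const2) (auto simp: M)
  qed
  have M0: "0 \<le> M"
    using M norm_ge_zero order_trans by blast
  have M'': "AE x in lborel. cmod (c' x * a' x) \<le> M * cmod (a' x)"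
    using M' by eventually_elim (simp add: norm_mult mult_right_mono)
  show ca: "(\<lambda>x. c' x * a' x) \<in> L2"
    by (rule L2_dominated(1)[OF a(2) _ M0 M'']) (intro borel_measurable_times c L2_D(1)[OF a(2)])
  let ?d = "\<lambda>n x. (c n x - c' x) * a' x"
  have dm: "?d n \<in> borel_measurable borel" for n
    using c L2_D(1)[OF a(2)] by measurable
  have d: "(\<lambda>n. LINT x|lborel. (cmod (?d n x))\<^sup>2) \<longlonglongrightarrow> (LINT x::'a|lborel. 0)"
  proof (rule integral_dominated_convergence)
    show "integrable lborel (\<lambda>x. (2 * M)\<^sup>2 * (cmod (a' x))\<^sup>2)"
      using L2_D(2)[OF a(2)] by auto
    show "(\<lambda>x. (cmod (?d n x))\<^sup>2) \<in> borel_measurable lborel" for n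
      using dm[of n] by measurable
    show "AE x in lborel. (\<lambda>n. (cmod (?d n x))\<^sup>2) \<longlonglongrightarrow> 0"
      using lim
    proof eventually_elim
      case (elim x)
      then have "(\<lambda>n. (cmod ((c n x - c' x) * a' x))\<^sup>2) \<longlonglongrightarrow> (cmod ((c' x - c' x) * a' x))\<^sup>2"
        by (intro tendsto_intros)
      then show ?case by simp
    qed
    show "AE x in lborel. norm ((cmod (?d n x))\<^sup>2) \<le> (2 * M)\<^sup>2 * (cmod (a' x))\<^sup>2" for n
      using M'
    proof eventually_elim
      case (elim x)
      have "cmod (c n x - c' x) \<le> 2 * M"
        using norm_triangle_ineq4[of "c n x" "c' x"] M[of n x] elim by linarith
      then have "cmod (?d n x) \<le> (2 * M) * cmod (a' x)"
        by (simp add: norm_mult mult_right_mono)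
      then have "(cmod (?d n x))\<^sup>2 \<le> ((2 * M) * cmod (a' x))\<^sup>2"
        by (intro power_mono) auto
      then show ?case
        by (simp add: power_mult_distrib)
    qed
  qed simp
  then have d2: "(\<lambda>n. l2_norm (?d n)) \<longlonglongrightarrow> 0"
    using tendsto_real_sqrt[OF d] by (simp add: l2_norm_def)
  have "norm (l2_norm (\<lambda>x. c n x * a n x - c' x * a' x)) \<le> M * l2_norm (\<lambda>x. a n x - a' x) + l2_norm (?d n)" for n
  proof -
    have 1: "(\<lambda>x. c n x * (a n x - a' x)) \<in> L2" "l2_norm (\<lambda>x. c n x * (a n x - a' x)) \<le> M * l2_norm (\<lambda>x. a n x - a' x)"
      using L2_mult_bounded[of "\<lambda>x. a n x - a' x" "c n" M] a c M by auto
    have "(\<lambda>x. c n x * a' x) \<in> L2"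
      using L2_mult_bounded(1)[OF a(2) c(1) M] .
    then have 2: "?d n \<in> L2"
      using L2_diff[OF _ ca] by (simp add: left_diff_distrib)
    have "l2_norm (\<lambda>x. c n x * (a n x - a' x) + ?d n x) \<le> M * l2_norm (\<lambda>x. a n x - a' x) + l2_norm (?d n)"
      using l2_norm_triangle[OF 1(1) 2] 1(2) by linarith
    then show ?thesis
      by (simp add: algebra_simps)
  qed
  moreover have "(\<lambda>n. M * l2_norm (\<lambda>x. a n x - a' x) + l2_norm (?d n)) \<longlonglongrightarrow> M * 0 + 0"
    by (intro tendsto_intros a d2)
  ultimately show "(\<lambda>n. l2_norm (\<lambda>x. c n x * a n x - c' x * a' x)) \<longlonglongrightarrow> 0"
    unfolding mult_zero_right add_0_left by (rule tendsto_0_bound)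
qed

lemma L2_integral_mult_tendsto:
  assumes "\<And>n. p n \<in> L2" "u \<in> L2" "((\<lambda>n. l2_norm (\<lambda>x. p n x - u x)) \<longlongrightarrow> 0) F"
    and "\<And>n. q n \<in> L2" "v \<in> L2" "((\<lambda>n. l2_norm (\<lambda>x. q n x - v x)) \<longlongrightarrow> 0) F"
  shows "((\<lambda>n. LINT x|lborel. p n x * q n x) \<longlongrightarrow> (LINT x|lborel. u x * v x)) F"
proof -
  have "l2_norm (\<lambda>x. cnj (p n x) - cnj (u x)) = l2_norm (\<lambda>x. p n x - u x)" for n
    using l2_norm_cnj[of "\<lambda>x. p n x - u x"] by (simp only: complex_cnj_diff)
  then have "((\<lambda>n. l2_norm (\<lambda>x. cnj (p n x) - cnj (u x))) \<longlongrightarrow> 0) F"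
    using assms(3) by simp
  then show ?thesis
    using l2_inner_tendsto[of "\<lambda>n x. cnj (p n x)" "\<lambda>x. cnj (u x)" F q v] assms
    by (simp add: l2_inner_def L2_cnj)
qed

section \<open>Smooth functions with compact support\<close>

lemma partial_eqI: "(f has_derivative D) (at x) \<Longrightarrow> partial b f x = D b"
  unfolding partial_def by (drule frechet_derivative_at) simp

lemma has_derivative_partial:
  fixes f :: "'a::euclidean_space \<Rightarrow> 'b::real_normed_vector"
  assumes "f differentiable (at x)"
  shows "(f has_derivative (\<lambda>v. \<Sum>b\<in>Basis. (v \<bullet> b) *\<^sub>R partial b f x)) (at x)"
proof -
  let ?D = "frechet_derivative f (at x)"
  have D: "(f has_derivative ?D) (at x)"
    using assms by (simp add: frechet_derivative_works)
  then have lin: "linear ?D"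
    by (rule has_derivative_linear)
  have "?D v = (\<Sum>b\<in>Basis. (v \<bullet> b) *\<^sub>R ?D b)" for v
  proof -
    have "?D v = ?D (\<Sum>b\<in>Basis. (v \<bullet> b) *\<^sub>R b)"
      by (simp add: euclidean_representation)
    also have "\<dots> = (\<Sum>b\<in>Basis. (v \<bullet> b) *\<^sub>R ?D b)"
      by (simp add: linear_sum[OF lin] linear_cmul[OF lin])
    finally show ?thesis .
  qed
  then have "?D = (\<lambda>v. \<Sum>b\<in>Basis. (v \<bullet> b) *\<^sub>R partial b f x)"
    unfolding partial_def by (rule ext)
  then show ?thesis
    using D by simp
qed

text \<open>Any explicit family of derivatives may be supplied, so smoothness of sums, products and
  compositions follows from the differentiation rules by induction on the order.\<close>

lemma Ck_Suc_I:
  fixes f :: "'a::euclidean_space \<Rightarrow> 'b::real_normed_vector"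
  assumes "\<And>x. (f has_derivative D x) (at x)" "\<And>b. b \<in> Basis \<Longrightarrow> Ck k (\<lambda>x. D x b)"
  shows "Ck (Suc k) f"
proof -
  have "partial b f = (\<lambda>x. D x b)" for b
    using partial_eqI[OF assms(1)] by auto
  then show ?thesis
    using assms by (auto simp: differentiable_def)
qed

lemma Ck_Suc_imp: "Ck (Suc k) f \<Longrightarrow> Ck k f"
proof (induction k arbitrary: f)
  case 0
  then show ?case
    by (auto simp: continuous_on_eq_continuous_at intro: differentiable_imp_continuous_within)
next
  case (Suc k)
  have "\<forall>x. f differentiable at x" "\<forall>b\<in>Basis. Ck (Suc k) (partial b f)"
    using Suc.prems Ck.simps(2)[of "Suc k" f] by blast+
  then show ?case
    using Suc.IH Ck.simps(2)[of k f] by blast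
qed

lemma Ck_continuous: "Ck k f \<Longrightarrow> continuous_on UNIV f"
  by (induction k) (auto dest: Ck_Suc_imp simp del: Ck.simps(2))

lemma Ck_const [simp]: "Ck k (\<lambda>x. c)"
proof (induction k arbitrary: c)
  case (Suc k)
  show ?case
    by (rule Ck_Suc_I[where D = "\<lambda>_ _. 0"]) (auto simp: Suc)
qed auto

lemma Ck_bounded_linear_comp:
  assumes L: "bounded_linear L"
  shows "Ck k f \<Longrightarrow> Ck k (\<lambda>x. L (f x))"
proof (induction k arbitrary: f)
  case 0
  then show ?case
    by (auto intro: bounded_linear.continuous_on[OF L])
next
  case (Suc k)
  show ?case
  proof (rule Ck_Suc_I)
    show "((\<lambda>x. L (f x)) has_derivative (\<lambda>v. L (frechet_derivative f (at x) v))) (at x)" for x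
      using Suc.prems by (intro bounded_linear.has_derivative[OF L]) (auto simp: frechet_derivative_works)
    show "Ck k (\<lambda>x. L (frechet_derivative f (at x) b))" if "b \<in> Basis" for b
      using Suc.prems that unfolding partial_def[symmetric] by (intro Suc.IH) simp
  qed
qed

lemma Ck_add:
  "Ck k f \<Longrightarrow> Ck k g \<Longrightarrow> Ck k (\<lambda>x. f x + g x)"
proof (induction k arbitrary: f g)
  case 0
  then show ?case by (auto intro: continuous_intros)
next
  case (Suc k)
  show ?case
  proof (rule Ck_Suc_I)
    show "((\<lambda>x. f x + g x) has_derivative (\<lambda>v. frechet_derivative f (at x) v + frechet_derivative g (at x) v)) (at x)" for x
      using Suc.prems by (intro has_derivative_add) (auto simp: frechet_derivative_works)
    show "Ck k (\<lambda>x. frechet_derivative f (at x) b + frechet_derivative g (at x) b)" if "b \<in> Basis" for b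
      using Suc.prems that unfolding partial_def[symmetric] by (intro Suc.IH) simp_all
  qed
qed

lemma Ck_mult:
  fixes f g :: "'a::euclidean_space \<Rightarrow> 'b::real_normed_algebra"
  shows "Ck k f \<Longrightarrow> Ck k g \<Longrightarrow> Ck k (\<lambda>x. f x * g x)"
proof (induction k arbitrary: f g)
  case 0
  then show ?case by (auto intro: continuous_intros)
next
  case (Suc k)
  have fg: "Ck k f" "Ck k g"
    using Suc.prems Ck_Suc_imp by blast+
  show ?case
  proof (rule Ck_Suc_I)
    show "((\<lambda>x. f x * g x) has_derivative (\<lambda>v. f x * frechet_derivative g (at x) v + frechet_derivative f (at x) v * g x)) (at x)" for x
      using Suc.prems by (intro has_derivative_mult) (auto simp: frechet_derivative_works)
    show "Ck k (\<lambda>x. f x * frechet_derivative g (at x) b + frechet_derivative f (at x) b * g x)" if "b \<in> Basis" for b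
      using Suc.prems that unfolding partial_def[symmetric] by (intro Ck_add Suc.IH fg) simp_all
  qed
qed

lemma Ck_minus_const_diff:
  "Ck k f \<Longrightarrow> Ck k (\<lambda>x. c - f x)"
  using Ck_add[OF Ck_const Ck_bounded_linear_comp[OF bounded_linear_minus[OF bounded_linear_ident]], of k f c] by simp

lemma partial_mult:
  fixes f g :: "'a::euclidean_space \<Rightarrow> 'b::real_normed_algebra"
  assumes "f differentiable (at x)" "g differentiable (at x)"
  shows "partial b (\<lambda>x. f x * g x) x = f x * partial b g x + partial b f x * g x"
  unfolding partial_def[of b f] partial_def[of b g]
  by (rule partial_eqI, rule has_derivative_mult) (use assms in \<open>auto simp: frechet_derivative_works\<close>)

lemma partial_bounded_linear:
  assumes L: "bounded_linear L" and f: "f differentiable (at x)"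
  shows "partial b (\<lambda>x. L (f x)) x = L (partial b f x)"
  unfolding partial_def[of b f]
  by (rule partial_eqI, rule bounded_linear.has_derivative[OF L]) (use f in \<open>auto simp: frechet_derivative_works\<close>)

lemma partial_diff:
  assumes "f differentiable (at x)" "g differentiable (at x)"
  shows "partial b (\<lambda>x. f x - g x) x = partial b f x - partial b g x"
  unfolding partial_def[of b f] partial_def[of b g]
  by (rule partial_eqI, rule has_derivative_diff) (use assms in \<open>auto simp: frechet_derivative_works\<close>)

lemma Ck_inner_const: "Ck k (\<lambda>x::'a::euclidean_space. x \<bullet> c)"
proof (cases k)
  case (Suc j)
  show ?thesis
    unfolding Suc by (rule Ck_Suc_I[where D = "\<lambda>_ v. v \<bullet> c"]) (auto intro!: derivative_eq_intros)
qed (auto intro: continuous_intros)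

lemma Ck_inner_self: "Ck k (\<lambda>x::'a::euclidean_space. x \<bullet> x)"
proof (cases k)
  case (Suc j)
  show ?thesis
    unfolding Suc
  proof (rule Ck_Suc_I[where D = "\<lambda>x v. 2 * (x \<bullet> v)"])
    show "Ck j (\<lambda>x::'a. 2 * (x \<bullet> b))" for b
      by (intro Ck_mult Ck_const Ck_inner_const)
  qed (auto intro!: derivative_eq_intros simp: inner_commute)
qed (auto intro: continuous_intros)

text \<open>The family \<open>exp (-1/s) / s\<^sup>j\<close>, extended by \<open>0\<close> to \<open>s \<le> 0\<close>, is closed under differentiation up to
  linear combinations, which gives the smoothness of \<open>exp (-1/s)\<close> at \<open>0\<close> by induction.\<close>

definition flat :: "nat \<Rightarrow> real \<Rightarrow> real"
  where "flat j s = (if s > 0 then exp (- (1 / s)) / s ^ j else 0)"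

text \<open>A single term of the exponential series is bounded by its sum. With
  \<open>x = 1 / s\<close> this bounds every \<open>flat j\<close> by a factorial.\<close>

lemma power_le_fact_exp: "0 \<le> x \<Longrightarrow> x ^ n \<le> fact n * exp (x::real)"
proof -
  assume x: "0 \<le> x"
  have "(\<Sum>i\<in>{n}. inverse (fact i) * x ^ i) \<le> (\<Sum>i. inverse (fact i) * x ^ i)"
    using x by (intro sum_le_suminf summable_exp) auto
  then have "inverse (fact n) * x ^ n \<le> exp x"
    by (simp add: exp_def scaleR_conv_of_real)
  then show ?thesis
    by (simp add: field_simps)
qed

lemma flat_nonneg: "0 \<le> flat j s"
  by (simp add: flat_def)

lemma flat_le_fact: "flat j s \<le> fact j"
proof (cases "s > 0")
  case True
  have "(1 / s) ^ j \<le> fact j * exp (1 / s)"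
    using True by (intro power_le_fact_exp) auto
  then show ?thesis
    using True by (simp add: flat_def exp_minus field_simps)
qed (simp add: flat_def)

text \<open>Two powers of \<open>1 / s\<close> are traded for the index:
  \<open>flat j s = flat (j + 2) s * s\<^sup>2\<close> for positive \<open>s\<close>. The quadratic
  decay makes the difference quotient at the origin tend to 0.\<close>

lemma flat_le_square: "flat j s \<le> fact (j + 2) * s\<^sup>2"
proof (cases "s > 0")
  case True
  then have "flat j s = flat (j + 2) s * s\<^sup>2"
    by (simp add: flat_def power_add power2_eq_square)
  then show ?thesis
    using flat_le_fact[of "j + 2" s] by (metis mult_right_mono zero_le_power2)
qed (simp add: flat_def)

text \<open>For positive \<open>s\<close> the exponent contributes a factor
  \<open>1 / s ^ 2\<close>, raising the index by two, and the power raises it by one. At 0 the bound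
  \<open>flat_le_square\<close> makes the derivative vanish, in agreement with the formula.\<close>

lemma flat_has_derivative:
  "(flat j has_real_derivative (flat (j + 2) s - of_nat j * flat (j + 1) s)) (at s)"
proof -
  consider "s > 0" | "s < 0" | "s = 0" by linarith
  then show ?thesis
  proof cases
    case 1
    have "((\<lambda>s. exp (- (1 / s)) * inverse (s ^ j)) has_real_derivative
        (exp (- (1 / s)) * (1 / s ^ 2) * inverse (s ^ j)
          + - (of_nat j * s ^ (j - 1)) * inverse (s ^ j) * inverse (s ^ j) * exp (- (1 / s)))) (at s)"
      using 1 by (auto intro!: derivative_eq_intros simp: power2_eq_square)
    moreover have "exp (- (1 / s)) * (1 / s ^ 2) * inverse (s ^ j)
          + - (of_nat j * s ^ (j - 1)) * inverse (s ^ j) * inverse (s ^ j) * exp (- (1 / s))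
        = flat (j + 2) s - of_nat j * flat (j + 1) s"
      using 1 by (cases j) (simp_all add: flat_def field_simps power2_eq_square)
    ultimately have "((\<lambda>s. exp (- (1 / s)) * inverse (s ^ j)) has_real_derivative
        flat (j + 2) s - of_nat j * flat (j + 1) s) (at s)"
      by simp
    then show ?thesis
      by (rule has_field_derivative_transform_within_open[where S = "{0<..}"])
        (use 1 in \<open>auto simp: flat_def divide_inverse\<close>)
  next
    case 2
    have "((\<lambda>s. 0) has_real_derivative 0) (at s)"
      by simp
    then have "(flat j has_real_derivative 0) (at s)"
      by (rule has_field_derivative_transform_within_open[where S = "{..<0}"])
        (use 2 in \<open>auto simp: flat_def\<close>)
    then show ?thesis
      using 2 by (simp add: flat_def)
  next
    case 3
    have "((\<lambda>h. flat j h / h) \<longlongrightarrow> 0) (at 0)"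
    proof (rule Lim_null_comparison)
      have "norm (flat j h / h) \<le> fact (j + 2) * \<bar>h\<bar>" for h
      proof (cases "h = 0")
        case False
        have "flat j h \<le> fact (j + 2) * (\<bar>h\<bar> * \<bar>h\<bar>)"
          using flat_le_square[of j h] by (simp add: power2_eq_square)
        then have "flat j h / \<bar>h\<bar> \<le> fact (j + 2) * \<bar>h\<bar>"
          using False by (subst pos_divide_le_eq) (auto simp only: mult.assoc zero_less_abs_iff)
        then show ?thesis
          by (simp only: real_norm_def abs_divide abs_of_nonneg[OF flat_nonneg])
      qed simp
      then show "\<forall>\<^sub>F h in at 0. norm (flat j h / h) \<le> fact (j + 2) * \<bar>h\<bar>"
        by (rule always_eventually[OF allI])
      have "((\<lambda>h::real. fact (j + 2) * \<bar>h\<bar>) \<longlongrightarrow> fact (j + 2) * \<bar>0\<bar>) (at 0)"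
        by (intro tendsto_intros)
      then show "((\<lambda>h::real. fact (j + 2) * \<bar>h\<bar>) \<longlongrightarrow> 0) (at 0)"
        by simp
    qed
    then have "(flat j has_real_derivative 0) (at 0)"
      by (simp add: has_field_derivative_iff flat_def)
    then show ?thesis
      using 3 by (simp add: flat_def)
  qed
qed

lemma flat_continuous: "continuous_on A (flat j)"
  using flat_has_derivative by (meson DERIV_isCont continuous_at_imp_continuous_on)

text \<open>The derivative involves higher members of the family, so the induction on the order has
  to cover all indices \<open>j\<close> at once.\<close>

lemma Ck_flat:
  fixes g :: "'a::euclidean_space \<Rightarrow> real"
  shows "Ck k g \<Longrightarrow> Ck k (\<lambda>x. flat j (g x))"
proof (induction k arbitrary: j)
  case 0
  then show ?case
    using continuous_on_compose2[OF flat_continuous[of UNIV j]] by auto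
next
  case (Suc k)
  have g: "Ck k g"
    using Suc.prems Ck_Suc_imp by blast
  show ?case
  proof (rule Ck_Suc_I)
    show "((\<lambda>x. flat j (g x)) has_derivative
        (\<lambda>v. (flat (j + 2) (g x) + (- of_nat j) * flat (j + 1) (g x)) * frechet_derivative g (at x) v)) (at x)" for x
    proof -
      have "(g has_derivative frechet_derivative g (at x)) (at x)"
        using Suc.prems by (simp add: frechet_derivative_works)
      from DERIV_compose_FDERIV[OF flat_has_derivative this, of j] show ?thesis
        by (simp add: mult.commute)
    qed
    show "Ck k (\<lambda>x. (flat (j + 2) (g x) + (- of_nat j) * flat (j + 1) (g x)) * frechet_derivative g (at x) b)"
      if "b \<in> Basis" for b
      using Suc.prems that unfolding partial_def[symmetric]
      by (intro Ck_mult Ck_add Ck_const Suc.IH g) auto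
  qed
qed

text \<open>The squared norm keeps the argument smooth at the origin. Two parameters serve two
  purposes: \<open>bump (r\<^sup>2) 1\<close> lives on the ball of radius \<open>r\<close> and
  yields mollifiers, while \<open>\<alpha> = n + 1\<close> and \<open>\<beta> = 1 / (n + 1)\<close>
  yield slowly varying cut-offs.\<close>

definition bump :: "real \<Rightarrow> real \<Rightarrow> 'a::euclidean_space \<Rightarrow> real"
  where "bump \<alpha> \<beta> x = flat 0 (\<alpha> - \<beta> * (x \<bullet> x))"

lemma Ck_bump: "Ck k (bump \<alpha> \<beta> :: 'a::euclidean_space \<Rightarrow> real)"
proof -
  have "Ck k (\<lambda>x::'a. flat 0 (\<alpha> - \<beta> * (x \<bullet> x)))"
    by (intro Ck_flat Ck_minus_const_diff Ck_mult Ck_const Ck_inner_self)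
  then show ?thesis
    by (simp add: bump_def[abs_def])
qed

lemma bump_nonneg: "0 \<le> bump \<alpha> \<beta> x"
  by (simp add: bump_def flat_nonneg)

lemma bump_le_1: "bump \<alpha> \<beta> x \<le> 1"
  using flat_le_fact[of 0] by (simp add: bump_def)

lemma bump_nonzero_iff: "bump \<alpha> \<beta> x \<noteq> 0 \<longleftrightarrow> \<beta> * (norm x)\<^sup>2 < \<alpha>"
  by (simp add: bump_def flat_def power2_norm_eq_inner)

lemma bump_support:
  assumes "0 \<le> R" "bump (R\<^sup>2) 1 x \<noteq> 0"
  shows "norm x < R"
  using assms bump_nonzero_iff[of "R\<^sup>2" 1 x] power_less_imp_less_base[of "norm x" 2 R] by simp

lemma bounded_support_zero_outside:
  fixes f :: "'a::euclidean_space \<Rightarrow> 'b::real_normed_vector"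
  assumes "\<And>x. R < norm x \<Longrightarrow> f x = 0" "R < norm x"
  shows "partial b f x = 0"
proof -
  have "((\<lambda>x. 0) has_derivative (\<lambda>v. 0)) (at x)"
    by simp
  then have "(f has_derivative (\<lambda>v. 0)) (at x)"
    by (rule has_derivative_transform_within_open[where s = "{x. R < norm x}"])
      (use assms in \<open>auto intro: open_Collect_less continuous_intros\<close>)
  then show ?thesis
    by (rule partial_eqI)
qed

lemma partial_zero_open:
  fixes f :: "'a::euclidean_space \<Rightarrow> 'b::real_normed_vector"
  assumes "open S" "x \<in> S" "\<And>y. y \<in> S \<Longrightarrow> f y = 0"
  shows "partial b f x = 0"
proof -
  have "((\<lambda>x. 0) has_derivative (\<lambda>v. 0)) (at x)"
    by simp
  then have "(f has_derivative (\<lambda>v. 0)) (at x)"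
    by (rule has_derivative_transform_within_open[where s = S]) (use assms in auto)
  then show ?thesis
    by (rule partial_eqI)
qed

section \<open>Test functions described by a radius bounding the support\<close>

lemma test_functionI:
  fixes f :: "'a::euclidean_space \<Rightarrow> 'b::real_normed_vector"
  assumes "\<And>k. Ck k f" "\<And>x. R < norm x \<Longrightarrow> f x = 0"
  shows "test_function f"
proof -
  have "{x. f x \<noteq> 0} \<subseteq> cball 0 R"
    using assms(2) by (force simp: not_le[symmetric])
  then have "bounded {x. f x \<noteq> 0}"
    by (rule bounded_subset[OF bounded_cball])
  then show ?thesis
    using assms(1) by (simp add: test_function_def compact_closure)
qed

lemma test_functionE:
  fixes f :: "'a::euclidean_space \<Rightarrow> 'b::real_normed_vector"
  assumes "test_function f"
  obtains R where "\<forall>k. Ck k f" "0 < R" "\<forall>x. R < norm x \<longrightarrow> f x = 0"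
proof -
  have "bounded {x. f x \<noteq> 0}"
    using assms by (simp add: test_function_def compact_closure)
  then obtain R where R: "0 < R" "\<forall>x\<in>{x. f x \<noteq> 0}. norm x \<le> R"
    unfolding bounded_pos by blast
  show thesis
  proof (rule that[OF _ R(1)])
    show "\<forall>k. Ck k f"
      using assms by (simp add: test_function_def)
    show "\<forall>x. R < norm x \<longrightarrow> f x = 0"
      using R(2) by force
  qed
qed

lemma test_function_partial:
  fixes f :: "'a::euclidean_space \<Rightarrow> 'b::real_normed_vector"
  assumes "test_function f" "b \<in> Basis"
  shows "test_function (partial b f)"
proof -
  obtain R where R[rule_format]: "\<forall>k. Ck k f" "0 < R" "\<forall>x. R < norm x \<longrightarrow> f x = 0"
    by (rule test_functionE[OF assms(1)])
  show ?thesis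
  proof (rule test_functionI)
    show "Ck k (partial b f)" for k
      using R(1)[of "Suc k"] assms(2) by simp
    show "partial b f x = 0" if "R < norm x" for x
      using bounded_support_zero_outside[OF R(3) that] .
  qed
qed

lemma test_function_differentiable: "test_function f \<Longrightarrow> f differentiable (at x)"
  unfolding test_function_def by (metis Ck.simps(2))

lemma test_function_continuous: "test_function f \<Longrightarrow> continuous_on UNIV f"
  by (meson Ck_continuous test_function_def)

lemma test_function_mult_left:
  fixes f g :: "'a::euclidean_space \<Rightarrow> 'b::real_normed_algebra"
  assumes "\<And>k. Ck k f" "test_function g"
  shows "test_function (\<lambda>x. f x * g x)"
proof -
  obtain R where R[rule_format]: "\<forall>k. Ck k g" "0 < R" "\<forall>x. R < norm x \<longrightarrow> g x = 0"
    by (rule test_functionE[OF assms(2)])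
  show ?thesis
    by (rule test_functionI[of _ R]) (auto intro!: Ck_mult assms simp: R)
qed

lemma Ck_reflect:
  fixes f :: "'a::euclidean_space \<Rightarrow> 'b::real_normed_vector"
  shows "Ck k f \<Longrightarrow> Ck k (\<lambda>y. f (c - y))"
proof (induction k arbitrary: f)
  case 0
  then show ?case
    by (auto intro!: continuous_on_compose2[of UNIV f] continuous_intros)
next
  case (Suc k)
  show ?case
  proof (rule Ck_Suc_I)
    show "((\<lambda>y. f (c - y)) has_derivative (\<lambda>v. frechet_derivative f (at (c - x)) (- v))) (at x)" for x
    proof -
      have 1: "((\<lambda>y. c - y) has_derivative (\<lambda>v. - v)) (at x)"
        by (auto intro!: derivative_eq_intros)
      have 2: "(f has_derivative frechet_derivative f (at (c - x))) (at (c - x))"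
        using Suc.prems by (simp add: frechet_derivative_works)
      show ?thesis
        using has_derivative_compose[OF 1 2] .
    qed
    show "Ck k (\<lambda>x. frechet_derivative f (at (c - x)) (- b))" if "b \<in> Basis" for b
    proof -
      have "frechet_derivative f (at (c - x)) (- b) = - partial b f (c - x)" for x
        using Suc.prems by (simp add: partial_def linear_neg[OF linear_frechet_derivative])
      moreover have "Ck k (\<lambda>x. partial b f (c - x))"
        using Suc that by simp
      ultimately show ?thesis
        using Ck_bounded_linear_comp[OF bounded_linear_minus[OF bounded_linear_ident], of k "\<lambda>x. partial b f (c - x)"] by simp
    qed
  qed
qed

lemma partial_reflect:
  fixes f :: "'a::euclidean_space \<Rightarrow> 'b::real_normed_vector"
  assumes "f differentiable (at (c - x))"
  shows "partial b (\<lambda>y. f (c - y)) x = - partial b f (c - x)"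
proof -
  have 1: "((\<lambda>y. c - y) has_derivative (\<lambda>v. - v)) (at x)"
    by (auto intro!: derivative_eq_intros)
  have 2: "(f has_derivative frechet_derivative f (at (c - x))) (at (c - x))"
    using assms by (simp add: frechet_derivative_works)
  show ?thesis
    using partial_eqI[OF has_derivative_compose[OF 1 2], of b] assms
    by (simp add: partial_def linear_neg[OF linear_frechet_derivative])
qed

lemma test_function_reflect:
  fixes f :: "'a::euclidean_space \<Rightarrow> 'b::real_normed_vector"
  assumes "test_function f"
  shows "test_function (\<lambda>y. f (c - y))"
proof -
  obtain R where R[rule_format]: "\<forall>k. Ck k f" "0 < R" "\<forall>x. R < norm x \<longrightarrow> f x = 0"
    by (rule test_functionE[OF assms])
  show ?thesis
  proof (rule test_functionI[of _ "R + norm c"])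
    show "f (c - y) = 0" if "R + norm c < norm y" for y
      using R(3)[of "c - y"] that norm_triangle_ineq2[of y c] by (simp add: norm_minus_commute)
  qed (intro Ck_reflect R)
qed

section \<open>Uniform estimates for functions of bounded support\<close>

lemma bounded_support_bounded:
  fixes f :: "'a::euclidean_space \<Rightarrow> 'b::real_normed_vector"
  assumes "continuous_on UNIV f" "\<And>x. R < norm x \<Longrightarrow> f x = 0"
  obtains M where "0 < M" "\<forall>x. norm (f x) \<le> M"
proof -
  have "compact (f ` cball 0 R)"
    by (intro compact_continuous_image compact_cball continuous_on_subset[OF assms(1)]) auto
  then obtain M where M: "0 < M" "\<And>x. x \<in> cball 0 R \<Longrightarrow> norm (f x) \<le> M"
    by (auto dest!: compact_imp_bounded simp: bounded_pos)
  have "norm (f x) \<le> M" for x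
    using M(2)[of x] M(1) assms(2)[of x] by (cases "norm x \<le> R") auto
  then show thesis
    using M(1) that by blast
qed

lemma bounded_support_uniformly_continuous:
  fixes f :: "'a::euclidean_space \<Rightarrow> 'b::real_normed_vector"
  assumes "continuous_on UNIV f" "\<And>x. R < norm x \<Longrightarrow> f x = 0" "0 < e"
  obtains d where "0 < d" "\<forall>x y. norm (x - y) < d \<longrightarrow> norm (f x - f y) < e"
proof -
  \<comment> \<open>Two points at distance less than 1 either both lie in this enlarged ball or both
    lie outside radius \<open>R\<close>, where \<open>f\<close> vanishes.\<close>
  have uc: "uniformly_continuous_on (cball 0 (R + 1)) f"
    by (intro compact_uniformly_continuous compact_cball continuous_on_subset[OF assms(1)]) auto
  from uc[unfolded uniformly_continuous_on_def, rule_format, OF assms(3)] obtain d where d: "0 < d"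
    "\<And>x y. x \<in> cball 0 (R + 1) \<Longrightarrow> y \<in> cball 0 (R + 1) \<Longrightarrow> dist y x < d \<Longrightarrow> dist (f y) (f x) < e"
    by blast
  show thesis
  proof (rule that[of "min d 1"], goal_cases)
    case 1
    show ?case using d(1) by simp
  next
    case 2
    have "norm (f x - f y) < e" if xy: "norm (x - y) < min d 1" for x y :: 'a
    proof (cases "norm x \<le> R + 1 \<and> norm y \<le> R + 1")
      case True
      then show ?thesis
        using d(2)[of y x] xy by (simp add: dist_norm)
    next
      case False
      then have "R < norm x" "R < norm y"
        using xy norm_triangle_ineq2[of x y] norm_triangle_ineq2[of y x] by (auto simp: norm_minus_commute)
      then show ?thesis
        using assms(2,3) by simp
    qed
    then show ?case by blast
  qed
qed

text \<open>The partial derivatives are uniformly continuous, so the mean value inequality gives one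
  \<open>d\<close> for all base points \<open>z\<close>. This uniformity is what allows
  differentiation under a convolution integral.\<close>

lemma bounded_support_uniform_derivative:
  fixes f :: "'a::euclidean_space \<Rightarrow> 'b::real_normed_vector"
  assumes f: "Ck 1 f" "\<And>x. R < norm x \<Longrightarrow> f x = 0" and e: "0 < e"
  obtains d where "0 < d"
    "\<forall>z v. norm v < d \<longrightarrow> norm (f (z + v) - f z - (\<Sum>b\<in>Basis. (v \<bullet> b) *\<^sub>R partial b f z)) \<le> e * norm v"
proof -
  \<comment> \<open>The derivative is a sum over \<open>DIM('a)\<close> coordinates, each of which
    receives an equal share of the error.\<close>
  define e' where "e' = e / DIM('a)"
  have e': "0 < e'"
    using e by (simp add: e'_def)
  have "\<exists>d>0. \<forall>x y. norm (x - y) < d \<longrightarrow> norm (partial b f x - partial b f y) < e'" if "b \<in> Basis" for b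
  proof -
    have c: "continuous_on UNIV (partial b f)"
      using f(1) that by simp
    have z: "partial b f x = 0" if "R < norm x" for x
      using bounded_support_zero_outside[OF f(2) that] .
    obtain d where "0 < d" "\<forall>x y. norm (x - y) < d \<longrightarrow> norm (partial b f x - partial b f y) < e'"
      by (rule bounded_support_uniformly_continuous[OF c z e'])
    then show ?thesis by blast
  qed
  then have "\<forall>b\<in>Basis. \<exists>d>0. \<forall>x y. norm (x - y) < d \<longrightarrow> norm (partial b f x - partial b f y) < e'"
    by blast
  from bchoice[OF this] obtain d where d: "\<And>b. b \<in> Basis \<Longrightarrow> 0 < d b"
    "\<And>b x y. b \<in> Basis \<Longrightarrow> norm (x - y) < d b \<Longrightarrow> norm (partial b f x - partial b f y) < e'"
    by blast
  define d0 where "d0 = Min (d ` Basis)"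
  have d0: "0 < d0" "\<And>b. b \<in> Basis \<Longrightarrow> d0 \<le> d b"
    using d(1) by (auto simp: d0_def)
  define D where "D x v = (\<Sum>b\<in>Basis. (v \<bullet> b) *\<^sub>R partial b f x)" for x v
  have "norm (f (z + v) - f z - D z v) \<le> e * norm v" if v: "norm v < d0" for z v
  proof -
    have "norm (f (z + v) - f z - D z (z + v - z)) \<le> norm (z + v - z) * e"
    proof (rule differentiable_bound_linearization[where S = "ball z d0" and f' = D and f = f and a = z and b = "z + v" and ?x0.0 = z])
      show "z + t *\<^sub>R (z + v - z) \<in> ball z d0" if "t \<in> {0..1}" for t
      proof -
        have "\<bar>t\<bar> * norm v \<le> 1 * norm v"
          using that by (intro mult_right_mono) auto
        then show ?thesis
          using v by (simp add: dist_norm)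
      qed
      show "(f has_derivative D x) (at x within ball z d0)" for x
        unfolding D_def[abs_def] using f(1)
        by (intro has_derivative_at_withinI[OF has_derivative_partial]) simp
      show "onorm (D x - D z) \<le> e" if "x \<in> ball z d0" for x
      proof (rule onorm_bound)
        fix w :: 'a
        have "(D x - D z) w = (\<Sum>b\<in>Basis. (w \<bullet> b) *\<^sub>R (partial b f x - partial b f z))"
          by (simp add: D_def sum_subtractf scaleR_diff_right)
        also have "norm \<dots> \<le> (\<Sum>b\<in>Basis. norm ((w \<bullet> b) *\<^sub>R (partial b f x - partial b f z)))"
          by (rule norm_sum)
        also have "\<dots> \<le> (\<Sum>b\<in>(Basis::'a set). norm w * e')"
        proof (rule sum_mono)
          fix b :: 'a assume b: "b \<in> Basis"
          have "norm (x - z) < d b"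
            using d0(2)[OF b] that by (simp add: dist_norm norm_minus_commute)
          then have "norm (partial b f x - partial b f z) \<le> e'"
            using d(2)[OF b] by (simp add: less_imp_le)
          then show "norm ((w \<bullet> b) *\<^sub>R (partial b f x - partial b f z)) \<le> norm w * e'"
            using Basis_le_norm[OF b, of w] by (auto intro!: mult_mono)
        qed
        also have "\<dots> = e * norm w"
          by (simp add: e'_def)
        finally show "norm ((D x - D z) w) \<le> e * norm w" .
      qed (use e in simp)
    qed (use d0 in simp)
    then show ?thesis
      by (simp add: mult.commute)
  qed
  then show thesis
    using d0(1) that unfolding D_def by blast
qed

section \<open>Convolution\<close>

definition locally_integrable :: "('a::euclidean_space \<Rightarrow> complex) \<Rightarrow> bool"
  where "locally_integrable q \<longleftrightarrow> q \<in> borel_measurable borel \<and>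
    (\<forall>R. integrable lborel (\<lambda>y. indicator (cball 0 R) y *\<^sub>R q y))"

definition conv :: "('a::euclidean_space \<Rightarrow> complex) \<Rightarrow> ('a \<Rightarrow> complex) \<Rightarrow> 'a \<Rightarrow> complex"
  where "conv q \<eta> x = (LINT y|lborel. q y * \<eta> (x - y))"

lemma integrable_indicator_bounded:
  fixes A :: "'a::euclidean_space set"
  assumes "A \<in> sets borel" "bounded A"
  shows "integrable lborel (\<lambda>x. indicator A x :: real)"
  using assms emeasure_bounded_finite[OF assms(2)] by (intro integrable_real_indicator) auto

lemma L2_bounded_support:
  fixes f :: "'a::euclidean_space \<Rightarrow> complex"
  assumes f: "f \<in> borel_measurable borel" and M: "\<And>x. cmod (f x) \<le> M"
    and R: "\<And>x. R < norm x \<Longrightarrow> f x = 0"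
  shows "f \<in> L2"
proof -
  have "integrable lborel (\<lambda>x. (cmod (f x))\<^sup>2)"
  proof (rule Bochner_Integration.integrable_bound)
    show "integrable lborel (\<lambda>x::'a. M\<^sup>2 * indicator (cball 0 R) x)"
      by (intro integrable_mult_right integrable_indicator_bounded) auto
    have "(cmod (f x))\<^sup>2 \<le> M\<^sup>2 * indicator (cball 0 R) x" for x
      using power_mono[OF M[of x] norm_ge_zero, of 2] R[of x] by (cases "norm x \<le> R") auto
    then show "AE x in lborel. norm ((cmod (f x))\<^sup>2) \<le> norm (M\<^sup>2 * indicator (cball 0 R) x)"
      by (intro AE_I2) auto
  qed (use f in measurable)
  then show ?thesis
    using f by (simp add: L2_def)
qed

lemma L2_indicator_cball: "(\<lambda>x. indicator (cball 0 R) x) \<in> L2"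
  by (rule L2_bounded_support[of _ 1 R]) (rule borel_measurable_indicator, simp, auto simp: indicator_def)

lemma L2_continuous_bounded_support:
  fixes f :: "'a::euclidean_space \<Rightarrow> complex"
  assumes "continuous_on UNIV f" "\<And>x. R < norm x \<Longrightarrow> f x = 0"
  shows "f \<in> L2"
proof -
  obtain M where "0 < M" "\<forall>x. cmod (f x) \<le> M"
    by (rule bounded_support_bounded[OF assms])
  then show ?thesis
    by (intro L2_bounded_support[OF borel_measurable_continuous_onI[OF assms(1)] _ assms(2)]) auto
qed

lemma test_function_L2:
  fixes f :: "'a::euclidean_space \<Rightarrow> complex"
  assumes "test_function f"
  shows "f \<in> L2"
proof -
  obtain R where R[rule_format]: "\<forall>k. Ck k f" "0 < R" "\<forall>x. R < norm x \<longrightarrow> f x = 0"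
    by (rule test_functionE[OF assms])
  show ?thesis
    by (rule L2_continuous_bounded_support[OF test_function_continuous[OF assms] R(3)])
qed

lemma L2_locally_integrable:
  fixes q :: "'a::euclidean_space \<Rightarrow> complex"
  assumes "q \<in> L2"
  shows "locally_integrable q"
proof -
  have "(\<lambda>x. complex_of_real (indicator (cball 0 R) x)) \<in> (L2 :: ('a \<Rightarrow> complex) set)" for R
    by (rule L2_bounded_support[of _ 1 R]) (auto simp: indicator_def)
  from L2_mult_integrable[OF this assms] show ?thesis
    using L2_D(1)[OF assms] by (simp add: locally_integrable_def scaleR_conv_of_real)
qed

lemma locally_integrable_const: "locally_integrable (\<lambda>x::'a::euclidean_space. c)"
  using integrable_indicator_bounded[of "cball (0::'a) _"]
  by (auto simp: locally_integrable_def intro!: integrable_scaleR_left)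

lemma conv_integrable:
  fixes \<eta> :: "'a::euclidean_space \<Rightarrow> complex"
  assumes q: "locally_integrable q" and c: "continuous_on UNIV \<eta>" and R: "\<And>x. R < norm x \<Longrightarrow> \<eta> x = 0"
  shows "integrable lborel (\<lambda>y. q y * \<eta> (x - y))"
proof -
  obtain M where M[rule_format]: "0 < M" "\<forall>x. cmod (\<eta> x) \<le> M"
    by (rule bounded_support_bounded[OF c R])
  have mm: "\<eta> \<in> borel_measurable borel"
    using c by (rule borel_measurable_continuous_onI)
  have qm: "q \<in> borel_measurable borel"
    using q by (simp add: locally_integrable_def)
  show ?thesis
  proof (rule Bochner_Integration.integrable_bound)
    show "integrable lborel (\<lambda>y. M *\<^sub>R (indicator (cball 0 (R + norm x)) y *\<^sub>R q y))"
      using q unfolding locally_integrable_def by (intro integrable_scaleR_right) blast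
    show "(\<lambda>y. q y * \<eta> (x - y)) \<in> borel_measurable lborel"
      using qm mm by measurable
    have "norm (q y * \<eta> (x - y)) \<le> norm (M *\<^sub>R (indicator (cball 0 (R + norm x)) y *\<^sub>R q y))" for y
    proof (cases "norm y \<le> R + norm x")
      case True
      have "cmod (q y) * cmod (\<eta> (x - y)) \<le> cmod (q y) * M"
        by (intro mult_left_mono M norm_ge_zero)
      then show ?thesis
        using True M(1) by (simp add: norm_mult mult.commute)
    next
      case False
      then have "R < norm (x - y)"
        using norm_triangle_ineq2[of y x] by (simp add: norm_minus_commute)
      then show ?thesis
        using R by simp
    qed
    then show "AE y in lborel. norm (q y * \<eta> (x - y)) \<le> norm (M *\<^sub>R (indicator (cball 0 (R + norm x)) y *\<^sub>R q y))"
      by (intro AE_I2)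
  qed
qed

text \<open>The first-order remainder of \<open>\<eta>\<close> is at most \<open>e' * norm v\<close>
  uniformly and vanishes outside a fixed ball, so its integral against \<open>q\<close> is at most
  the mass of \<open>q\<close> on that ball times \<open>e' * norm v\<close>.\<close>

lemma conv_has_derivative:
  fixes \<eta> :: "'a::euclidean_space \<Rightarrow> complex"
  assumes q: "locally_integrable q" and c: "Ck 1 \<eta>" and R: "\<And>x. R < norm x \<Longrightarrow> \<eta> x = 0"
  shows "(conv q \<eta> has_derivative (\<lambda>v. \<Sum>b\<in>Basis. (v \<bullet> b) *\<^sub>R conv q (partial b \<eta>) x)) (at x)"
  unfolding has_derivative_at_alt
proof (intro conjI allI impI)
  show "bounded_linear (\<lambda>v. \<Sum>b\<in>Basis. (v \<bullet> b) *\<^sub>R conv q (partial b \<eta>) x)"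
    by (intro bounded_linear_sum bounded_linear_compose[OF bounded_linear_scaleR_left bounded_linear_inner_left])
  fix e :: real
  assume e: "0 < e"
  have c0: "continuous_on UNIV \<eta>"
    using c Ck_continuous by blast
  have cb: "continuous_on UNIV (partial b \<eta>)" if "b \<in> Basis" for b
    using c that by simp
  have zb: "partial b \<eta> z = 0" if "R < norm z" for b z
    using bounded_support_zero_outside[OF R that] .
  \<comment> \<open>The mass of \<open>q\<close> on the points that \<open>\<eta>\<close> can reach
    from \<open>x\<close> or from any \<open>y\<close> with distance less than 1 to
    \<open>x\<close>; hence the additional 1 in the radius.\<close>
  define A where "A = (LINT z|lborel. norm (indicator (cball 0 (R + norm x + 1)) z *\<^sub>R q z))"
  have qi: "integrable lborel (\<lambda>z. indicator (cball 0 (R + norm x + 1)) z *\<^sub>R q z)"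
    using q unfolding locally_integrable_def by blast
  have A: "0 \<le> A"
    unfolding A_def by (intro Bochner_Integration.integral_nonneg) auto
  define e' where "e' = e / (A + 1)"
  have e': "0 < e'" "A * e' \<le> e"
    using e A by (auto simp: e'_def field_simps)
  obtain d where d: "0 < d"
    "\<forall>z v. norm v < d \<longrightarrow> norm (\<eta> (z + v) - \<eta> z - (\<Sum>b\<in>Basis. (v \<bullet> b) *\<^sub>R partial b \<eta> z)) \<le> e' * norm v"
    by (rule bounded_support_uniform_derivative[OF c R e'(1)])
  have "norm (conv q \<eta> y - conv q \<eta> x - (\<Sum>b\<in>Basis. ((y - x) \<bullet> b) *\<^sub>R conv q (partial b \<eta>) x)) \<le> e * norm (y - x)"
    if y: "norm (y - x) < min d 1" for y
  proof -
    define v where "v = y - x"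
    define D where "D z = \<eta> (z + v) - \<eta> z - (\<Sum>b\<in>Basis. (v \<bullet> b) *\<^sub>R partial b \<eta> z)" for z
    have D1: "cmod (D z) \<le> e' * norm v" for z
      using d(2) y unfolding D_def v_def by auto
    have D0: "D (x - z) = 0" if "R + norm x + 1 < norm z" for z
    proof -
      have "R + 1 < norm (x - z)"
        using that norm_triangle_ineq2[of z x] by (simp add: norm_minus_commute)
      moreover have "norm (x - z) - norm v \<le> norm (x - z + v)"
        using norm_diff_ineq[of "x - z" v] .
      moreover have "norm v < 1"
        using y by (simp add: v_def)
      ultimately have "R < norm (x - z)" "R < norm (x - z + v)"
        by linarith+
      then show ?thesis
        by (simp add: D_def R zb)
    qed
    have i1: "integrable lborel (\<lambda>z. q z * \<eta> (w - z))" for w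
      by (intro conv_integrable[OF q c0 R])
    have i2: "integrable lborel (\<lambda>z. q z * partial b \<eta> (x - z))" if "b \<in> Basis" for b
      by (intro conv_integrable[OF q cb[OF that] zb])
    have i3: "integrable lborel (\<lambda>z. \<Sum>b\<in>Basis. (v \<bullet> b) *\<^sub>R (q z * partial b \<eta> (x - z)))"
      by (intro Bochner_Integration.integrable_sum integrable_scaleR_right i2)
    have eq: "q z * D (x - z) = q z * \<eta> (y - z) - q z * \<eta> (x - z) - (\<Sum>b\<in>Basis. (v \<bullet> b) *\<^sub>R (q z * partial b \<eta> (x - z)))" for z
      by (simp add: D_def v_def algebra_simps sum_distrib_left)
    have "conv q \<eta> y - conv q \<eta> x - (\<Sum>b\<in>Basis. (v \<bullet> b) *\<^sub>R conv q (partial b \<eta>) x)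
        = (LINT z|lborel. q z * D (x - z))"
      unfolding eq conv_def
      using i1 i2 i3 by (simp add: Bochner_Integration.integral_diff Bochner_Integration.integral_sum)
    also have "norm \<dots> \<le> (LINT z|lborel. norm (indicator (cball 0 (R + norm x + 1)) z *\<^sub>R q z) * (e' * norm v))"
    proof (rule order_trans[OF integral_norm_bound integral_mono])
      show "integrable lborel (\<lambda>z. norm (q z * D (x - z)))"
        unfolding eq by (intro integrable_norm Bochner_Integration.integrable_diff i1 i3)
      show "integrable lborel (\<lambda>z. norm (indicator (cball 0 (R + norm x + 1)) z *\<^sub>R q z) * (e' * norm v))"
        by (intro integrable_mult_left integrable_norm qi)
      show "norm (q z * D (x - z)) \<le> norm (indicator (cball 0 (R + norm x + 1)) z *\<^sub>R q z) * (e' * norm v)" for z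
      proof (cases "norm z \<le> R + norm x + 1")
        case True
        then show ?thesis
          using mult_left_mono[OF D1[of "x - z"] norm_ge_zero[of "q z"]] by (simp add: norm_mult)
      next
        case False
        then show ?thesis
          using D0[of z] by simp
      qed
    qed
    also have "\<dots> = (A * e') * norm v"
      by (simp add: A_def)
    also have "\<dots> \<le> e * norm v"
      by (intro mult_right_mono e'(2) norm_ge_zero)
    finally show ?thesis
      by (simp add: v_def)
  qed
  then show "\<exists>d>0. \<forall>y. norm (y - x) < d \<longrightarrow>
      norm (conv q \<eta> y - conv q \<eta> x - (\<Sum>b\<in>Basis. ((y - x) \<bullet> b) *\<^sub>R conv q (partial b \<eta>) x)) \<le> e * norm (y - x)"
    using d(1) by (intro exI[of _ "min d 1"]) simp
qed

lemma partial_conv: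
  fixes \<eta> :: "'a::euclidean_space \<Rightarrow> complex"
  assumes "locally_integrable q" "Ck 1 \<eta>" "\<And>x. R < norm x \<Longrightarrow> \<eta> x = 0" "b \<in> Basis"
  shows "partial b (conv q \<eta>) x = conv q (partial b \<eta>) x"
proof -
  have "(\<Sum>i\<in>Basis. (b \<bullet> i) *\<^sub>R conv q (partial i \<eta>) x) = (\<Sum>i\<in>Basis. if i = b then conv q (partial b \<eta>) x else 0)"
    using assms(4) by (intro sum.cong) (auto simp: inner_Basis)
  then show ?thesis
    using partial_eqI[OF conv_has_derivative[OF assms(1-3), where x = x], where b = b] assms(4) by simp
qed

lemma Ck_conv:
  fixes \<eta> :: "'a::euclidean_space \<Rightarrow> complex"
  assumes q: "locally_integrable q"
  shows "test_function \<eta> \<Longrightarrow> Ck k (conv q \<eta>)"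
proof (induction k arbitrary: \<eta>)
  case (0 \<eta>)
  obtain R where R[rule_format]: "\<forall>k. Ck k \<eta>" "0 < R" "\<forall>x. R < norm x \<longrightarrow> \<eta> x = 0"
    by (rule test_functionE[OF 0])
  have "isCont (conv q \<eta>) x" for x
    by (rule has_derivative_continuous[OF conv_has_derivative[OF q R(1) R(3)]])
  then show ?case
    by (simp add: continuous_at_imp_continuous_on)
next
  case (Suc k \<eta>)
  obtain R where R[rule_format]: "\<forall>k. Ck k \<eta>" "0 < R" "\<forall>x. R < norm x \<longrightarrow> \<eta> x = 0"
    by (rule test_functionE[OF Suc.prems])
  have "conv q \<eta> differentiable (at x)" for x
    using conv_has_derivative[OF q R(1) R(3)] by (auto simp: differentiable_def)
  moreover have "Ck k (partial b (conv q \<eta>))" if b: "b \<in> Basis" for b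
  proof -
    have "partial b (conv q \<eta>) = conv q (partial b \<eta>)"
      using partial_conv[OF q R(1) R(3) b] by auto
    then show ?thesis
      using Suc.IH[OF test_function_partial[OF Suc.prems b]] by simp
  qed
  ultimately show ?case
    by simp
qed

section \<open>Reflections and the integral of a derivative\<close>

lemma lborel_distr_reflect: "distr lborel borel (\<lambda>y. c - y) = (lborel :: 'a::euclidean_space measure)"
  using lborel_affine[of "-1" c] by (simp add: density_1)

lemma integral_reflect_translate:
  fixes f :: "'a::euclidean_space \<Rightarrow> complex"
  assumes "f \<in> borel_measurable borel"
  shows "(LINT y|lborel. f (c - y)) = (LINT y|lborel. f y)"
  using integral_distr[of "\<lambda>y. c - y" lborel borel f] assms by (simp add: lborel_distr_reflect)

text \<open>Convolution of \<open>f\<close> with the constant 1 is the constant integral of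
  \<open>f\<close>, so its derivative is 0; by \<open>partial_conv\<close> that derivative is also
  the integral of the partial derivative. Every integration by parts below rests on this.\<close>

lemma integral_partial_zero:
  fixes f :: "'a::euclidean_space \<Rightarrow> complex"
  assumes f: "Ck 1 f" "\<And>x. R < norm x \<Longrightarrow> f x = 0" and b: "b \<in> Basis"
  shows "(LINT x|lborel. partial b f x) = 0"
proof -
  have "f \<in> borel_measurable borel" "partial b f \<in> borel_measurable borel"
    using Ck_continuous[OF f(1)] f(1) b by (auto intro!: borel_measurable_continuous_onI)
  then have 1: "conv (\<lambda>_. 1) f x = (LINT y|lborel. f y)" "conv (\<lambda>_. 1) (partial b f) x = (LINT y|lborel. partial b f y)" for x
    by (simp_all add: conv_def integral_reflect_translate)
  have "partial b (conv (\<lambda>_. 1) f) 0 = (LINT y|lborel. partial b f y)"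
    using partial_conv[OF locally_integrable_const[of 1] f(1) f(2) b] by (simp add: 1)
  moreover have "partial b (conv (\<lambda>_. 1) f) (0::'a) = 0"
    unfolding 1(1)[abs_def] by (rule partial_eqI[of _ "\<lambda>_. 0"]) simp
  ultimately show ?thesis
    by simp
qed

section \<open>Continuity of translations in the mean\<close>

lemma L2_dominated_tendsto:
  fixes p :: "nat \<Rightarrow> 'a::euclidean_space \<Rightarrow> complex"
  assumes f: "f \<in> L2" and p: "\<And>n. p n \<in> borel_measurable borel" and u: "u \<in> borel_measurable borel"
    and le: "\<And>n. AE x in lborel. cmod (p n x) \<le> C * cmod (f x)"
    and lim: "AE x in lborel. (\<lambda>n. p n x) \<longlonglongrightarrow> u x"
  shows "(\<lambda>n. l2_norm (\<lambda>x. p n x - u x)) \<longlonglongrightarrow> 0"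
proof -
  have le': "AE x in lborel. \<forall>n. cmod (p n x) \<le> C * cmod (f x)"
    using le by (simp add: AE_all_countable)
  have "(\<lambda>n. LINT x|lborel. (cmod (p n x - u x))\<^sup>2) \<longlonglongrightarrow> (LINT x::'a|lborel. 0)"
  proof (rule integral_dominated_convergence)
    show "integrable lborel (\<lambda>x. (2 * C)\<^sup>2 * (cmod (f x))\<^sup>2)"
      using L2_D(2)[OF f] by auto
    show "(\<lambda>x. (cmod (p n x - u x))\<^sup>2) \<in> borel_measurable lborel" for n
      using p[of n] u by measurable
    show "AE x in lborel. (\<lambda>n. (cmod (p n x - u x))\<^sup>2) \<longlonglongrightarrow> 0"
      using lim
    proof eventually_elim
      case (elim x)
      then have "(\<lambda>n. (cmod (p n x - u x))\<^sup>2) \<longlonglongrightarrow> (cmod (u x - u x))\<^sup>2"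
        by (intro tendsto_intros)
      then show ?case by simp
    qed
    show "AE x in lborel. norm ((cmod (p n x - u x))\<^sup>2) \<le> (2 * C)\<^sup>2 * (cmod (f x))\<^sup>2" for n
      using le' lim
    proof eventually_elim
      case (elim x)
      have "cmod (u x) \<le> C * cmod (f x)"
        using tendsto_norm[OF elim(2)] by (rule LIMSEQ_le_const2) (use elim(1) in auto)
      then have "cmod (p n x - u x) \<le> (2 * C) * cmod (f x)"
        using norm_triangle_ineq4[of "p n x" "u x"] spec[OF elim(1), of n] by linarith
      then have "(cmod (p n x - u x))\<^sup>2 \<le> ((2 * C) * cmod (f x))\<^sup>2"
        by (intro power_mono) auto
      then show ?case
        by (simp add: power_mult_distrib)
    qed
  qed simp
  from tendsto_real_sqrt[OF this] show ?thesis
    by (simp add: l2_norm_def)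
qed

lemma lborel_distr_translate: "distr lborel borel (\<lambda>y. y - c) = (lborel :: 'a::euclidean_space measure)"
  using lborel_affine[of 1 "- c"] by (simp add: density_1)

lemma L2_translate:
  fixes f :: "'a::euclidean_space \<Rightarrow> complex"
  assumes f: "f \<in> L2"
  shows "(\<lambda>x. f (x - h)) \<in> L2" "l2_norm (\<lambda>x. f (x - h)) = l2_norm f"
proof -
  have m: "f \<in> borel_measurable borel"
    using L2_D(1)[OF f] .
  have m2: "(\<lambda>x. f (x - h)) \<in> borel_measurable borel"
    using m by measurable
  have "(\<lambda>x. (cmod (f x))\<^sup>2) \<in> borel_measurable borel"
    using m by measurable
  then have "integrable lborel (\<lambda>x. (cmod (f (x - h)))\<^sup>2) \<longleftrightarrow> integrable lborel (\<lambda>x. (cmod (f x))\<^sup>2)"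
    "(LINT x|lborel. (cmod (f (x - h)))\<^sup>2) = (LINT x|lborel. (cmod (f x))\<^sup>2)"
    using integrable_distr_eq[of "\<lambda>x. x - h" lborel borel "\<lambda>x. (cmod (f x))\<^sup>2"]
      integral_distr[of "\<lambda>x. x - h" lborel borel "\<lambda>x. (cmod (f x))\<^sup>2"]
    by (simp_all add: lborel_distr_translate)
  then show "(\<lambda>x. f (x - h)) \<in> L2" "l2_norm (\<lambda>x. f (x - h)) = l2_norm f"
    using m2 L2_D(2)[OF f] by (simp_all add: L2_def l2_norm_def)
qed

text \<open>Stated along sequences of shifts because dominated convergence is sequential. Membership
  in \<open>L2\<close> is included so that the class is handled as a whole under sums, multiples and
  limits in the mean.\<close>

definition translation_continuous :: "('a::euclidean_space \<Rightarrow> complex) \<Rightarrow> bool"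
  where "translation_continuous f \<longleftrightarrow> f \<in> L2 \<and>
    (\<forall>h. h \<longlonglongrightarrow> 0 \<longrightarrow> (\<lambda>n. l2_norm (\<lambda>x. f (x - h n) - f x)) \<longlonglongrightarrow> 0)"

lemma translation_continuous_add:
  assumes "translation_continuous f" "translation_continuous g"
  shows "translation_continuous (\<lambda>x. f x + g x)"
  unfolding translation_continuous_def
proof (intro conjI allI impI)
  have L: "f \<in> L2" "g \<in> L2"
    using assms by (auto simp: translation_continuous_def)
  then show "(\<lambda>x. f x + g x) \<in> L2" by blast
  fix h :: "nat \<Rightarrow> 'a" assume h: "h \<longlonglongrightarrow> 0"
  have "(\<lambda>n. l2_norm (\<lambda>x. f (x - h n) - f x) + l2_norm (\<lambda>x. g (x - h n) - g x)) \<longlonglongrightarrow> 0 + 0"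
    using assms h by (intro tendsto_add) (auto simp: translation_continuous_def)
  moreover have "norm (l2_norm (\<lambda>x. f (x - h n) + g (x - h n) - (f x + g x)))
      \<le> l2_norm (\<lambda>x. f (x - h n) - f x) + l2_norm (\<lambda>x. g (x - h n) - g x)" for n
    unfolding add_diff_add real_norm_def abs_of_nonneg[OF l2_norm_nonneg]
    by (intro l2_norm_triangle L2_diff L2_translate(1) L)
  ultimately show "(\<lambda>n. l2_norm (\<lambda>x. f (x - h n) + g (x - h n) - (f x + g x))) \<longlonglongrightarrow> 0"
    unfolding add_0_left by (rule tendsto_0_bound[rotated])
qed

lemma translation_continuous_cmult:
  assumes "translation_continuous f"
  shows "translation_continuous (\<lambda>x. c * f x)"
  unfolding translation_continuous_def
proof (intro conjI allI impI)
  show "(\<lambda>x. c * f x) \<in> L2"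
    using assms by (auto simp: translation_continuous_def)
  fix h :: "nat \<Rightarrow> 'a" assume h: "h \<longlonglongrightarrow> 0"
  have "(\<lambda>n. cmod c * l2_norm (\<lambda>x. f (x - h n) - f x)) \<longlonglongrightarrow> cmod c * 0"
    using assms h by (intro tendsto_mult_left) (auto simp: translation_continuous_def)
  then show "(\<lambda>n. l2_norm (\<lambda>x. c * f (x - h n) - c * f x)) \<longlonglongrightarrow> 0"
    by (simp add: l2_norm_cmult right_diff_distrib[symmetric])
qed

text \<open>Translations are isometries, so replacing \<open>f\<close> by an approximant costs twice
  the approximation error, uniformly in the shift.\<close>

lemma translation_continuous_lim:
  assumes p: "\<And>n. translation_continuous (p n)" and f: "f \<in> L2"
    and lim: "(\<lambda>n. l2_norm (\<lambda>x. p n x - f x)) \<longlonglongrightarrow> 0"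
  shows "translation_continuous f"
  unfolding translation_continuous_def
proof (intro conjI allI impI f)
  have pL: "p n \<in> L2" for n
    using p by (simp add: translation_continuous_def)
  fix h :: "nat \<Rightarrow> 'a" assume h: "h \<longlonglongrightarrow> 0"
  have *: "l2_norm (\<lambda>x. f (x - h n) - f x)
      \<le> 2 * l2_norm (\<lambda>x. p k x - f x) + l2_norm (\<lambda>x. p k (x - h n) - p k x)" for n k
  proof -
    have t: "l2_norm (\<lambda>x. f (x - h n) - p k (x - h n)) = l2_norm (\<lambda>x. p k x - f x)"
      using L2_translate(2)[OF L2_diff[OF f pL[of k]], of "h n"] by (simp add: l2_norm_minus_commute[of f])
    have L: "(\<lambda>x. f (x - h n)) \<in> L2" "(\<lambda>x. p k (x - h n)) \<in> L2"
      using L2_translate(1) f pL by blast+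
    show ?thesis
      using l2_norm_triangle_diff[OF L(1) L(2) f] l2_norm_triangle_diff[OF L(2) pL[of k] f] t by linarith
  qed
  show "(\<lambda>n. l2_norm (\<lambda>x. f (x - h n) - f x)) \<longlonglongrightarrow> 0"
  proof (rule LIMSEQ_I)
    fix e :: real assume e: "0 < e"
    then have "0 < e / 4" by simp
    from LIMSEQ_D[OF lim this] obtain k where k: "l2_norm (\<lambda>x. p k x - f x) < e / 4"
      by auto
    have "(\<lambda>n. l2_norm (\<lambda>x. p k (x - h n) - p k x)) \<longlonglongrightarrow> 0"
      using p h by (simp add: translation_continuous_def)
    from LIMSEQ_D[OF this, of "e / 2"] e obtain N where N: "\<forall>n\<ge>N. l2_norm (\<lambda>x. p k (x - h n) - p k x) < e / 2"
      by auto
    have "norm (l2_norm (\<lambda>x. f (x - h n) - f x) - 0) < e" if "n \<ge> N" for n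
      using *[of n k] k spec[OF N, of n] that by simp
    then show "\<exists>N. \<forall>n\<ge>N. norm (l2_norm (\<lambda>x. f (x - h n) - f x) - 0) < e"
      by blast
  qed
qed

text \<open>The indicator of the shifted box converges at every point off the frontier, and the
  frontier of a convex set is negligible. A bounded sequence of shifts keeps all supports in one
  ball, which supplies the majorant.\<close>

lemma translation_continuous_box: "translation_continuous (\<lambda>x. indicator (box a b) x)"
  unfolding translation_continuous_def
proof (intro conjI allI impI)
  obtain R0 where R0: "\<forall>x\<in>box a b. norm x \<le> R0"
    using bounded_box[of a b] unfolding bounded_iff by blast
  define R where "R = max R0 0"
  have R: "norm x \<le> R" if "x \<in> box a b" for x
    using R0 that unfolding R_def by force
  show "(\<lambda>x. indicator (box a b) x) \<in> L2"
    by (rule L2_bounded_support[of _ 1 R]) (use R in \<open>force simp: indicator_def\<close>)+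
  fix h :: "nat \<Rightarrow> 'a" assume h: "h \<longlonglongrightarrow> 0"
  obtain H where H: "\<And>n. norm (h n) \<le> H"
    using convergent_imp_bounded[OF h] by (auto simp: bounded_iff)
  define f where "f = (\<lambda>x::'a. indicator (cball 0 (R + H)) x :: complex)"
  show "(\<lambda>n. l2_norm (\<lambda>x. indicator (box a b) (x - h n) - indicator (box a b) x)) \<longlonglongrightarrow> 0"
  proof (rule L2_dominated_tendsto[of f _ _ 1])
    show "f \<in> L2"
      unfolding f_def by (rule L2_indicator_cball)
    show "(\<lambda>x. indicator (box a b) (x - h n) :: complex) \<in> borel_measurable borel" for n
      by measurable
    have "cmod (indicator (box a b) (x - h n)) \<le> 1 * cmod (f x)" for n x
    proof (cases "x - h n \<in> box a b")
      case True
      then have "norm (x - h n) \<le> R"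
        using R by blast
      then have "norm x \<le> R + H"
        using norm_triangle_sub[of x "h n"] H[of n] by linarith
      then show ?thesis
        by (simp add: f_def indicator_def)
    qed (simp add: f_def)
    then show "AE x in lborel. cmod (indicator (box a b) (x - h n)) \<le> 1 * cmod (f x)" for n
      by (intro AE_I2)
    have neg: "AE x in lborel. x \<notin> frontier (box a b)"
    proof (rule AE_I')
      have "negligible (frontier (box a b))"
        by (intro negligible_convex_frontier convex_box)
      then show "frontier (box a b) \<in> null_sets lborel"
        by (simp add: negligible_iff_null_sets null_sets_completion_iff)
    qed auto
    have t: "(\<lambda>n. x - h n) \<longlonglongrightarrow> x" for x
      using tendsto_diff[OF tendsto_const h, of x] by simp
    show "AE x in lborel. (\<lambda>n. indicator (box a b) (x - h n) :: complex) \<longlonglongrightarrow> indicator (box a b) x"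
      using neg
    proof eventually_elim
      case (elim x)
      have "\<forall>\<^sub>F n in sequentially. (indicator (box a b) (x - h n) :: complex) = indicator (box a b) x"
      proof (cases "x \<in> box a b")
        case True
        with topological_tendstoD[OF t open_box True] show ?thesis
          by (auto elim: eventually_mono simp: indicator_def)
      next
        case False
        then have "x \<in> - closure (box a b)"
          using elim by (auto simp: frontier_def interior_open[OF open_box])
        then have "\<forall>\<^sub>F n in sequentially. x - h n \<in> - closure (box a b)"
          by (rule topological_tendstoD[OF t open_Compl[OF closed_closure]])
        then show ?thesis
          by eventually_elim (use False closure_subset[of "box a b"] in \<open>auto simp: indicator_def\<close>)
      qed
      then show ?case
        by (rule tendsto_eventually)
    qed
  qed measurable
qed

lemma sets_borel_box: "sets (borel :: 'a::euclidean_space measure) = sigma_sets UNIV (range (\<lambda>(a, b). box a b))"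
  by (subst borel_eq_box) (rule sets_measure_of, simp)

text \<open>Boxes are an intersection-stable generator of the Borel sets, so the claim spreads by
  induction over complements and disjoint unions. Intersecting with a fixed box throughout keeps
  every set of finite measure, hence every indicator in \<open>L2\<close>.\<close>

lemma translation_continuous_bounded_set:
  fixes A :: "'a::euclidean_space set"
  assumes "A \<in> sets borel"
  shows "translation_continuous (\<lambda>x. indicator (A \<inter> box l u) x)"
proof -
  have A: "A \<in> sigma_sets UNIV (range (\<lambda>(a, b). box a b))"
    using assms by (simp add: sets_borel_box)
  have Is: "Int_stable (range (\<lambda>(a::'a, b). box a b))"
    by (auto simp: Int_stable_def box_Int_box)
  have Gs: "range (\<lambda>(a::'a, b). box a b) \<subseteq> Pow UNIV"
    by simp
  show ?thesis
  proof (rule sigma_sets_induct_disjoint[OF Is Gs A, where P = "\<lambda>A. translation_continuous (\<lambda>x. indicator (A \<inter> box l u) x)"])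
    fix A :: "'a set" assume "A \<in> range (\<lambda>(a, b). box a b)"
    then show "translation_continuous (\<lambda>x. indicator (A \<inter> box l u) x)"
      by (auto simp: box_Int_box translation_continuous_box)
  next
    have "translation_continuous (\<lambda>x. 0 * indicator (box l u) x)"
      by (rule translation_continuous_cmult[OF translation_continuous_box])
    then show "translation_continuous (\<lambda>x. indicator ({} \<inter> box l u) x)"
      by simp
  next
    fix A :: "'a set" assume "translation_continuous (\<lambda>x. indicator (A \<inter> box l u) x)"
    from translation_continuous_add[OF translation_continuous_box translation_continuous_cmult[OF this], of l u "-1"]
    have "translation_continuous (\<lambda>x. indicator (box l u) x + (-1) * indicator (A \<inter> box l u) x)" .
    moreover have "(\<lambda>x. indicator (box l u) x + (-1) * indicator (A \<inter> box l u) x)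
        = (\<lambda>x. indicator ((UNIV - A) \<inter> box l u) x :: complex)"
      by (auto simp: indicator_def fun_eq_iff)
    ultimately show "translation_continuous (\<lambda>x. indicator ((UNIV - A) \<inter> box l u) x)"
      by (simp only:)
  next
    fix A :: "nat \<Rightarrow> 'a set"
    assume d: "disjoint_family A" and A: "range A \<subseteq> sigma_sets UNIV (range (\<lambda>(a, b). box a b))"
      and IH: "\<And>i. translation_continuous (\<lambda>x. indicator (A i \<inter> box l u) x)"
    have Ab: "A i \<in> sets borel" for i
      using A by (auto simp: sets_borel_box)
    define p where "p n x = (\<Sum>i<n. indicator (A i \<inter> box l u) x :: complex)" for n x
    have p: "translation_continuous (p n)" for n
    proof (induction n)
      case 0
      have "translation_continuous (\<lambda>x. 0 * indicator (box l u) x)"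
        by (rule translation_continuous_cmult[OF translation_continuous_box])
      then show ?case
        by (simp add: p_def[abs_def])
    next
      case (Suc n)
      from translation_continuous_add[OF Suc IH[of n]] show ?case
        by (simp add: p_def[abs_def])
    qed
    have p_eq: "p n x = indicator ((\<Union>i<n. A i) \<inter> box l u) x" for n x
    proof (induction n)
      case (Suc n)
      have "x \<notin> A n" if "i < n" "x \<in> A i" for i
      proof -
        have "A i \<inter> A n = {}"
          using disjoint_family_onD[OF d, of i n] that(1) by simp
        then show ?thesis
          using that(2) by blast
      qed
      then have "x \<notin> A n \<or> x \<notin> (\<Union>i<n. A i)"
        by blast
      then show ?case
        using Suc by (auto simp: p_def indicator_def less_Suc_eq)
    qed (simp add: p_def)
    have L: "(\<lambda>x. indicator (box l u) x) \<in> L2"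
      using translation_continuous_box[of l u] unfolding translation_continuous_def by (rule conjunct1)
    have m: "(\<lambda>x. indicator ((\<Union>i. A i) \<inter> box l u) x :: complex) \<in> borel_measurable borel"
      using Ab by measurable
    show "translation_continuous (\<lambda>x. indicator ((\<Union>i. A i) \<inter> box l u) x)"
    proof (rule translation_continuous_lim[OF p])
      show "(\<lambda>x. indicator ((\<Union>i. A i) \<inter> box l u) x :: complex) \<in> L2"
        by (rule L2_dominated(1)[OF L m, of 1]) (auto simp: indicator_def)
      show "(\<lambda>n. l2_norm (\<lambda>x. p n x - indicator ((\<Union>i. A i) \<inter> box l u) x)) \<longlonglongrightarrow> 0"
      proof (rule L2_dominated_tendsto[OF L _ m, of _ 1])
        show "p n \<in> borel_measurable borel" for n
          using p[of n] unfolding translation_continuous_def by (intro L2_D(1)) (rule conjunct1)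
        show "AE x in lborel. cmod (p n x) \<le> 1 * cmod (indicator (box l u) x)" for n
          by (intro AE_I2) (auto simp: p_eq indicator_def)
        have "(\<lambda>n. p n x) \<longlonglongrightarrow> indicator ((\<Union>i. A i) \<inter> box l u) x" for x
        proof (rule tendsto_eventually)
          show "\<forall>\<^sub>F n in sequentially. p n x = indicator ((\<Union>i. A i) \<inter> box l u) x"
          proof (cases "x \<in> (\<Union>i. A i)")
            case True
            then obtain i where "x \<in> A i" by blast
            then show ?thesis
              by (intro eventually_sequentiallyI[of "Suc i"]) (force simp: p_eq indicator_def)
          qed (auto simp: p_eq indicator_def)
        qed
        then show "AE x in lborel. (\<lambda>n. p n x) \<longlonglongrightarrow> indicator ((\<Union>i. A i) \<inter> box l u) x"
          by (intro AE_I2)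
      qed
    qed
  qed
qed

text \<open>Simple functions dominated by \<open>2 * cmod (f x)\<close> and restricted to growing
  cubes converge to \<open>f\<close> in the mean; each is a finite combination of indicators of
  bounded Borel sets.\<close>

lemma L2_translation_continuous:
  fixes f :: "'a::euclidean_space \<Rightarrow> complex"
  assumes f: "f \<in> L2"
  shows "translation_continuous f"
proof -
  have fm: "f \<in> borel_measurable lborel"
    using L2_D(1)[OF f] by simp
  obtain s where s: "\<And>i. simple_function lborel (s i)"
    "\<And>x. (\<lambda>i. s i x) \<longlonglongrightarrow> f x" "\<And>i x. cmod (s i x) \<le> 2 * cmod (f x)"
    using borel_measurable_implies_sequence_metric[OF fm, of 0] by (auto simp: dist_norm)
  define B where "B n = box ((- real n) *\<^sub>R \<Sum>Basis) (real n *\<^sub>R \<Sum>(Basis::'a set))" for n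
  have Bin: "\<forall>\<^sub>F n in sequentially. x \<in> B n" for x
  proof (rule eventually_sequentiallyI)
    fix n assume n: "nat \<lceil>norm x + 1\<rceil> \<le> n"
    have "x \<bullet> b < real n" "- real n < x \<bullet> b" if "b \<in> Basis" for b
      using Basis_le_norm[OF that, of x] n by linarith+
    then show "x \<in> B n"
      by (auto simp: B_def mem_box)
  qed
  define p where "p n x = indicator (B n) x * s n x" for n x
  have p: "translation_continuous (p n)" for n
  proof -
    have fin: "finite (range (s n))"
      using simple_functionD(1)[OF s(1), of n] by simp
    have eq: "p n = (\<lambda>x. \<Sum>y\<in>range (s n). y * indicator (s n -` {y} \<inter> B n) x)"
    proof
      fix x
      have "(\<Sum>y\<in>range (s n). y * indicator (s n -` {y} \<inter> B n) x)
          = (\<Sum>y\<in>range (s n). if y = s n x then s n x * indicator (B n) x else 0)"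
        by (intro sum.cong) (auto simp: indicator_def)
      then show "p n x = (\<Sum>y\<in>range (s n). y * indicator (s n -` {y} \<inter> B n) x)"
        using fin by (simp add: p_def mult.commute)
    qed
    have "translation_continuous (\<lambda>x. \<Sum>y\<in>Y. y * indicator (s n -` {y} \<inter> B n) x)"
      if "finite Y" for Y
      using that
    proof induction
      case empty
      have "translation_continuous (\<lambda>x. 0 * indicator (box 0 0) x)"
        by (rule translation_continuous_cmult[OF translation_continuous_box])
      then show ?case by simp
    next
      case (insert y Y)
      have "s n -` {y} \<in> sets borel"
        using simple_functionD(2)[OF s(1), of n "{y}"] by simp
      then have "translation_continuous (\<lambda>x. indicator (s n -` {y} \<inter> B n) x)"
        unfolding B_def by (rule translation_continuous_bounded_set)
      from translation_continuous_add[OF translation_continuous_cmult[OF this] insert.IH]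
      show ?case
        unfolding sum.insert[OF insert.hyps(1,2)] .
    qed
    from this[OF fin] show ?thesis
      unfolding eq .
  qed
  show ?thesis
  proof (rule translation_continuous_lim[OF p f])
    show "(\<lambda>n. l2_norm (\<lambda>x. p n x - f x)) \<longlonglongrightarrow> 0"
    proof (rule L2_dominated_tendsto[OF f _ L2_D(1)[OF f], of _ 2])
      show "p n \<in> borel_measurable borel" for n
        using p[of n] unfolding translation_continuous_def by (intro L2_D(1)) (rule conjunct1)
      show "AE x in lborel. cmod (p n x) \<le> 2 * cmod (f x)" for n
        using s(3)[of n] by (intro AE_I2) (auto simp: p_def indicator_def)
      have "(\<lambda>n. p n x) \<longlonglongrightarrow> f x" for x
      proof -
        have "\<forall>\<^sub>F n in sequentially. s n x = p n x"
          using Bin[of x] by eventually_elim (simp add: p_def)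
        then show ?thesis
          using s(2)[of x] by (rule Lim_transform_eventually[rotated])
      qed
      then show "AE x in lborel. (\<lambda>n. p n x) \<longlonglongrightarrow> f x"
        by (intro AE_I2)
    qed
  qed
qed

text \<open>Returns from sequences to a radius: if no radius worked, shifts shorter than
  \<open>1 / (n + 1)\<close> would violate the sequential statement.\<close>

lemma L2_translation_small:
  fixes f :: "'a::euclidean_space \<Rightarrow> complex"
  assumes f: "f \<in> L2" and e: "0 < e"
  shows "\<exists>d>0. \<forall>h. norm h < d \<longrightarrow> l2_norm (\<lambda>x. f (x - h) - f x) \<le> e"
proof (rule ccontr)
  define N where "N h = l2_norm (\<lambda>x. f (x - h) - f x)" for h
  assume "\<not> ?thesis"
  then have neg: "\<not> (\<exists>d>0. \<forall>h. norm h < d \<longrightarrow> N h \<le> e)"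
    unfolding N_def .
  have "\<exists>h. norm h < inverse (real (Suc n)) \<and> e < N h" for n
  proof -
    have "0 < inverse (real (Suc n))" by simp
    then have "\<not> (\<forall>h. norm h < inverse (real (Suc n)) \<longrightarrow> N h \<le> e)"
      using neg by blast
    then show ?thesis
      by (simp add: not_le)
  qed
  then obtain h where h: "\<And>n. norm (h n) < inverse (real (Suc n))" "\<And>n. e < N (h n)"
    by metis
  have "h \<longlonglongrightarrow> 0"
    by (rule tendsto_0_bound[OF less_imp_le[OF h(1)] LIMSEQ_inverse_real_of_nat])
  then have "(\<lambda>n. N (h n)) \<longlonglongrightarrow> 0"
    using L2_translation_continuous[OF f] by (simp add: translation_continuous_def N_def)
  then have "e \<le> 0"
    by (rule LIMSEQ_le_const) (intro exI[of _ 0] allI impI less_imp_le h(2))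
  then show False
    using e by simp
qed

section \<open>Mollification\<close>

definition mollifier :: "real \<Rightarrow> 'a::euclidean_space \<Rightarrow> real"
  where "mollifier r x = bump (r\<^sup>2) 1 x / (LINT y|lborel. bump (r\<^sup>2) 1 (y::'a))"

definition mollify :: "real \<Rightarrow> ('a::euclidean_space \<Rightarrow> complex) \<Rightarrow> 'a \<Rightarrow> complex"
  where "mollify r f = conv f (\<lambda>z. complex_of_real (mollifier r z))"

lemma bump_measurable: "bump \<alpha> \<beta> \<in> borel_measurable (borel :: 'a::euclidean_space measure)"
  by (rule borel_measurable_continuous_onI[OF Ck_continuous[OF Ck_bump]])

lemma bump_integrable:
  assumes r: "0 < r"
  shows "integrable lborel (bump (r\<^sup>2) 1 :: 'a::euclidean_space \<Rightarrow> real)"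
proof (rule Bochner_Integration.integrable_bound)
  show "integrable lborel (\<lambda>x::'a. indicator (cball 0 r) x :: real)"
    by (rule integrable_indicator_bounded) auto
  show "bump (r\<^sup>2) 1 \<in> borel_measurable (lborel :: 'a measure)"
    using bump_measurable by simp
  have "norm (bump (r\<^sup>2) 1 x) \<le> norm (indicator (cball 0 r) x :: real)" for x :: 'a
    using bump_support[of r x] bump_nonneg[of "r\<^sup>2" 1 x] bump_le_1[of "r\<^sup>2" 1 x] r
    by (cases "bump (r\<^sup>2) 1 x = 0") auto
  then show "AE x::'a in lborel. norm (bump (r\<^sup>2) 1 x) \<le> norm (indicator (cball 0 r) x :: real)"
    by (intro AE_I2)
qed

lemma bump_integral_pos:
  assumes r: "0 < r"
  shows "0 < (LINT y|lborel. bump (r\<^sup>2) 1 (y::'a::euclidean_space))"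
proof -
  have "(LINT y|lborel. bump (r\<^sup>2) 1 (y::'a)) \<noteq> 0"
  proof
    assume "(LINT y|lborel. bump (r\<^sup>2) 1 (y::'a)) = 0"
    then have "AE x::'a in lborel. bump (r\<^sup>2) 1 x = 0"
      using integral_nonneg_eq_0_iff_AE[OF bump_integrable[OF r]] bump_nonneg by auto
    then have "AE x::'a in lborel. x \<notin> ball 0 r"
    proof eventually_elim
      case (elim x)
      then show ?case
        using bump_nonzero_iff[of "r\<^sup>2" 1 x] power_strict_mono[of "norm x" r 2] by auto
    qed
    then have "ball (0::'a) r \<in> null_sets lborel"
      using AE_iff_null_sets[of "ball (0::'a) r" lborel] by simp
    then have "negligible (ball (0::'a) r)"
      by (simp add: negligible_iff_null_sets null_sets_completionI)
    then show False
      using open_not_negligible[of "ball (0::'a) r"] r by simp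
  qed
  moreover have "0 \<le> (LINT y|lborel. bump (r\<^sup>2) 1 (y::'a))"
    by (intro Bochner_Integration.integral_nonneg bump_nonneg)
  ultimately show ?thesis by simp
qed

lemma mollifier_nonneg: "0 \<le> mollifier r x"
  unfolding mollifier_def by (intro divide_nonneg_nonneg Bochner_Integration.integral_nonneg bump_nonneg)

lemma mollifier_support: "0 < r \<Longrightarrow> r \<le> norm x \<Longrightarrow> mollifier r x = 0"
  using bump_support[of r x] by (auto simp: mollifier_def)

lemma mollifier_measurable [measurable]: "mollifier r \<in> borel_measurable borel"
  unfolding mollifier_def using bump_measurable[of "r\<^sup>2" 1] by measurable

lemma mollifier_integrable: "0 < r \<Longrightarrow> integrable lborel (mollifier r)"
  unfolding mollifier_def by (intro integrable_divide bump_integrable)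

lemma mollifier_integral: "0 < r \<Longrightarrow> (LINT x|lborel. mollifier r (x::'a::euclidean_space)) = 1"
  using bump_integral_pos[of r, where 'a = 'a] by (simp add: mollifier_def)

lemma mollifier_nn_integral:
  assumes "0 < r"
  shows "(\<integral>\<^sup>+x. ennreal (mollifier r (x::'a::euclidean_space)) \<partial>lborel) = 1"
  using nn_integral_eq_integral[OF mollifier_integrable[OF assms, where 'a = 'a]] mollifier_integral[OF assms, where 'a = 'a]
  by (simp add: mollifier_nonneg)

lemma test_function_mollifier:
  assumes "0 < r"
  shows "test_function (\<lambda>x::'a::euclidean_space. complex_of_real (mollifier r x))"
proof (rule test_functionI)
  define Z where "Z = (LINT y|lborel. bump (r\<^sup>2) 1 (y::'a))"
  have "(\<lambda>x::'a. complex_of_real (mollifier r x)) = (\<lambda>x. complex_of_real (inverse Z * bump (r\<^sup>2) 1 x))"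
    by (simp add: mollifier_def Z_def divide_inverse mult.commute)
  moreover have "Ck k (\<lambda>x::'a. complex_of_real (inverse Z * bump (r\<^sup>2) 1 x))" for k
    by (intro Ck_bounded_linear_comp[OF bounded_linear_of_real] Ck_mult Ck_const Ck_bump)
  ultimately show "Ck k (\<lambda>x::'a. complex_of_real (mollifier r x))" for k
    by simp
  show "complex_of_real (mollifier r x) = 0" if "r < norm x" for x :: 'a
    using mollifier_support[OF assms, of x] that by simp
qed

lemma Ck_mollify: "0 < r \<Longrightarrow> locally_integrable f \<Longrightarrow> Ck k (mollify r f)"
  unfolding mollify_def by (intro Ck_conv test_function_mollifier)

lemma mollify_integrable:
  assumes "0 < r" "locally_integrable f"
  shows "integrable lborel (\<lambda>y. complex_of_real (mollifier r y) * f (x - y))"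
proof -
  obtain R where R[rule_format]: "\<forall>k. Ck k (\<lambda>x::'a. complex_of_real (mollifier r x))" "0 < R"
    "\<forall>x::'a. R < norm x \<longrightarrow> complex_of_real (mollifier r x) = 0"
    by (rule test_functionE[OF test_function_mollifier[OF assms(1)]])
  have fm: "f \<in> borel_measurable borel"
    using assms(2) by (simp add: locally_integrable_def)
  have m: "(\<lambda>y. f y * complex_of_real (mollifier r (x - y))) \<in> borel_measurable borel"
    using fm by measurable
  have "integrable (distr lborel borel (\<lambda>y. x - y)) (\<lambda>y. f y * complex_of_real (mollifier r (x - y)))"
    unfolding lborel_distr_reflect
    by (rule conv_integrable[OF assms(2) Ck_continuous[OF R(1)] R(3)])
  then show ?thesis
    using integrable_distr_eq[of "\<lambda>y. x - y" lborel borel "\<lambda>y. f y * complex_of_real (mollifier r (x - y))"] m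
    by (simp add: mult.commute)
qed

lemma mollify_alt:
  assumes "f \<in> borel_measurable borel"
  shows "mollify r f x = (LINT y|lborel. complex_of_real (mollifier r y) * f (x - y))"
  using integral_reflect_translate[of "\<lambda>y. f y * complex_of_real (mollifier r (x - y))" x] assms
  by (simp add: mollify_def conv_def mult.commute)

lemma mollify_diff:
  assumes "0 < r" "locally_integrable f"
  shows "integrable lborel (\<lambda>y. complex_of_real (mollifier r y) * (f (x - y) - f x))"
    "mollify r f x - f x = (LINT y|lborel. complex_of_real (mollifier r y) * (f (x - y) - f x))"
proof -
  have fm: "f \<in> borel_measurable borel"
    using assms(2) by (simp add: locally_integrable_def)
  have i: "integrable lborel (\<lambda>y::'a. complex_of_real (mollifier r y) * f x)"
    by (intro integrable_mult_left integrable_of_real mollifier_integrable assms)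
  have "(LINT y::'a|lborel. complex_of_real (mollifier r y) * f x) = f x"
    using mollifier_integral[OF assms(1), where 'a = 'a] by simp
  then show "integrable lborel (\<lambda>y. complex_of_real (mollifier r y) * (f (x - y) - f x))"
    "mollify r f x - f x = (LINT y|lborel. complex_of_real (mollifier r y) * (f (x - y) - f x))"
    using mollify_integrable[OF assms, of x] i by (simp_all add: mollify_alt[OF fm] right_diff_distrib)
qed

lemma mollify_pointwise:
  fixes f :: "'a::euclidean_space \<Rightarrow> complex"
  assumes r: "0 < r" and f: "locally_integrable f"
    and le: "\<And>y. norm y < r \<Longrightarrow> cmod (f (x - y) - f x) \<le> e"
  shows "cmod (mollify r f x - f x) \<le> e"
proof -
  have "cmod (mollify r f x - f x) \<le> (LINT y|lborel. mollifier r (y::'a) * e)"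
    unfolding mollify_diff(2)[OF r f]
  proof (rule order_trans[OF integral_norm_bound integral_mono])
    show "integrable lborel (\<lambda>y. cmod (complex_of_real (mollifier r y) * (f (x - y) - f x)))"
      by (intro integrable_norm mollify_diff(1)[OF r f])
    show "integrable lborel (\<lambda>y::'a. mollifier r y * e)"
      by (intro integrable_mult_left mollifier_integrable r)
    show "cmod (complex_of_real (mollifier r y) * (f (x - y) - f x)) \<le> mollifier r y * e" for y
    proof (cases "norm y < r")
      case True
      then show ?thesis
        using le mollifier_nonneg[of r y] by (simp add: norm_mult mult_left_mono)
    next
      case False
      then show ?thesis
        using mollifier_support[OF r, of y] by simp
    qed
  qed
  also have "\<dots> = e"
    using mollifier_integral[OF r, where 'a = 'a] by simp
  finally show ?thesis .
qed

text \<open>The difference is an average of \<open>f (x - y) - f x\<close> over the kernel. Writing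
  the kernel as a product of two square roots, Cauchy-Schwarz gives Jensen's inequality for the
  square, and Tonelli then reduces the bound to translations shorter than \<open>r\<close>.\<close>

lemma mollify_L2_diff:
  fixes f :: "'a::euclidean_space \<Rightarrow> complex"
  assumes r: "0 < r" and f: "f \<in> L2" and e: "0 \<le> e"
    and le: "\<And>h. norm h < r \<Longrightarrow> l2_norm (\<lambda>x. f (x - h) - f x) \<le> e"
  shows "(\<lambda>x. mollify r f x - f x) \<in> L2" "l2_norm (\<lambda>x. mollify r f x - f x) \<le> e"
proof -
  let ?m = "mollifier r :: 'a \<Rightarrow> real"
  have fm[measurable]: "f \<in> borel_measurable borel"
    using L2_D(1)[OF f] .
  have fl: "locally_integrable f"
    by (rule L2_locally_integrable[OF f])
  have "continuous_on UNIV (mollify r f)"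
    by (rule Ck_continuous[OF Ck_mollify[OF r fl]])
  then have Fm: "(\<lambda>x. mollify r f x - f x) \<in> borel_measurable borel"
    by (intro borel_measurable_diff fm borel_measurable_continuous_onI)
  have jensen: "ennreal ((cmod (mollify r f x - f x))\<^sup>2)
      \<le> (\<integral>\<^sup>+y. ennreal (?m y * (cmod (f (x - y) - f x))\<^sup>2) \<partial>lborel)" for x
  proof -
    have "ennreal (cmod (mollify r f x - f x)) \<le> (\<integral>\<^sup>+y. ennreal (cmod (complex_of_real (?m y) * (f (x - y) - f x))) \<partial>lborel)"
      unfolding mollify_diff(2)[OF r fl] by (rule integral_norm_bound_ennreal[OF mollify_diff(1)[OF r fl]])
    also have "\<dots> = (\<integral>\<^sup>+y. ennreal (sqrt (?m y)) * ennreal (sqrt (?m y) * cmod (f (x - y) - f x)) \<partial>lborel)"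
      by (intro nn_integral_cong)
        (simp add: ennreal_mult'[symmetric] mollifier_nonneg norm_mult mult.assoc[symmetric])
    finally have "ennreal (cmod (mollify r f x - f x)) ^ 2
        \<le> (\<integral>\<^sup>+y. ennreal (sqrt (?m y)) * ennreal (sqrt (?m y) * cmod (f (x - y) - f x)) \<partial>lborel) ^ 2"
      by (rule power_mono) simp
    also have "\<dots> \<le> (\<integral>\<^sup>+y. (ennreal (sqrt (?m y)))\<^sup>2 \<partial>lborel)
        * (\<integral>\<^sup>+y. (ennreal (sqrt (?m y) * cmod (f (x - y) - f x)))\<^sup>2 \<partial>lborel)"
      by (rule Cauchy_Schwarz_nn_integral) measurable
    also have "(\<integral>\<^sup>+y. (ennreal (sqrt (?m y)))\<^sup>2 \<partial>lborel) = 1"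
      using mollifier_nn_integral[OF r, where 'a = 'a] by (simp add: ennreal_power mollifier_nonneg)
    also have "(\<integral>\<^sup>+y. (ennreal (sqrt (?m y) * cmod (f (x - y) - f x)))\<^sup>2 \<partial>lborel)
        = (\<integral>\<^sup>+y. ennreal (?m y * (cmod (f (x - y) - f x))\<^sup>2) \<partial>lborel)"
      by (intro nn_integral_cong) (simp add: ennreal_power mollifier_nonneg power_mult_distrib)
    finally show ?thesis
      by (simp add: ennreal_power)
  qed
  have "(\<integral>\<^sup>+x. ennreal ((cmod (mollify r f x - f x))\<^sup>2) \<partial>lborel)
      \<le> (\<integral>\<^sup>+x. (\<integral>\<^sup>+y. ennreal (?m y * (cmod (f (x - y) - f x))\<^sup>2) \<partial>lborel) \<partial>lborel)"
    by (intro nn_integral_mono jensen)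
  also have "\<dots> = (\<integral>\<^sup>+y. (\<integral>\<^sup>+x. ennreal (?m y * (cmod (f (x - y) - f x))\<^sup>2) \<partial>lborel) \<partial>lborel)"
    by (rule lborel_pair.Fubini'[symmetric]) measurable
  also have "\<dots> \<le> (\<integral>\<^sup>+y. ennreal (?m y) * ennreal (e\<^sup>2) \<partial>lborel)"
  proof (rule nn_integral_mono)
    fix y :: 'a
    have d: "(\<lambda>x. f (x - y) - f x) \<in> L2"
      by (intro L2_diff L2_translate(1) f)
    have "(\<integral>\<^sup>+x. ennreal (?m y * (cmod (f (x - y) - f x))\<^sup>2) \<partial>lborel)
        = (\<integral>\<^sup>+x. ennreal (?m y) * ennreal ((cmod (f (x - y) - f x))\<^sup>2) \<partial>lborel)"
      by (intro nn_integral_cong) (simp add: ennreal_mult mollifier_nonneg)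
    also have "\<dots> = ennreal (?m y) * ennreal ((l2_norm (\<lambda>x. f (x - y) - f x))\<^sup>2)"
      by (subst nn_integral_cmult) (measurable, simp add: nn_integral_power2_L2[OF d])
    also have "\<dots> \<le> ennreal (?m y) * ennreal (e\<^sup>2)"
    proof (cases "norm y < r")
      case True
      then have "(l2_norm (\<lambda>x. f (x - y) - f x))\<^sup>2 \<le> e\<^sup>2"
        by (intro power_mono le) auto
      then show ?thesis
        by (intro mult_left_mono ennreal_leI) auto
    next
      case False
      then show ?thesis
        using mollifier_support[OF r, of y] by simp
    qed
    finally show "(\<integral>\<^sup>+x. ennreal (?m y * (cmod (f (x - y) - f x))\<^sup>2) \<partial>lborel) \<le> ennreal (?m y) * ennreal (e\<^sup>2)" .
  qed
  also have "\<dots> = ennreal (e\<^sup>2)"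
    by (subst nn_integral_multc) (measurable, simp add: mollifier_nn_integral[OF r])
  finally have *: "(\<integral>\<^sup>+x. ennreal ((cmod (mollify r f x - f x))\<^sup>2) \<partial>lborel) \<le> ennreal (e\<^sup>2)" .
  show "(\<lambda>x. mollify r f x - f x) \<in> L2" "l2_norm (\<lambda>x. mollify r f x - f x) \<le> e"
    by (rule L2_nn_integral_bound[OF Fm e *])+
qed

abbreviation moll :: "nat \<Rightarrow> ('a::euclidean_space \<Rightarrow> complex) \<Rightarrow> 'a \<Rightarrow> complex"
  where "moll n \<equiv> mollify (inverse (real (Suc n)))"

lemma inverse_Suc_pos: "0 < inverse (real (Suc n))"
  by simp

lemma inverse_Suc_less: "N \<le> n \<Longrightarrow> inverse (real (Suc N)) < d \<Longrightarrow> inverse (real (Suc n)) < d"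
  using le_imp_inverse_le[of "real (Suc N)" "real (Suc n)"] by linarith

lemma moll_L2:
  fixes f :: "'a::euclidean_space \<Rightarrow> complex"
  assumes f: "f \<in> L2"
  shows "moll n f \<in> L2"
proof -
  have "l2_norm (\<lambda>x. f (x - h) - f x) \<le> 2 * l2_norm f" for h
    using l2_norm_triangle[OF L2_translate(1)[OF f] L2_uminus[OF f], of h] L2_translate(2)[OF f, of h]
      l2_norm_cmult[of "-1" f] by simp
  then have "(\<lambda>x. moll n f x - f x) \<in> L2"
    by (intro mollify_L2_diff(1)[OF inverse_Suc_pos f, of "2 * l2_norm f"]) auto
  from L2_add[OF this f] show ?thesis
    by simp
qed

lemma moll_tendsto_L2:
  fixes f :: "'a::euclidean_space \<Rightarrow> complex"
  assumes f: "f \<in> L2"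
  shows "(\<lambda>n. l2_norm (\<lambda>x. moll n f x - f x)) \<longlonglongrightarrow> 0"
proof (rule LIMSEQ_I)
  fix e :: real assume e: "0 < e"
  then have "0 < e / 2" by simp
  from L2_translation_small[OF f this] obtain d where d: "0 < d"
    "\<And>h. norm h < d \<Longrightarrow> l2_norm (\<lambda>x. f (x - h) - f x) \<le> e / 2"
    by blast
  obtain N where N: "inverse (real (Suc N)) < d"
    using reals_Archimedean[OF d(1)] by auto
  have "norm (l2_norm (\<lambda>x. moll n f x - f x) - 0) < e" if "n \<ge> N" for n
  proof -
    have "l2_norm (\<lambda>x. f (x - h) - f x) \<le> e / 2" if "norm h < inverse (real (Suc n))" for h
      using inverse_Suc_less[OF \<open>n \<ge> N\<close> N] that by (intro d(2)) (rule less_trans)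
    then have "l2_norm (\<lambda>x. moll n f x - f x) \<le> e / 2"
      using e by (intro mollify_L2_diff(2)[OF inverse_Suc_pos f]) simp_all
    then show ?thesis
      using e by simp
  qed
  then show "\<exists>N. \<forall>n\<ge>N. norm (l2_norm (\<lambda>x. moll n f x - f x) - 0) < e"
    by blast
qed

lemma moll_uniform:
  fixes f :: "'a::euclidean_space \<Rightarrow> complex"
  assumes f: "f \<in> L2" and c: "continuous_on UNIV f" and e: "0 < e"
  shows "\<exists>N. \<forall>n\<ge>N. \<forall>x\<in>cball 0 R. cmod (moll n f x - f x) \<le> e"
proof -
  \<comment> \<open>The mollifier radius is at most 1, so averages around points of
    \<open>cball 0 R\<close> see only the ball of radius \<open>R + 1\<close>.\<close>
  have "uniformly_continuous_on (cball 0 (R + 1)) f"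
    by (intro compact_uniformly_continuous compact_cball continuous_on_subset[OF c]) auto
  from this[unfolded uniformly_continuous_on_def, rule_format, OF e] obtain d where d: "0 < d"
    "\<And>x y. x \<in> cball 0 (R + 1) \<Longrightarrow> y \<in> cball 0 (R + 1) \<Longrightarrow> dist y x < d \<Longrightarrow> dist (f y) (f x) < e"
    by blast
  obtain N where N: "inverse (real (Suc N)) < d"
    using reals_Archimedean[OF d(1)] by auto
  have "cmod (moll n f x - f x) \<le> e" if n: "n \<ge> N" and x: "x \<in> cball 0 R" for n x
  proof (rule mollify_pointwise[OF inverse_Suc_pos L2_locally_integrable[OF f]])
    fix y :: 'a assume y: "norm y < inverse (real (Suc n))"
    have "inverse (real (Suc n)) < d" "inverse (real (Suc n)) \<le> 1"
      using inverse_Suc_less[OF n N] le_imp_inverse_le[of 1 "real (Suc n)"] by auto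
    then have "norm y < d" "norm (x - y) \<le> R + 1"
      using y x norm_triangle_ineq4[of x y] unfolding mem_cball dist_0_norm by linarith+
    then have "x - y \<in> cball 0 (R + 1)" "x \<in> cball 0 (R + 1)" "dist (x - y) x < d"
      using x unfolding mem_cball dist_0_norm by (simp_all add: dist_norm)
    then have "dist (f (x - y)) (f x) < e"
      by (intro d(2))
    then show "cmod (f (x - y) - f x) \<le> e"
      by (simp add: dist_norm)
  qed
  then show ?thesis by blast
qed

lemma moll_tendsto_pointwise:
  fixes f :: "'a::euclidean_space \<Rightarrow> complex"
  assumes "f \<in> L2" "continuous_on UNIV f"
  shows "(\<lambda>n. moll n f x) \<longlonglongrightarrow> f x"
proof (rule LIMSEQ_I)
  fix e :: real assume "0 < e"
  then have "0 < e / 2" by simp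
  from moll_uniform[OF assms this, of "norm x"] obtain N where N: "\<forall>n\<ge>N. \<forall>y\<in>cball 0 (norm x). cmod (moll n f y - f y) \<le> e / 2"
    by blast
  have "norm (moll n f x - f x) < e" if "n \<ge> N" for n
  proof -
    have "cmod (moll n f x - f x) \<le> e / 2"
      using N that by (simp del: of_nat_Suc)
    then show ?thesis
      using \<open>0 < e\<close> by linarith
  qed
  then show "\<exists>N. \<forall>n\<ge>N. norm (moll n f x - f x) < e"
    by blast
qed

text \<open>A mollification evaluated at \<open>x\<close> is the pairing with this reflected kernel.
  Hence anything assumed about pairings with test functions supported in an open set applies to
  mollifications at nearby points.\<close>

lemma test_function_mollifier_reflect:
  assumes "0 < r"
  shows "test_function (\<lambda>y::'a::euclidean_space. complex_of_real (mollifier r (x - y)))"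
    "\<And>y. complex_of_real (mollifier r (x - y)) \<noteq> 0 \<Longrightarrow> y \<in> ball x r"
    "partial b (\<lambda>y::'a. complex_of_real (mollifier r (x - y))) y
      = - partial b (\<lambda>z. complex_of_real (mollifier r z)) (x - y)"
proof -
  show "test_function (\<lambda>y::'a. complex_of_real (mollifier r (x - y)))"
    by (rule test_function_reflect[OF test_function_mollifier[OF assms]])
  show "\<And>y. complex_of_real (mollifier r (x - y)) \<noteq> 0 \<Longrightarrow> y \<in> ball x r"
    using mollifier_support[OF assms, of "x - _"] by (force simp: dist_norm)
  show "partial b (\<lambda>y::'a. complex_of_real (mollifier r (x - y))) y
      = - partial b (\<lambda>z. complex_of_real (mollifier r z)) (x - y)"
    by (rule partial_reflect[OF test_function_differentiable[OF test_function_mollifier[OF assms]]])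
qed

lemma mollify_has_derivative:
  fixes f :: "'a::euclidean_space \<Rightarrow> complex"
  assumes "0 < r" "locally_integrable f"
  shows "(mollify r f has_derivative
    (\<lambda>v. \<Sum>b\<in>Basis. (v \<bullet> b) *\<^sub>R - (LINT y|lborel. f y * partial b (\<lambda>y. complex_of_real (mollifier r (x - y))) y))) (at x)"
proof -
  obtain R where R[rule_format]: "\<forall>k. Ck k (\<lambda>x::'a. complex_of_real (mollifier r x))" "0 < R"
    "\<forall>x::'a. R < norm x \<longrightarrow> complex_of_real (mollifier r x) = 0"
    by (rule test_functionE[OF test_function_mollifier[OF assms(1)]])
  show ?thesis
    using conv_has_derivative[OF assms(2) R(1) R(3), where x = x]
    by (simp add: mollify_def test_function_mollifier_reflect(3)[OF assms(1)] conv_def)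
qed

text \<open>The fundamental lemma of the calculus of variations: at a point of \<open>S\<close> the
  mollifications vanish once their radius fits into \<open>S\<close>, and along a subsequence they
  converge to \<open>f\<close> almost everywhere.\<close>

lemma L2_zero_on_open:
  fixes f :: "'a::euclidean_space \<Rightarrow> complex"
  assumes f: "f \<in> L2" and S: "open S"
    and z: "\<And>\<phi>. test_function \<phi> \<Longrightarrow> {x. \<phi> x \<noteq> 0} \<subseteq> S \<Longrightarrow> (LINT x|lborel. f x * \<phi> x) = 0"
  shows "AE x in lborel. x \<in> S \<longrightarrow> f x = 0"
proof -
  obtain k where k: "strict_mono k" "AE x in lborel. (\<lambda>n. moll (k n) f x) \<longlonglongrightarrow> f x"
    by (rule L2_lim_AE_subseq[OF moll_L2[OF f] f moll_tendsto_L2[OF f]])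
  from k(2) show ?thesis
  proof eventually_elim
    case (elim x)
    show ?case
    proof
      assume "x \<in> S"
      then obtain d where d: "0 < d" "ball x d \<subseteq> S"
        using S open_contains_ball by blast
      obtain N where N: "inverse (real (Suc N)) < d"
        using reals_Archimedean[OF d(1)] by auto
      have "moll n f x = 0" if "n \<ge> N" for n
      proof -
        have "ball x (inverse (real (Suc n))) \<subseteq> S"
          using subset_ball[OF less_imp_le[OF inverse_Suc_less[OF that N]], of x] d(2) by (rule subset_trans)
        then show ?thesis
          unfolding mollify_def conv_def
          using test_function_mollifier_reflect(1,2)[OF inverse_Suc_pos, where x = x]
          by (intro z) blast+
      qed
      then have "\<forall>\<^sub>F n in sequentially. moll (k n) f x = 0"
        using strict_mono_imp_increasing[OF k(1)] by (intro eventually_sequentiallyI[of N]) (meson le_trans)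
      then have "(\<lambda>n. moll (k n) f x) \<longlonglongrightarrow> 0"
        by (rule tendsto_eventually)
      then show "f x = 0"
        using elim LIMSEQ_unique by blast
    qed
  qed
qed

text \<open>The lemma of du Bois-Reymond. Mollifications of radius less than \<open>r / 2\<close>
  have zero gradient on the concentric ball of half the radius, because their kernels stay inside
  \<open>ball x0 r\<close>; so they are constant there, and so is their limit.\<close>

lemma L2_zero_gradient_constant:
  fixes q :: "'a::euclidean_space \<Rightarrow> complex"
  assumes q: "q \<in> L2" and r: "0 < r"
    and z: "\<And>\<phi> b. test_function \<phi> \<Longrightarrow> {x. \<phi> x \<noteq> 0} \<subseteq> ball x0 r \<Longrightarrow> b \<in> Basis
      \<Longrightarrow> (LINT x|lborel. q x * partial b \<phi> x) = 0"
  shows "\<exists>c. AE x in lborel. x \<in> ball x0 (r / 2) \<longrightarrow> q x = c"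
proof -
  obtain k where k: "strict_mono k" "AE x in lborel. (\<lambda>n. moll (k n) q x) \<longlonglongrightarrow> q x"
    by (rule L2_lim_AE_subseq[OF moll_L2[OF q] q moll_tendsto_L2[OF q]])
  obtain N where N: "inverse (real (Suc N)) < r / 2"
    using reals_Archimedean[of "r / 2"] r by auto
  have const: "moll n q x = moll n q x0" if n: "n \<ge> N" and x: "x \<in> ball x0 (r / 2)" for n x
  proof -
    have s: "inverse (real (Suc n)) < r / 2"
      by (rule inverse_Suc_less[OF n N])
    have "(moll n q has_derivative (\<lambda>h. 0)) (at x within ball x0 (r / 2))" if x: "x \<in> ball x0 (r / 2)" for x
    proof -
      have sub: "ball x (inverse (real (Suc n))) \<subseteq> ball x0 r"
      proof
        fix y assume "y \<in> ball x (inverse (real (Suc n)))"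
        then show "y \<in> ball x0 r"
          using dist_triangle[of x0 y x] x s by simp
      qed
      have "(LINT y|lborel. q y * partial b (\<lambda>y. complex_of_real (mollifier (inverse (real (Suc n))) (x - y))) y) = 0"
        if "b \<in> Basis" for b
        using test_function_mollifier_reflect(1,2)[OF inverse_Suc_pos, where x = x] sub that
        by (intro z) blast+
      then have "(\<lambda>v. \<Sum>b\<in>Basis. (v \<bullet> b) *\<^sub>R - (LINT y|lborel. q y *
          partial b (\<lambda>y. complex_of_real (mollifier (inverse (real (Suc n))) (x - y))) y)) = (\<lambda>v. 0)"
        by (intro ext sum.neutral ballI) (simp del: of_nat_Suc)
      then have "(moll n q has_derivative (\<lambda>h. 0)) (at x)"
        using mollify_has_derivative[OF inverse_Suc_pos L2_locally_integrable[OF q], of n x] by (simp only:)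
      then show ?thesis
        by (rule has_derivative_at_withinI)
    qed
    from has_derivative_zero_constant[OF convex_ball this] obtain c where "\<And>x. x \<in> ball x0 (r / 2) \<Longrightarrow> moll n q x = c"
      by blast
    then show ?thesis
      using x r by simp
  qed
  \<comment> \<open>The constant is the limit of the mollified values at the centre; that limit
    exists as soon as one point of the smaller ball is a point of convergence.\<close>
  have "AE x in lborel. x \<in> ball x0 (r / 2) \<longrightarrow> q x = lim (\<lambda>n. moll (k n) q x0)"
    using k(2)
  proof eventually_elim
    case (elim x)
    show ?case
    proof
      assume x: "x \<in> ball x0 (r / 2)"
      have "\<forall>\<^sub>F n in sequentially. moll (k n) q x = moll (k n) q x0"
        using strict_mono_imp_increasing[OF k(1)] by (intro eventually_sequentiallyI[of N] const x) (meson le_trans)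
      then have "(\<lambda>n. moll (k n) q x0) \<longlonglongrightarrow> q x"
        using elim by (rule Lim_transform_eventually[rotated])
      then show "q x = lim (\<lambda>n. moll (k n) q x0)"
        by (rule limI[symmetric])
    qed
  qed
  then show ?thesis by blast
qed

section \<open>Weak gradients\<close>

lemma H1_gradientD:
  assumes "H1_gradient u G"
  shows "u \<in> L2" "\<And>b. b \<in> Basis \<Longrightarrow> G b \<in> L2"
    "\<And>b \<phi>. b \<in> Basis \<Longrightarrow> test_function \<phi> \<Longrightarrow>
      (LINT x|lborel. u x * partial b \<phi> x) = - (LINT x|lborel. G b x * \<phi> x)"
  using assms by (auto simp: H1_gradient_def)

lemma H1_gradient_unique:
  assumes "H1_gradient u G" "H1_gradient u G'" "b \<in> Basis"
  shows "AE x in lborel. G b x = G' b x"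
proof -
  have L: "G b \<in> L2" "G' b \<in> L2"
    using assms H1_gradientD(2) by blast+
  have "AE x in lborel. x \<in> UNIV \<longrightarrow> G b x - G' b x = 0"
  proof (rule L2_zero_on_open[OF L2_diff[OF L] open_UNIV])
    fix \<phi> :: "'a \<Rightarrow> complex" assume t: "test_function \<phi>"
    have "(LINT x|lborel. G b x * \<phi> x) = (LINT x|lborel. G' b x * \<phi> x)"
      using H1_gradientD(3)[OF assms(1,3) t] H1_gradientD(3)[OF assms(2,3) t] by simp
    then show "(LINT x|lborel. (G b x - G' b x) * \<phi> x) = 0"
      using L2_mult_integrable[OF L(1) test_function_L2[OF t]] L2_mult_integrable[OF L(2) test_function_L2[OF t]]
      by (simp add: left_diff_distrib)
  qed
  then show ?thesis by simp
qed

text \<open>The weak derivative is tested with a reflected mollifier; the sign of weak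
  differentiation cancels the sign produced by the reflection.\<close>

lemma partial_mollify_H1:
  assumes "0 < r" "H1_gradient u G" "b \<in> Basis"
  shows "partial b (mollify r u) x = mollify r (G b) x"
proof -
  let ?m = "\<lambda>y. complex_of_real (mollifier r (x - y))"
  have "partial b (mollify r u) x = (\<Sum>i\<in>Basis. (b \<bullet> i) *\<^sub>R - (LINT y|lborel. u y * partial i ?m y))"
    by (rule partial_eqI[OF mollify_has_derivative[OF assms(1) L2_locally_integrable[OF H1_gradientD(1)[OF assms(2)]]]])
  also have "\<dots> = (\<Sum>i\<in>Basis. if i = b then - (LINT y|lborel. u y * partial b ?m y) else 0)"
    using assms(3) by (intro sum.cong) (auto simp: inner_Basis)
  also have "\<dots> = - (LINT y|lborel. u y * partial b ?m y)"
    using assms(3) by simp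
  also have "\<dots> = (LINT y|lborel. G b y * ?m y)"
    using H1_gradientD(3)[OF assms(2,3) test_function_mollifier_reflect(1)[OF assms(1)]] by simp
  finally show ?thesis
    by (simp add: mollify_def conv_def)
qed

text \<open>The limits of integrals in the regularisation arguments below have this shape: a bounded
  coefficient converging almost everywhere, times two factors converging in the mean. Integrability
  is recorded as well, so that integrals of sums can be split.\<close>

lemma L2_triple_tendsto:
  fixes c :: "nat \<Rightarrow> 'a::euclidean_space \<Rightarrow> complex"
  assumes c: "\<And>n. c n \<in> borel_measurable borel" "c' \<in> borel_measurable borel"
    and M: "\<And>n x. cmod (c n x) \<le> M"
    and lim: "AE x in lborel. (\<lambda>n. c n x) \<longlonglongrightarrow> c' x"
    and a: "\<And>n. a n \<in> L2" "a' \<in> L2" "(\<lambda>n. l2_norm (\<lambda>x. a n x - a' x)) \<longlonglongrightarrow> 0"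
    and q: "\<And>n. q n \<in> L2" "q' \<in> L2" "(\<lambda>n. l2_norm (\<lambda>x. q n x - q' x)) \<longlonglongrightarrow> 0"
  shows "(\<lambda>n. LINT x|lborel. (c n x * a n x) * q n x) \<longlonglongrightarrow> (LINT x|lborel. (c' x * a' x) * q' x)"
    "integrable lborel (\<lambda>x. (c n x * a n x) * q n x)" "integrable lborel (\<lambda>x. (c' x * a' x) * q' x)"
proof -
  have L: "(\<lambda>x. c n x * a n x) \<in> L2" for n
    by (rule L2_mult_bounded(1)[OF a(1) c(1) M])
  note L' = L2_bounded_mult_tendsto[OF c M lim a]
  show "(\<lambda>n. LINT x|lborel. (c n x * a n x) * q n x) \<longlonglongrightarrow> (LINT x|lborel. (c' x * a' x) * q' x)"
    by (rule L2_integral_mult_tendsto[OF L L' q])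
  show "integrable lborel (\<lambda>x. (c n x * a n x) * q n x)"
    by (rule L2_mult_integrable[OF L q(1)])
  show "integrable lborel (\<lambda>x. (c' x * a' x) * q' x)"
    by (rule L2_mult_integrable[OF L'(1) q(2)])
qed

lemma l2_norm_0 [simp]: "l2_norm (\<lambda>x. 0) = 0"
  by (simp add: l2_norm_def)

lemma Ck_differentiable: "Ck (Suc k) f \<Longrightarrow> f differentiable (at x)"
  by simp

lemma moll_smooth:
  assumes "H1_gradient u G"
  shows "Ck k (moll n u)" "moll n u differentiable (at x)"
    "b \<in> Basis \<Longrightarrow> partial b (moll n u) x = moll n (G b) x"
proof -
  have l: "locally_integrable u"
    by (rule L2_locally_integrable[OF H1_gradientD(1)[OF assms]])
  show "Ck k (moll n u)"
    by (rule Ck_mollify[OF inverse_Suc_pos l])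
  show "moll n u differentiable (at x)"
    by (rule Ck_differentiable[OF Ck_mollify[OF inverse_Suc_pos l, where k = "Suc 0"]])
  show "b \<in> Basis \<Longrightarrow> partial b (moll n u) x = moll n (G b) x"
    by (rule partial_mollify_H1[OF inverse_Suc_pos assms])
qed

lemma test_function_bounded:
  fixes \<phi> :: "'a::euclidean_space \<Rightarrow> complex"
  assumes "test_function \<phi>"
  obtains M where "0 < M" "\<forall>x. cmod (\<phi> x) \<le> M"
proof -
  obtain R where R[rule_format]: "\<forall>k. Ck k \<phi>" "0 < R" "\<forall>x. R < norm x \<longrightarrow> \<phi> x = 0"
    by (rule test_functionE[OF assms])
  obtain M where "0 < M" "\<forall>x. cmod (\<phi> x) \<le> M"
    by (rule bounded_support_bounded[OF test_function_continuous[OF assms] R(3)])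
  then show thesis
    by (rule that)
qed

lemma test_function_measurable:
  fixes \<phi> :: "'a::euclidean_space \<Rightarrow> complex"
  shows "test_function \<phi> \<Longrightarrow> \<phi> \<in> borel_measurable borel"
  by (intro borel_measurable_continuous_onI test_function_continuous)

text \<open>Both factors are mollified, the classical product rule is integrated, and the three
  terms pass to the limit. A product of two \<open>H1\<close> functions is in general only
  integrable, so the rule is an identity against test functions and not an
  \<open>H1_gradient\<close>.\<close>

lemma H1_product:
  fixes u w :: "'a::euclidean_space \<Rightarrow> complex"
  assumes u: "H1_gradient u Gu" and w: "H1_gradient w Gw" and b: "b \<in> Basis" and t: "test_function \<phi>"
  shows "(LINT x|lborel. (u x * w x) * partial b \<phi> x)
    = - (LINT x|lborel. (u x * Gw b x + Gu b x * w x) * \<phi> x)"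
proof -
  obtain R where R[rule_format]: "\<forall>k. Ck k \<phi>" "0 < R" "\<forall>x. R < norm x \<longrightarrow> \<phi> x = 0"
    by (rule test_functionE[OF t])
  have t': "test_function (partial b \<phi>)"
    by (rule test_function_partial[OF t b])
  obtain M where M[rule_format]: "0 < M" "\<forall>x. cmod (\<phi> x) \<le> M"
    by (rule test_function_bounded[OF t])
  obtain M' where M'[rule_format]: "0 < M'" "\<forall>x. cmod (partial b \<phi> x) \<le> M'"
    by (rule test_function_bounded[OF t'])
  note L = H1_gradientD(1)[OF u] H1_gradientD(1)[OF w] H1_gradientD(2)[OF u b] H1_gradientD(2)[OF w b]
  note T = L2_triple_tendsto[OF test_function_measurable test_function_measurable _ AE_I2[OF tendsto_const]
      moll_L2 _ moll_tendsto_L2 moll_L2 _ moll_tendsto_L2]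
  note T1 = T[OF t' t' M'(2) L(1) L(1) L(1) L(2) L(2) L(2)]
  note T2 = T[OF t t M(2) L(1) L(1) L(1) L(4) L(4) L(4)]
  note T3 = T[OF t t M(2) L(3) L(3) L(3) L(2) L(2) L(2)]
  have eq: "(LINT x|lborel. (partial b \<phi> x * moll n u x) * moll n w x)
      + ((LINT x|lborel. (\<phi> x * moll n u x) * moll n (Gw b) x)
      + (LINT x|lborel. (\<phi> x * moll n (Gu b) x) * moll n w x)) = 0" for n
  proof -
    have c: "Ck 1 (\<lambda>x. (moll n u x * moll n w x) * \<phi> x)"
      by (intro Ck_mult moll_smooth(1)[OF u] moll_smooth(1)[OF w] R(1))
    have z: "(moll n u x * moll n w x) * \<phi> x = 0" if "R < norm x" for x
      using R(3)[OF that] by simp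
    have d: "(\<lambda>x. moll n u x * moll n w x) differentiable (at x)" for x
      by (intro differentiable_mult moll_smooth(2)[OF u] moll_smooth(2)[OF w])
    have "partial b (\<lambda>x. (moll n u x * moll n w x) * \<phi> x) x
        = (partial b \<phi> x * moll n u x) * moll n w x
          + ((\<phi> x * moll n u x) * moll n (Gw b) x + (\<phi> x * moll n (Gu b) x) * moll n w x)" for x
      unfolding partial_mult[OF d test_function_differentiable[OF t]]
        partial_mult[OF moll_smooth(2)[OF u] moll_smooth(2)[OF w]] moll_smooth(3)[OF u b] moll_smooth(3)[OF w b]
      by (simp add: algebra_simps)
    then have "(LINT x|lborel. (partial b \<phi> x * moll n u x) * moll n w x
          + ((\<phi> x * moll n u x) * moll n (Gw b) x + (\<phi> x * moll n (Gu b) x) * moll n w x)) = 0"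
      using integral_partial_zero[OF c z b] by simp
    then show ?thesis
      using T1(2)[of n] T2(2)[of n] T3(2)[of n]
      by (simp only: Bochner_Integration.integral_add Bochner_Integration.integrable_add)
  qed
  have "(\<lambda>n. (LINT x|lborel. (partial b \<phi> x * moll n u x) * moll n w x)
      + ((LINT x|lborel. (\<phi> x * moll n u x) * moll n (Gw b) x)
      + (LINT x|lborel. (\<phi> x * moll n (Gu b) x) * moll n w x)))
    \<longlonglongrightarrow> (LINT x|lborel. (partial b \<phi> x * u x) * w x)
      + ((LINT x|lborel. (\<phi> x * u x) * Gw b x) + (LINT x|lborel. (\<phi> x * Gu b x) * w x))"
    by (intro tendsto_add T1(1) T2(1) T3(1))
  then have "(LINT x|lborel. (partial b \<phi> x * u x) * w x)
      + ((LINT x|lborel. (\<phi> x * u x) * Gw b x) + (LINT x|lborel. (\<phi> x * Gu b x) * w x)) = 0"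
    unfolding eq by (simp add: tendsto_const_iff)
  also have "(LINT x|lborel. (\<phi> x * u x) * Gw b x) + (LINT x|lborel. (\<phi> x * Gu b x) * w x)
      = (LINT x|lborel. (\<phi> x * u x) * Gw b x + (\<phi> x * Gu b x) * w x)"
    using T2(3) T3(3) by simp
  finally show ?thesis
    by (simp add: add_eq_0_iff2 algebra_simps)
qed

lemma H1_gradient_cnj:
  assumes "H1_gradient u G"
  shows "H1_gradient (\<lambda>x. cnj (u x)) (\<lambda>b x. cnj (G b x))"
  unfolding H1_gradient_def
proof (intro conjI ballI allI impI)
  note D = H1_gradientD[OF assms]
  show "(\<lambda>x. cnj (u x)) \<in> L2"
    by (rule L2_cnj[OF D(1)])
  fix b :: 'a assume b: "b \<in> Basis"
  show "(\<lambda>x. cnj (G b x)) \<in> L2"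
    by (rule L2_cnj[OF D(2)[OF b]])
  fix \<phi> :: "'a \<Rightarrow> complex" assume t: "test_function \<phi>"
  obtain R where R[rule_format]: "\<forall>k. Ck k \<phi>" "0 < R" "\<forall>x. R < norm x \<longrightarrow> \<phi> x = 0"
    by (rule test_functionE[OF t])
  have t': "test_function (\<lambda>x. cnj (\<phi> x))"
    by (rule test_functionI[of _ R]) (auto intro!: Ck_bounded_linear_comp[OF bounded_linear_cnj] simp: R)
  have "(LINT x|lborel. cnj (u x * partial b (\<lambda>x. cnj (\<phi> x)) x)) = - (LINT x|lborel. cnj (G b x * cnj (\<phi> x)))"
    unfolding Bochner_Integration.integral_cnj D(3)[OF b t'] by simp
  then show "(LINT x|lborel. cnj (u x) * partial b \<phi> x) = - (LINT x|lborel. cnj (G b x) * \<phi> x)"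
    by (simp add: partial_bounded_linear[OF bounded_linear_cnj test_function_differentiable[OF t]])
qed

section \<open>Restriction of a weakly differentiable function to a component of its support\<close>

text \<open>By the second assumption every point has a neighbourhood on which the product is either
  \<open>g\<close> or 0, so the jump of the indicator is never seen by the derivative.\<close>

lemma Ck_indicator_mult:
  fixes g :: "'a::euclidean_space \<Rightarrow> complex"
  assumes "\<And>k. Ck k g"
    and "\<And>x. \<exists>S. open S \<and> x \<in> S \<and> (S \<subseteq> C \<or> S \<inter> C = {} \<or> (\<forall>y\<in>S. g y = 0))"
  shows "Ck 1 (\<lambda>x. indicator C x * g x)" "\<And>x b. partial b (\<lambda>x. indicator C x * g x) x = indicator C x * partial b g x"
proof -
  have diff: "g differentiable (at x)" for x
    by (rule Ck_differentiable[OF assms(1)[of "Suc 0"]])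
  have D: "((\<lambda>x. indicator C x * g x) has_derivative (\<lambda>v. indicator C x * frechet_derivative g (at x) v)) (at x)" for x
  proof -
    obtain S where S: "open S" "x \<in> S" "S \<subseteq> C \<or> S \<inter> C = {} \<or> (\<forall>y\<in>S. g y = 0)"
      using assms(2) by blast
    have g: "(g has_derivative frechet_derivative g (at x)) (at x)"
      using diff by (simp add: frechet_derivative_works)
    have z: "((\<lambda>x. 0) has_derivative (\<lambda>v. 0::complex)) (at x)"
      by simp
    consider "S \<subseteq> C" | "S \<inter> C = {}" | "\<forall>y\<in>S. g y = 0"
      using S(3) by blast
    then show ?thesis
    proof cases
      case 1
      have "((\<lambda>x. indicator C x * g x) has_derivative frechet_derivative g (at x)) (at x)"
        by (rule has_derivative_transform_within_open[OF g S(1,2)]) (use 1 in \<open>auto simp: indicator_def\<close>)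
      then show ?thesis
        using 1 S(2) by (auto simp: indicator_def)
    next
      case 2
      have "((\<lambda>x. indicator C x * g x) has_derivative (\<lambda>v. 0)) (at x)"
        by (rule has_derivative_transform_within_open[OF z S(1,2)]) (use 2 in \<open>auto simp: indicator_def\<close>)
      then show ?thesis
        using 2 S(2) by (auto simp: indicator_def)
    next
      case 3
      have "(g has_derivative (\<lambda>v. 0)) (at x)"
        by (rule has_derivative_transform_within_open[OF z S(1,2)]) (use 3 in auto)
      then have "frechet_derivative g (at x) = (\<lambda>v. 0)"
        using frechet_derivative_at by fastforce
      moreover have "((\<lambda>x. indicator C x * g x) has_derivative (\<lambda>v. 0)) (at x)"
        by (rule has_derivative_transform_within_open[OF z S(1,2)]) (use 3 in auto)
      ultimately show ?thesis
        by simp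
    qed
  qed
  show p: "partial b (\<lambda>x. indicator C x * g x) x = indicator C x * partial b g x" for x b
    unfolding partial_def[of b g] by (rule partial_eqI[OF D])
  have "isCont (\<lambda>x. indicator C x * partial b g x) x" if b: "b \<in> Basis" for b x
  proof -
    obtain S where S: "open S" "x \<in> S" "S \<subseteq> C \<or> S \<inter> C = {} \<or> (\<forall>y\<in>S. g y = 0)"
      using assms(2) by blast
    have c: "isCont (partial b g) x"
      using Ck_continuous[of 0 "partial b g"] assms(1)[of "Suc 0"] b
      by (auto simp: continuous_on_eq_continuous_at)
    have ev: "\<forall>\<^sub>F y in nhds x. y \<in> S"
      using S by (auto simp: eventually_nhds)
    consider "S \<subseteq> C" | "S \<inter> C = {} \<or> (\<forall>y\<in>S. g y = 0)"
      using S(3) by blast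
    then show ?thesis
    proof cases
      case 1
      have "\<forall>\<^sub>F y in nhds x. partial b g y = indicator C y * partial b g y"
        using ev by eventually_elim (use 1 in \<open>auto simp: indicator_def\<close>)
      from isCont_cong[OF this] show ?thesis
        using c by simp
    next
      case 2
      have "\<forall>\<^sub>F y in nhds x. 0 = indicator C y * partial b g y"
        using ev
      proof eventually_elim
        case (elim y)
        show ?case
          using 2
        proof
          assume "S \<inter> C = {}"
          then show ?thesis
            using elim by (auto simp: indicator_def)
        next
          assume "\<forall>y\<in>S. g y = 0"
          then show ?thesis
            using partial_zero_open[OF S(1) elim, of g b] by simp
        qed
      qed
      from isCont_cong[OF this] show ?thesis
        by simp
    qed
  qed
  then have "continuous_on UNIV (\<lambda>x. indicator C x * partial b g x)" if "b \<in> Basis" for b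
    using that by (simp add: continuous_at_imp_continuous_on)
  moreover have "(\<lambda>x. indicator C x * g x) differentiable (at x)" for x
    using D by (auto simp: differentiable_def)
  moreover have "partial b (\<lambda>x. indicator C x * g x) = (\<lambda>x. indicator C x * partial b g x)" for b
    using p by (rule ext)
  ultimately show "Ck 1 (\<lambda>x. indicator C x * g x)"
    by (simp add: One_nat_def)
qed

text \<open>The cut-off \<open>cutoff \<epsilon> z\<close> vanishes for \<open>|z|\<^sup>2 \<le> \<epsilon>\<close> and tends to \<open>1\<close> for \<open>z \<noteq> 0\<close> as \<open>\<epsilon> \<rightarrow> 0\<close>; the derivative of
  \<open>z \<mapsto> cutoff \<epsilon> z * z\<close> in the direction \<open>w\<close> is \<open>cutoff \<epsilon> z * w + cutoff1 \<epsilon> z * w + cutoff2 \<epsilon> z * cnj w\<close>, where all three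
  coefficients are bounded independently of \<open>\<epsilon>\<close>.\<close>

definition cutoff :: "real \<Rightarrow> complex \<Rightarrow> complex"
  where "cutoff \<epsilon> z = complex_of_real (flat 0 ((cmod z)\<^sup>2 / \<epsilon> - 1))"

definition cutoff1 :: "real \<Rightarrow> complex \<Rightarrow> complex"
  where "cutoff1 \<epsilon> z = complex_of_real (flat 2 ((cmod z)\<^sup>2 / \<epsilon> - 1) / \<epsilon>) * (z * cnj z)"

definition cutoff2 :: "real \<Rightarrow> complex \<Rightarrow> complex"
  where "cutoff2 \<epsilon> z = complex_of_real (flat 2 ((cmod z)\<^sup>2 / \<epsilon> - 1) / \<epsilon>) * (z * z)"

lemma cutoff_le: "cmod (cutoff \<epsilon> z) \<le> 1"
  using flat_le_fact[of 0] by (simp add: cutoff_def flat_nonneg)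

text \<open>With \<open>s + 1 = (cmod z)\<^sup>2 / \<epsilon>\<close> the left side is the modulus
  of \<open>cutoff1\<close> and of \<open>cutoff2\<close>. It equals
  \<open>flat 1 s + flat 2 s\<close> for positive \<open>s\<close>, and 3 is the sum of their bounds
  1 and 2.\<close>

lemma flat_2_bound: "flat 2 s * (s + 1) \<le> 3"
proof (cases "0 < s")
  case True
  then have "flat 2 s * (s + 1) = flat 1 s + flat 2 s"
    by (simp add: flat_def field_simps power2_eq_square)
  then show ?thesis
    using flat_le_fact[of 1 s] flat_le_fact[of 2 s] by (simp add: fact_2)
qed (simp add: flat_def)

lemma cutoff12_norm:
  assumes "0 < \<epsilon>"
  shows "cmod (cutoff1 \<epsilon> z) = flat 2 ((cmod z)\<^sup>2 / \<epsilon> - 1) * (((cmod z)\<^sup>2 / \<epsilon> - 1) + 1)"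
    "cmod (cutoff2 \<epsilon> z) = flat 2 ((cmod z)\<^sup>2 / \<epsilon> - 1) * (((cmod z)\<^sup>2 / \<epsilon> - 1) + 1)"
  using assms flat_nonneg[of 2 "(cmod z)\<^sup>2 / \<epsilon> - 1"]
  by (simp_all add: cutoff1_def cutoff2_def norm_mult norm_divide power2_eq_square)

lemma cutoff12_le:
  assumes "0 < \<epsilon>"
  shows "cmod (cutoff1 \<epsilon> z) \<le> 3" "cmod (cutoff2 \<epsilon> z) \<le> 3"
  unfolding cutoff12_norm[OF assms] by (rule flat_2_bound)+

lemma continuous_cutoff:
  "continuous_on UNIV (cutoff \<epsilon>)" "continuous_on UNIV (cutoff1 \<epsilon>)" "continuous_on UNIV (cutoff2 \<epsilon>)"
proof -
  have c: "continuous_on UNIV (\<lambda>z::complex. flat j ((cmod z)\<^sup>2 / \<epsilon> - 1))" for j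
    by (rule continuous_on_compose2[OF flat_continuous[of UNIV j]])
      (auto intro!: continuous_intros simp: divide_inverse)
  show "continuous_on UNIV (cutoff \<epsilon>)" "continuous_on UNIV (cutoff1 \<epsilon>)" "continuous_on UNIV (cutoff2 \<epsilon>)"
    unfolding cutoff_def[abs_def] cutoff1_def[abs_def] cutoff2_def[abs_def] divide_inverse[of "flat 2 _"]
    by (intro continuous_intros c)+
qed

lemma flat_tendsto:
  "(flat 0 \<longlongrightarrow> 1) at_top" "((\<lambda>s. flat 2 s * (s + 1)) \<longlongrightarrow> 0) at_top"
proof -
  have i: "((\<lambda>s::real. 1 / s) \<longlongrightarrow> 0) at_top"
    by (intro tendsto_divide_0[OF tendsto_const] filterlim_at_top_imp_at_infinity filterlim_ident)
  have e: "((\<lambda>s::real. exp (- (1 / s))) \<longlongrightarrow> exp (- 0)) at_top"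
    by (intro tendsto_intros i)
  have "\<forall>\<^sub>F s in at_top. exp (- (1 / s)) = flat 0 (s::real)"
    using eventually_gt_at_top[of 0] by eventually_elim (simp add: flat_def)
  from Lim_transform_eventually[OF e this] show "(flat 0 \<longlongrightarrow> 1) at_top"
    by simp
  have e2: "((\<lambda>s::real. exp (- (1 / s)) * ((1 / s) + (1 / s) * (1 / s))) \<longlongrightarrow> exp (- 0) * (0 + 0 * 0)) at_top"
    by (intro tendsto_intros i)
  have "\<forall>\<^sub>F s in at_top. exp (- (1 / s)) * ((1 / s) + (1 / s) * (1 / s)) = flat 2 s * (s + 1::real)"
    using eventually_gt_at_top[of 0]
    by eventually_elim (simp add: flat_def field_simps power2_eq_square)
  from Lim_transform_eventually[OF e2 this] show "((\<lambda>s. flat 2 s * (s + 1)) \<longlongrightarrow> 0) at_top"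
    by simp
qed

lemma cutoff_tendsto:
  "(\<lambda>n. cutoff (inverse (real (Suc n))) z) \<longlonglongrightarrow> (if z = 0 then 0 else 1)"
  "(\<lambda>n. cutoff1 (inverse (real (Suc n))) z) \<longlonglongrightarrow> 0"
  "(\<lambda>n. cutoff2 (inverse (real (Suc n))) z) \<longlonglongrightarrow> 0"
proof -
  let ?s = "\<lambda>n. (cmod z)\<^sup>2 / inverse (real (Suc n)) - 1"
  have lim: "filterlim ?s at_top sequentially" if "z \<noteq> 0"
  proof -
    have "filterlim (\<lambda>n. real (Suc n)) at_top sequentially"
      by (rule filterlim_compose[OF filterlim_real_sequentially filterlim_Suc])
    then have "filterlim (\<lambda>n. (cmod z)\<^sup>2 * real (Suc n)) at_top sequentially"
      using that by (intro filterlim_tendsto_pos_mult_at_top[OF tendsto_const]) auto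
    then have "filterlim (\<lambda>n. (-1) + (cmod z)\<^sup>2 * real (Suc n)) at_top sequentially"
      by (rule filterlim_tendsto_add_at_top[OF tendsto_const])
    then show ?thesis
      by (simp add: divide_inverse algebra_simps)
  qed
  show "(\<lambda>n. cutoff (inverse (real (Suc n))) z) \<longlonglongrightarrow> (if z = 0 then 0 else 1)"
  proof (cases "z = 0")
    case False
    have "(\<lambda>n. complex_of_real (flat 0 (?s n))) \<longlonglongrightarrow> complex_of_real 1"
      by (intro tendsto_of_real filterlim_compose[OF flat_tendsto(1) lim[OF False]])
    then show ?thesis
      using False by (simp add: cutoff_def)
  qed (simp add: cutoff_def flat_def)
  have c: "(\<lambda>n. flat 2 (?s n) * (?s n + 1)) \<longlonglongrightarrow> 0"
  proof (cases "z = 0")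
    case False
    show ?thesis
      by (rule filterlim_compose[OF flat_tendsto(2) lim[OF False]])
  qed (simp add: flat_def)
  show "(\<lambda>n. cutoff1 (inverse (real (Suc n))) z) \<longlonglongrightarrow> 0" "(\<lambda>n. cutoff2 (inverse (real (Suc n))) z) \<longlonglongrightarrow> 0"
    by (rule tendsto_norm_zero_cancel, unfold cutoff12_norm[OF inverse_Suc_pos], rule c)+
qed

lemma Ck_cutoff:
  fixes w :: "'a::euclidean_space \<Rightarrow> complex"
  assumes "Ck k w"
  shows "Ck k (\<lambda>x. cutoff \<epsilon> (w x))"
proof -
  have eq: "cutoff \<epsilon> (w x) = complex_of_real (flat 0 (inverse \<epsilon> * (Re (w x) * Re (w x) + Im (w x) * Im (w x)) + (-1)))" for x
    unfolding cutoff_def cmod_power2 by (simp add: power2_eq_square divide_inverse mult.commute)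
  show ?thesis
    unfolding eq
    by (intro Ck_bounded_linear_comp[OF bounded_linear_of_real] Ck_flat Ck_add Ck_mult Ck_const
        Ck_bounded_linear_comp[OF bounded_linear_Re assms] Ck_bounded_linear_comp[OF bounded_linear_Im assms])
qed

text \<open>The derivative of the squared modulus is \<open>cnj w * w' + w * cnj w'\<close>;
  multiplied by \<open>w\<close>, its two halves give \<open>cutoff1\<close> and
  \<open>cutoff2\<close>. The conjugate enters because a function of the modulus is not complex
  differentiable.\<close>

lemma partial_cutoff_mult:
  fixes w :: "'a::euclidean_space \<Rightarrow> complex"
  assumes "w differentiable (at x)"
  shows "partial b (\<lambda>x. cutoff \<epsilon> (w x) * w x) x
    = cutoff \<epsilon> (w x) * partial b w x + cutoff1 \<epsilon> (w x) * partial b w x + cutoff2 \<epsilon> (w x) * cnj (partial b w x)"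
proof -
  let ?w' = "frechet_derivative w (at x)"
  have w: "(w has_derivative ?w') (at x)"
    using assms by (simp add: frechet_derivative_works)
  let ?s = "(cmod (w x))\<^sup>2 / \<epsilon> - 1"
  have "((\<lambda>x. (w x \<bullet> w x) * inverse \<epsilon> - 1) has_derivative (\<lambda>v. (w x \<bullet> ?w' v + ?w' v \<bullet> w x) * inverse \<epsilon> - 0)) (at x)"
    by (intro has_derivative_diff has_derivative_mult_left has_derivative_inner has_derivative_const w)
  then have s: "((\<lambda>x. (cmod (w x))\<^sup>2 / \<epsilon> - 1) has_derivative (\<lambda>v. 2 * (w x \<bullet> ?w' v) / \<epsilon>)) (at x)"
    by (simp add: power2_norm_eq_inner inner_commute divide_inverse mult.commute)
  have f: "((\<lambda>x. flat 0 ((cmod (w x))\<^sup>2 / \<epsilon> - 1)) has_derivative (\<lambda>v. (2 * (w x \<bullet> ?w' v) / \<epsilon>) * flat 2 ?s)) (at x)"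
    using DERIV_compose_FDERIV[OF flat_has_derivative s, of 0] by (simp add: numeral_2_eq_2)
  have "((\<lambda>x. cutoff \<epsilon> (w x) * w x) has_derivative
      (\<lambda>v. cutoff \<epsilon> (w x) * ?w' v + complex_of_real ((2 * (w x \<bullet> ?w' v) / \<epsilon>) * flat 2 ?s) * w x)) (at x)"
    unfolding cutoff_def by (intro has_derivative_mult has_derivative_of_real f w)
  from partial_eqI[OF this, of b] have
    "partial b (\<lambda>x. cutoff \<epsilon> (w x) * w x) x
      = cutoff \<epsilon> (w x) * partial b w x + complex_of_real ((2 * (w x \<bullet> partial b w x) / \<epsilon>) * flat 2 ?s) * w x"
    by (simp add: partial_def)
  also have "complex_of_real ((2 * (w x \<bullet> partial b w x) / \<epsilon>) * flat 2 ?s) * w x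
      = complex_of_real (flat 2 ?s / \<epsilon>) * (complex_of_real (2 * (w x \<bullet> partial b w x)) * w x)"
    by simp
  also have "complex_of_real (2 * (w x \<bullet> partial b w x)) = cnj (w x) * partial b w x + w x * cnj (partial b w x)"
    by (simp add: complex_eq_iff inner_complex_def)
  finally show ?thesis
    by (simp add: cutoff1_def cutoff2_def algebra_simps)
qed


text \<open>Boundary points of \<open>C\<close> are zeros of \<open>u\<close>. Suppressing values of
  modulus below \<open>sqrt \<epsilon>\<close> makes the regularised function vanish near them, so
  multiplication by the indicator of \<open>C\<close> keeps it \<open>C^1\<close> and an ordinary
  integration by parts is allowed. The bounds on the cut-off derivatives are uniform in
  \<open>\<epsilon>\<close>, so the cut-off can be removed.\<close>

lemma H1_indicator:
  fixes u :: "'a::euclidean_space \<Rightarrow> complex"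
  assumes u: "H1_gradient u G" and c: "continuous_on UNIV u"
    and C: "open C" "open D" "C \<inter> D = {}" "{x. u x \<noteq> 0} = C \<union> D"
  shows "H1_gradient (\<lambda>x. indicator C x * u x) (\<lambda>b x. indicator C x * G b x)"
proof -
  have iC: "(\<lambda>x. indicator C x :: complex) \<in> borel_measurable borel"
    using C(1) by (intro borel_measurable_indicator) auto
  have i1: "cmod (indicator C x) \<le> 1" for x
    by (simp add: indicator_def)
  have L: "u \<in> L2" "\<And>b. b \<in> Basis \<Longrightarrow> G b \<in> L2"
    using H1_gradientD[OF u] by auto
  have main: "(LINT x|lborel. (indicator C x * u x) * partial b \<phi> x) = - (LINT x|lborel. (indicator C x * G b x) * \<phi> x)"
    if b: "b \<in> Basis" and t: "test_function \<phi>" for b \<phi>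
  proof -
    obtain R where R[rule_format]: "\<forall>k. Ck k \<phi>" "0 < R" "\<forall>x. R < norm x \<longrightarrow> \<phi> x = 0"
      by (rule test_functionE[OF t])
    have t': "test_function (partial b \<phi>)"
      by (rule test_function_partial[OF t b])
    note Lp = test_function_L2[OF t] test_function_L2[OF t']
    have mc: "(\<lambda>x. indicator C x * K (w x)) \<in> borel_measurable borel"
      if "continuous_on UNIV K" "continuous_on UNIV w" for K :: "complex \<Rightarrow> complex" and w :: "'a \<Rightarrow> complex"
    proof -
      have "continuous_on UNIV (\<lambda>x. K (w x))"
        by (rule continuous_on_compose2[OF that]) simp
      then show ?thesis
        by (intro borel_measurable_times iC borel_measurable_continuous_onI)
    qed
    have bc: "cmod (indicator C x * z) \<le> M" if "cmod z \<le> M" for x z M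
      using that order_trans[OF norm_ge_zero that] by (simp add: indicator_def)
    \<comment> \<open>The identity at a fixed level \<open>\<epsilon>\<close>. Mollification is sent
      to its limit here, and only afterwards does the level tend to 0.\<close>
    have eps: "(LINT x|lborel. ((indicator C x * cutoff \<epsilon> (u x)) * u x) * partial b \<phi> x)
        + ((LINT x|lborel. ((indicator C x * cutoff \<epsilon> (u x)) * G b x) * \<phi> x)
        + ((LINT x|lborel. ((indicator C x * cutoff1 \<epsilon> (u x)) * G b x) * \<phi> x)
        + (LINT x|lborel. ((indicator C x * cutoff2 \<epsilon> (u x)) * cnj (G b x)) * \<phi> x))) = 0"
      if e: "0 < \<epsilon>" for \<epsilon>
    proof -
      \<comment> \<open>With an error of at most half of \<open>sqrt \<epsilon>\<close>, a
        mollification stays strictly below \<open>sqrt \<epsilon>\<close> at every zero of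
        \<open>u\<close> in the ball, hence also near it, and there the cut-off vanishes.\<close>
      have "0 < sqrt \<epsilon> / 2"
        using e by simp
      from moll_uniform[OF L(1) c this, of R] obtain N where
        N: "\<forall>n\<ge>N. \<forall>x\<in>cball 0 R. cmod (moll n u x - u x) \<le> sqrt \<epsilon> / 2"
        by blast
      define un where "un n = moll (n + N) u" for n
      define gn where "gn n = moll (n + N) (G b)" for n
      have uc: "continuous_on UNIV (un n)" for n
        unfolding un_def by (rule Ck_continuous[OF moll_smooth(1)[OF u, where k = 0]])
      have ul: "AE x in lborel. (\<lambda>n. indicator C x * K (un n x)) \<longlonglongrightarrow> indicator C x * K (u x)"
        if K: "continuous_on UNIV K" for K :: "complex \<Rightarrow> complex"
      proof (rule AE_I2)
        fix x
        have "(\<lambda>n. un n x) \<longlonglongrightarrow> u x"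
          unfolding un_def by (rule LIMSEQ_ignore_initial_segment[OF moll_tendsto_pointwise[OF L(1) c]])
        then show "(\<lambda>n. indicator C x * K (un n x)) \<longlonglongrightarrow> indicator C x * K (u x)"
          by (intro tendsto_mult tendsto_const continuous_on_tendsto_compose[OF K]) auto
      qed
      note ua = moll_L2[OF L(1), of "_ + N", folded un_def] L(1) LIMSEQ_ignore_initial_segment[OF moll_tendsto_L2[OF L(1)], of N, folded un_def]
      note ga = moll_L2[OF L(2)[OF b], of "_ + N", folded gn_def] L(2)[OF b] LIMSEQ_ignore_initial_segment[OF moll_tendsto_L2[OF L(2)[OF b]], of N, folded gn_def]
      have ga': "(\<lambda>n. l2_norm (\<lambda>x. cnj (gn n x) - cnj (G b x))) \<longlonglongrightarrow> 0"
        using ga(3) l2_norm_cnj[of "\<lambda>x. gn _ x - G b x"] unfolding complex_cnj_diff by (simp only:)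
      have zz: "(\<lambda>n::nat. l2_norm (\<lambda>x. f x - f x)) \<longlonglongrightarrow> 0" for f :: "'a \<Rightarrow> complex"
        by simp
      note T1 = L2_triple_tendsto[OF mc[OF continuous_cutoff(1)[of \<epsilon>] uc] mc[OF continuous_cutoff(1) c] bc[OF cutoff_le] ul[OF continuous_cutoff(1)]
          ua Lp(2) Lp(2) zz]
      note T2 = L2_triple_tendsto[OF mc[OF continuous_cutoff(1)[of \<epsilon>] uc] mc[OF continuous_cutoff(1) c] bc[OF cutoff_le] ul[OF continuous_cutoff(1)]
          ga Lp(1) Lp(1) zz]
      note T3 = L2_triple_tendsto[OF mc[OF continuous_cutoff(2) uc] mc[OF continuous_cutoff(2) c] bc[OF cutoff12_le(1)[OF e]] ul[OF continuous_cutoff(2)]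
          ga Lp(1) Lp(1) zz]
      note T4 = L2_triple_tendsto[OF mc[OF continuous_cutoff(3) uc] mc[OF continuous_cutoff(3) c] bc[OF cutoff12_le(2)[OF e]] ul[OF continuous_cutoff(3)]
          L2_cnj[OF ga(1)] L2_cnj[OF ga(2)] ga' Lp(1) Lp(1) zz]
      have eq: "(LINT x|lborel. ((indicator C x * cutoff \<epsilon> (un n x)) * un n x) * partial b \<phi> x)
        + ((LINT x|lborel. ((indicator C x * cutoff \<epsilon> (un n x)) * gn n x) * \<phi> x)
        + ((LINT x|lborel. ((indicator C x * cutoff1 \<epsilon> (un n x)) * gn n x) * \<phi> x)
        + (LINT x|lborel. ((indicator C x * cutoff2 \<epsilon> (un n x)) * cnj (gn n x)) * \<phi> x))) = 0" for n
      proof -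
        define g where "g x = (cutoff \<epsilon> (un n x) * un n x) * \<phi> x" for x
        have us: "Ck k (un n)" "un n differentiable (at x)" "partial b (un n) x = gn n x" for k x
          unfolding un_def gn_def by (rule moll_smooth(1)[OF u] moll_smooth(2)[OF u] moll_smooth(3)[OF u b])+
        have s1: "Ck k (\<lambda>x. cutoff \<epsilon> (un n x) * un n x)" for k
          by (intro Ck_mult Ck_cutoff us)
        have s2: "Ck k g" for k
          unfolding g_def[abs_def] by (intro Ck_mult s1 R(1))
        \<comment> \<open>Points outside \<open>C\<close> and \<open>D\<close> are zeros of
          \<open>u\<close>: within radius \<open>R\<close> the cut-off vanishes nearby, and farther
          out the test function does.\<close>
        have near: "\<exists>S. open S \<and> x \<in> S \<and> (S \<subseteq> C \<or> S \<inter> C = {} \<or> (\<forall>y\<in>S. g y = 0))" for x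
        proof -
          consider "x \<in> C" | "x \<in> D" | "R < norm x" | "u x = 0" "norm x \<le> R"
            using C(4) by fastforce
          then show ?thesis
          proof cases
            case 1
            then show ?thesis
              using C(1) by blast
          next
            case 2
            then show ?thesis
              using C(2,3) by blast
          next
            case 3
            have "open {x::'a. R < norm x}"
              by (intro open_Collect_less continuous_intros)
            then show ?thesis
              using 3 R(3) by (intro exI[of _ "{x. R < norm x}"]) (auto simp: g_def)
          next
            case 4
            have "cmod (un n x - u x) \<le> sqrt \<epsilon> / 2"
              using N 4(2) unfolding un_def by (simp del: of_nat_Suc of_nat_add)
            then have "cmod (un n x) < sqrt \<epsilon>"
              unfolding 4(1) diff_0_right using \<open>0 < sqrt \<epsilon> / 2\<close> by linarith
            moreover have "open {x. cmod (un n x) < sqrt \<epsilon>}"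
              by (intro open_Collect_less continuous_intros uc)
            moreover have "g y = 0" if "cmod (un n y) < sqrt \<epsilon>" for y
            proof -
              have "(cmod (un n y))\<^sup>2 < (sqrt \<epsilon>)\<^sup>2"
                using that by (intro power_strict_mono) auto
              then have "(cmod (un n y))\<^sup>2 / \<epsilon> - 1 < 0"
                using e by simp
              then show ?thesis
                by (simp add: g_def cutoff_def flat_def)
            qed
            ultimately show ?thesis
              by (intro exI[of _ "{x. cmod (un n x) < sqrt \<epsilon>}"]) simp
          qed
        qed
        note I = Ck_indicator_mult[OF s2 near]
        have z: "indicator C x * g x = 0" if "R < norm x" for x
          using R(3)[OF that] by (simp add: g_def)
        have "partial b (\<lambda>x. indicator C x * g x) x = ((indicator C x * cutoff \<epsilon> (un n x)) * un n x) * partial b \<phi> x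
          + (((indicator C x * cutoff \<epsilon> (un n x)) * gn n x) * \<phi> x
          + (((indicator C x * cutoff1 \<epsilon> (un n x)) * gn n x) * \<phi> x
          + ((indicator C x * cutoff2 \<epsilon> (un n x)) * cnj (gn n x)) * \<phi> x))" for x
        proof -
          have "partial b g x = (cutoff \<epsilon> (un n x) * un n x) * partial b \<phi> x
              + (cutoff \<epsilon> (un n x) * gn n x + cutoff1 \<epsilon> (un n x) * gn n x + cutoff2 \<epsilon> (un n x) * cnj (gn n x)) * \<phi> x"
            unfolding g_def[abs_def]
              partial_mult[OF Ck_differentiable[OF s1[of "Suc 0"]] test_function_differentiable[OF t]]
              partial_cutoff_mult[OF us(2)] us(3) ..
          then show ?thesis
            unfolding I(2) by (simp add: algebra_simps)
        qed
        then have "(LINT x|lborel. ((indicator C x * cutoff \<epsilon> (un n x)) * un n x) * partial b \<phi> x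
          + (((indicator C x * cutoff \<epsilon> (un n x)) * gn n x) * \<phi> x
          + (((indicator C x * cutoff1 \<epsilon> (un n x)) * gn n x) * \<phi> x
          + ((indicator C x * cutoff2 \<epsilon> (un n x)) * cnj (gn n x)) * \<phi> x))) = 0"
          using integral_partial_zero[OF I(1) z b] by simp
        then show ?thesis
          using T1(2)[of n] T2(2)[of n] T3(2)[of n] T4(2)[of n]
          by (simp only: Bochner_Integration.integral_add Bochner_Integration.integrable_add)
      qed
      have "(\<lambda>n. (LINT x|lborel. ((indicator C x * cutoff \<epsilon> (un n x)) * un n x) * partial b \<phi> x)
        + ((LINT x|lborel. ((indicator C x * cutoff \<epsilon> (un n x)) * gn n x) * \<phi> x)
        + ((LINT x|lborel. ((indicator C x * cutoff1 \<epsilon> (un n x)) * gn n x) * \<phi> x)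
        + (LINT x|lborel. ((indicator C x * cutoff2 \<epsilon> (un n x)) * cnj (gn n x)) * \<phi> x))))
        \<longlonglongrightarrow> (LINT x|lborel. ((indicator C x * cutoff \<epsilon> (u x)) * u x) * partial b \<phi> x)
        + ((LINT x|lborel. ((indicator C x * cutoff \<epsilon> (u x)) * G b x) * \<phi> x)
        + ((LINT x|lborel. ((indicator C x * cutoff1 \<epsilon> (u x)) * G b x) * \<phi> x)
        + (LINT x|lborel. ((indicator C x * cutoff2 \<epsilon> (u x)) * cnj (G b x)) * \<phi> x)))"
        by (intro tendsto_add T1(1) T2(1) T3(1) T4(1))
      then show ?thesis
        unfolding eq by (simp add: tendsto_const_iff)
    qed
    let ?e = "\<lambda>n. inverse (real (Suc n))"
    \<comment> \<open>Since \<open>u\<close> has no zero on \<open>C\<close>, the first coefficient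
      tends to the full indicator, while the two terms from differentiating the cut-off
      disappear.\<close>
    have el: "AE x in lborel. (\<lambda>n. indicator C x * cutoff (?e n) (u x)) \<longlonglongrightarrow> indicator C x"
      "AE x in lborel. (\<lambda>n. indicator C x * cutoff1 (?e n) (u x)) \<longlonglongrightarrow> 0"
      "AE x in lborel. (\<lambda>n. indicator C x * cutoff2 (?e n) (u x)) \<longlonglongrightarrow> 0"
    proof -
      have "(\<lambda>n. indicator C x * cutoff (?e n) (u x)) \<longlonglongrightarrow> indicator C x * (if u x = 0 then 0 else 1)" for x
        by (intro tendsto_mult tendsto_const cutoff_tendsto(1))
      moreover have "indicator C x * (if u x = 0 then 0 else 1) = (indicator C x :: complex)" for x
        using C(4) by (auto simp: indicator_def)
      ultimately show "AE x in lborel. (\<lambda>n. indicator C x * cutoff (?e n) (u x)) \<longlonglongrightarrow> indicator C x"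
        by (intro AE_I2) (simp only:)
      show "AE x in lborel. (\<lambda>n. indicator C x * cutoff1 (?e n) (u x)) \<longlonglongrightarrow> 0"
        "AE x in lborel. (\<lambda>n. indicator C x * cutoff2 (?e n) (u x)) \<longlonglongrightarrow> 0"
        by (intro AE_I2 tendsto_mult_right_zero cutoff_tendsto)+
    qed
    have zz: "(\<lambda>n::nat. l2_norm (\<lambda>x. f x - f x)) \<longlonglongrightarrow> 0" for f :: "'a \<Rightarrow> complex"
      by simp
    have m0: "(\<lambda>x::'a. 0::complex) \<in> borel_measurable borel"
      by simp
    note T1 = L2_triple_tendsto[OF mc[OF continuous_cutoff(1) c] iC bc[OF cutoff_le] el(1) L(1) L(1) zz Lp(2) Lp(2) zz]
    note T2 = L2_triple_tendsto[OF mc[OF continuous_cutoff(1) c] iC bc[OF cutoff_le] el(1) L(2)[OF b] L(2)[OF b] zz Lp(1) Lp(1) zz]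
    note T3 = L2_triple_tendsto[OF mc[OF continuous_cutoff(2) c] m0 bc[OF cutoff12_le(1)[OF inverse_Suc_pos]] el(2) L(2)[OF b] L(2)[OF b] zz Lp(1) Lp(1) zz]
    note T4 = L2_triple_tendsto[OF mc[OF continuous_cutoff(3) c] m0 bc[OF cutoff12_le(2)[OF inverse_Suc_pos]] el(3) L2_cnj[OF L(2)[OF b]] L2_cnj[OF L(2)[OF b]] zz Lp(1) Lp(1) zz]
    have "(\<lambda>n. (LINT x|lborel. ((indicator C x * cutoff (?e n) (u x)) * u x) * partial b \<phi> x)
        + ((LINT x|lborel. ((indicator C x * cutoff (?e n) (u x)) * G b x) * \<phi> x)
        + ((LINT x|lborel. ((indicator C x * cutoff1 (?e n) (u x)) * G b x) * \<phi> x)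
        + (LINT x|lborel. ((indicator C x * cutoff2 (?e n) (u x)) * cnj (G b x)) * \<phi> x))))
      \<longlonglongrightarrow> (LINT x|lborel. (indicator C x * u x) * partial b \<phi> x)
        + ((LINT x|lborel. (indicator C x * G b x) * \<phi> x)
        + ((LINT x|lborel. (0 * G b x) * \<phi> x)
        + (LINT x|lborel. (0 * cnj (G b x)) * \<phi> x)))"
      by (intro tendsto_add T1(1) T2(1) T3(1) T4(1))
    then have "(LINT x|lborel. (indicator C x * u x) * partial b \<phi> x) + (LINT x|lborel. (indicator C x * G b x) * \<phi> x) = 0"
      unfolding eps[OF inverse_Suc_pos] by (simp add: tendsto_const_iff)
    then show ?thesis
      by (simp add: add_eq_0_iff2)
  qed
  show ?thesis
    unfolding H1_gradient_def
    using main L2_mult_bounded(1)[OF L(1) iC i1] L2_mult_bounded(1)[OF L(2) iC i1] by blast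
qed


section \<open>Functions with the same density and the same current\<close>

text \<open>At a zero of \<open>w\<close> the numerator vanishes on a neighbourhood, so the quotient
  is locally 0 there. Division by zero yields 0, and therefore the quotient rule holds in the same
  form at these points.\<close>

lemma Ck_quotient:
  fixes f w :: "'a::euclidean_space \<Rightarrow> complex"
  assumes f: "Ck 1 f" and w: "Ck 1 w"
    and nz: "\<And>x. w x \<noteq> 0 \<or> (\<exists>S. open S \<and> x \<in> S \<and> (\<forall>y\<in>S. f y = 0))"
  shows "Ck 1 (\<lambda>x. f x / w x)"
    "\<And>x b. partial b (\<lambda>x. f x / w x) x = (partial b f x * w x - f x * partial b w x) / (w x * w x)"
proof -
  have d: "f differentiable (at x)" "w differentiable (at x)" for x
    using f w by (auto simp: One_nat_def)
  have D: "((\<lambda>x. f x / w x) has_derivative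
      (\<lambda>v. (frechet_derivative f (at x) v * w x - f x * frechet_derivative w (at x) v) / (w x * w x))) (at x)" for x
  proof (cases "w x = 0")
    case False
    then show ?thesis
      using d[of x] by (intro has_derivative_divide') (auto simp: frechet_derivative_works)
  next
    case True
    then obtain S where S: "open S" "x \<in> S" "\<forall>y\<in>S. f y = 0"
      using nz[of x] by blast
    have z: "((\<lambda>x. 0) has_derivative (\<lambda>v. 0::complex)) (at x)"
      by simp
    have "((\<lambda>x. f x / w x) has_derivative (\<lambda>v. 0)) (at x)"
      by (rule has_derivative_transform_within_open[OF z S(1,2)]) (use S(3) in auto)
    then show ?thesis
      using True by simp
  qed
  show p: "partial b (\<lambda>x. f x / w x) x = (partial b f x * w x - f x * partial b w x) / (w x * w x)" for x b
    unfolding partial_def[of b f] partial_def[of b w] by (rule partial_eqI[OF D])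
  have "isCont (\<lambda>x. (partial b f x * w x - f x * partial b w x) / (w x * w x)) x" if b: "b \<in> Basis" for b x
  proof (cases "w x = 0")
    case False
    have "isCont f x" "isCont w x" "isCont (partial b f) x" "isCont (partial b w) x"
      using f w b Ck_continuous[OF f] Ck_continuous[OF w] by (auto simp: One_nat_def continuous_on_eq_continuous_at)
    then show ?thesis
      using False by (intro continuous_intros) auto
  next
    case True
    then obtain S where S: "open S" "x \<in> S" "\<forall>y\<in>S. f y = 0"
      using nz[of x] by blast
    have "\<forall>\<^sub>F y in nhds x. y \<in> S"
      using S by (auto simp: eventually_nhds)
    then have "\<forall>\<^sub>F y in nhds x. 0 = (partial b f y * w y - f y * partial b w y) / (w y * w y)"
    proof eventually_elim
      case (elim y)
      then show ?case
        using S(3) partial_zero_open[OF S(1) elim, of f b] by simp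
    qed
    from isCont_cong[OF this] show ?thesis
      by simp
  qed
  then have "continuous_on UNIV (\<lambda>x. (partial b f x * w x - f x * partial b w x) / (w x * w x))" if "b \<in> Basis" for b
    using that by (simp add: continuous_at_imp_continuous_on)
  moreover have "(\<lambda>x. f x / w x) differentiable (at x)" for x
    using D by (auto simp: differentiable_def)
  moreover have "partial b (\<lambda>x. f x / w x) = (\<lambda>x. (partial b f x * w x - f x * partial b w x) / (w x * w x))" for b
    using p by (rule ext)
  ultimately show "Ck 1 (\<lambda>x. f x / w x)"
    by (simp add: One_nat_def)
qed

lemma L2_mult_test_integrable:
  fixes f g :: "'a::euclidean_space \<Rightarrow> complex"
  assumes "f \<in> L2" "g \<in> L2" "test_function \<phi>"
  shows "integrable lborel (\<lambda>x. (f x * g x) * \<phi> x)"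
proof -
  obtain M where M[rule_format]: "0 < M" "\<forall>x. cmod (\<phi> x) \<le> M"
    by (rule test_function_bounded[OF assms(3)])
  have "(\<lambda>x. \<phi> x * f x) \<in> L2"
    by (rule L2_mult_bounded(1)[OF assms(1) test_function_measurable[OF assms(3)] M(2)])
  from L2_mult_integrable[OF this assms(2)] show ?thesis
    by (simp add: algebra_simps)
qed

text \<open>The weak derivative of the density is twice the real part of \<open>cnj v * Gv\<close>,
  and the current is its imaginary part. Equal densities and currents thus give equality of both
  parts.\<close>

lemma same_density_current_product:
  fixes u v :: "'a::euclidean_space \<Rightarrow> complex"
  assumes u: "H1_gradient u Gu" and v: "H1_gradient v Gv" and c: "continuous_on UNIV u"
    and dens: "AE x in lborel. cmod (v x) = cmod (u x)"
    and cur: "AE x in lborel. Im (cnj (v x) * Gv b x) = Im (cnj (u x) * Gu b x)"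
    and b: "b \<in> Basis"
  shows "AE x in lborel. x \<in> ball x0 r \<longrightarrow> cnj (v x) * Gv b x = cnj (u x) * Gu b x"
proof -
  define iK where "iK x = (indicator (cball x0 r) x :: complex)" for x
  have iKm: "iK \<in> borel_measurable borel"
    unfolding iK_def by (rule borel_measurable_indicator) simp
  note L = H1_gradientD(1)[OF u] H1_gradientD(1)[OF v] H1_gradientD(2)[OF u b] H1_gradientD(2)[OF v b]
  note m = L2_D(1)[OF L(1)] L2_D(1)[OF L(2)] L2_D(1)[OF L(3)] L2_D(1)[OF L(4)]
  note Lc = L2_cnj[OF L(1)] L2_cnj[OF L(2)] L2_cnj[OF L(3)] L2_cnj[OF L(4)]
  note mc = L2_D(1)[OF Lc(1)] L2_D(1)[OF Lc(2)] L2_D(1)[OF Lc(3)] L2_D(1)[OF Lc(4)]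
  have "compact (u ` cball x0 r)"
    by (intro compact_continuous_image compact_cball continuous_on_subset[OF c]) auto
  then obtain M where M: "0 < M" "\<And>x. x \<in> cball x0 r \<Longrightarrow> cmod (u x) \<le> M"
    by (auto dest!: compact_imp_bounded simp: bounded_pos)
  \<comment> \<open>A product of two square-integrable functions need not be in \<open>L2\<close>.
    On the ball both moduli equal the bounded function \<open>cmod (u x)\<close>, and the truncated
    product becomes admissible for \<open>L2_zero_on_open\<close>.\<close>
  have LM: "(\<lambda>x. (iK x * p x) * g x) \<in> L2"
    if "p \<in> borel_measurable borel" "AE x in lborel. cmod (p x) = cmod (u x)" "g \<in> L2" for p g
  proof (rule L2_dominated(1)[OF that(3) _ less_imp_le[OF M(1)]])
    show "(\<lambda>x. (iK x * p x) * g x) \<in> borel_measurable borel"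
      by (intro borel_measurable_times iKm that L2_D(1)[OF that(3)])
    show "AE x in lborel. cmod ((iK x * p x) * g x) \<le> M * cmod (g x)"
      using that(2)
    proof eventually_elim
      case (elim x)
      have "cmod (iK x * p x) \<le> M"
        using M elim by (cases "x \<in> cball x0 r") (auto simp: iK_def)
      then show ?case
        unfolding norm_mult[of "iK x * p x"] by (rule mult_right_mono) simp
    qed
  qed
  define f where "f x = ((iK x * v x) * cnj (Gv b x) + (iK x * cnj (v x)) * Gv b x)
    - ((iK x * u x) * cnj (Gu b x) + (iK x * cnj (u x)) * Gu b x)" for x
  have f: "f \<in> L2"
    unfolding f_def[abs_def]
    by (intro L2_diff L2_add LM L Lc m mc) (use dens in auto)
  have "AE x in lborel. x \<in> ball x0 r \<longrightarrow> f x = 0"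
  proof (rule L2_zero_on_open[OF f open_ball])
    fix \<phi> :: "'a \<Rightarrow> complex" assume t: "test_function \<phi>" and supp: "{x. \<phi> x \<noteq> 0} \<subseteq> ball x0 r"
    note Pv = H1_product[OF v H1_gradient_cnj[OF v] b t]
    note Pu = H1_product[OF u H1_gradient_cnj[OF u] b t]
    have "(LINT x|lborel. (v x * cnj (v x)) * partial b \<phi> x) = (LINT x|lborel. (u x * cnj (u x)) * partial b \<phi> x)"
    proof (rule integral_cong_AE)
      show "AE x in lborel. (v x * cnj (v x)) * partial b \<phi> x = (u x * cnj (u x)) * partial b \<phi> x"
        using dens by eventually_elim (simp add: complex_norm_square[symmetric])
      note mp = test_function_measurable[OF test_function_partial[OF t b]]
      show "(\<lambda>x. (v x * cnj (v x)) * partial b \<phi> x) \<in> borel_measurable lborel"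
        "(\<lambda>x. (u x * cnj (u x)) * partial b \<phi> x) \<in> borel_measurable lborel"
        unfolding measurable_lborel2 by (intro borel_measurable_times m mc mp)+
    qed
    then have "(LINT x|lborel. (v x * cnj (Gv b x) + Gv b x * cnj (v x)) * \<phi> x)
        = (LINT x|lborel. (u x * cnj (Gu b x) + Gu b x * cnj (u x)) * \<phi> x)"
      using Pv Pu by simp
    moreover have "integrable lborel (\<lambda>x. (v x * cnj (Gv b x) + Gv b x * cnj (v x)) * \<phi> x)"
      "integrable lborel (\<lambda>x. (u x * cnj (Gu b x) + Gu b x * cnj (u x)) * \<phi> x)"
      unfolding distrib_right
      by (intro Bochner_Integration.integrable_add L2_mult_test_integrable L Lc t)+
    ultimately have "(LINT x|lborel. (v x * cnj (Gv b x) + Gv b x * cnj (v x)) * \<phi> x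
        - (u x * cnj (Gu b x) + Gu b x * cnj (u x)) * \<phi> x) = 0"
      by simp
    moreover have "f x * \<phi> x = (v x * cnj (Gv b x) + Gv b x * cnj (v x)) * \<phi> x
        - (u x * cnj (Gu b x) + Gu b x * cnj (u x)) * \<phi> x" for x
    proof (cases "\<phi> x = 0")
      case False
      then have "iK x = 1"
        using supp ball_subset_cball[of x0 r] by (auto simp: iK_def indicator_def)
      then show ?thesis
        by (simp add: f_def algebra_simps)
    qed simp
    ultimately show "(LINT x|lborel. f x * \<phi> x) = 0"
      by simp
  qed
  then show ?thesis
    using cur
  proof eventually_elim
    case (elim x)
    show ?case
    proof
      assume x: "x \<in> ball x0 r"
      then have "iK x = 1"
        using ball_subset_cball[of x0 r] by (auto simp: iK_def indicator_def)
      then have "(v x * cnj (Gv b x) + cnj (v x) * Gv b x) - (u x * cnj (Gu b x) + cnj (u x) * Gu b x) = 0"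
        using elim(1) x by (simp add: f_def)
      then have "Re (cnj (v x) * Gv b x) = Re (cnj (u x) * Gu b x)"
        by (simp add: complex_eq_iff)
      then show "cnj (v x) * Gv b x = cnj (u x) * Gu b x"
        using elim(2) by (simp only: complex_eq_iff)
    qed
  qed
qed

text \<open>The weak gradient of \<open>v / u\<close> has numerator \<open>u * Gv - v * Gu\<close>.
  Multiplied by \<open>cnj u\<close> and using equal moduli, this is
  \<open>v * (cnj v * Gv - cnj u * Gu)\<close>, which is 0 by the preceding lemma. So the quotient
  is constant on a smaller ball.\<close>

lemma same_density_current_ratio:
  fixes u v :: "'a::euclidean_space \<Rightarrow> complex"
  assumes u: "H1_gradient u Gu" and v: "H1_gradient v Gv" and c: "continuous_on UNIV u"
    and dens: "AE x in lborel. cmod (v x) = cmod (u x)"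
    and cur: "\<And>b. b \<in> Basis \<Longrightarrow> AE x in lborel. Im (cnj (v x) * Gv b x) = Im (cnj (u x) * Gu b x)"
    and r: "0 < r" and nz: "\<And>x. x \<in> cball x0 r \<Longrightarrow> u x \<noteq> 0"
  shows "\<exists>k. AE x in lborel. x \<in> ball x0 (r / 2) \<longrightarrow> v x = k * u x"
proof -
  define iK where "iK x = (indicator (cball x0 r) x :: complex)" for x
  have iKm: "iK \<in> borel_measurable borel"
    unfolding iK_def by (rule borel_measurable_indicator) simp
  note L = H1_gradientD(1)[OF u] H1_gradientD(1)[OF v]
  note m = L2_D(1)[OF L(1)] L2_D(1)[OF L(2)]
  have "continuous_on (cball x0 r) (\<lambda>x. cmod (u x))"
    by (intro continuous_intros continuous_on_subset[OF c]) auto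
  moreover have "cball x0 r \<noteq> {}"
    using r by simp
  ultimately obtain z where z: "z \<in> cball x0 r" "\<And>x. x \<in> cball x0 r \<Longrightarrow> cmod (u z) \<le> cmod (u x)"
    using continuous_attains_inf[OF compact_cball] by blast
  define \<mu> where "\<mu> = cmod (u z)"
  have \<mu>: "0 < \<mu>" "\<And>x. x \<in> cball x0 r \<Longrightarrow> \<mu> \<le> cmod (u x)"
    using z nz[of z] by (auto simp: \<mu>_def)
  \<comment> \<open>Mollifications of \<open>u\<close> will be kept within \<open>\<mu> / 2\<close>
    of \<open>u\<close> on the ball, so \<open>\<mu> / 2\<close> bounds their modulus from below as
    well; hence the common bound \<open>2 / \<mu>\<close> for all reciprocals.\<close>
  have iKb: "cmod (iK x / w) \<le> 2 / \<mu>" if "x \<in> cball x0 r \<Longrightarrow> \<mu> / 2 \<le> cmod w" for x w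
  proof (cases "x \<in> cball x0 r")
    case True
    then have "1 / cmod w \<le> 1 / (\<mu> / 2)"
      using that \<mu>(1) by (intro divide_left_mono mult_pos_pos) auto
    then show ?thesis
      using True by (simp add: iK_def norm_divide)
  qed (use \<mu>(1) in \<open>simp add: iK_def\<close>)
  have "cball x0 r \<subseteq> cball 0 (norm x0 + r)"
  proof
    fix y assume "y \<in> cball x0 r"
    then show "y \<in> cball 0 (norm x0 + r)"
      using norm_triangle_ineq2[of y x0] by (simp add: dist_norm norm_minus_commute)
  qed
  moreover have "0 < \<mu> / 2"
    using \<mu>(1) by simp
  from moll_uniform[OF L(1) c this, of "norm x0 + r"] obtain N where
    "\<forall>n\<ge>N. \<forall>x\<in>cball 0 (norm x0 + r). cmod (moll n u x - u x) \<le> \<mu> / 2"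
    by blast
  ultimately have N: "cmod (moll (n + N) u x - u x) \<le> \<mu> / 2" if "x \<in> cball x0 r" for n x
    using that by (meson le_add2 subsetD)
  define un where "un n = moll (n + N) u" for n
  define vn where "vn n = moll (n + N) v" for n
  have unb: "\<mu> / 2 \<le> cmod (un n x)" if "x \<in> cball x0 r" for n x
    using N[OF that, of n] \<mu>(2)[OF that] norm_triangle_ineq2[of "u x" "un n x"]
    by (simp add: un_def norm_minus_commute del: of_nat_Suc of_nat_add)
  have unc: "continuous_on UNIV (un n)" for n
    unfolding un_def by (rule Ck_continuous[OF moll_smooth(1)[OF u, where k = 0]])
  have unm: "un n \<in> borel_measurable borel" for n
    by (rule borel_measurable_continuous_onI[OF unc])
  have unl: "(\<lambda>n. un n x) \<longlonglongrightarrow> u x" for x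
    unfolding un_def by (rule LIMSEQ_ignore_initial_segment[OF moll_tendsto_pointwise[OF L(1) c]])
  define q where "q x = (iK x / u x) * v x" for x
  have q: "q \<in> L2"
    unfolding q_def
  proof (rule L2_mult_bounded(1)[OF L(2)])
    show "(\<lambda>x. iK x / u x) \<in> borel_measurable borel"
      by (intro borel_measurable_divide iKm m)
    show "cmod (iK x / u x) \<le> 2 / \<mu>" for x
      using \<mu> by (intro iKb) force
  qed
  have "\<exists>k. AE x in lborel. x \<in> ball x0 (r / 2) \<longrightarrow> q x = k"
  proof (rule L2_zero_gradient_constant[OF q r])
    fix \<phi> :: "'a \<Rightarrow> complex" and b :: 'a
    assume t: "test_function \<phi>" and supp: "{x. \<phi> x \<noteq> 0} \<subseteq> ball x0 r" and b: "b \<in> Basis"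
    note G = H1_gradientD(2)[OF u b] H1_gradientD(2)[OF v b]
    obtain R where R[rule_format]: "\<forall>k. Ck k \<phi>" "0 < R" "\<forall>x. R < norm x \<longrightarrow> \<phi> x = 0"
      by (rule test_functionE[OF t])
    obtain M where M[rule_format]: "0 < M" "\<forall>x. cmod (\<phi> x) \<le> M"
      by (rule test_function_bounded[OF t])
    note t' = test_function_partial[OF t b]
    note Lp = test_function_L2[OF t] test_function_L2[OF t']
    have \<phi>0: "\<phi> x = 0" if "x \<notin> ball x0 r" for x
      using supp that by blast
    have d\<phi>0: "partial b \<phi> x = 0" if "x \<notin> cball x0 r" for x
      by (rule partial_zero_open[of "- cball x0 r"]) (use that \<phi>0 ball_subset_cball[of x0 r] in auto)
    define gun where "gun n = moll (n + N) (Gu b)" for n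
    define gvn where "gvn n = moll (n + N) (Gv b)" for n
    note va = moll_L2[OF L(2), of "_ + N", folded vn_def] L(2) LIMSEQ_ignore_initial_segment[OF moll_tendsto_L2[OF L(2)], of N, folded vn_def]
    note gu = moll_L2[OF G(1), of "_ + N", folded gun_def] G(1) LIMSEQ_ignore_initial_segment[OF moll_tendsto_L2[OF G(1)], of N, folded gun_def]
    note gv = moll_L2[OF G(2), of "_ + N", folded gvn_def] G(2) LIMSEQ_ignore_initial_segment[OF moll_tendsto_L2[OF G(2)], of N, folded gvn_def]
    have zz: "(\<lambda>n::nat. l2_norm (\<lambda>x. f x - f x)) \<longlonglongrightarrow> 0" for f :: "'a \<Rightarrow> complex"
      by simp
    have c1: "(\<lambda>x. iK x / un n x) \<in> borel_measurable borel" "(\<lambda>x. iK x / u x) \<in> borel_measurable borel"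
      "cmod (iK x / un n x) \<le> 2 / \<mu>" for n x
      by (intro borel_measurable_divide iKm unm m iKb unb)+
    have l1: "(\<lambda>n. iK x / un n x) \<longlonglongrightarrow> iK x / u x" for x
    proof (cases "x \<in> cball x0 r")
      case True
      then show ?thesis
        by (intro tendsto_divide tendsto_const unl nz)
    qed (simp add: iK_def)
    have c2: "(\<lambda>x. (iK x / un n x) * (iK x / un n x) * \<phi> x) \<in> borel_measurable borel"
      "(\<lambda>x. (iK x / u x) * (iK x / u x) * \<phi> x) \<in> borel_measurable borel" for n
      by (intro borel_measurable_times c1 test_function_measurable[OF t])+
    have b2: "cmod ((iK x / un n x) * (iK x / un n x) * \<phi> x) \<le> (2 / \<mu>) * (2 / \<mu>) * M" for n x
      unfolding norm_mult using \<mu>(1) by (intro mult_mono c1(3) M(2)) auto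
    have l2: "(\<lambda>n. (iK x / un n x) * (iK x / un n x) * \<phi> x) \<longlonglongrightarrow> (iK x / u x) * (iK x / u x) * \<phi> x" for x
      by (intro tendsto_mult l1 tendsto_const)
    note T1 = L2_triple_tendsto[OF c1(1,2,3) AE_I2[OF l1] va Lp(2) Lp(2) zz]
    note T2 = L2_triple_tendsto[OF c1(1,2,3) AE_I2[OF l1] gv Lp(1) Lp(1) zz]
    note T3 = L2_triple_tendsto[OF c2(1,2) b2 AE_I2[OF l2] va gu]
    \<comment> \<open>The integral of a derivative of \<open>\<phi> * vn n / un n\<close> vanishes.
      This quotient is \<open>C^1\<close> on the whole space because \<open>\<phi>\<close> is 0
      wherever \<open>un n\<close> may have zeros.\<close>
    have eq: "(LINT x|lborel. ((iK x / un n x) * vn n x) * partial b \<phi> x)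
        + ((LINT x|lborel. ((iK x / un n x) * gvn n x) * \<phi> x)
        - (LINT x|lborel. (((iK x / un n x) * (iK x / un n x) * \<phi> x) * vn n x) * gun n x)) = 0" for n
    proof -
      have us: "Ck k (un n)" "partial b (un n) x = gun n x" for k x
        unfolding un_def gun_def by (rule moll_smooth(1)[OF u] moll_smooth(3)[OF u b])+
      have vs: "Ck k (vn n)" "vn n differentiable (at x)" "partial b (vn n) x = gvn n x" for k x
        unfolding vn_def gvn_def by (rule moll_smooth(1)[OF v] moll_smooth(2)[OF v] moll_smooth(3)[OF v b])+
      have F: "Ck 1 (\<lambda>x. \<phi> x * vn n x)"
        by (intro Ck_mult R(1) vs)
      have nz': "un n x \<noteq> 0 \<or> (\<exists>S. open S \<and> x \<in> S \<and> (\<forall>y\<in>S. \<phi> y * vn n y = 0))" for x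
      proof (cases "x \<in> cball x0 r")
        case True
        then show ?thesis
          using unb[OF True, of n] \<mu>(1) by auto
      next
        case False
        then show ?thesis
          using \<phi>0 ball_subset_cball[of x0 r] by (intro disjI2 exI[of _ "- cball x0 r"]) auto
      qed
      note Q = Ck_quotient[OF F us(1) nz']
      have z: "\<phi> x * vn n x / un n x = 0" if "R < norm x" for x
        using R(3)[OF that] by simp
      have "partial b (\<lambda>x. \<phi> x * vn n x / un n x) x = ((iK x / un n x) * vn n x) * partial b \<phi> x
          + (((iK x / un n x) * gvn n x) * \<phi> x
          - (((iK x / un n x) * (iK x / un n x) * \<phi> x) * vn n x) * gun n x)" for x
        unfolding Q(2) partial_mult[OF test_function_differentiable[OF t] vs(2)] us(2) vs(3)
      proof (cases "x \<in> cball x0 r")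
        case True
        then have "un n x \<noteq> 0"
          using unb[OF True, of n] \<mu>(1) by auto
        then show "((\<phi> x * gvn n x + partial b \<phi> x * vn n x) * un n x - \<phi> x * vn n x * gun n x) / (un n x * un n x)
            = ((iK x / un n x) * vn n x) * partial b \<phi> x
          + (((iK x / un n x) * gvn n x) * \<phi> x
          - (((iK x / un n x) * (iK x / un n x) * \<phi> x) * vn n x) * gun n x)"
          using True by (simp add: iK_def field_simps)
      next
        case False
        then have "\<phi> x = 0"
          using \<phi>0 ball_subset_cball[of x0 r] by blast
        then show "((\<phi> x * gvn n x + partial b \<phi> x * vn n x) * un n x - \<phi> x * vn n x * gun n x) / (un n x * un n x)
            = ((iK x / un n x) * vn n x) * partial b \<phi> x
          + (((iK x / un n x) * gvn n x) * \<phi> x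
          - (((iK x / un n x) * (iK x / un n x) * \<phi> x) * vn n x) * gun n x)"
          using d\<phi>0[OF False] by simp
      qed
      then have "(LINT x|lborel. ((iK x / un n x) * vn n x) * partial b \<phi> x
          + (((iK x / un n x) * gvn n x) * \<phi> x
          - (((iK x / un n x) * (iK x / un n x) * \<phi> x) * vn n x) * gun n x)) = 0"
        using integral_partial_zero[OF Q(1) z b] by simp
      then show ?thesis
        using T1(2)[of n] T2(2)[of n] T3(2)[of n]
        by (simp only: Bochner_Integration.integral_add Bochner_Integration.integral_diff
            Bochner_Integration.integrable_add Bochner_Integration.integrable_diff)
    qed
    have "(\<lambda>n. (LINT x|lborel. ((iK x / un n x) * vn n x) * partial b \<phi> x)
        + ((LINT x|lborel. ((iK x / un n x) * gvn n x) * \<phi> x)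
        - (LINT x|lborel. (((iK x / un n x) * (iK x / un n x) * \<phi> x) * vn n x) * gun n x)))
      \<longlonglongrightarrow> (LINT x|lborel. ((iK x / u x) * v x) * partial b \<phi> x)
        + ((LINT x|lborel. ((iK x / u x) * Gv b x) * \<phi> x)
        - (LINT x|lborel. (((iK x / u x) * (iK x / u x) * \<phi> x) * v x) * Gu b x))"
      by (intro tendsto_add tendsto_diff T1(1) T2(1) T3(1))
    then have lim: "(LINT x|lborel. q x * partial b \<phi> x)
        + ((LINT x|lborel. ((iK x / u x) * Gv b x) * \<phi> x)
        - (LINT x|lborel. (((iK x / u x) * (iK x / u x) * \<phi> x) * v x) * Gu b x)) = 0"
      unfolding eq q_def by (simp add: tendsto_const_iff)
    have "(LINT x|lborel. ((iK x / u x) * Gv b x) * \<phi> x)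
        = (LINT x|lborel. (((iK x / u x) * (iK x / u x) * \<phi> x) * v x) * Gu b x)"
    proof (rule integral_cong_AE)
      show "(\<lambda>x. ((iK x / u x) * Gv b x) * \<phi> x) \<in> borel_measurable lborel"
        "(\<lambda>x. (((iK x / u x) * (iK x / u x) * \<phi> x) * v x) * Gu b x) \<in> borel_measurable lborel"
        unfolding measurable_lborel2
        by (intro borel_measurable_times c1 c2 test_function_measurable[OF t] m L2_D(1)[OF G(1)] L2_D(1)[OF G(2)])+
      show "AE x in lborel. ((iK x / u x) * Gv b x) * \<phi> x = (((iK x / u x) * (iK x / u x) * \<phi> x) * v x) * Gu b x"
        using same_density_current_product[OF u v c dens cur[OF b] b, of x0 r] dens
      proof eventually_elim
        case (elim x)
        show ?case
        proof (cases "x \<in> ball x0 r")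
          case True
          then have x: "iK x = 1" "u x \<noteq> 0"
            using nz ball_subset_cball[of x0 r] by (auto simp: iK_def indicator_def)
          have vu: "u x * cnj (u x) = v x * cnj (v x)"
            using elim(2) by (simp add: complex_norm_square[symmetric])
          have "cnj (u x) * (u x * Gv b x) = (u x * cnj (u x)) * Gv b x"
            by (simp only: mult.assoc mult.left_commute)
          also have "\<dots> = v x * (cnj (v x) * Gv b x)"
            unfolding vu by (rule mult.assoc)
          also have "\<dots> = cnj (u x) * (v x * Gu b x)"
            using elim(1) True by simp
          finally have "u x * Gv b x = v x * Gu b x"
            using x(2) by simp
          then show ?thesis
            using x by (simp add: field_simps)
        qed (simp add: \<phi>0)
      qed
    qed
    then show "(LINT x|lborel. q x * partial b \<phi> x) = 0"
      using lim by simp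
  qed
  then obtain k where "AE x in lborel. x \<in> ball x0 (r / 2) \<longrightarrow> q x = k"
    by blast
  then have "AE x in lborel. x \<in> ball x0 (r / 2) \<longrightarrow> v x = k * u x"
  proof eventually_elim
    case (elim x)
    show ?case
    proof
      assume x: "x \<in> ball x0 (r / 2)"
      then have "x \<in> cball x0 r"
        using r by simp
      then show "v x = k * u x"
        using elim x nz[of x] by (auto simp: q_def iK_def field_simps)
    qed
  qed
  then show ?thesis by blast
qed

section \<open>The energy form\<close>

text \<open>A chosen representative of the weak gradient. By \<open>H1_gradient_unique\<close>
  another choice changes each basis component on a null set only; for functions outside
  \<open>H1\<close> the value is unspecified.\<close>

definition grad :: "('a::euclidean_space \<Rightarrow> complex) \<Rightarrow> 'a \<Rightarrow> 'a \<Rightarrow> complex"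
  where "grad u = (SOME G. H1_gradient u G)"

lemma H1_gradient_grad: "H1_gradient u G \<Longrightarrow> H1_gradient u (grad u)"
  unfolding grad_def by (rule someI[where P = "H1_gradient u"])

lemma H1_gradient_diff:
  assumes "H1_gradient u G" "H1_gradient v K"
  shows "H1_gradient (\<lambda>x. u x - v x) (\<lambda>b x. G b x - K b x)"
  unfolding H1_gradient_def
proof (intro conjI ballI allI impI)
  note D = H1_gradientD[OF assms(1)] H1_gradientD[OF assms(2)]
  show "(\<lambda>x. u x - v x) \<in> L2"
    by (intro L2_diff D)
  fix b :: 'a assume b: "b \<in> Basis"
  show "(\<lambda>x. G b x - K b x) \<in> L2"
    by (intro L2_diff D b)
  fix \<phi> :: "'a \<Rightarrow> complex" assume t: "test_function \<phi>"
  note Lp = test_function_L2[OF t] test_function_L2[OF test_function_partial[OF t b]]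
  show "(LINT x|lborel. (u x - v x) * partial b \<phi> x) = - (LINT x|lborel. (G b x - K b x) * \<phi> x)"
    using L2_mult_integrable[OF D(1) Lp(2)] L2_mult_integrable[OF D(4) Lp(2)]
      L2_mult_integrable[OF D(2)[OF b] Lp(1)] L2_mult_integrable[OF D(5)[OF b] Lp(1)] D(3)[OF b t] D(6)[OF b t]
    by (simp add: left_diff_distrib)
qed

lemma H1_gradient_cong_AE:
  assumes "H1_gradient u G" "v \<in> borel_measurable borel" "AE x in lborel. v x = u x"
  shows "H1_gradient v G"
  unfolding H1_gradient_def
proof (intro conjI ballI allI impI)
  note D = H1_gradientD[OF assms(1)]
  show "v \<in> L2"
    by (rule L2_cong_AE[OF D(1) assms(2,3)])
  fix b :: 'a assume b: "b \<in> Basis"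
  show "G b \<in> L2"
    by (rule D(2)[OF b])
  fix \<phi> :: "'a \<Rightarrow> complex" assume t: "test_function \<phi>"
  note m = test_function_measurable[OF test_function_partial[OF t b]]
  have "(LINT x|lborel. v x * partial b \<phi> x) = (LINT x|lborel. u x * partial b \<phi> x)"
  proof (rule integral_cong_AE)
    show "AE x in lborel. v x * partial b \<phi> x = u x * partial b \<phi> x"
      using assms(3) by eventually_elim simp
  qed (unfold measurable_lborel2, (intro borel_measurable_times assms(2) L2_D(1)[OF D(1)] m)+)
  then show "(LINT x|lborel. v x * partial b \<phi> x) = - (LINT x|lborel. G b x * \<phi> x)"
    using D(3)[OF b t] by simp
qed

lemma H1_gradient_test:
  fixes u :: "'a::euclidean_space \<Rightarrow> complex"
  assumes "test_function u"
  shows "H1_gradient u (\<lambda>b. partial b u)"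
  unfolding H1_gradient_def
proof (intro conjI ballI allI impI)
  show "u \<in> L2"
    by (rule test_function_L2[OF assms])
  fix b :: 'a assume b: "b \<in> Basis"
  note t' = test_function_partial[OF assms b]
  show "partial b u \<in> L2"
    by (rule test_function_L2[OF t'])
  fix \<phi> :: "'a \<Rightarrow> complex" assume t: "test_function \<phi>"
  note tp = test_function_partial[OF t b]
  obtain R where R[rule_format]: "\<forall>k. Ck k \<phi>" "0 < R" "\<forall>x. R < norm x \<longrightarrow> \<phi> x = 0"
    by (rule test_functionE[OF t])
  have c: "Ck 1 (\<lambda>x. u x * \<phi> x)"
    using assms R(1) by (intro Ck_mult) (auto simp: test_function_def)
  have z: "u x * \<phi> x = 0" if "R < norm x" for x
    using R(3)[OF that] by simp
  have "(LINT x|lborel. u x * partial b \<phi> x + partial b u x * \<phi> x) = 0"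
    using integral_partial_zero[OF c z b]
    by (simp add: partial_mult[OF test_function_differentiable[OF assms] test_function_differentiable[OF t]])
  then show "(LINT x|lborel. u x * partial b \<phi> x) = - (LINT x|lborel. partial b u x * \<phi> x)"
    using L2_mult_integrable[OF test_function_L2[OF assms] test_function_L2[OF tp]]
      L2_mult_integrable[OF test_function_L2[OF t'] test_function_L2[OF t]]
    by (simp add: add_eq_0_iff2)
qed

text \<open>Closedness of the weak gradient: both sides of its defining identity are continuous in
  the mean for a fixed test function.\<close>

lemma H1_gradient_lim:
  assumes p: "\<And>n::nat. H1_gradient (p n) (G n)" and u: "u \<in> L2" "(\<lambda>n. l2_norm (\<lambda>x. p n x - u x)) \<longlonglongrightarrow> 0"
    and K: "\<And>b. b \<in> Basis \<Longrightarrow> K b \<in> L2" "\<And>b. b \<in> Basis \<Longrightarrow> (\<lambda>n. l2_norm (\<lambda>x. G n b x - K b x)) \<longlonglongrightarrow> 0"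
  shows "H1_gradient u K"
  unfolding H1_gradient_def
proof (intro conjI ballI allI impI u K)
  fix b :: 'a and \<phi> :: "'a \<Rightarrow> complex"
  assume b: "b \<in> Basis" and t: "test_function \<phi>"
  note Lp = test_function_L2[OF t] test_function_L2[OF test_function_partial[OF t b]]
  have "(\<lambda>n. LINT x|lborel. p n x * partial b \<phi> x) \<longlonglongrightarrow> (LINT x|lborel. u x * partial b \<phi> x)"
    by (rule L2_integral_mult_tendsto[OF H1_gradientD(1)[OF p] u Lp(2) Lp(2)]) simp
  moreover have "(\<lambda>n. - (LINT x|lborel. G n b x * \<phi> x)) \<longlonglongrightarrow> - (LINT x|lborel. K b x * \<phi> x)"
    by (intro tendsto_minus L2_integral_mult_tendsto[OF H1_gradientD(2)[OF p b] K(1)[OF b] K(2)[OF b] Lp(1) Lp(1)]) simp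
  ultimately show "(LINT x|lborel. u x * partial b \<phi> x) = - (LINT x|lborel. K b x * \<phi> x)"
    unfolding H1_gradientD(3)[OF p b t] by (rule LIMSEQ_unique)
qed

lemma l2_norm_diff_square_le:
  assumes "f \<in> L2" "g \<in> L2"
  shows "(l2_norm (\<lambda>x. f x - g x))\<^sup>2 \<le> 2 * (l2_norm f)\<^sup>2 + 2 * (l2_norm g)\<^sup>2"
proof -
  have "l2_norm (\<lambda>x. f x - g x) \<le> l2_norm f + l2_norm g"
    using l2_norm_triangle[OF assms(1) L2_uminus[OF assms(2)]] l2_norm_cmult[of "-1" g] by simp
  then have "(l2_norm (\<lambda>x. f x - g x))\<^sup>2 \<le> (l2_norm f + l2_norm g)\<^sup>2"
    by (intro power_mono) auto
  also have "\<dots> \<le> 2 * (l2_norm f)\<^sup>2 + 2 * (l2_norm g)\<^sup>2"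
    using sum_squares_bound[of "l2_norm f" "l2_norm g"] unfolding power2_sum by linarith
  finally show ?thesis .
qed

text \<open>The constant \<open>c0\<close> shifts the potential to at least 1, which makes the form
  positive and lets it dominate the \<open>L2\<close> norm.\<close>

locale schroedinger_potential =
  fixes V :: "'a::euclidean_space \<Rightarrow> real" and c0 :: real
  assumes V_cont: "continuous_on UNIV V" and V_ge: "1 \<le> V x + c0"
begin

text \<open>With the square root of the shifted potential as a multiplier, the potential energy is
  itself a squared \<open>L2\<close> norm.\<close>

definition weight :: "('a \<Rightarrow> complex) \<Rightarrow> 'a \<Rightarrow> complex"
  where "weight u x = complex_of_real (sqrt (V x + c0)) * u x"

definition form_dom :: "('a \<Rightarrow> complex) \<Rightarrow> bool"
  where "form_dom u \<longleftrightarrow> (\<exists>G. H1_gradient u G) \<and> weight u \<in> L2"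

text \<open>The quadratic form of the Hamiltonian plus \<open>c0\<close>, written through
  \<open>L2\<close> norms only, so that its limits reduce to limits of norms.\<close>

definition form :: "('a \<Rightarrow> complex) \<Rightarrow> real"
  where "form u = (1/2) * (\<Sum>b\<in>Basis. (l2_norm (grad u b))\<^sup>2) + (l2_norm (weight u))\<^sup>2"

lemma sqrt_cont: "continuous_on UNIV (\<lambda>x. complex_of_real (sqrt (V x + c0)))"
  by (intro continuous_intros V_cont)

lemma weight_measurable: "u \<in> borel_measurable borel \<Longrightarrow> weight u \<in> borel_measurable borel"
  unfolding weight_def[abs_def] by (intro borel_measurable_times borel_measurable_continuous_onI[OF sqrt_cont])

lemma V_pos: "0 < V x + c0"
  using V_ge[of x] by linarith

lemma weight_ge: "cmod (u x) \<le> cmod (weight u x)"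
proof -
  have "1 \<le> sqrt (V x + c0)"
    using V_ge[of x] by simp
  then have "1 * cmod (u x) \<le> \<bar>sqrt (V x + c0)\<bar> * cmod (u x)"
    by (intro mult_right_mono) auto
  then show ?thesis
    by (simp add: weight_def norm_mult)
qed

lemma weight_diff: "weight (\<lambda>x. u x - v x) = (\<lambda>x. weight u x - weight v x)"
  by (simp add: weight_def fun_eq_iff right_diff_distrib)

text \<open>The weighted density differs from \<open>V x * (cmod (u x))\<^sup>2\<close> by
  \<open>c0\<close> times the density, which is integrable.\<close>

lemma form_dom_iff: "form_dom u \<longleftrightarrow> finite_energy V u"
proof -
  have "weight u \<in> L2 \<longleftrightarrow> integrable lborel (\<lambda>x. V x * (cmod (u x))\<^sup>2)" if u: "u \<in> L2"
  proof -
    have e: "(cmod (weight u x))\<^sup>2 = V x * (cmod (u x))\<^sup>2 + c0 * (cmod (u x))\<^sup>2" for x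
      using V_pos[of x] by (simp add: weight_def norm_mult power_mult_distrib distrib_right)
    have i: "integrable lborel (\<lambda>x. c0 * (cmod (u x))\<^sup>2)"
      using L2_D(2)[OF u] by simp
    have "integrable lborel (\<lambda>x. V x * (cmod (u x))\<^sup>2)"
      if "integrable lborel (\<lambda>x. V x * (cmod (u x))\<^sup>2 + c0 * (cmod (u x))\<^sup>2)"
      using Bochner_Integration.integrable_diff[OF that i] by simp
    then show ?thesis
      using i weight_measurable[OF L2_D(1)[OF u]] unfolding L2_def by (auto simp: e)
  qed
  then show ?thesis
    unfolding form_dom_def finite_energy_def using H1_gradientD(1) by blast
qed

lemma form_domD:
  assumes "form_dom u"
  shows "u \<in> L2" "weight u \<in> L2" "H1_gradient u (grad u)" "\<And>b. b \<in> Basis \<Longrightarrow> grad u b \<in> L2"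
proof -
  obtain G where "H1_gradient u G"
    using assms by (auto simp: form_dom_def)
  then show g: "H1_gradient u (grad u)"
    by (rule H1_gradient_grad)
  show "u \<in> L2" "weight u \<in> L2" "\<And>b. b \<in> Basis \<Longrightarrow> grad u b \<in> L2"
    using H1_gradientD(1,2)[OF g] assms by (auto simp: form_dom_def)
qed

lemma form_eq:
  assumes "H1_gradient u G"
  shows "form u = (1/2) * (\<Sum>b\<in>Basis. (l2_norm (G b))\<^sup>2) + (l2_norm (weight u))\<^sup>2"
proof -
  note g = H1_gradient_grad[OF assms]
  have "l2_norm (grad u b) = l2_norm (G b)" if b: "b \<in> Basis" for b
  proof (rule l2_norm_cong_AE)
    show "AE x in lborel. cmod (grad u b x) = cmod (G b x)"
      using H1_gradient_unique[OF g assms b] by eventually_elim simp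
  qed (intro L2_D(1) H1_gradientD(2)[OF g b] H1_gradientD(2)[OF assms b])+
  then show ?thesis
    by (simp add: form_def)
qed

lemma form_nonneg: "0 \<le> form u"
  by (simp add: form_def sum_nonneg)

lemma form_dom_diff:
  assumes "form_dom u" "form_dom v"
  shows "form_dom (\<lambda>x. u x - v x)"
  unfolding form_dom_def weight_diff
  using H1_gradient_diff[OF form_domD(3)[OF assms(1)] form_domD(3)[OF assms(2)]]
    L2_diff[OF form_domD(2)[OF assms(1)] form_domD(2)[OF assms(2)]] by blast

lemma form_diff_eq:
  assumes "form_dom u" "form_dom v"
  shows "form (\<lambda>x. u x - v x) = (1/2) * (\<Sum>b\<in>Basis. (l2_norm (\<lambda>x. grad u b x - grad v b x))\<^sup>2)
    + (l2_norm (\<lambda>x. weight u x - weight v x))\<^sup>2"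
  using form_eq[OF H1_gradient_diff[OF form_domD(3)[OF assms(1)] form_domD(3)[OF assms(2)]]]
  by (simp only: weight_diff)

lemma form_minus_commute:
  assumes "form_dom u" "form_dom v"
  shows "form (\<lambda>x. u x - v x) = form (\<lambda>x. v x - u x)"
  unfolding form_diff_eq[OF assms] form_diff_eq[OF assms(2,1)]
  by (simp only: l2_norm_minus_commute[of "grad u _"] l2_norm_minus_commute[of "weight u"])

lemma form_diff_le:
  assumes "form_dom u" "form_dom v"
  shows "form (\<lambda>x. u x - v x) \<le> 2 * form u + 2 * form v"
proof -
  have "(\<Sum>b\<in>(Basis::'a set). (l2_norm (\<lambda>x. grad u b x - grad v b x))\<^sup>2)
      \<le> (\<Sum>b\<in>(Basis::'a set). 2 * (l2_norm (grad u b))\<^sup>2 + 2 * (l2_norm (grad v b))\<^sup>2)"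
    using assms by (intro sum_mono l2_norm_diff_square_le form_domD)
  also have "\<dots> = 2 * (\<Sum>b\<in>(Basis::'a set). (l2_norm (grad u b))\<^sup>2) + 2 * (\<Sum>b\<in>(Basis::'a set). (l2_norm (grad v b))\<^sup>2)"
    by (simp add: sum.distrib sum_distrib_left)
  finally have S: "(\<Sum>b\<in>(Basis::'a set). (l2_norm (\<lambda>x. grad u b x - grad v b x))\<^sup>2)
      \<le> 2 * (\<Sum>b\<in>(Basis::'a set). (l2_norm (grad u b))\<^sup>2) + 2 * (\<Sum>b\<in>(Basis::'a set). (l2_norm (grad v b))\<^sup>2)" .
  have alg: "1/2 * a + b \<le> 2 * (1/2 * s + w) + 2 * (1/2 * s' + w')"
    if "a \<le> 2 * s + 2 * s'" "b \<le> 2 * w + 2 * w'" for a b s s' w w' :: real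
    using that unfolding distrib_left by linarith
  show ?thesis
    unfolding form_diff_eq[OF assms] form_def
    by (rule alg[OF S l2_norm_diff_square_le[OF form_domD(2)[OF assms(1)] form_domD(2)[OF assms(2)]]])
qed

text \<open>A quadratic substitute for the triangle inequality; the factor 2 is that of
  \<open>(a + b)\<^sup>2 \<le> 2 * a\<^sup>2 + 2 * b\<^sup>2\<close> and is harmless in smallness
  arguments.\<close>

lemma form_triangle:
  assumes "form_dom u" "form_dom v" "form_dom w"
  shows "form (\<lambda>x. u x - w x) \<le> 2 * form (\<lambda>x. u x - v x) + 2 * form (\<lambda>x. v x - w x)"
  using form_diff_le[OF form_dom_diff[OF assms(1,2)] form_dom_diff[OF assms(3,2)]]
    form_minus_commute[OF assms(3,2)] by simp

text \<open>The 2 compensates the factor 1/2 in front of the gradient part; the bound on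
  \<open>u\<close> itself comes from the shifted potential being at least 1.\<close>

lemma l2_norm_le_form:
  assumes "form_dom u"
  shows "(l2_norm u)\<^sup>2 \<le> 2 * form u" "b \<in> Basis \<Longrightarrow> (l2_norm (grad u b))\<^sup>2 \<le> 2 * form u" "(l2_norm (weight u))\<^sup>2 \<le> 2 * form u"
proof -
  define S where "S = (\<Sum>b\<in>(Basis::'a set). (l2_norm (grad u b))\<^sup>2)"
  have f: "2 * form u = S + 2 * (l2_norm (weight u))\<^sup>2"
    by (simp add: form_def S_def)
  have s: "0 \<le> S"
    unfolding S_def by (simp add: sum_nonneg)
  have "l2_norm u \<le> 1 * l2_norm (weight u)"
    by (rule L2_dominated(2)[OF form_domD(2)[OF assms] L2_D(1)[OF form_domD(1)[OF assms]]]) (simp_all add: weight_ge)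
  then have "(l2_norm u)\<^sup>2 \<le> (l2_norm (weight u))\<^sup>2"
    by (intro power_mono) auto
  then show "(l2_norm u)\<^sup>2 \<le> 2 * form u" "(l2_norm (weight u))\<^sup>2 \<le> 2 * form u"
    unfolding f using s zero_le_power2[of "l2_norm (weight u)"] by linarith+
  show "(l2_norm (grad u b))\<^sup>2 \<le> 2 * form u" if "b \<in> Basis"
  proof -
    have "(l2_norm (grad u b))\<^sup>2 \<le> S"
      unfolding S_def using that by (intro member_le_sum) auto
    then show ?thesis
      unfolding f using zero_le_power2[of "l2_norm (weight u)"] by linarith
  qed
qed

lemma l2_norm_grad_diff_le:
  assumes "form_dom u" "form_dom v" "b \<in> Basis"
  shows "(l2_norm (\<lambda>x. grad u b x - grad v b x))\<^sup>2 \<le> 2 * form (\<lambda>x. u x - v x)"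
proof -
  note d = form_dom_diff[OF assms(1,2)]
  have "l2_norm (\<lambda>x. grad u b x - grad v b x) = l2_norm (grad (\<lambda>x. u x - v x) b)"
  proof (rule l2_norm_cong_AE)
    show "AE x in lborel. cmod (grad u b x - grad v b x) = cmod (grad (\<lambda>x. u x - v x) b x)"
      using H1_gradient_unique[OF H1_gradient_diff[OF form_domD(3)[OF assms(1)] form_domD(3)[OF assms(2)]] form_domD(3)[OF d] assms(3)]
      by eventually_elim simp
  qed (intro L2_D(1) L2_diff form_domD(4)[OF assms(1,3)] form_domD(4)[OF assms(2,3)] form_domD(4)[OF d assms(3)])+
  then show ?thesis
    using l2_norm_le_form(2)[OF d assms(3)] by simp
qed

lemma form_dom_cong_AE:
  assumes "form_dom u" "v \<in> borel_measurable borel" "AE x in lborel. v x = u x"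
  shows "form_dom v" "form v = form u"
proof -
  have w: "AE x in lborel. weight v x = weight u x"
    using assms(3) by eventually_elim (simp add: weight_def)
  note g = H1_gradient_cong_AE[OF form_domD(3)[OF assms(1)] assms(2,3)]
  note m = weight_measurable[OF assms(2)] L2_D(1)[OF form_domD(2)[OF assms(1)]]
  show "form_dom v"
    using g L2_cong_AE[OF form_domD(2)[OF assms(1)] m(1) w] by (auto simp: form_dom_def)
  have "l2_norm (weight v) = l2_norm (weight u)"
    by (rule l2_norm_cong_AE[OF m]) (use w in eventually_elim, simp)
  then show "form v = form u"
    unfolding form_eq[OF g] by (simp add: form_def)
qed

lemma form_small_imp_small:
  assumes "\<And>n. form_dom (p n)" "form_dom u" "((\<lambda>n. form (\<lambda>x. p n x - u x)) \<longlongrightarrow> 0) F"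
  shows "((\<lambda>n. l2_norm (\<lambda>x. p n x - u x)) \<longlongrightarrow> 0) F"
    "b \<in> Basis \<Longrightarrow> ((\<lambda>n. l2_norm (\<lambda>x. grad (p n) b x - grad u b x)) \<longlongrightarrow> 0) F"
    "((\<lambda>n. l2_norm (\<lambda>x. weight (p n) x - weight u x)) \<longlongrightarrow> 0) F"
proof -
  note d = form_dom_diff[OF assms(1,2)]
  have s: "((\<lambda>n. sqrt (2 * form (\<lambda>x. p n x - u x))) \<longlongrightarrow> 0) F"
  proof -
    have "((\<lambda>n. sqrt (2 * form (\<lambda>x. p n x - u x))) \<longlongrightarrow> sqrt (2 * 0)) F"
      by (intro tendsto_intros assms(3))
    then show ?thesis by simp
  qed
  have r: "norm a \<le> sqrt (2 * form (\<lambda>x. p n x - u x))" if "0 \<le> a" "a\<^sup>2 \<le> 2 * form (\<lambda>x. p n x - u x)" for a n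
    using real_le_rsqrt[OF that(2)] that(1) by simp
  show "((\<lambda>n. l2_norm (\<lambda>x. p n x - u x)) \<longlongrightarrow> 0) F"
    by (rule tendsto_0_bound[OF r s]) (simp, rule l2_norm_le_form(1)[OF d])
  show "((\<lambda>n. l2_norm (\<lambda>x. weight (p n) x - weight u x)) \<longlongrightarrow> 0) F"
    by (rule tendsto_0_bound[OF r s]) (simp, rule l2_norm_le_form(3)[OF d, unfolded weight_diff])
  show "((\<lambda>n. l2_norm (\<lambda>x. grad (p n) b x - grad u b x)) \<longlongrightarrow> 0) F" if b: "b \<in> Basis"
  proof (rule tendsto_0_bound[OF r s])
    fix n
    show "(l2_norm (\<lambda>x. grad (p n) b x - grad u b x))\<^sup>2 \<le> 2 * form (\<lambda>x. p n x - u x)"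
      by (rule l2_norm_grad_diff_le[OF assms(1,2) b])
  qed simp
qed

lemma form_tendsto:
  assumes "\<And>n. form_dom (p n)" "form_dom u" "((\<lambda>n. form (\<lambda>x. p n x - u x)) \<longlongrightarrow> 0) F"
  shows "((\<lambda>n. form (p n)) \<longlongrightarrow> form u) F"
  unfolding form_def
  by (intro tendsto_intros l2_norm_tendsto form_domD assms form_small_imp_small)

text \<open>Closedness of the form. Functions, gradients and weighted functions converge separately
  in \<open>L2\<close>; \<open>H1_gradient_lim\<close> identifies the limit gradient, and
  multiplying by the bounded inverse weight identifies the weighted limit.\<close>

lemma form_complete:
  fixes p :: "nat \<Rightarrow> 'a \<Rightarrow> complex"
  assumes p: "\<And>n. form_dom (p n)"
    and cauchy: "\<And>e. e > 0 \<Longrightarrow> \<exists>N. \<forall>m\<ge>N. \<forall>n\<ge>N. form (\<lambda>x. p m x - p n x) < e"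
  shows "\<exists>u. form_dom u \<and> (\<lambda>n. form (\<lambda>x. p n x - u x)) \<longlonglongrightarrow> 0"
proof -
  have small: "\<exists>N. \<forall>m\<ge>N. \<forall>n\<ge>N. a m n < e"
    if sq: "\<And>m n. (a m n)\<^sup>2 \<le> 2 * form (\<lambda>x. p m x - p n x)" and "e > 0" for a :: "nat \<Rightarrow> nat \<Rightarrow> real" and e
  proof -
    have "0 < e\<^sup>2 / 2"
      using \<open>e > 0\<close> by simp
    from cauchy[OF this] obtain N where N: "\<forall>m\<ge>N. \<forall>n\<ge>N. form (\<lambda>x. p m x - p n x) < e\<^sup>2 / 2"
      by blast
    have "a m n < e" if mn: "m \<ge> N" "n \<ge> N" for m n
    proof -
      have "form (\<lambda>x. p m x - p n x) < e\<^sup>2 / 2"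
        using N mn by blast
      then have "(a m n)\<^sup>2 < e\<^sup>2"
        using sq[of m n] by linarith
      then show ?thesis
        using \<open>e > 0\<close> by (intro power_less_imp_less_base[of "a m n" 2 e]) auto
    qed
    then show ?thesis by blast
  qed
  note d = form_dom_diff[OF p p]
  have "\<exists>u\<in>L2. (\<lambda>n. l2_norm (\<lambda>x. p n x - u x)) \<longlonglongrightarrow> 0"
    by (rule L2_complete[OF form_domD(1)[OF p] small[OF l2_norm_le_form(1)[OF d]]])
  then obtain u where u: "u \<in> L2" "(\<lambda>n. l2_norm (\<lambda>x. p n x - u x)) \<longlonglongrightarrow> 0"
    by blast
  have "\<exists>w\<in>L2. (\<lambda>n. l2_norm (\<lambda>x. weight (p n) x - w x)) \<longlonglongrightarrow> 0"
    by (rule L2_complete[OF form_domD(2)[OF p] small[OF l2_norm_le_form(3)[OF d, unfolded weight_diff]]])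
  then obtain w where w: "w \<in> L2" "(\<lambda>n. l2_norm (\<lambda>x. weight (p n) x - w x)) \<longlonglongrightarrow> 0"
    by blast
  have "\<exists>K\<in>L2. (\<lambda>n. l2_norm (\<lambda>x. grad (p n) b x - K x)) \<longlonglongrightarrow> 0" if b: "b \<in> Basis" for b
  proof (rule L2_complete[OF form_domD(4)[OF p b] small])
    fix m n
    show "(l2_norm (\<lambda>x. grad (p m) b x - grad (p n) b x))\<^sup>2 \<le> 2 * form (\<lambda>x. p m x - p n x)"
      by (rule l2_norm_grad_diff_le[OF p p b])
  qed
  then have "\<forall>b\<in>Basis. \<exists>K. K \<in> L2 \<and> (\<lambda>n. l2_norm (\<lambda>x. grad (p n) b x - K x)) \<longlonglongrightarrow> 0"
    by blast
  from bchoice[OF this] obtain K where K: "\<And>b. b \<in> Basis \<Longrightarrow> K b \<in> L2"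
    "\<And>b. b \<in> Basis \<Longrightarrow> (\<lambda>n. l2_norm (\<lambda>x. grad (p n) b x - K b x)) \<longlonglongrightarrow> 0"
    by blast
  have uK: "H1_gradient u K"
    by (rule H1_gradient_lim[OF form_domD(3)[OF p] u K])
  \<comment> \<open>The weight itself may be unbounded, but its inverse is at most 1, so
    multiplication by it is continuous in \<open>L2\<close>.\<close>
  define s where "s x = 1 / complex_of_real (sqrt (V x + c0))" for x
  have s0: "complex_of_real (sqrt (V x + c0)) \<noteq> 0" for x
    using V_pos[of x] by simp
  have sm: "s \<in> borel_measurable borel"
    unfolding s_def[abs_def]
    by (intro borel_measurable_divide borel_measurable_const borel_measurable_continuous_onI[OF sqrt_cont])
  have s1: "cmod (s x) \<le> 1" for x
    using V_ge[of x] by (simp add: s_def norm_divide)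
  note B = L2_bounded_mult_tendsto[OF sm sm s1 AE_I2[OF tendsto_const] form_domD(2)[OF p] w]
  have sp: "s x * weight (p n) x = p n x" for n x
    using s0[of x] by (simp add: s_def weight_def)
  have "AE x in lborel. u x = s x * w x"
    by (rule L2_lim_unique_AE[OF form_domD(1)[OF p] u(1) B(1) u(2)]) (use B(2) in \<open>simp only: sp\<close>)
  then have wu: "AE x in lborel. weight u x = w x"
  proof eventually_elim
    case (elim x)
    then show ?case
      using s0[of x] by (simp add: weight_def s_def)
  qed
  have wL: "weight u \<in> L2"
    by (rule L2_cong_AE[OF w(1) weight_measurable[OF L2_D(1)[OF u(1)]] wu])
  have ud: "form_dom u"
    using uK wL by (auto simp: form_dom_def)
  have "form (\<lambda>x. p n x - u x) = (1/2) * (\<Sum>b\<in>Basis. (l2_norm (\<lambda>x. grad (p n) b x - K b x))\<^sup>2)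
      + (l2_norm (\<lambda>x. weight (p n) x - w x))\<^sup>2" for n
  proof -
    have "l2_norm (\<lambda>x. weight (p n) x - weight u x) = l2_norm (\<lambda>x. weight (p n) x - w x)"
    proof (rule l2_norm_cong_AE)
      show "AE x in lborel. cmod (weight (p n) x - weight u x) = cmod (weight (p n) x - w x)"
        using wu by eventually_elim simp
    qed (intro L2_D(1) L2_diff form_domD(2)[OF p] wL w(1))+
    then show ?thesis
      using form_eq[OF H1_gradient_diff[OF form_domD(3)[OF p] uK]] by (simp only: weight_diff)
  qed
  moreover have "(\<lambda>n. (1/2) * (\<Sum>b\<in>Basis. (l2_norm (\<lambda>x. grad (p n) b x - K b x))\<^sup>2)
      + (l2_norm (\<lambda>x. weight (p n) x - w x))\<^sup>2) \<longlonglongrightarrow> (1/2) * (\<Sum>b\<in>(Basis::'a set). 0\<^sup>2) + 0\<^sup>2"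
    by (intro tendsto_intros K w)
  ultimately have "(\<lambda>n. form (\<lambda>x. p n x - u x)) \<longlonglongrightarrow> 0"
    by simp
  then show ?thesis
    using ud by blast
qed

end

section \<open>Test functions form a core of the energy form\<close>

lemma partial_bump:
  "partial b (bump \<alpha> \<beta>) x = flat 2 (\<alpha> - \<beta> * (x \<bullet> x)) * (- (2 * \<beta> * (x \<bullet> b)))"
proof -
  have s: "((\<lambda>x::'a. \<alpha> - \<beta> * (x \<bullet> x)) has_derivative (\<lambda>v. 0 - \<beta> * (x \<bullet> v + v \<bullet> x))) (at x)"
    by (intro has_derivative_diff has_derivative_const has_derivative_mult_right has_derivative_inner has_derivative_ident)
  have "(bump \<alpha> \<beta> has_derivative (\<lambda>v. (0 - \<beta> * (x \<bullet> v + v \<bullet> x)) * flat 2 (\<alpha> - \<beta> * (x \<bullet> x)))) (at x)"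
    using DERIV_compose_FDERIV[OF flat_has_derivative s, of 0] by (simp add: bump_def[abs_def] numeral_2_eq_2)
  from partial_eqI[OF this, of b] show ?thesis
    by (simp add: inner_commute algebra_simps)
qed

text \<open>Supported where \<open>norm x \<le> n + 1\<close>. The argument of \<open>flat 0\<close>
  tends to infinity at each fixed point, so the values tend to 1, while the small second parameter
  keeps the gradient bounded.\<close>

definition cutoff_fun :: "nat \<Rightarrow> 'a::euclidean_space \<Rightarrow> complex"
  where "cutoff_fun n x = complex_of_real (bump (real (Suc n)) (1 / real (Suc n)) x)"

lemma cutoff_fun_test: "test_function (cutoff_fun n :: 'a::euclidean_space \<Rightarrow> complex)"
proof (rule test_functionI)
  show "Ck k (cutoff_fun n :: 'a \<Rightarrow> complex)" for k
    unfolding cutoff_fun_def[abs_def] by (intro Ck_bounded_linear_comp[OF bounded_linear_of_real] Ck_bump)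
  show "cutoff_fun n x = 0" if "real (Suc n) < norm x" for x :: 'a
  proof -
    have "(real (Suc n))\<^sup>2 < (norm x)\<^sup>2"
      using that by (intro power_strict_mono) auto
    then have "\<not> 1 / real (Suc n) * (norm x)\<^sup>2 < real (Suc n)"
      by (simp add: field_simps power2_eq_square)
    then show ?thesis
      using bump_nonzero_iff[of "real (Suc n)" "1 / real (Suc n)" x] by (simp add: cutoff_fun_def)
  qed
qed

lemma cutoff_fun_le: "cmod (cutoff_fun n x) \<le> 1"
  using bump_le_1[of "real (Suc n)" "1 / real (Suc n)" x] bump_nonneg[of "real (Suc n)" "1 / real (Suc n)" x]
  by (simp add: cutoff_fun_def)

text \<open>The 4 is the bound 2 for \<open>flat 2\<close> times the 2 from differentiating the
  squared norm. On the support \<open>norm x\<close> is at most \<open>n + 1\<close>, which cancels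
  the remaining factor; the second estimate gives decay at fixed \<open>x\<close>.\<close>

lemma cutoff_fun_partial:
  fixes x :: "'a::euclidean_space"
  assumes b: "b \<in> Basis"
  shows "cmod (partial b (cutoff_fun n) x) \<le> 4" "cmod (partial b (cutoff_fun n) x) \<le> 4 * norm x * inverse (real (Suc n))"
proof -
  let ?K = "real (Suc n)" and ?s = "real (Suc n) - 1 / real (Suc n) * (x \<bullet> x)"
  have e0: "partial b (cutoff_fun n) x = complex_of_real (partial b (bump ?K (1 / ?K)) x)"
    unfolding cutoff_fun_def[abs_def]
    by (rule partial_bounded_linear[OF bounded_linear_of_real Ck_differentiable[OF Ck_bump[of "Suc 0"]]])
  have e: "cmod (partial b (cutoff_fun n) x) = flat 2 ?s * (2 * (1 / ?K) * \<bar>x \<bullet> b\<bar>)"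
    unfolding e0 norm_of_real partial_bump abs_mult abs_minus_cancel abs_of_nonneg[OF flat_nonneg] by simp
  have f: "flat 2 ?s \<le> 2"
    using flat_le_fact[of 2 ?s] by (simp add: fact_2)
  have e1: "2 * (1 / ?K) * \<bar>x \<bullet> b\<bar> \<le> 2 * (1 / ?K) * norm x"
    using Basis_le_norm[OF b, of x] by (intro mult_left_mono) auto
  have e2: "cmod (partial b (cutoff_fun n) x) \<le> 2 * (2 * (1 / ?K) * norm x)"
    unfolding e by (intro mult_mono f e1) simp_all
  then show "cmod (partial b (cutoff_fun n) x) \<le> 4 * norm x * inverse ?K"
    by (simp add: field_simps del: of_nat_Suc)
  show "cmod (partial b (cutoff_fun n) x) \<le> 4"
  proof (cases "norm x \<le> ?K")
    case True
    then have "(1 / ?K) * norm x \<le> 1"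
      by (simp add: divide_le_eq)
    then show ?thesis
      using e2 by linarith
  next
    case False
    then have "?K * ?K < norm x * norm x"
      by (intro mult_strict_mono) auto
    then have "?s < 0"
      by (simp add: field_simps dot_square_norm power2_eq_square del: of_nat_Suc)
    then show ?thesis
      unfolding e by (simp add: flat_def)
  qed
qed

lemma cutoff_fun_tendsto:
  fixes x :: "'a::euclidean_space"
  shows "(\<lambda>n. cutoff_fun n x) \<longlonglongrightarrow> 1" "b \<in> Basis \<Longrightarrow> (\<lambda>n. partial b (cutoff_fun n) x) \<longlonglongrightarrow> 0"
proof -
  have "filterlim (\<lambda>n. real (Suc n)) at_top sequentially"
    by (rule filterlim_compose[OF filterlim_real_sequentially filterlim_Suc])
  moreover have "(\<lambda>n. - ((x \<bullet> x) * inverse (real (Suc n)))) \<longlonglongrightarrow> - ((x \<bullet> x) * 0)"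
    by (intro tendsto_minus tendsto_mult tendsto_const LIMSEQ_inverse_real_of_nat)
  ultimately have "filterlim (\<lambda>n. - ((x \<bullet> x) * inverse (real (Suc n))) + real (Suc n)) at_top sequentially"
    by (intro filterlim_tendsto_add_at_top)
  then have "(\<lambda>n. flat 0 (- ((x \<bullet> x) * inverse (real (Suc n))) + real (Suc n))) \<longlonglongrightarrow> 1"
    by (rule filterlim_compose[OF flat_tendsto(1)])
  then have "(\<lambda>n. complex_of_real (flat 0 (- ((x \<bullet> x) * inverse (real (Suc n))) + real (Suc n)))) \<longlonglongrightarrow> complex_of_real 1"
    by (rule tendsto_of_real)
  moreover have "- ((x \<bullet> x) * inverse (real (Suc n))) + real (Suc n) = real (Suc n) - 1 / real (Suc n) * (x \<bullet> x)" for n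
    by (simp add: divide_inverse)
  ultimately show "(\<lambda>n. cutoff_fun n x) \<longlonglongrightarrow> 1"
    by (simp add: cutoff_fun_def bump_def del: of_nat_Suc)
  have "(\<lambda>n. 4 * norm x * inverse (real (Suc n))) \<longlonglongrightarrow> 4 * norm x * 0"
    by (intro tendsto_mult tendsto_const LIMSEQ_inverse_real_of_nat)
  then show "(\<lambda>n. partial b (cutoff_fun n) x) \<longlonglongrightarrow> 0" if "b \<in> Basis"
    unfolding mult_zero_right by (rule tendsto_0_bound[OF cutoff_fun_partial(2)[OF that]])
qed

text \<open>A product of two test functions is a test function, and testing the weak derivative of
  \<open>u\<close> with it gives the Leibniz rule.\<close>

lemma H1_gradient_test_mult:
  fixes u \<eta> :: "'a::euclidean_space \<Rightarrow> complex"
  assumes u: "H1_gradient u G" and t: "test_function \<eta>"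
  shows "H1_gradient (\<lambda>x. \<eta> x * u x) (\<lambda>b x. \<eta> x * G b x + partial b \<eta> x * u x)"
  unfolding H1_gradient_def
proof (intro conjI ballI allI impI)
  note L = H1_gradientD(1,2)[OF u]
  obtain M where M[rule_format]: "0 < M" "\<forall>x. cmod (\<eta> x) \<le> M"
    by (rule test_function_bounded[OF t])
  note m = test_function_measurable[OF t]
  show "(\<lambda>x. \<eta> x * u x) \<in> L2"
    by (rule L2_mult_bounded(1)[OF L(1) m M(2)])
  fix b :: 'a assume b: "b \<in> Basis"
  note t' = test_function_partial[OF t b]
  note m' = test_function_measurable[OF t']
  obtain M' where M'[rule_format]: "0 < M'" "\<forall>x. cmod (partial b \<eta> x) \<le> M'"
    by (rule test_function_bounded[OF t'])
  show "(\<lambda>x. \<eta> x * G b x + partial b \<eta> x * u x) \<in> L2"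
    by (intro L2_add L2_mult_bounded(1)[OF L(1) m' M'(2)] L2_mult_bounded(1)[OF L(2)[OF b] m M(2)])
  fix \<phi> :: "'a \<Rightarrow> complex" assume p: "test_function \<phi>"
  have \<eta>C: "Ck k \<eta>" for k
    using t by (simp add: test_function_def)
  have tp: "test_function (\<lambda>x. \<eta> x * \<phi> x)"
    by (rule test_function_mult_left[OF \<eta>C p])
  have 1: "(LINT x|lborel. u x * (\<eta> x * partial b \<phi> x + partial b \<eta> x * \<phi> x)) = - (LINT x|lborel. G b x * (\<eta> x * \<phi> x))"
    using H1_gradientD(3)[OF u b tp]
    by (simp add: partial_mult[OF test_function_differentiable[OF t] test_function_differentiable[OF p]])
  note i1 = L2_mult_test_integrable[OF L(1) test_function_L2[OF test_function_partial[OF p b]] t]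
  note i2 = L2_mult_test_integrable[OF L(1) test_function_L2[OF t'] p]
  note i3 = L2_mult_test_integrable[OF L(2)[OF b] test_function_L2[OF t] p]
  have "(LINT x|lborel. (u x * partial b \<phi> x) * \<eta> x + (u x * partial b \<eta> x) * \<phi> x) = - (LINT x|lborel. (G b x * \<eta> x) * \<phi> x)"
    using 1 by (simp add: algebra_simps)
  then have "(LINT x|lborel. (u x * partial b \<phi> x) * \<eta> x)
      = - ((LINT x|lborel. (G b x * \<eta> x) * \<phi> x) + (LINT x|lborel. (u x * partial b \<eta> x) * \<phi> x))"
    unfolding Bochner_Integration.integral_add[OF i1 i2] by (simp add: algebra_simps eq_neg_iff_add_eq_0)
  also have "\<dots> = - (LINT x|lborel. (G b x * \<eta> x) * \<phi> x + (u x * partial b \<eta> x) * \<phi> x)"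
    unfolding Bochner_Integration.integral_add[OF i3 i2] ..
  finally show "(LINT x|lborel. (\<eta> x * u x) * partial b \<phi> x) = - (LINT x|lborel. (\<eta> x * G b x + partial b \<eta> x * u x) * \<phi> x)"
    by (simp add: algebra_simps)
qed

context schroedinger_potential
begin

lemma weight_mult: "weight (\<lambda>x. \<eta> x * u x) x = \<eta> x * weight u x"
  by (simp add: weight_def)

lemma form_dom_test:
  assumes "test_function u"
  shows "form_dom u"
proof -
  obtain R where R[rule_format]: "\<forall>k. Ck k u" "0 < R" "\<forall>x. R < norm x \<longrightarrow> u x = 0"
    by (rule test_functionE[OF assms])
  have "weight u \<in> L2"
    unfolding weight_def[abs_def]
    by (rule L2_continuous_bounded_support[of _ R])
      (auto intro!: continuous_on_mult sqrt_cont test_function_continuous[OF assms] simp: R)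
  then show ?thesis
    using H1_gradient_test[OF assms] by (auto simp: form_dom_def)
qed

lemma form_dom_test_mult:
  assumes "form_dom u" "test_function \<eta>"
  shows "form_dom (\<lambda>x. \<eta> x * u x)"
proof -
  obtain M where M[rule_format]: "0 < M" "\<forall>x. cmod (\<eta> x) \<le> M"
    by (rule test_function_bounded[OF assms(2)])
  have "weight (\<lambda>x. \<eta> x * u x) \<in> L2"
    unfolding weight_mult[abs_def] weight_mult
    using L2_mult_bounded(1)[OF form_domD(2)[OF assms(1)] test_function_measurable[OF assms(2)] M(2)] by (simp add: weight_mult[abs_def])
  then show ?thesis
    using H1_gradient_test_mult[OF form_domD(3)[OF assms(1)] assms(2)] by (auto simp: form_dom_def)
qed

lemma form_tendsto_0I:
  assumes "\<And>n::nat. H1_gradient (p n) (G n)" "\<And>b. b \<in> Basis \<Longrightarrow> (\<lambda>n. l2_norm (G n b)) \<longlonglongrightarrow> 0"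
    "(\<lambda>n. l2_norm (weight (p n))) \<longlonglongrightarrow> 0"
  shows "(\<lambda>n. form (p n)) \<longlonglongrightarrow> 0"
proof -
  have "(\<lambda>n. (1/2) * (\<Sum>b\<in>Basis. (l2_norm (G n b))\<^sup>2) + (l2_norm (weight (p n)))\<^sup>2)
      \<longlonglongrightarrow> (1/2) * (\<Sum>b\<in>(Basis::'a set). 0\<^sup>2) + 0\<^sup>2"
    by (intro tendsto_intros assms)
  then show ?thesis
    by (simp add: form_eq[OF assms(1)])
qed

text \<open>The gradient acquires the extra term \<open>partial b (cutoff_fun n) x * u x\<close>,
  which is dominated by 4 times \<open>u\<close> and tends to 0 pointwise; the other terms converge
  because the cut-offs are bounded by 1.\<close>

lemma form_cutoff_tendsto:
  assumes u: "form_dom u"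
  shows "(\<lambda>n. form (\<lambda>x. cutoff_fun n x * u x - u x)) \<longlonglongrightarrow> 0"
proof (rule form_tendsto_0I[OF H1_gradient_diff[OF H1_gradient_test_mult[OF form_domD(3)[OF u] cutoff_fun_test] form_domD(3)[OF u]]])
  have zz: "(\<lambda>n::nat. l2_norm (\<lambda>x. f x - f x)) \<longlonglongrightarrow> 0" for f :: "'a \<Rightarrow> complex"
    by simp
  have m1: "(\<lambda>x::'a. 1::complex) \<in> borel_measurable borel" and m0: "(\<lambda>x::'a. 0::complex) \<in> borel_measurable borel"
    by auto
  have c: "cutoff_fun n \<in> borel_measurable (borel :: 'a measure)" for n
    by (rule test_function_measurable[OF cutoff_fun_test])
  have cl: "AE x::'a in lborel. (\<lambda>n. cutoff_fun n x) \<longlonglongrightarrow> 1"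
    by (intro AE_I2 cutoff_fun_tendsto(1))
  have B: "(\<lambda>n. l2_norm (\<lambda>x. cutoff_fun n x * f x - f x)) \<longlonglongrightarrow> 0" if "f \<in> L2" for f :: "'a \<Rightarrow> complex"
    using L2_bounded_mult_tendsto(2)[OF c m1 cutoff_fun_le cl that that zz] by simp
  show "(\<lambda>n. l2_norm (\<lambda>x. (cutoff_fun n x * grad u b x + partial b (cutoff_fun n) x * u x) - grad u b x)) \<longlonglongrightarrow> 0"
    if b: "b \<in> Basis" for b
  proof -
    have c': "partial b (cutoff_fun n) \<in> borel_measurable borel" for n
      by (rule test_function_measurable[OF test_function_partial[OF cutoff_fun_test b]])
    have cl': "AE x in lborel. (\<lambda>n. partial b (cutoff_fun n) x) \<longlonglongrightarrow> 0"
      by (intro AE_I2 cutoff_fun_tendsto(2) b)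
    have z: "(\<lambda>n. l2_norm (\<lambda>x. partial b (cutoff_fun n) x * u x)) \<longlonglongrightarrow> 0"
      using L2_bounded_mult_tendsto(2)[OF c' m0 cutoff_fun_partial(1)[OF b] cl' form_domD(1)[OF u] form_domD(1)[OF u] zz] by simp
    have s: "(\<lambda>n. l2_norm (\<lambda>x. cutoff_fun n x * grad u b x - grad u b x) + l2_norm (\<lambda>x. partial b (cutoff_fun n) x * u x)) \<longlonglongrightarrow> 0"
      using tendsto_add[OF B[OF form_domD(4)[OF u b]] z] by simp
    show ?thesis
    proof (rule tendsto_0_bound[OF _ s])
      fix n
      have L: "(\<lambda>x. cutoff_fun n x * grad u b x - grad u b x) \<in> L2" "(\<lambda>x. partial b (cutoff_fun n) x * u x) \<in> L2"
        by (intro L2_diff L2_mult_bounded(1)[OF form_domD(4)[OF u b] c cutoff_fun_le] form_domD(4)[OF u b]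
            L2_mult_bounded(1)[OF form_domD(1)[OF u] c' cutoff_fun_partial(1)[OF b]])+
      show "norm (l2_norm (\<lambda>x. (cutoff_fun n x * grad u b x + partial b (cutoff_fun n) x * u x) - grad u b x))
          \<le> l2_norm (\<lambda>x. cutoff_fun n x * grad u b x - grad u b x) + l2_norm (\<lambda>x. partial b (cutoff_fun n) x * u x)"
        using l2_norm_triangle[OF L] by (simp add: algebra_simps)
    qed
  qed
  show "(\<lambda>n. l2_norm (weight (\<lambda>x. cutoff_fun n x * u x - u x))) \<longlonglongrightarrow> 0"
    unfolding weight_diff using B[OF form_domD(2)[OF u]] by (simp add: weight_mult)
qed

text \<open>The fixed cut-off \<open>\<eta>\<close> is essential for the potential part: the weight
  may be unbounded, but its product with \<open>\<eta>\<close> is continuous with bounded support,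
  hence a bounded multiplier.\<close>

lemma form_mollify_tendsto:
  fixes \<eta> :: "'a \<Rightarrow> complex"
  assumes u: "form_dom u" and t: "test_function \<eta>"
  shows "(\<lambda>n. form (\<lambda>x. \<eta> x * moll n u x - \<eta> x * u x)) \<longlonglongrightarrow> 0"
proof -
  have mt: "test_function (\<lambda>x. \<eta> x * moll n u x)" for n
    using test_function_mult_left[OF moll_smooth(1)[OF form_domD(3)[OF u]] t, of n] by (simp add: mult.commute)
  have pm: "partial b (\<lambda>x. \<eta> x * moll n u x) x = \<eta> x * moll n (grad u b) x + partial b \<eta> x * moll n u x"
    if "b \<in> Basis" for n b x
    unfolding partial_mult[OF test_function_differentiable[OF t] moll_smooth(2)[OF form_domD(3)[OF u]]]
      moll_smooth(3)[OF form_domD(3)[OF u] that] ..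
  have BM: "(\<lambda>n. l2_norm (\<lambda>x. c x * moll n f x - c x * f x)) \<longlonglongrightarrow> 0"
    if "c \<in> borel_measurable borel" "\<And>x. cmod (c x) \<le> M" "f \<in> L2" for c f M
    using L2_bounded_mult_tendsto(2)[OF that(1,1,2) AE_I2[OF tendsto_const] moll_L2[OF that(3)] that(3) moll_tendsto_L2[OF that(3)]] .
  obtain M where M[rule_format]: "0 < M" "\<forall>x. cmod (\<eta> x) \<le> M"
    by (rule test_function_bounded[OF t])
  note m = test_function_measurable[OF t]
  show ?thesis
  proof (rule form_tendsto_0I[OF H1_gradient_diff[OF H1_gradient_test[OF mt] H1_gradient_test_mult[OF form_domD(3)[OF u] t]]])
    show "(\<lambda>n. l2_norm (\<lambda>x. partial b (\<lambda>x. \<eta> x * moll n u x) x - (\<eta> x * grad u b x + partial b \<eta> x * u x))) \<longlonglongrightarrow> 0"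
      if b: "b \<in> Basis" for b
    proof -
      note t' = test_function_partial[OF t b]
      note m' = test_function_measurable[OF t']
      obtain M' where M'[rule_format]: "0 < M'" "\<forall>x. cmod (partial b \<eta> x) \<le> M'"
        by (rule test_function_bounded[OF t'])
      have s: "(\<lambda>n. l2_norm (\<lambda>x. \<eta> x * moll n (grad u b) x - \<eta> x * grad u b x)
          + l2_norm (\<lambda>x. partial b \<eta> x * moll n u x - partial b \<eta> x * u x)) \<longlonglongrightarrow> 0"
        using tendsto_add[OF BM[OF m M(2) form_domD(4)[OF u b]] BM[OF m' M'(2) form_domD(1)[OF u]]] by simp
      show ?thesis
      proof (rule tendsto_0_bound[OF _ s])
        fix n
        have L: "(\<lambda>x. \<eta> x * moll n (grad u b) x - \<eta> x * grad u b x) \<in> L2"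
          "(\<lambda>x. partial b \<eta> x * moll n u x - partial b \<eta> x * u x) \<in> L2"
          by (intro L2_diff L2_mult_bounded(1)[OF _ m M(2)] L2_mult_bounded(1)[OF _ m' M'(2)] moll_L2 form_domD(4)[OF u b] form_domD(1)[OF u])+
        show "norm (l2_norm (\<lambda>x. partial b (\<lambda>x. \<eta> x * moll n u x) x - (\<eta> x * grad u b x + partial b \<eta> x * u x)))
            \<le> l2_norm (\<lambda>x. \<eta> x * moll n (grad u b) x - \<eta> x * grad u b x)
              + l2_norm (\<lambda>x. partial b \<eta> x * moll n u x - partial b \<eta> x * u x)"
          unfolding pm[OF b] add_diff_add real_norm_def abs_of_nonneg[OF l2_norm_nonneg]
          by (rule l2_norm_triangle[OF L])
      qed
    qed
    show "(\<lambda>n. l2_norm (weight (\<lambda>x. \<eta> x * moll n u x - \<eta> x * u x))) \<longlonglongrightarrow> 0"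
    proof -
      obtain R where R[rule_format]: "\<forall>k. Ck k \<eta>" "0 < R" "\<forall>x. R < norm x \<longrightarrow> \<eta> x = 0"
        by (rule test_functionE[OF t])
      define c where "c x = complex_of_real (sqrt (V x + c0)) * \<eta> x" for x
      have cc: "continuous_on UNIV c"
        unfolding c_def[abs_def] by (intro continuous_on_mult sqrt_cont test_function_continuous[OF t])
      have cz: "c x = 0" if "R < norm x" for x
        using R(3)[OF that] by (simp add: c_def)
      obtain M' where M'[rule_format]: "0 < M'" "\<forall>x. cmod (c x) \<le> M'"
        by (rule bounded_support_bounded[OF cc cz])
      show ?thesis
        using BM[OF borel_measurable_continuous_onI[OF cc] M'(2) form_domD(1)[OF u]]
        by (simp add: weight_def[abs_def] c_def algebra_simps)
    qed
  qed
qed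

text \<open>Cutting off before smoothing gives a product that is a test function and keeps the
  potential weight under control. The shares \<open>e / 4\<close> pay for the factors 2 in
  \<open>form_triangle\<close>.\<close>

lemma form_core:
  assumes u: "form_dom u" and e: "0 < e"
  shows "\<exists>\<phi>. test_function \<phi> \<and> form (\<lambda>x. \<phi> x - u x) < e"
proof -
  have "0 < e / 4"
    using e by simp
  from LIMSEQ_D[OF form_cutoff_tendsto[OF u] this] obtain k where
    "norm (form (\<lambda>x. cutoff_fun k x * u x - u x) - 0) < e / 4"
    by blast
  then have k: "form (\<lambda>x. cutoff_fun k x * u x - u x) < e / 4"
    by simp
  from LIMSEQ_D[OF form_mollify_tendsto[OF u cutoff_fun_test[of k]] \<open>0 < e / 4\<close>] obtain n where
    "norm (form (\<lambda>x. cutoff_fun k x * moll n u x - cutoff_fun k x * u x) - 0) < e / 4"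
    by blast
  then have n: "form (\<lambda>x. cutoff_fun k x * moll n u x - cutoff_fun k x * u x) < e / 4"
    by simp
  have t: "test_function (\<lambda>x. cutoff_fun k x * moll n u x)"
    using test_function_mult_left[OF moll_smooth(1)[OF form_domD(3)[OF u]] cutoff_fun_test, of n k] by (simp add: mult.commute)
  have "form (\<lambda>x. cutoff_fun k x * moll n u x - u x) < e"
    using form_triangle[OF form_dom_test[OF t] form_dom_test_mult[OF u cutoff_fun_test[of k]] u] k n by linarith
  then show ?thesis
    using t by blast
qed

section \<open>The Hamiltonian and its closure\<close>

definition ham :: "('a \<Rightarrow> complex) \<Rightarrow> 'a \<Rightarrow> complex"
  where "ham \<phi> x = - (1/2) * laplacian \<phi> x + complex_of_real (V x) * \<phi> x"

lemma hamiltonian_eq: "hamiltonian V = {(\<phi>, ham \<phi>) | \<phi>. test_function \<phi>}"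
  by (simp add: hamiltonian_def ham_def[abs_def])

lemma potential_mult_L2:
  assumes "test_function \<phi>"
  shows "(\<lambda>x. complex_of_real (V x) * \<phi> x) \<in> L2"
proof -
  obtain R where R[rule_format]: "\<forall>k. Ck k \<phi>" "0 < R" "\<forall>x. R < norm x \<longrightarrow> \<phi> x = 0"
    by (rule test_functionE[OF assms])
  show ?thesis
    by (rule L2_continuous_bounded_support[of _ R])
      (auto intro!: continuous_intros V_cont test_function_continuous[OF assms] simp: R)
qed

lemma L2_sum: "finite I \<Longrightarrow> (\<And>i. i \<in> I \<Longrightarrow> f i \<in> L2) \<Longrightarrow> (\<lambda>x. \<Sum>i\<in>I. f i x) \<in> L2"
  by (induction I rule: finite_induct) auto

lemma laplacian_L2: "test_function \<phi> \<Longrightarrow> laplacian \<phi> \<in> L2"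
  unfolding laplacian_def[abs_def]
  by (intro L2_sum test_function_L2 test_function_partial) auto

lemma ham_L2: "test_function \<phi> \<Longrightarrow> ham \<phi> \<in> L2"
  unfolding ham_def[abs_def] by (intro L2_add L2_cmult laplacian_L2 potential_mult_L2)

lemma test_function_diff:
  fixes f g :: "'a \<Rightarrow> complex"
  assumes "test_function f" "test_function g"
  shows "test_function (\<lambda>x. f x - g x)"
proof -
  obtain R where R[rule_format]: "\<forall>k. Ck k f" "0 < R" "\<forall>x. R < norm x \<longrightarrow> f x = 0"
    by (rule test_functionE[OF assms(1)])
  obtain S where S[rule_format]: "\<forall>k. Ck k g" "0 < S" "\<forall>x. S < norm x \<longrightarrow> g x = 0"
    by (rule test_functionE[OF assms(2)])
  have "Ck k (\<lambda>x. f x + - g x)" for k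
    by (intro Ck_add R(1) Ck_bounded_linear_comp[OF bounded_linear_minus[OF bounded_linear_ident]] S(1))
  then show ?thesis
    by (intro test_functionI[of _ "max R S"]) (auto simp: R S)
qed

lemma ham_diff:
  assumes "test_function f" "test_function g"
  shows "ham (\<lambda>x. f x - g x) = (\<lambda>x. ham f x - ham g x)"
proof -
  have 1: "partial b (\<lambda>x. f x - g x) = (\<lambda>x. partial b f x - partial b g x)" for b
    by (rule ext) (intro partial_diff test_function_differentiable assms)
  have "laplacian (\<lambda>x. f x - g x) x = laplacian f x - laplacian g x" for x
    unfolding laplacian_def 1 sum_subtractf[symmetric]
    by (intro sum.cong refl partial_diff test_function_differentiable test_function_partial assms)
  then show ?thesis
    by (simp add: ham_def fun_eq_iff algebra_simps)
qed

text \<open>One integration by parts in each direction turns the Laplacian term into the gradient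
  norms, and the shift of the potential accounts for \<open>c0\<close> times the squared
  norm.\<close>

lemma form_test:
  assumes t: "test_function \<phi>"
  shows "form \<phi> = Re (l2_inner \<phi> (ham \<phi>)) + c0 * (l2_norm \<phi>)\<^sup>2"
proof -
  note Lt = test_function_L2[OF t]
  have ibp: "l2_inner \<phi> (partial b (partial b \<phi>)) = - complex_of_real ((l2_norm (partial b \<phi>))\<^sup>2)" if b: "b \<in> Basis" for b
    using H1_gradientD(3)[OF H1_gradient_cnj[OF H1_gradient_test[OF t]] b test_function_partial[OF t b]]
    unfolding l2_inner_self[symmetric] l2_inner_def .
  have i: "integrable lborel (\<lambda>x. cnj (\<phi> x) * f x)" if "f \<in> L2" for f
    by (rule L2_mult_integrable[OF L2_cnj[OF Lt] that])
  have Lb: "partial b (partial b \<phi>) \<in> L2" if "b \<in> Basis" for b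
    by (intro test_function_L2 test_function_partial t that)
  have "l2_inner \<phi> (laplacian \<phi>) = (LINT x|lborel. (\<Sum>b\<in>Basis. cnj (\<phi> x) * partial b (partial b \<phi>) x))"
    by (simp add: l2_inner_def laplacian_def sum_distrib_left)
  also have "\<dots> = (\<Sum>b\<in>Basis. l2_inner \<phi> (partial b (partial b \<phi>)))"
    unfolding l2_inner_def by (rule Bochner_Integration.integral_sum) (rule i[OF Lb])
  also have "\<dots> = - complex_of_real (\<Sum>b\<in>Basis. (l2_norm (partial b \<phi>))\<^sup>2)"
    by (simp add: ibp sum_negf)
  finally have lap: "l2_inner \<phi> (laplacian \<phi>) = - complex_of_real (\<Sum>b\<in>Basis. (l2_norm (partial b \<phi>))\<^sup>2)" .
  have "l2_inner \<phi> (ham \<phi>) = (LINT x|lborel. - (1/2) * (cnj (\<phi> x) * laplacian \<phi> x) + cnj (\<phi> x) * (complex_of_real (V x) * \<phi> x))"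
    by (simp add: l2_inner_def ham_def algebra_simps)
  also have "\<dots> = - (1/2) * l2_inner \<phi> (laplacian \<phi>) + l2_inner \<phi> (\<lambda>x. complex_of_real (V x) * \<phi> x)"
    unfolding l2_inner_def
    using i[OF laplacian_L2[OF t]] i[OF potential_mult_L2[OF t]] by simp
  finally have h: "l2_inner \<phi> (ham \<phi>) = complex_of_real ((1/2) * (\<Sum>b\<in>Basis. (l2_norm (partial b \<phi>))\<^sup>2))
      + l2_inner \<phi> (\<lambda>x. complex_of_real (V x) * \<phi> x)"
    unfolding lap by simp
  have w: "cnj (weight \<phi> x) * weight \<phi> x = cnj (\<phi> x) * (complex_of_real (V x) * \<phi> x) + complex_of_real c0 * (cnj (\<phi> x) * \<phi> x)" for x
  proof -
    have "complex_of_real (sqrt (V x + c0)) * complex_of_real (sqrt (V x + c0)) = complex_of_real (V x + c0)"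
      using V_pos[of x] by (simp add: of_real_mult[symmetric] del: of_real_mult)
    moreover have "cnj (weight \<phi> x) * weight \<phi> x
        = (complex_of_real (sqrt (V x + c0)) * complex_of_real (sqrt (V x + c0))) * (cnj (\<phi> x) * \<phi> x)"
      by (simp add: weight_def)
    ultimately show ?thesis
      by (simp add: algebra_simps)
  qed
  have "l2_inner (weight \<phi>) (weight \<phi>) = l2_inner \<phi> (\<lambda>x. complex_of_real (V x) * \<phi> x) + complex_of_real c0 * l2_inner \<phi> \<phi>"
    unfolding l2_inner_def w using i[OF potential_mult_L2[OF t]] i[OF Lt] by simp
  then have w2: "l2_inner \<phi> (\<lambda>x. complex_of_real (V x) * \<phi> x) = complex_of_real ((l2_norm (weight \<phi>))\<^sup>2 - c0 * (l2_norm \<phi>)\<^sup>2)"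
    unfolding l2_inner_self by (simp add: algebra_simps)
  show ?thesis
    unfolding form_eq[OF H1_gradient_test[OF t]] h w2 by simp
qed

lemma op_closure_diff:
  assumes "(u, f) \<in> op_closure (hamiltonian V)" "(v, g) \<in> op_closure (hamiltonian V)"
  shows "(\<lambda>x. u x - v x, \<lambda>x. f x - g x) \<in> op_closure (hamiltonian V)"
proof -
  obtain p q where pq: "\<And>n::nat. (p n, q n) \<in> hamiltonian V" "(\<lambda>n. l2_norm (\<lambda>x. p n x - u x)) \<longlonglongrightarrow> 0"
    "(\<lambda>n. l2_norm (\<lambda>x. q n x - f x)) \<longlonglongrightarrow> 0" and L: "u \<in> L2" "f \<in> L2"
    using assms(1) unfolding op_closure_def by blast
  obtain p' q' where pq': "\<And>n::nat. (p' n, q' n) \<in> hamiltonian V" "(\<lambda>n. l2_norm (\<lambda>x. p' n x - v x)) \<longlonglongrightarrow> 0"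
    "(\<lambda>n. l2_norm (\<lambda>x. q' n x - g x)) \<longlonglongrightarrow> 0" and L': "v \<in> L2" "g \<in> L2"
    using assms(2) unfolding op_closure_def by blast
  have t: "test_function (p n)" "q n = ham (p n)" "test_function (p' n)" "q' n = ham (p' n)" for n
    using pq(1)[of n] pq'(1)[of n] by (auto simp: hamiltonian_eq)
  have lim: "(\<lambda>n. l2_norm (\<lambda>x. (a n x - b n x) - (a' x - b' x))) \<longlonglongrightarrow> 0"
    if "\<And>n. a n \<in> L2" "\<And>n. b n \<in> L2" "a' \<in> L2" "b' \<in> L2"
      "(\<lambda>n. l2_norm (\<lambda>x. a n x - a' x)) \<longlonglongrightarrow> 0" "(\<lambda>n. l2_norm (\<lambda>x. b n x - b' x)) \<longlonglongrightarrow> 0"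
    for a b :: "nat \<Rightarrow> 'a \<Rightarrow> complex" and a' b'
  proof (rule tendsto_0_bound)
    show "(\<lambda>n. l2_norm (\<lambda>x. a n x - a' x) + l2_norm (\<lambda>x. b' x - b n x)) \<longlonglongrightarrow> 0"
      using tendsto_add[OF that(5,6)] by (simp add: l2_norm_minus_commute[of b'])
    have e: "(\<lambda>x. (a n x - b n x) - (a' x - b' x)) = (\<lambda>x. (a n x - a' x) + (b' x - b n x))" for n
      by (simp add: fun_eq_iff)
    show "norm (l2_norm (\<lambda>x. (a n x - b n x) - (a' x - b' x))) \<le> l2_norm (\<lambda>x. a n x - a' x) + l2_norm (\<lambda>x. b' x - b n x)" for n
      unfolding e real_norm_def abs_of_nonneg[OF l2_norm_nonneg] by (intro l2_norm_triangle L2_diff that)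
  qed
  have "(\<lambda>x. p n x - p' n x, \<lambda>x. q n x - q' n x) \<in> hamiltonian V" for n
    using test_function_diff[OF t(1,3)[of n]] ham_diff[OF t(1,3)[of n]] unfolding hamiltonian_eq t(2,4) by auto
  moreover have "(\<lambda>n. l2_norm (\<lambda>x. (p n x - p' n x) - (u x - v x))) \<longlonglongrightarrow> 0"
    by (intro lim test_function_L2 t L L' pq pq')
  moreover have "(\<lambda>n. l2_norm (\<lambda>x. (q n x - q' n x) - (f x - g x))) \<longlonglongrightarrow> 0"
    by (intro lim L L' pq pq') (auto simp: t ham_L2)
  ultimately show ?thesis
    unfolding op_closure_def using L2_diff[OF L(1) L'(1)] L2_diff[OF L(2) L'(2)]
    by (intro CollectI case_prodI conjI exI[of _ "\<lambda>n x. p n x - p' n x"] exI[of _ "\<lambda>n x. q n x - q' n x"] allI)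
qed

lemma hamiltonian_in_closure:
  assumes "test_function \<phi>"
  shows "(\<phi>, ham \<phi>) \<in> op_closure (hamiltonian V)"
proof -
  have "(\<phi>, ham \<phi>) \<in> hamiltonian V"
    using assms by (auto simp: hamiltonian_eq)
  then show ?thesis
    unfolding op_closure_def using test_function_L2[OF assms] ham_L2[OF assms]
    by (intro CollectI case_prodI conjI exI[of _ "\<lambda>n. \<phi>"] exI[of _ "\<lambda>n. ham \<phi>"] allI) simp_all
qed

text \<open>By \<open>form_test\<close>, the form of a difference of test functions is controlled by
  \<open>L2\<close> norms of the functions and of their images. A sequence converging in the graph
  norm is therefore Cauchy for the form, so the operator domain lies in the form domain and the
  identity passes to the limit.\<close>

lemma op_closure_form:
  assumes "(u, f) \<in> op_closure (hamiltonian V)"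
  shows "form_dom u" "form u = Re (l2_inner u f) + c0 * (l2_norm u)\<^sup>2"
proof -
  obtain p q where pq: "\<And>n::nat. (p n, q n) \<in> hamiltonian V" "(\<lambda>n. l2_norm (\<lambda>x. p n x - u x)) \<longlonglongrightarrow> 0"
    "(\<lambda>n. l2_norm (\<lambda>x. q n x - f x)) \<longlonglongrightarrow> 0" and L: "u \<in> L2" "f \<in> L2"
    using assms unfolding op_closure_def by blast
  have t: "test_function (p n)" "q n = ham (p n)" for n
    using pq(1)[of n] by (auto simp: hamiltonian_eq)
  have qL: "q n \<in> L2" for n
    unfolding t(2) by (rule ham_L2[OF t(1)])
  note pL = test_function_L2[OF t(1)]
  define a where "a n = l2_norm (\<lambda>x. p n x - u x)" for n
  define b where "b n = l2_norm (\<lambda>x. q n x - f x)" for n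
  have bound: "form (\<lambda>x. p m x - p n x) \<le> (a m + a n) * (b m + b n) + \<bar>c0\<bar> * (a m + a n)\<^sup>2" for m n
  proof -
    have A: "l2_norm (\<lambda>x. p m x - p n x) \<le> a m + a n"
      using l2_norm_triangle_diff[OF pL L(1) pL, of m n] by (simp add: a_def l2_norm_minus_commute[of u])
    have B: "l2_norm (\<lambda>x. q m x - q n x) \<le> b m + b n"
      using l2_norm_triangle_diff[OF qL L(2) qL, of m n] by (simp add: b_def l2_norm_minus_commute[of f])
    have "form (\<lambda>x. p m x - p n x) = Re (l2_inner (\<lambda>x. p m x - p n x) (\<lambda>x. q m x - q n x)) + c0 * (l2_norm (\<lambda>x. p m x - p n x))\<^sup>2"
      using form_test[OF test_function_diff[OF t(1) t(1)], of m n] unfolding t(2) ham_diff[OF t(1) t(1)] .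
    also have "Re (l2_inner (\<lambda>x. p m x - p n x) (\<lambda>x. q m x - q n x)) \<le> (a m + a n) * (b m + b n)"
    proof -
      have "Re (l2_inner (\<lambda>x. p m x - p n x) (\<lambda>x. q m x - q n x)) \<le> l2_norm (\<lambda>x. p m x - p n x) * l2_norm (\<lambda>x. q m x - q n x)"
        by (rule order_trans[OF complex_Re_le_cmod l2_inner_bound]) (intro L2_diff pL qL)+
      also have "\<dots> \<le> (a m + a n) * (b m + b n)"
        using A B by (intro mult_mono) (auto simp: a_def)
      finally show ?thesis .
    qed
    also have "c0 * (l2_norm (\<lambda>x. p m x - p n x))\<^sup>2 \<le> \<bar>c0\<bar> * (a m + a n)\<^sup>2"
      using A by (intro mult_mono power_mono) auto
    finally show ?thesis by simp
  qed
  have cauchy: "\<exists>N. \<forall>m\<ge>N. \<forall>n\<ge>N. form (\<lambda>x. p m x - p n x) < e" if e: "e > 0" for e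
  proof -
    \<comment> \<open>For distances below \<open>d \<le> 1\<close> the two terms of
      \<open>bound\<close> are at most \<open>4 * d\<close> and
      \<open>4 * \<bar>c0\<bar> * d\<close>; the extra 1 makes the final inequality strict.\<close>
    define K where "K = 4 + 4 * \<bar>c0\<bar> + 1"
    have K: "0 < K"
      by (simp add: K_def)
    define d where "d = min 1 (e / K)"
    have "d \<le> e / K"
      by (simp add: d_def)
    then have "d * K \<le> e"
      using K by (simp add: pos_le_divide_eq)
    then have d: "0 < d" "d \<le> 1" "d * (4 + 4 * \<bar>c0\<bar> + 1) \<le> e"
      using e K by (auto simp: d_def K_def)
    obtain N1 where N1: "\<forall>n\<ge>N1. norm (a n - 0) < d"
      using LIMSEQ_D[OF pq(2)[folded a_def] d(1)] by blast
    obtain N2 where N2: "\<forall>n\<ge>N2. norm (b n - 0) < d"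
      using LIMSEQ_D[OF pq(3)[folded b_def] d(1)] by blast
    have "form (\<lambda>x. p m x - p n x) < e" if "m \<ge> max N1 N2" "n \<ge> max N1 N2" for m n
    proof -
      have "norm (a m - 0) < d" "norm (a n - 0) < d" "norm (b m - 0) < d" "norm (b n - 0) < d"
        using N1 N2 that by auto
      then have ab: "a m + a n \<le> 2 * d" "b m + b n \<le> 2 * d" "0 \<le> a m + a n" "0 \<le> b m + b n"
        by (auto simp: a_def b_def)
      have "(a m + a n) * (b m + b n) + \<bar>c0\<bar> * (a m + a n)\<^sup>2 \<le> (2 * d) * (2 * d) + \<bar>c0\<bar> * (2 * d)\<^sup>2"
        using ab by (intro add_mono mult_mono power_mono) auto
      also have "\<dots> = (d * d) * (4 + 4 * \<bar>c0\<bar>)"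
        by (simp add: power2_eq_square algebra_simps)
      also have "\<dots> \<le> (d * 1) * (4 + 4 * \<bar>c0\<bar>)"
        using d by (intro mult_right_mono mult_left_mono) auto
      also have "\<dots> < d * (4 + 4 * \<bar>c0\<bar> + 1)"
        using d by simp
      finally show ?thesis
        using bound[of m n] d(3) by linarith
    qed
    then show ?thesis by blast
  qed
  obtain v where v: "form_dom v" "(\<lambda>n. form (\<lambda>x. p n x - v x)) \<longlonglongrightarrow> 0"
    using form_complete[OF form_dom_test[OF t(1)] cauchy] by blast
  have "AE x in lborel. u x = v x"
    by (rule L2_lim_unique_AE[OF pL L(1) form_domD(1)[OF v(1)] pq(2) form_small_imp_small(1)[OF form_dom_test[OF t(1)] v]])
  note c = form_dom_cong_AE[OF v(1) L2_D(1)[OF L(1)] this]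
  show "form_dom u"
    by (rule c(1))
  have "(\<lambda>n. Re (l2_inner (p n) (q n)) + c0 * (l2_norm (p n))\<^sup>2) \<longlonglongrightarrow> Re (l2_inner u f) + c0 * (l2_norm u)\<^sup>2"
    by (intro tendsto_intros l2_inner_tendsto l2_norm_tendsto pL qL L pq)
  then have "(\<lambda>n. form (p n)) \<longlonglongrightarrow> Re (l2_inner u f) + c0 * (l2_norm u)\<^sup>2"
    unfolding form_test[OF t(1)] t(2) .
  then show "form u = Re (l2_inner u f) + c0 * (l2_norm u)\<^sup>2"
    using form_tendsto[OF form_dom_test[OF t(1)] v] c(2) LIMSEQ_unique by metis
qed

end

section \<open>Conservation of the energy form\<close>

locale schroedinger_group = schroedinger_potential V c0 for V :: "'a::euclidean_space \<Rightarrow> real" and c0 +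
  fixes U :: "real \<Rightarrow> ('a \<Rightarrow> complex) \<Rightarrow> 'a \<Rightarrow> complex"
  assumes unitary: "unitary_group U" and gen: "generator U = op_closure (hamiltonian V)"
begin

lemma U_L2: "f \<in> L2 \<Longrightarrow> U t f \<in> L2"
  and U_linear: "f \<in> L2 \<Longrightarrow> g \<in> L2 \<Longrightarrow> AE x in lborel. U t (\<lambda>y. a * f y + c * g y) x = a * U t f x + c * U t g x"
  and U_inner: "f \<in> L2 \<Longrightarrow> g \<in> L2 \<Longrightarrow> l2_inner (U t f) (U t g) = l2_inner f g"
  and U_0: "f \<in> L2 \<Longrightarrow> AE x in lborel. U 0 f x = f x"
  and U_add: "f \<in> L2 \<Longrightarrow> AE x in lborel. U (s + t) f x = U s (U t f) x"
  and U_cont_0: "f \<in> L2 \<Longrightarrow> ((\<lambda>t. l2_norm (\<lambda>x. U t f x - f x)) \<longlongrightarrow> 0) (at 0)"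
  using unitary unfolding unitary_group_def by blast+

lemma U_measurable: "f \<in> L2 \<Longrightarrow> U t f \<in> borel_measurable borel"
  by (intro L2_D(1) U_L2)

lemma U_norm:
  assumes "f \<in> L2"
  shows "l2_norm (U t f) = l2_norm f"
proof -
  have "complex_of_real ((l2_norm (U t f))\<^sup>2) = complex_of_real ((l2_norm f)\<^sup>2)"
    using U_inner[OF assms assms, of t] by (simp only: l2_inner_self)
  then have "(l2_norm (U t f))\<^sup>2 = (l2_norm f)\<^sup>2"
    by (simp only: of_real_eq_iff)
  then show ?thesis
    by (rule power2_eq_imp_eq) simp_all
qed

lemma U_diff:
  assumes "f \<in> L2" "g \<in> L2"
  shows "AE x in lborel. U t (\<lambda>y. f y - g y) x = U t f x - U t g x"
  using U_linear[OF assms, of t 1 "-1"] by simp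

lemma U_norm_diff:
  assumes "f \<in> L2" "g \<in> L2"
  shows "l2_norm (\<lambda>x. U t f x - U t g x) = l2_norm (\<lambda>x. f x - g x)"
proof -
  have "l2_norm (\<lambda>x. U t f x - U t g x) = l2_norm (U t (\<lambda>y. f y - g y))"
  proof (rule l2_norm_cong_AE)
    show "AE x in lborel. cmod (U t f x - U t g x) = cmod (U t (\<lambda>y. f y - g y) x)"
      using U_diff[OF assms, of t] by eventually_elim simp
  qed (intro borel_measurable_diff U_measurable L2_diff assms)+
  then show ?thesis
    using U_norm[OF L2_diff[OF assms]] by simp
qed

lemma U_commute:
  assumes "f \<in> L2"
  shows "AE x in lborel. U s (U t f) x = U t (U s f) x"
  using U_add[OF assms, of s t] U_add[OF assms, of t s] unfolding add.commute[of t s] by eventually_elim simp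

lemma U_inverse:
  assumes "f \<in> L2"
  shows "AE x in lborel. U t (U (- t) f) x = f x" "AE x in lborel. U (- t) (U t f) x = f x"
  using U_add[OF assms, of t "- t"] U_add[OF assms, of "- t" t] U_0[OF assms] by (eventually_elim, simp)+

lemma U_cont:
  assumes "f \<in> L2"
  shows "((\<lambda>s. l2_norm (\<lambda>x. U s f x - U t f x)) \<longlongrightarrow> 0) (at t)"
proof (rule LIM_offset_zero_cancel)
  have "l2_norm (\<lambda>x. U (t + h) f x - U t f x) = l2_norm (\<lambda>x. U h (U t f) x - U t f x)" for h
  proof (rule l2_norm_cong_AE)
    show "AE x in lborel. cmod (U (t + h) f x - U t f x) = cmod (U h (U t f) x - U t f x)"
      using U_add[OF assms, of h t] unfolding add.commute[of h t] by eventually_elim simp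
  qed (intro borel_measurable_diff U_measurable U_L2 assms)+
  then show "((\<lambda>h. l2_norm (\<lambda>x. U (t + h) f x - U t f x)) \<longlongrightarrow> 0) (at 0)"
    using U_cont_0[OF U_L2[OF assms]] by simp
qed

lemma generator_D:
  assumes "(u, w) \<in> op_closure (hamiltonian V)"
  shows "u \<in> L2" "w \<in> L2"
    "((\<lambda>h. l2_norm (\<lambda>x. \<i> * ((U h u x - u x) / complex_of_real h) - w x)) \<longlongrightarrow> 0) (at 0)"
  using assms unfolding gen[symmetric] generator_def by auto

text \<open>\<open>U t\<close> commutes with the difference quotients at time 0 and preserves norms,
  so the error of the quotient is the same before and after applying it.\<close>

lemma generator_invariant:
  assumes "(u, w) \<in> op_closure (hamiltonian V)"
  shows "(U t u, U t w) \<in> op_closure (hamiltonian V)"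
proof -
  note D = generator_D[OF assms]
  have "l2_norm (\<lambda>x. \<i> * ((U h (U t u) x - U t u x) / complex_of_real h) - U t w x)
      = l2_norm (\<lambda>x. \<i> * ((U h u x - u x) / complex_of_real h) - w x)" for h
  proof -
    define a where "a = \<i> / complex_of_real h"
    have Ld: "(\<lambda>x. U h u x - u x) \<in> L2"
      by (intro L2_diff U_L2 D)
    have e1: "AE x in lborel. U t (\<lambda>x. a * (U h u x - u x) + (-1) * w x) x = a * U t (\<lambda>x. U h u x - u x) x + (-1) * U t w x"
      by (rule U_linear[OF Ld D(2)])
    have "l2_norm (\<lambda>x. \<i> * ((U h (U t u) x - U t u x) / complex_of_real h) - U t w x)
        = l2_norm (U t (\<lambda>x. a * (U h u x - u x) + (-1) * w x))"
    proof (rule l2_norm_cong_AE)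
      show "AE x in lborel. cmod (\<i> * ((U h (U t u) x - U t u x) / complex_of_real h) - U t w x)
          = cmod (U t (\<lambda>x. a * (U h u x - u x) + (-1) * w x) x)"
        using e1 U_diff[OF U_L2[OF D(1), of h] D(1), of t] U_commute[OF D(1), of t h]
      proof eventually_elim
        case (elim x)
        show ?case
          unfolding elim by (simp add: a_def)
      qed
      have "(\<lambda>x. a * (U h (U t u) x - U t u x) - U t w x) \<in> L2"
        by (intro L2_diff L2_cmult U_L2 D)
      then show "(\<lambda>x. \<i> * ((U h (U t u) x - U t u x) / complex_of_real h) - U t w x) \<in> borel_measurable borel"
        using L2_D(1) by (simp add: a_def)
    qed (intro U_measurable L2_add L2_cmult Ld D)
    also have "\<dots> = l2_norm (\<lambda>x. a * (U h u x - u x) + (-1) * w x)"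
      by (intro U_norm L2_add L2_cmult Ld D)
    finally show ?thesis
      by (simp add: a_def)
  qed
  then show ?thesis
    unfolding gen[symmetric] generator_def using D U_L2 by auto
qed

text \<open>On the domain of the generator the form is an inner product plus a multiple of the
  squared norm, and unitarity preserves both.\<close>

lemma generator_form_conserved:
  assumes "(u, w) \<in> op_closure (hamiltonian V)"
  shows "form_dom (U t u)" "form (U t u) = form u"
proof -
  note D = generator_D[OF assms]
  note I = generator_invariant[OF assms, of t]
  show "form_dom (U t u)"
    by (rule op_closure_form(1)[OF I])
  show "form (U t u) = form u"
    unfolding op_closure_form(2)[OF I] op_closure_form(2)[OF assms] U_inner[OF D(1,2)] U_norm[OF D(1)] ..
qed

text \<open>The difference of two evolved states is again in the domain, where the form is bounded
  by \<open>L2\<close> norms; these tend to 0 by strong continuity applied to the state and to its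
  image.\<close>

lemma generator_form_continuous:
  assumes "(u, w) \<in> op_closure (hamiltonian V)"
  shows "((\<lambda>s. form (\<lambda>x. U s u x - U t u x)) \<longlongrightarrow> 0) (at t)"
proof (rule tendsto_0_bound)
  note D = generator_D[OF assms]
  have "((\<lambda>s. l2_norm (\<lambda>x. U s u x - U t u x) * l2_norm (\<lambda>x. U s w x - U t w x)
      + \<bar>c0\<bar> * (l2_norm (\<lambda>x. U s u x - U t u x))\<^sup>2) \<longlongrightarrow> 0 * 0 + \<bar>c0\<bar> * 0\<^sup>2) (at t)"
    by (intro tendsto_intros U_cont D)
  then show "((\<lambda>s. l2_norm (\<lambda>x. U s u x - U t u x) * l2_norm (\<lambda>x. U s w x - U t w x)
      + \<bar>c0\<bar> * (l2_norm (\<lambda>x. U s u x - U t u x))\<^sup>2) \<longlongrightarrow> 0) (at t)"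
    by simp
  fix s
  note dd = op_closure_diff[OF generator_invariant[OF assms, of s] generator_invariant[OF assms, of t]]
  have "Re (l2_inner (\<lambda>x. U s u x - U t u x) (\<lambda>x. U s w x - U t w x))
      \<le> l2_norm (\<lambda>x. U s u x - U t u x) * l2_norm (\<lambda>x. U s w x - U t w x)"
    by (rule order_trans[OF complex_Re_le_cmod l2_inner_bound]) (intro L2_diff U_L2 D)+
  moreover have "c0 * (l2_norm (\<lambda>x. U s u x - U t u x))\<^sup>2 \<le> \<bar>c0\<bar> * (l2_norm (\<lambda>x. U s u x - U t u x))\<^sup>2"
    by (intro mult_right_mono) auto
  ultimately have "form (\<lambda>x. U s u x - U t u x) \<le> l2_norm (\<lambda>x. U s u x - U t u x) * l2_norm (\<lambda>x. U s w x - U t w x)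
      + \<bar>c0\<bar> * (l2_norm (\<lambda>x. U s u x - U t u x))\<^sup>2"
    unfolding op_closure_form(2)[OF dd] by (rule add_mono)
  then show "norm (form (\<lambda>x. U s u x - U t u x)) \<le> l2_norm (\<lambda>x. U s u x - U t u x) * l2_norm (\<lambda>x. U s w x - U t w x)
      + \<bar>c0\<bar> * (l2_norm (\<lambda>x. U s u x - U t u x))\<^sup>2"
    unfolding real_norm_def abs_of_nonneg[OF form_nonneg] .
qed

lemma U_form_test:
  assumes "test_function \<phi>" "test_function \<eta>"
  shows "form (\<lambda>x. U t \<phi> x - U t \<eta> x) = form (\<lambda>x. \<phi> x - \<eta> x)"
proof -
  note t = test_function_diff[OF assms]
  note g = generator_form_conserved[OF hamiltonian_in_closure[OF t], of t]
  note L = test_function_L2[OF assms(1)] test_function_L2[OF assms(2)]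
  have "AE x in lborel. U t \<phi> x - U t \<eta> x = U t (\<lambda>x. \<phi> x - \<eta> x) x"
    using U_diff[OF L, of t] by eventually_elim simp
  from form_dom_cong_AE(2)[OF g(1) borel_measurable_diff[OF U_measurable[OF L(1)] U_measurable[OF L(2)]] this]
  show ?thesis
    using g(2) by simp
qed

text \<open>Extension by density of the form isometry \<open>U_form_test\<close>. Evolved
  approximants are Cauchy in the form, and their form limit agrees almost everywhere with the
  \<open>L2\<close> limit \<open>U t u\<close>, which is thereby in the form domain.\<close>

lemma U_form_approx:
  assumes u: "form_dom u"
  shows "form_dom (U t u)" "test_function \<phi> \<Longrightarrow> form (\<lambda>x. U t \<phi> x - U t u x) = form (\<lambda>x. \<phi> x - u x)"
proof -
  have "\<forall>n. \<exists>\<phi>. test_function \<phi> \<and> form (\<lambda>x. \<phi> x - u x) < inverse (real (Suc n))"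
    using form_core[OF u inverse_Suc_pos] by blast
  from choice[OF this] obtain p where p: "\<And>n. test_function (p n)"
    "\<And>n. form (\<lambda>x. p n x - u x) < inverse (real (Suc n))"
    by blast
  have plim: "(\<lambda>n. form (\<lambda>x. p n x - u x)) \<longlonglongrightarrow> 0"
    by (rule tendsto_0_bound[OF _ LIMSEQ_inverse_real_of_nat])
      (simp only: real_norm_def abs_of_nonneg[OF form_nonneg] less_imp_le[OF p(2)])
  note pd = form_dom_test[OF p(1)]
  note pL = form_domD(1)[OF pd]
  note Ud = generator_form_conserved(1)[OF hamiltonian_in_closure]
  have cauchy: "\<exists>N. \<forall>m\<ge>N. \<forall>n\<ge>N. form (\<lambda>x. U t (p m) x - U t (p n) x) < e" if e: "e > 0" for e
  proof -
    have "0 < e / 4"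
      using e by simp
    from LIMSEQ_D[OF plim this] obtain N where N: "\<forall>n\<ge>N. norm (form (\<lambda>x. p n x - u x) - 0) < e / 4"
      by blast
    have "form (\<lambda>x. U t (p m) x - U t (p n) x) < e" if "m \<ge> N" "n \<ge> N" for m n
    proof -
      have "form (\<lambda>x. p m x - u x) < e / 4" "form (\<lambda>x. p n x - u x) < e / 4"
        using N that by auto
      moreover have "form (\<lambda>x. p m x - p n x) \<le> 2 * form (\<lambda>x. p m x - u x) + 2 * form (\<lambda>x. p n x - u x)"
        using form_triangle[OF pd u pd, of m n] form_minus_commute[OF u pd[of n]] by simp
      ultimately show ?thesis
        unfolding U_form_test[OF p(1) p(1)] by linarith
    qed
    then show ?thesis by blast
  qed
  obtain v where v: "form_dom v" "(\<lambda>n. form (\<lambda>x. U t (p n) x - v x)) \<longlonglongrightarrow> 0"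
    using form_complete[OF Ud[OF p(1)] cauchy] by blast
  have "(\<lambda>n. l2_norm (\<lambda>x. U t (p n) x - U t u x)) \<longlonglongrightarrow> 0"
    unfolding U_norm_diff[OF pL form_domD(1)[OF u]]
    by (rule form_small_imp_small(1)[OF pd u plim])
  then have uv: "AE x in lborel. U t u x = v x"
    by (rule L2_lim_unique_AE[OF U_L2[OF pL] U_L2[OF form_domD(1)[OF u]] form_domD(1)[OF v(1)] _
          form_small_imp_small(1)[OF Ud[OF p(1)] v]])
  note c = form_dom_cong_AE[OF v(1) U_measurable[OF form_domD(1)[OF u]] uv]
  show d: "form_dom (U t u)"
    by (rule c(1))
  have lim: "(\<lambda>n. form (\<lambda>x. U t (p n) x - U t u x)) \<longlonglongrightarrow> 0"
  proof -
    have "form (\<lambda>x. U t (p n) x - U t u x) = form (\<lambda>x. U t (p n) x - v x)" for n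
    proof (rule form_dom_cong_AE(2)[OF form_dom_diff[OF Ud[OF p(1)] v(1)]])
      show "AE x in lborel. U t (p n) x - U t u x = U t (p n) x - v x"
        using uv by eventually_elim simp
    qed (intro borel_measurable_diff U_measurable pL form_domD(1)[OF u])
    then show ?thesis
      using v(2) by simp
  qed
  show "form (\<lambda>x. U t \<phi> x - U t u x) = form (\<lambda>x. \<phi> x - u x)" if t: "test_function \<phi>"
  proof -
    \<comment> \<open>The form distance to a fixed \<open>a\<close> is continuous in the other
      argument. Applied before and after the evolution, it carries \<open>U_form_test\<close> from
      the approximants over to \<open>u\<close>.\<close>
    have conv: "(\<lambda>n. form (\<lambda>x. a x - q n x)) \<longlonglongrightarrow> form (\<lambda>x. a x - b x)"
      if "\<And>n. form_dom (q n)" "form_dom a" "form_dom b" "(\<lambda>n. form (\<lambda>x. q n x - b x)) \<longlonglongrightarrow> 0"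
      for a b and q :: "nat \<Rightarrow> 'a \<Rightarrow> complex"
    proof (rule form_tendsto[OF form_dom_diff[OF that(2,1)] form_dom_diff[OF that(2,3)]])
      have "form (\<lambda>x. (a x - q n x) - (a x - b x)) = form (\<lambda>x. q n x - b x)" for n
        using form_minus_commute[OF that(3) that(1), of n] by simp
      then show "(\<lambda>n. form (\<lambda>x. (a x - q n x) - (a x - b x))) \<longlonglongrightarrow> 0"
        using that(4) by simp
    qed
    have "(\<lambda>n. form (\<lambda>x. \<phi> x - p n x)) \<longlonglongrightarrow> form (\<lambda>x. U t \<phi> x - U t u x)"
      using conv[OF Ud[OF p(1)] Ud[OF t, of t] d lim] unfolding U_form_test[OF t p(1)] .
    then show ?thesis
      using conv[OF pd form_dom_test[OF t] u plim] by (rule LIMSEQ_unique)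
  qed
qed

text \<open>The form of a state is its form distance to the zero function, which is a test function
  covered by \<open>U_form_approx\<close>.\<close>

lemma U_form_bounded:
  assumes u: "form_dom u"
  shows "form (U t u) \<le> form u"
proof -
  have "test_function (\<lambda>x::'a. 0::complex)"
    by (rule test_functionI[of _ 0]) simp_all
  note z = this
  \<comment> \<open>Linearity with zero coefficients shows that \<open>U t\<close> sends the zero
    function to one that vanishes almost everywhere; for representatives no more can be
    said.\<close>
  have "AE x in lborel. U t (\<lambda>x. 0 * u x + 0 * u x) x = 0 * U t u x + 0 * U t u x"
    by (rule U_linear[OF form_domD(1)[OF u] form_domD(1)[OF u]])
  then have z0: "AE x in lborel. 0 - U t u x = U t (\<lambda>x. 0) x - U t u x"
    by simp
  note d0 = generator_form_conserved(1)[OF hamiltonian_in_closure[OF z], of t]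
  have neg: "form (\<lambda>x. 0 - v x) = form v" if "form_dom v" for v
    using form_minus_commute[OF form_dom_test[OF z] that] by simp
  have "form (U t u) = form (\<lambda>x. 0 - U t u x)"
    by (rule neg[OF U_form_approx(1)[OF u], symmetric])
  also have "\<dots> = form (\<lambda>x. U t (\<lambda>x. 0) x - U t u x)"
  proof (rule form_dom_cong_AE(2)[OF form_dom_diff[OF d0 U_form_approx(1)[OF u]] _ z0])
    show "(\<lambda>x. 0 - U t u x) \<in> borel_measurable borel"
      using U_measurable[OF form_domD(1)[OF u]] by simp
  qed
  also have "\<dots> = form u"
    unfolding U_form_approx(2)[OF u z] by (rule neg[OF u])
  finally show ?thesis by simp
qed

text \<open>A test function close to \<open>u\<close> stays equally close at all times, since the
  form distance is conserved; continuity is thus inherited from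
  \<open>generator_form_continuous\<close>.\<close>

lemma U_form_continuous:
  assumes u: "form_dom u"
  shows "((\<lambda>s. form (\<lambda>x. U s u x - U t u x)) \<longlongrightarrow> 0) (at t)"
proof (rule tendstoI)
  fix e :: real assume e: "0 < e"
  \<comment> \<open>Two applications of \<open>form_triangle\<close> produce the factors 2, 4 and 4,
    so the total is below ten twelfths of \<open>e\<close>.\<close>
  then have "0 < e / 12" by simp
  from form_core[OF u this] obtain \<phi> where \<phi>: "test_function \<phi>" "form (\<lambda>x. \<phi> x - u x) < e / 12"
    by blast
  note Ud = generator_form_conserved(1)[OF hamiltonian_in_closure[OF \<phi>(1)]]
  note Uu = U_form_approx(1)[OF u]
  have "\<forall>\<^sub>F s in at t. dist (form (\<lambda>x. U s \<phi> x - U t \<phi> x)) 0 < e / 12"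
    by (rule tendstoD[OF generator_form_continuous[OF hamiltonian_in_closure[OF \<phi>(1)]] \<open>0 < e / 12\<close>])
  then show "\<forall>\<^sub>F s in at t. dist (form (\<lambda>x. U s u x - U t u x)) 0 < e"
  proof eventually_elim
    case (elim s)
    have 1: "form (\<lambda>x. U s u x - U t u x) \<le> 2 * form (\<lambda>x. U s u x - U s \<phi> x) + 2 * form (\<lambda>x. U s \<phi> x - U t u x)"
      by (rule form_triangle[OF Uu Ud Uu])
    have 2: "form (\<lambda>x. U s \<phi> x - U t u x) \<le> 2 * form (\<lambda>x. U s \<phi> x - U t \<phi> x) + 2 * form (\<lambda>x. U t \<phi> x - U t u x)"
      by (rule form_triangle[OF Ud Ud Uu])
    have 3: "form (\<lambda>x. U r \<phi> x - U r u x) < e / 12" for r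
      using U_form_approx(2)[OF u \<phi>(1), of r] \<phi>(2) by simp
    have 4: "form (\<lambda>x. U s \<phi> x - U t \<phi> x) < e / 12"
      using elim form_nonneg by (simp add: dist_real_def)
    have 5: "form (\<lambda>x. U s u x - U s \<phi> x) < e / 12"
      using 3[of s] form_minus_commute[OF Uu Ud, of s s] by simp
    have "form (\<lambda>x. U s u x - U t u x) < e"
      using 1 2 3[of t] 4 5 e by linarith
    then show ?case
      using form_nonneg by (simp add: dist_real_def)
  qed
qed

end

section \<open>Trajectories\<close>

definition current :: "('a::euclidean_space \<Rightarrow> complex) \<Rightarrow> 'a \<Rightarrow> 'a"
  where "current u x = (\<Sum>b\<in>Basis. Im (cnj (u x) * grad u b x) *\<^sub>R b)"

lemma current_measurable:
  assumes "H1_gradient u (grad u)"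
  shows "current u \<in> borel_measurable borel"
  unfolding current_def[abs_def]
proof (intro borel_measurable_sum borel_measurable_scaleR borel_measurable_const)
  fix b :: 'a assume "b \<in> Basis"
  then have "(\<lambda>x. cnj (u x) * grad u b x) \<in> borel_measurable borel"
    using H1_gradientD(1,2)[OF assms] by (intro borel_measurable_times L2_D(1) L2_cnj) auto
  then show "(\<lambda>x. Im (cnj (u x) * grad u b x)) \<in> borel_measurable borel"
    by measurable
qed

section \<open>Continuity of the current as a map into L1\<close>

lemma current_diff_le:
  "norm (current u x - current w x)
    \<le> (\<Sum>b\<in>Basis. cmod (u x - w x) * cmod (grad u b x) + cmod (w x) * cmod (grad u b x - grad w b x))"
proof -
  have e: "current u x - current w x = (\<Sum>b\<in>Basis. (Im (cnj (u x) * grad u b x) - Im (cnj (w x) * grad w b x)) *\<^sub>R b)"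
    by (simp add: current_def sum_subtractf scaleR_diff_left)
  show ?thesis
    unfolding e
  proof (rule sum_norm_le)
    fix b :: 'a assume b: "b \<in> Basis"
    have "cnj (u x) * grad u b x - cnj (w x) * grad w b x
        = cnj (u x - w x) * grad u b x + cnj (w x) * (grad u b x - grad w b x)"
      by (simp add: algebra_simps)
    then have "cmod (cnj (u x) * grad u b x - cnj (w x) * grad w b x)
        \<le> cmod (cnj (u x - w x) * grad u b x) + cmod (cnj (w x) * (grad u b x - grad w b x))"
      by (simp only: norm_triangle_ineq)
    moreover have "\<bar>Im (cnj (u x) * grad u b x) - Im (cnj (w x) * grad w b x)\<bar> \<le> cmod (cnj (u x) * grad u b x - cnj (w x) * grad w b x)"
      using abs_Im_le_cmod[of "cnj (u x) * grad u b x - cnj (w x) * grad w b x"] by (simp only: minus_complex.simps)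
    ultimately show "norm ((Im (cnj (u x) * grad u b x) - Im (cnj (w x) * grad w b x)) *\<^sub>R b)
        \<le> cmod (u x - w x) * cmod (grad u b x) + cmod (w x) * cmod (grad u b x - grad w b x)"
      using b unfolding norm_mult complex_mod_cnj by simp
  qed
qed

lemma current_L1_diff:
  assumes u: "H1_gradient u (grad u)" and w: "H1_gradient w (grad w)"
  shows "integrable lborel (\<lambda>x. current u x - current w x)"
    "(LINT x|lborel. norm (current u x - current w x))
      \<le> (\<Sum>b\<in>Basis. l2_norm (\<lambda>x. u x - w x) * l2_norm (grad u b) + l2_norm w * l2_norm (\<lambda>x. grad u b x - grad w b x))"
proof -
  note L = H1_gradientD[OF u] H1_gradientD[OF w]
  let ?g = "\<lambda>x. \<Sum>b\<in>Basis. cmod (u x - w x) * cmod (grad u b x) + cmod (w x) * cmod (grad u b x - grad w b x)"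
  have i: "integrable lborel (\<lambda>x. cmod (u x - w x) * cmod (grad u b x))"
    "integrable lborel (\<lambda>x. cmod (w x) * cmod (grad u b x - grad w b x))" if "b \<in> Basis" for b
    by (intro L2_norm_mult_integrable[of "\<lambda>x. u x - w x" "grad u b"] L2_norm_mult_integrable[of w "\<lambda>x. grad u b x - grad w b x"]
        L2_diff L that)+
  have ig: "integrable lborel ?g"
    by (intro Bochner_Integration.integrable_sum Bochner_Integration.integrable_add i)
  have m: "(\<lambda>x. current u x - current w x) \<in> borel_measurable lborel"
    unfolding measurable_lborel2 by (intro borel_measurable_diff current_measurable u w)
  have g0: "0 \<le> ?g x" for x
    by (intro sum_nonneg add_nonneg_nonneg mult_nonneg_nonneg norm_ge_zero)
  have "norm (current u x - current w x) \<le> norm (?g x)" for x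
    unfolding real_norm_def abs_of_nonneg[OF g0] by (rule current_diff_le)
  then show d: "integrable lborel (\<lambda>x. current u x - current w x)"
    by (intro Bochner_Integration.integrable_bound[OF ig m] AE_I2)
  have "(LINT x|lborel. norm (current u x - current w x)) \<le> (LINT x|lborel. ?g x)"
    by (intro integral_mono integrable_norm d ig current_diff_le)
  also have "\<dots> = (\<Sum>b\<in>Basis. (LINT x|lborel. cmod (u x - w x) * cmod (grad u b x))
      + (LINT x|lborel. cmod (w x) * cmod (grad u b x - grad w b x)))"
    using i by (simp add: Bochner_Integration.integral_sum Bochner_Integration.integral_add)
  also have "\<dots> \<le> (\<Sum>b\<in>Basis. l2_norm (\<lambda>x. u x - w x) * l2_norm (grad u b) + l2_norm w * l2_norm (\<lambda>x. grad u b x - grad w b x))"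
    by (intro sum_mono add_mono L2_cauchy_schwarz_norm L2_diff L)
  finally show "(LINT x|lborel. norm (current u x - current w x))
      \<le> (\<Sum>b\<in>Basis. l2_norm (\<lambda>x. u x - w x) * l2_norm (grad u b) + l2_norm w * l2_norm (\<lambda>x. grad u b x - grad w b x))" .
qed

lemma current_L1:
  assumes u: "H1_gradient u (grad u)"
  shows "integrable lborel (current u)"
    "(LINT x|lborel. norm (current u x)) \<le> (\<Sum>b\<in>Basis. l2_norm u * l2_norm (grad u b))"
proof -
  note L = H1_gradientD[OF u]
  let ?g = "\<lambda>x. \<Sum>b\<in>Basis. cmod (u x) * cmod (grad u b x)"
  have i: "integrable lborel (\<lambda>x. cmod (u x) * cmod (grad u b x))" if "b \<in> Basis" for b
    by (intro L2_norm_mult_integrable L that)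
  have ig: "integrable lborel ?g"
    by (intro Bochner_Integration.integrable_sum i)
  have m: "current u \<in> borel_measurable lborel"
    unfolding measurable_lborel2 by (intro current_measurable u)
  have g0: "0 \<le> ?g x" for x
    by (intro sum_nonneg mult_nonneg_nonneg norm_ge_zero)
  have le: "norm (current u x) \<le> ?g x" for x
    unfolding current_def
  proof (rule sum_norm_le)
    fix b :: 'a assume b: "b \<in> Basis"
    show "norm (Im (cnj (u x) * grad u b x) *\<^sub>R b) \<le> cmod (u x) * cmod (grad u b x)"
      using b abs_Im_le_cmod[of "cnj (u x) * grad u b x"] unfolding norm_mult complex_mod_cnj by simp
  qed
  have "norm (current u x) \<le> norm (?g x)" for x
    unfolding real_norm_def abs_of_nonneg[OF g0] by (rule le)
  then show d: "integrable lborel (current u)"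
    by (intro Bochner_Integration.integrable_bound[OF ig m] AE_I2)
  have "(LINT x|lborel. norm (current u x)) \<le> (LINT x|lborel. ?g x)"
    by (intro integral_mono integrable_norm d ig le)
  also have "\<dots> = (\<Sum>b\<in>Basis. LINT x|lborel. cmod (u x) * cmod (grad u b x))"
    using i by (simp add: Bochner_Integration.integral_sum)
  also have "\<dots> \<le> (\<Sum>b\<in>Basis. l2_norm u * l2_norm (grad u b))"
    by (intro sum_mono L2_cauchy_schwarz_norm L)
  finally show "(LINT x|lborel. norm (current u x)) \<le> (\<Sum>b\<in>Basis. l2_norm u * l2_norm (grad u b))" .
qed

text \<open>Step functions sampling at the grid points \<open>k / (n + 1)\<close> in \<open>[-n, n]\<close>; they witness strong measurability of
  continuous curves.\<close>

definition grid :: "nat \<Rightarrow> real \<Rightarrow> real"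
  where "grid n t = real_of_int \<lfloor>max (- real n) (min (real n) t) * real (Suc n)\<rfloor> / real (Suc n)"

lemma grid_simple: "simple_function lborel (grid n)"
proof (rule simple_function_borel_measurable)
  show "grid n \<in> borel_measurable lborel"
    unfolding grid_def[abs_def] by measurable
  define B where "B = int n * int (Suc n)"
  have "grid n t \<in> (\<lambda>k. real_of_int k / real (Suc n)) ` {- B .. B}" for t
  proof -
    let ?c = "max (- real n) (min (real n) t)"
    have c: "- real n \<le> ?c" "?c \<le> real n"
      by auto
    have "- real n * real (Suc n) \<le> ?c * real (Suc n)" "?c * real (Suc n) \<le> real n * real (Suc n)"
      by (intro mult_right_mono c; simp)+
    note floor_mono[OF this(1)] floor_mono[OF this(2)]
    moreover have "real n * real (Suc n) = real_of_int B" "- real n * real (Suc n) = real_of_int (- B)"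
      by (simp_all add: B_def)
    ultimately have "\<lfloor>?c * real (Suc n)\<rfloor> \<in> {- B .. B}"
      by (simp only: floor_of_int atLeastAtMost_iff)
    then show ?thesis
      unfolding grid_def by blast
  qed
  then have "range (grid n) \<subseteq> (\<lambda>k. real_of_int k / real (Suc n)) ` {- B .. B}"
    by blast
  then show "finite (grid n ` space lborel)"
    by (simp add: finite_subset)
qed

lemma grid_tendsto: "(\<lambda>n. grid n t) \<longlonglongrightarrow> t"
proof (rule LIM_zero_cancel, rule Lim_null_comparison)
  show "(\<lambda>n. inverse (real (Suc n))) \<longlonglongrightarrow> 0"
    by (rule LIMSEQ_inverse_real_of_nat)
  show "\<forall>\<^sub>F n in sequentially. norm (grid n t - t) \<le> inverse (real (Suc n))"
  proof (rule eventually_sequentiallyI)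
    fix n assume "nat \<lceil>\<bar>t\<bar>\<rceil> \<le> n"
    then have "\<bar>t\<bar> \<le> real n"
      by linarith
    then have e: "max (- real n) (min (real n) t) = t"
      by (auto simp: max_def min_def)
    have S: "0 < real (Suc n)"
      by simp
    have "\<bar>real_of_int \<lfloor>t * real (Suc n)\<rfloor> - t * real (Suc n)\<bar> \<le> 1"
      by linarith
    then have "\<bar>real_of_int \<lfloor>t * real (Suc n)\<rfloor> - t * real (Suc n)\<bar> / real (Suc n) \<le> 1 / real (Suc n)"
      using S by (intro divide_right_mono) auto
    moreover have "grid n t - t = (real_of_int \<lfloor>t * real (Suc n)\<rfloor> - t * real (Suc n)) / real (Suc n)"
      unfolding grid_def e using S by (simp add: diff_divide_distrib del: of_nat_Suc)
    ultimately show "norm (grid n t - t) \<le> inverse (real (Suc n))"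
      by (simp add: inverse_eq_divide abs_divide del: of_nat_Suc)
  qed
qed

context schroedinger_group
begin

text \<open>The density needs only \<open>L2\<close> continuity of the group, but the current
  contains the gradient: its \<open>L1\<close> continuity comes from
  \<open>U_form_continuous\<close>, and its uniform bound from
  \<open>U_form_bounded\<close>.\<close>

lemma trajectory:
  assumes v: "form_dom v"
  shows "qhd_trajectory_of V (\<lambda>t. U t v) (\<lambda>t x. (cmod (U t v x))\<^sup>2) (\<lambda>t. current (U t v))"
proof -
  note vL = form_domD(1)[OF v]
  note d = U_form_approx(1)[OF v]
  note g = form_domD(3)[OF d]
  note UL = U_L2[OF vL]
  have bes: "bounded_energy_solution V (\<lambda>t. U t v)"
    unfolding bounded_energy_solution_def
    using unitary gen vL v[unfolded form_dom_iff] UL by (intro exI[of _ U] exI[of _ v]) auto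
  have l1: "continuous_into_L1 (\<lambda>t x. (cmod (U t v x))\<^sup>2)"
    unfolding continuous_into_L1_def
  proof (intro conjI allI)
    show "integrable lborel (\<lambda>x. (cmod (U t v x))\<^sup>2)" for t
      by (rule L2_D(2)[OF UL])
    fix t
    have lim: "((\<lambda>s. l2_norm (\<lambda>x. U s v x - U t v x) * (2 * l2_norm v)) \<longlongrightarrow> 0) (at t)"
      using tendsto_mult_right[OF U_cont[OF vL, of t], of "2 * l2_norm v"] by simp
    show "((\<lambda>s. LINT x|lborel. \<bar>(cmod (U s v x))\<^sup>2 - (cmod (U t v x))\<^sup>2\<bar>) \<longlongrightarrow> 0) (at t)"
    proof (rule tendsto_0_bound[OF _ lim])
      fix s
      note Ld = L2_diff[OF UL[of s] UL[of t]]
      have le: "\<bar>(cmod (U s v x))\<^sup>2 - (cmod (U t v x))\<^sup>2\<bar>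
          \<le> cmod (U s v x - U t v x) * cmod (U s v x) + cmod (U s v x - U t v x) * cmod (U t v x)" for x
      proof -
        have "(cmod (U s v x))\<^sup>2 - (cmod (U t v x))\<^sup>2 = (cmod (U s v x) - cmod (U t v x)) * (cmod (U s v x) + cmod (U t v x))"
          by (simp add: power2_eq_square algebra_simps)
        then have "\<bar>(cmod (U s v x))\<^sup>2 - (cmod (U t v x))\<^sup>2\<bar> = \<bar>cmod (U s v x) - cmod (U t v x)\<bar> * (cmod (U s v x) + cmod (U t v x))"
          by (simp add: abs_mult)
        also have "\<dots> \<le> cmod (U s v x - U t v x) * (cmod (U s v x) + cmod (U t v x))"
          by (intro mult_right_mono norm_triangle_ineq3) auto
        finally show ?thesis
          by (simp add: distrib_left)
      qed
      note i1 = L2_norm_mult_integrable[OF Ld UL[of s]] and i2 = L2_norm_mult_integrable[OF Ld UL[of t]]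
      have "(LINT x|lborel. \<bar>(cmod (U s v x))\<^sup>2 - (cmod (U t v x))\<^sup>2\<bar>)
          \<le> (LINT x|lborel. cmod (U s v x - U t v x) * cmod (U s v x) + cmod (U s v x - U t v x) * cmod (U t v x))"
        by (intro integral_mono le Bochner_Integration.integrable_add i1 i2 integrable_abs Bochner_Integration.integrable_diff L2_D(2)[OF UL])
      also have "\<dots> = (LINT x|lborel. cmod (U s v x - U t v x) * cmod (U s v x)) + (LINT x|lborel. cmod (U s v x - U t v x) * cmod (U t v x))"
        by (rule Bochner_Integration.integral_add[OF i1 i2])
      also have "\<dots> \<le> l2_norm (\<lambda>x. U s v x - U t v x) * l2_norm v + l2_norm (\<lambda>x. U s v x - U t v x) * l2_norm v"
        using L2_cauchy_schwarz_norm[OF Ld UL[of s]] L2_cauchy_schwarz_norm[OF Ld UL[of t]] unfolding U_norm[OF vL]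
        by (rule add_mono)
      finally have "(LINT x|lborel. \<bar>(cmod (U s v x))\<^sup>2 - (cmod (U t v x))\<^sup>2\<bar>) \<le> l2_norm (\<lambda>x. U s v x - U t v x) * (2 * l2_norm v)"
        unfolding mult_2 distrib_left .
      moreover have "0 \<le> (LINT x|lborel. \<bar>(cmod (U s v x))\<^sup>2 - (cmod (U t v x))\<^sup>2\<bar>)"
        by (intro Bochner_Integration.integral_nonneg) simp
      ultimately show "norm (LINT x|lborel. \<bar>(cmod (U s v x))\<^sup>2 - (cmod (U t v x))\<^sup>2\<bar>) \<le> l2_norm (\<lambda>x. U s v x - U t v x) * (2 * l2_norm v)"
        by (simp only: real_norm_def abs_of_nonneg)
    qed
  qed
  \<comment> \<open>The \<open>L1\<close> distance of the currents at two times. Its continuity at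
    \<open>s = t\<close> serves both strong measurability and continuity into distributions.\<close>
  define D where "D t s = (LINT x|lborel. norm (current (U s v) x - current (U t v) x))" for t s
  have D: "D t \<midarrow>t\<rightarrow> 0" for t
  proof -
    have gl: "((\<lambda>s. l2_norm (\<lambda>x. grad (U s v) b x - grad (U t v) b x)) \<longlongrightarrow> 0) (at t)" if "b \<in> Basis" for b
      by (rule form_small_imp_small(2)[OF d d U_form_continuous[OF v] that])
    have gn: "((\<lambda>s. l2_norm (grad (U s v) b)) \<longlongrightarrow> l2_norm (grad (U t v) b)) (at t)" if "b \<in> Basis" for b
      by (rule l2_norm_tendsto[OF form_domD(4)[OF d that] form_domD(4)[OF d that] gl[OF that]])
    have "((\<lambda>s. \<Sum>b\<in>Basis. l2_norm (\<lambda>x. U s v x - U t v x) * l2_norm (grad (U s v) b)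
        + l2_norm (U t v) * l2_norm (\<lambda>x. grad (U s v) b x - grad (U t v) b x))
      \<longlongrightarrow> (\<Sum>b\<in>(Basis::'a set). 0 * l2_norm (grad (U t v) b) + l2_norm (U t v) * 0)) (at t)"
      by (intro tendsto_intros U_cont[OF vL] gl gn)
    then have lim: "((\<lambda>s. \<Sum>b\<in>Basis. l2_norm (\<lambda>x. U s v x - U t v x) * l2_norm (grad (U s v) b)
        + l2_norm (U t v) * l2_norm (\<lambda>x. grad (U s v) b x - grad (U t v) b x)) \<longlongrightarrow> 0) (at t)"
      by simp
    have "0 \<le> D t s" for s
      unfolding D_def by (intro Bochner_Integration.integral_nonneg) simp
    then show ?thesis
      by (intro tendsto_0_bound[OF _ lim]) (simp add: D_def current_L1_diff(2)[OF g g])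
  qed
  have Dc: "isCont (D t) t" for t
    using D[of t] by (simp add: isCont_def D_def)
  have bound: "(LINT x|lborel. norm (current (U t v) x)) \<le> (\<Sum>b\<in>(Basis::'a set). l2_norm v * sqrt (2 * form v))" for t
  proof (rule order_trans[OF current_L1(2)[OF g] sum_mono])
    fix b :: 'a assume b: "b \<in> Basis"
    have "(l2_norm (grad (U t v) b))\<^sup>2 \<le> 2 * form v"
      using l2_norm_le_form(2)[OF d b, of t] U_form_bounded[OF v, of t] by linarith
    then have "l2_norm (grad (U t v) b) \<le> sqrt (2 * form v)"
      by (rule real_le_rsqrt)
    then show "l2_norm (U t v) * l2_norm (grad (U t v) b) \<le> l2_norm v * sqrt (2 * form v)"
      unfolding U_norm[OF vL] by (rule mult_left_mono) simp
  qed
  have bl1: "bounded_into_L1 (\<lambda>t. current (U t v))"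
    unfolding bounded_into_L1_def
  proof (intro conjI)
    show "AE t in lborel. integrable lborel (current (U t v))"
      by (intro AE_I2 current_L1(1) g)
    show "\<exists>C. AE t in lborel. (LINT x|lborel. norm (current (U t v) x)) \<le> C"
      using bound by (intro exI[of _ "\<Sum>b\<in>(Basis::'a set). l2_norm v * sqrt (2 * form v)"] AE_I2)
    \<comment> \<open>A curve sampled through \<open>grid n\<close> takes finitely many values, so
      it is a simple function with values in a function space.\<close>
    define s where "s n = (\<lambda>r. current (U r v)) \<circ> grid n" for n
    have "simple_function lborel (s n)" for n
      unfolding s_def by (rule simple_function_compose[OF grid_simple])
    moreover have "integrable lborel (s n t)" for n t
      unfolding s_def o_def by (rule current_L1(1)[OF g])
    moreover have "(\<lambda>n. LINT x|lborel. norm (s n t x - current (U t v) x)) \<longlonglongrightarrow> 0" for t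
    proof -
      have "(\<lambda>n. D t (grid n t)) \<longlonglongrightarrow> D t t"
        by (rule isCont_tendsto_compose[OF Dc grid_tendsto])
      then show ?thesis
        by (simp add: D_def s_def)
    qed
    ultimately show "\<exists>s. (\<forall>n. simple_function lborel (s n) \<and> (\<forall>t. integrable lborel (s n t)))
        \<and> (AE t in lborel. (\<lambda>n. LINT x|lborel. norm (s n t x - current (U t v) x)) \<longlonglongrightarrow> 0)"
      by (intro exI[of _ s]) (simp add: AE_I2)
  qed
  have cd: "continuous_into_distributions (\<lambda>t. current (U t v))"
    unfolding continuous_into_distributions_def
  proof (intro allI impI)
    fix \<phi> :: "'a \<Rightarrow> real" assume t: "test_function \<phi>"
    obtain R where R[rule_format]: "\<forall>k. Ck k \<phi>" "0 < R" "\<forall>x. R < norm x \<longrightarrow> \<phi> x = 0"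
      by (rule test_functionE[OF t])
    obtain M where M[rule_format]: "0 < M" "\<forall>x. norm (\<phi> x) \<le> M"
      by (rule bounded_support_bounded[OF test_function_continuous[OF t] R(3)])
    have \<phi>m: "\<phi> \<in> borel_measurable borel"
      by (rule borel_measurable_continuous_onI[OF test_function_continuous[OF t]])
    have i: "integrable lborel (\<lambda>x. \<phi> x *\<^sub>R f x)" if "integrable lborel f" for f :: "'a \<Rightarrow> 'a"
    proof (rule Bochner_Integration.integrable_bound)
      show "integrable lborel (\<lambda>x. M *\<^sub>R f x)"
        by (intro integrable_scaleR_right that)
      show "(\<lambda>x. \<phi> x *\<^sub>R f x) \<in> borel_measurable lborel"
        using \<phi>m borel_measurable_integrable[OF that] by simp
      have "norm (\<phi> x *\<^sub>R f x) \<le> norm (M *\<^sub>R f x)" for x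
        using M(2)[of x] M(1) by (simp add: mult_right_mono)
      then show "AE x in lborel. norm (\<phi> x *\<^sub>R f x) \<le> norm (M *\<^sub>R f x)"
        by (intro AE_I2)
    qed
    note j = current_L1(1)[OF g]
    have "(\<lambda>s. LINT x|lborel. \<phi> x *\<^sub>R current (U s v) x) \<midarrow>t\<rightarrow> (LINT x|lborel. \<phi> x *\<^sub>R current (U t v) x)" for t
    proof (rule LIM_zero_cancel, rule tendsto_0_bound)
      show "((\<lambda>s. M * D t s) \<longlongrightarrow> 0) (at t)"
        using tendsto_mult_left[OF D[of t], of M] by simp
      fix s
      have "(LINT x|lborel. \<phi> x *\<^sub>R current (U s v) x) - (LINT x|lborel. \<phi> x *\<^sub>R current (U t v) x)
          = (LINT x|lborel. \<phi> x *\<^sub>R (current (U s v) x - current (U t v) x))"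
        using i[OF j[of s]] i[OF j[of t]] by (simp add: scaleR_diff_right)
      also have "norm \<dots> \<le> (LINT x|lborel. M * norm (current (U s v) x - current (U t v) x))"
      proof (rule order_trans[OF integral_norm_bound integral_mono])
        show "integrable lborel (\<lambda>x. norm (\<phi> x *\<^sub>R (current (U s v) x - current (U t v) x)))"
          by (intro integrable_norm i current_L1_diff(1) g)
        show "integrable lborel (\<lambda>x. M * norm (current (U s v) x - current (U t v) x))"
          by (intro integrable_mult_right integrable_norm current_L1_diff(1) g)
        show "norm (\<phi> x *\<^sub>R (current (U s v) x - current (U t v) x)) \<le> M * norm (current (U s v) x - current (U t v) x)" for x
          using M(2)[of x] by (simp add: mult_right_mono)
      qed
      finally show "norm ((LINT x|lborel. \<phi> x *\<^sub>R current (U s v) x) - (LINT x|lborel. \<phi> x *\<^sub>R current (U t v) x)) \<le> M * D t s"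
        by (simp add: D_def)
    qed
    then have "continuous_on UNIV (\<lambda>t. LINT x|lborel. \<phi> x *\<^sub>R current (U t v) x)"
      by (simp add: continuous_on_eq_continuous_at isCont_def)
    then show "(\<forall>t. integrable lborel (\<lambda>x. \<phi> x *\<^sub>R current (U t v) x)) \<and> continuous_on UNIV (\<lambda>t. LINT x|lborel. \<phi> x *\<^sub>R current (U t v) x)"
      using i[OF j] by blast
  qed
  have "is_current (U t v) (current (U t v))" for t
    unfolding is_current_def using current_measurable[OF g] g
    by (intro conjI exI[of _ "grad (U t v)"]) (simp_all add: current_def)
  then show ?thesis
    unfolding qhd_trajectory_of_def using bes l1 bl1 cd by simp
qed

text \<open>Unitarity gives \<open>l2_inner \<eta> (U (t + h) u) = l2_inner (U (- h) \<eta>) (U t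
  u)\<close>, so the difference quotient falls on \<open>\<eta>\<close>, which lies in the domain of
  the generator; \<open>u\<close> may be any element of \<open>L2\<close>.\<close>

lemma test_inner_has_vector_derivative:
  assumes \<eta>: "test_function \<eta>" and u: "u \<in> L2"
  shows "((\<lambda>t. l2_inner \<eta> (U t u)) has_vector_derivative - \<i> * l2_inner (ham \<eta>) (U t u)) (at t)"
  unfolding has_vector_derivative_def has_derivative_at
proof (intro conjI)
  show "bounded_linear (\<lambda>x. x *\<^sub>R (- \<i> * l2_inner (ham \<eta>) (U t u)))"
    by (rule bounded_linear_scaleR_left)
  let ?g = "U t u"
  define N where "N s = l2_norm (\<lambda>x. \<i> * ((U s \<eta> x - \<eta> x) / complex_of_real s) - ham \<eta> x)" for s
  note \<eta>L = test_function_L2[OF \<eta>] and hL = ham_L2[OF \<eta>]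
  have gL: "?g \<in> L2"
    by (rule U_L2[OF u])
  have "(N \<longlongrightarrow> 0) (at 0)"
    unfolding N_def by (rule generator_D(3)[OF hamiltonian_in_closure[OF \<eta>]])
  \<comment> \<open>The increment \<open>h\<close> of time becomes \<open>- h\<close> on the test
    function, so the limit defining the generator is reflected.\<close>
  then have "(N \<longlongrightarrow> 0) (filtermap uminus (at 0))"
    using filtermap_at_minus[of "0::real"] by simp
  then have "((\<lambda>h. N (- h)) \<longlongrightarrow> 0) (at 0)"
    by (simp only: filterlim_filtermap)
  then have lim: "((\<lambda>h. N (- h) * l2_norm ?g) \<longlongrightarrow> 0) (at 0)"
    using tendsto_mult_left_zero by blast
  show "(\<lambda>h. norm (l2_inner \<eta> (U (t + h) u) - l2_inner \<eta> ?g - h *\<^sub>R (- \<i> * l2_inner (ham \<eta>) ?g)) / norm h) \<midarrow>0\<rightarrow> 0"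
  proof (rule tendsto_0_bound[OF _ lim])
    fix h :: real
    show "norm (norm (l2_inner \<eta> (U (t + h) u) - l2_inner \<eta> ?g - h *\<^sub>R (- \<i> * l2_inner (ham \<eta>) ?g)) / norm h) \<le> N (- h) * l2_norm ?g"
    proof (cases "h = 0")
      case True
      then show ?thesis
        by (simp add: N_def)
    next
      case False
      have "l2_inner \<eta> (U (t + h) u) = l2_inner (U (- h) \<eta>) (U (- h) (U (t + h) u))"
        by (rule U_inner[OF \<eta>L U_L2[OF u], symmetric])
      also have "\<dots> = l2_inner (U (- h) \<eta>) ?g"
      proof (rule l2_inner_cong_AE)
        show "AE x in lborel. U (- h) (U (t + h) u) x = U t u x"
          using U_add[OF u, of "- h" "t + h"] by eventually_elim simp
      qed (intro U_measurable \<eta>L U_L2 u | simp)+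
      finally have e: "l2_inner \<eta> (U (t + h) u) - l2_inner \<eta> ?g = l2_inner (\<lambda>x. U (- h) \<eta> x - \<eta> x) ?g"
        using l2_inner_diff_left[OF U_L2[OF \<eta>L] \<eta>L gL] by simp
      define q where "q x = \<i> * ((U (- h) \<eta> x - \<eta> x) / complex_of_real (- h)) - ham \<eta> x" for x
      have qL: "q \<in> L2"
      proof -
        have "(\<lambda>x. (\<i> / complex_of_real (- h)) * (U (- h) \<eta> x - \<eta> x) - ham \<eta> x) \<in> L2"
          by (intro L2_diff L2_cmult U_L2 \<eta>L hL)
        then show ?thesis
          by (simp add: q_def[abs_def])
      qed
      have "U (- h) \<eta> x - \<eta> x = (\<i> * complex_of_real h) * (q x + ham \<eta> x)" for x
        using False by (simp add: q_def field_simps)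
      then have "l2_inner (\<lambda>x. U (- h) \<eta> x - \<eta> x) ?g = (LINT x|lborel. (- \<i> * complex_of_real h) * (cnj (q x) * ?g x) + (- \<i> * complex_of_real h) * (cnj (ham \<eta> x) * ?g x))"
        by (simp add: l2_inner_def algebra_simps)
      also have "\<dots> = (- \<i> * complex_of_real h) * l2_inner q ?g + (- \<i> * complex_of_real h) * l2_inner (ham \<eta>) ?g"
        using L2_mult_integrable[OF L2_cnj[OF qL] gL] L2_mult_integrable[OF L2_cnj[OF hL] gL]
        by (simp add: l2_inner_def)
      finally have "l2_inner \<eta> (U (t + h) u) - l2_inner \<eta> ?g - h *\<^sub>R (- \<i> * l2_inner (ham \<eta>) ?g) = (- \<i> * complex_of_real h) * l2_inner q ?g"
        unfolding e by (simp add: scaleR_conv_of_real)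
      then have "norm (norm (l2_inner \<eta> (U (t + h) u) - l2_inner \<eta> ?g - h *\<^sub>R (- \<i> * l2_inner (ham \<eta>) ?g)) / norm h) = cmod (l2_inner q ?g)"
        using False by (simp add: norm_mult)
      also have "\<dots> \<le> l2_norm q * l2_norm ?g"
        by (rule l2_inner_bound[OF qL gL])
      finally show ?thesis
        by (simp add: N_def q_def[abs_def])
    qed
  qed
qed

end

section \<open>Rigidity on the components of the space-time support\<close>

text \<open>Nonempty open sets are not null. This turns almost everywhere identities into equalities
  between constants.\<close>

lemma AE_ex_open:
  fixes S :: "'a::euclidean_space set"
  assumes "open S" "S \<noteq> {}" "AE x in lborel. Q x"
  shows "\<exists>x\<in>S. Q x"
proof (rule ccontr)
  assume neg: "\<not> ?thesis"
  have "AE x in lborel. x \<notin> S"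
    using assms(3) by eventually_elim (use neg in blast)
  then have "S \<in> null_sets lborel"
    using AE_iff_null_sets[of S lborel] assms(1) by simp
  then have "negligible S"
    by (simp add: negligible_iff_null_sets null_sets_completionI)
  then show False
    using open_not_negligible assms(1,2) by blast
qed

lemma integral_mollifier_reflect:
  assumes r: "0 < r"
  shows "integrable lborel (\<lambda>y. mollifier r (c - y :: 'a::euclidean_space))"
    "(LINT y|lborel. mollifier r (c - y :: 'a)) = 1"
proof -
  have m: "(\<lambda>y::'a. complex_of_real (mollifier r y)) \<in> borel_measurable borel"
    by measurable
  have "(\<lambda>y::'a. mollifier r y) \<in> borel_measurable borel"
    by measurable
  then show "integrable lborel (\<lambda>y::'a. mollifier r (c - y))"
    using integrable_distr_eq[of "\<lambda>y. c - y" lborel borel "mollifier r :: 'a \<Rightarrow> real"] mollifier_integrable[OF r, where 'a = 'a]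
    by (simp add: lborel_distr_reflect)
  have "complex_of_real (LINT y|lborel. mollifier r (c - y :: 'a)) = complex_of_real 1"
    using integral_reflect_translate[OF m, of c] mollifier_integral[OF r, where 'a = 'a] by simp
  then show "(LINT y|lborel. mollifier r (c - y :: 'a)) = 1"
    by (simp only: of_real_eq_iff)
qed

lemma laplacian_zero_open:
  fixes f :: "'a::euclidean_space \<Rightarrow> complex"
  assumes "open S" "x \<in> S" "\<And>y. y \<in> S \<Longrightarrow> f y = 0"
  shows "laplacian f x = 0"
proof -
  have "partial b f y = 0" if "y \<in> S" for b y
    by (rule partial_zero_open[OF assms(1) that assms(3)])
  then have "partial b (partial b f) x = 0" for b
    by (rule partial_zero_open[OF assms(1,2)])
  then show ?thesis
    by (simp add: laplacian_def)
qed

context schroedinger_group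
begin

text \<open>Testing with a bump \<open>\<eta>\<close>, the functions \<open>n(t) = \<langle>\<eta>, U t v\<rangle>\<close> and \<open>m(t) = \<langle>\<eta>, U t u\<rangle>\<close> satisfy \<open>n = \<theta> m\<close> and,
  since the Hamiltonian is local, \<open>n' = \<theta> m'\<close>; hence the spatially constant ratio \<open>\<theta>\<close> has zero time derivative.\<close>

lemma locally_constant_ratio:
  assumes u: "u \<in> L2" and v: "form_dom v"
    and \<psi>: "\<And>t. AE x in lborel. \<psi> t x = U t u x" and G: "\<And>t. H1_gradient (\<psi> t) (G t)"
    and cont: "continuous_on UNIV (\<lambda>(x, t). \<psi> t x)"
    and dens: "\<And>t. AE x in lborel. cmod (U t v x) = cmod (\<psi> t x)"
    and cur: "\<And>t b. b \<in> Basis \<Longrightarrow> AE x in lborel. Im (cnj (U t v x) * grad (U t v) b x) = Im (cnj (\<psi> t x) * G t b x)"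
    and nz: "\<psi> t0 x0 \<noteq> 0"
  shows "\<exists>k. \<exists>r>0. \<exists>\<tau>>0. \<forall>t\<in>ball t0 \<tau>. AE x in lborel. x \<in> ball x0 r \<longrightarrow> U t v x = k * \<psi> t x"
proof -
  note vL = form_domD(1)[OF v]
  have \<psi>L: "\<psi> t \<in> L2" for t
    by (rule H1_gradientD(1)[OF G])
  have \<psi>c: "continuous_on UNIV (\<psi> t)" for t
  proof -
    have "continuous_on UNIV (\<lambda>x. (\<lambda>(x, t). \<psi> t x) (x, t))"
      by (rule continuous_on_compose2[OF cont]) (auto intro!: continuous_intros)
    then show ?thesis
      by simp
  qed
  define z0 where "z0 = \<psi> t0 x0"
  define \<delta> where "\<delta> = (cmod z0)\<^sup>2 / 2"
  have \<delta>: "0 < \<delta>"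
    using nz by (simp add: \<delta>_def z0_def)
  \<comment> \<open>A half-plane condition instead of a lower bound for the modulus: it survives
    averaging with a nonnegative kernel, so the pairing \<open>m\<close> below cannot vanish by
    cancellation.\<close>
  define S where "S = {p. \<delta> < Re (cnj z0 * (\<lambda>(x, t). \<psi> t x) p)}"
  have "open S"
    unfolding S_def by (intro open_Collect_less continuous_intros cont)
  moreover have "(x0, t0) \<in> S"
  proof -
    have "Re (cnj z0 * z0) = (cmod z0)\<^sup>2"
      unfolding cmod_power2 by (simp add: power2_eq_square)
    moreover have "\<delta> < (cmod z0)\<^sup>2"
      using \<delta> by (simp add: \<delta>_def)
    ultimately have "\<delta> < Re (cnj z0 * \<psi> t0 x0)"
      unfolding z0_def[symmetric] by (rule ssubst)
    then show ?thesis
      unfolding S_def by (simp only: mem_Collect_eq prod.case)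
  qed
  ultimately obtain A B where AB: "open A" "open B" "x0 \<in> A" "t0 \<in> B" "A \<times> B \<subseteq> S"
    by (auto elim!: open_prod_elim)
  obtain r where r: "0 < r" "cball x0 r \<subseteq> A"
    using AB(1,3) open_contains_cball by blast
  obtain \<tau> where \<tau>: "0 < \<tau>" "ball t0 \<tau> \<subseteq> B"
    using AB(2,4) open_contains_ball by blast
  have pos: "\<delta> < Re (cnj z0 * \<psi> t x)" if "x \<in> cball x0 r" "t \<in> ball t0 \<tau>" for x t
  proof -
    have "(x, t) \<in> A \<times> B"
      using that r(2) \<tau>(2) by (intro SigmaI subsetD[OF r(2)] subsetD[OF \<tau>(2)])
    then have "(x, t) \<in> S"
      by (rule subsetD[OF AB(5)])
    then show ?thesis
      unfolding S_def by (simp only: mem_Collect_eq prod.case)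
  qed
  have "\<exists>k. AE x in lborel. x \<in> ball x0 (r / 2) \<longrightarrow> U t v x = k * \<psi> t x" if t: "t \<in> ball t0 \<tau>" for t
  proof (rule same_density_current_ratio[OF G form_domD(3)[OF U_form_approx(1)[OF v]] \<psi>c dens cur r(1)])
    show "\<psi> t x \<noteq> 0" if "x \<in> cball x0 r" for x
      using pos[OF that t] \<delta> by auto
  qed
  then have "\<forall>t\<in>ball t0 \<tau>. \<exists>k. AE x in lborel. x \<in> ball x0 (r / 2) \<longrightarrow> U t v x = k * \<psi> t x"
    by blast
  from bchoice[OF this] obtain \<theta> where \<theta>: "\<And>t. t \<in> ball t0 \<tau> \<Longrightarrow> AE x in lborel. x \<in> ball x0 (r / 2) \<longrightarrow> U t v x = \<theta> t * \<psi> t x"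
    by blast
  \<comment> \<open>The radius \<open>r / 3\<close> leaves a margin: the closed support lies in the
    open ball of radius \<open>r / 2\<close> on which the ratio is constant, and so does that of
    \<open>ham \<eta>\<close>.\<close>
  define \<eta> where "\<eta> y = complex_of_real (mollifier (r / 3) (x0 - y))" for y
  have r3: "0 < r / 3"
    using r(1) by simp
  have \<eta>: "test_function \<eta>"
    unfolding \<eta>_def[abs_def] by (rule test_function_mollifier_reflect(1)[OF r3])
  have \<eta>0: "\<eta> y = 0" if "y \<notin> ball x0 (r / 3)" for y
    using test_function_mollifier_reflect(2)[OF r3, of x0 y] that unfolding \<eta>_def by blast
  have sub: "ball x0 (r / 3) \<subseteq> ball x0 (r / 2)" "cball x0 (r / 3) \<subseteq> ball x0 (r / 2)"
    using r(1) by auto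
  have h0: "ham \<eta> y = 0" if "y \<notin> ball x0 (r / 2)" for y
  proof -
    have y: "y \<in> - cball x0 (r / 3)"
      using that sub(2) by blast
    have z: "\<eta> x = 0" if "x \<in> - cball x0 (r / 3)" for x
      using that \<eta>0 ball_subset_cball[of x0 "r / 3"] by blast
    show ?thesis
      using laplacian_zero_open[where f=\<eta>, OF _ y z] z[OF y] by (simp add: ham_def open_Compl)
  qed
  note \<eta>L = test_function_L2[OF \<eta>] and hL = ham_L2[OF \<eta>]
  \<comment> \<open>Used for \<open>w = \<eta>\<close> and for \<open>w = ham \<eta>\<close>; the
    second use is where locality of the Hamiltonian enters.\<close>
  have ratio: "l2_inner w (U t v) = \<theta> t * l2_inner w (U t u)"
    if w: "w \<in> L2" "\<And>y. y \<notin> ball x0 (r / 2) \<Longrightarrow> w y = 0" and t: "t \<in> ball t0 \<tau>" for w t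
  proof -
    have "l2_inner w (U t v) = (LINT x|lborel. \<theta> t * (cnj (w x) * U t u x))"
      unfolding l2_inner_def
    proof (rule integral_cong_AE)
      show "AE x in lborel. cnj (w x) * U t v x = \<theta> t * (cnj (w x) * U t u x)"
        using \<theta>[OF t] \<psi>[of t]
      proof eventually_elim
        case (elim x)
        then show ?case
          using w(2)[of x] by (cases "x \<in> ball x0 (r / 2)") auto
      qed
    qed (unfold measurable_lborel2, (intro borel_measurable_times borel_measurable_const L2_D(1)[OF L2_cnj[OF w(1)]] U_measurable vL u)+)
    then show ?thesis
      by (simp add: l2_inner_def)
  qed
  define m where "m t = l2_inner \<eta> (U t u)" for t
  define n where "n t = l2_inner \<eta> (U t v)" for t
  have m0: "m t \<noteq> 0" if t: "t \<in> ball t0 \<tau>" for t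
  proof -
    have "m t = l2_inner \<eta> (\<psi> t)"
      unfolding m_def by (rule l2_inner_cong_AE[OF _ _ _ _ _ AE_mp[OF \<psi>[of t]]])
        (auto intro: L2_D(1) \<eta>L \<psi>L U_L2[OF u])
    then have "cnj z0 * m t = (LINT x|lborel. cnj z0 * (\<eta> x * \<psi> t x))"
      by (simp add: l2_inner_def \<eta>_def)
    moreover have i: "integrable lborel (\<lambda>x. cnj z0 * (\<eta> x * \<psi> t x))"
      by (intro integrable_mult_right L2_mult_integrable \<eta>L \<psi>L)
    ultimately have "Re (cnj z0 * m t) = (LINT x|lborel. Re (cnj z0 * (\<eta> x * \<psi> t x)))"
      by (simp only: integral_Re)
    also have "\<dots> \<ge> (LINT x|lborel. mollifier (r / 3) (x0 - x) * \<delta>)"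
    proof (rule integral_mono)
      show "integrable lborel (\<lambda>x. mollifier (r / 3) (x0 - x) * \<delta>)"
        by (intro integrable_mult_left integral_mollifier_reflect(1) r3)
      show "integrable lborel (\<lambda>x. Re (cnj z0 * (\<eta> x * \<psi> t x)))"
        by (intro integrable_Re i)
      fix x
      have e: "Re (cnj z0 * (\<eta> x * \<psi> t x)) = mollifier (r / 3) (x0 - x) * Re (cnj z0 * \<psi> t x)"
        by (simp add: \<eta>_def algebra_simps)
      show "mollifier (r / 3) (x0 - x) * \<delta> \<le> Re (cnj z0 * (\<eta> x * \<psi> t x))"
      proof (cases "x \<in> ball x0 (r / 3)")
        case True
        then have "x \<in> cball x0 r"
          using r(1) by simp
        then show ?thesis
          unfolding e using pos[OF _ t] by (intro mult_left_mono mollifier_nonneg) (auto intro: less_imp_le)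
      next
        case False
        then have "mollifier (r / 3) (x0 - x) = 0"
          using \<eta>0[OF False] by (simp add: \<eta>_def)
        then show ?thesis
          unfolding e by simp
      qed
    qed
    finally have "\<delta> \<le> Re (cnj z0 * m t)"
      using integral_mollifier_reflect[OF r3, of x0] by simp
    then show ?thesis
      using \<delta> by auto
  qed
  \<comment> \<open>The \<open>\<theta> t\<close> were chosen separately for each time; this formula
    makes them a quotient of differentiable functions.\<close>
  have \<theta>_eq: "\<theta> t = n t / m t" if t: "t \<in> ball t0 \<tau>" for t
  proof -
    have "l2_inner \<eta> (U t v) = \<theta> t * l2_inner \<eta> (U t u)"
      by (rule ratio[OF \<eta>L \<eta>0 t]) (use sub(1) in blast)
    then show ?thesis
      using m0[OF t] by (simp add: n_def m_def)
  qed
  have "((\<lambda>t. n t / m t) has_derivative (\<lambda>h. 0)) (at t within ball t0 \<tau>)" if t: "t \<in> ball t0 \<tau>" for t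
  proof -
    have dn: "(n has_derivative (\<lambda>h. h *\<^sub>R (- \<i> * l2_inner (ham \<eta>) (U t v)))) (at t)"
      using test_inner_has_vector_derivative[OF \<eta> vL, of t] by (simp add: n_def[abs_def] has_vector_derivative_def)
    have dm: "(m has_derivative (\<lambda>h. h *\<^sub>R (- \<i> * l2_inner (ham \<eta>) (U t u)))) (at t)"
      using test_inner_has_vector_derivative[OF \<eta> u, of t] by (simp add: m_def[abs_def] has_vector_derivative_def)
    have "n t = \<theta> t * m t"
      using \<theta>_eq[OF t] m0[OF t] by simp
    moreover have "l2_inner (ham \<eta>) (U t v) = \<theta> t * l2_inner (ham \<eta>) (U t u)"
      by (rule ratio[OF hL h0 t])
    ultimately have z: "(\<lambda>h. (h *\<^sub>R (- \<i> * l2_inner (ham \<eta>) (U t v)) * m t - n t * h *\<^sub>R (- \<i> * l2_inner (ham \<eta>) (U t u))) / (m t * m t)) = (\<lambda>h. 0)"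
      by (simp add: fun_eq_iff scaleR_conv_of_real)
    have "((\<lambda>t. n t / m t) has_derivative (\<lambda>h. (h *\<^sub>R (- \<i> * l2_inner (ham \<eta>) (U t v)) * m t - n t * h *\<^sub>R (- \<i> * l2_inner (ham \<eta>) (U t u))) / (m t * m t))) (at t)"
      by (rule has_derivative_divide'[OF dn dm m0[OF t]])
    then show ?thesis
      unfolding z by (rule has_derivative_at_withinI)
  qed
  from has_derivative_zero_constant[OF convex_ball this] obtain k where k: "\<And>t. t \<in> ball t0 \<tau> \<Longrightarrow> n t / m t = k"
    by blast
  have "AE x in lborel. x \<in> ball x0 (r / 2) \<longrightarrow> U t v x = k * \<psi> t x" if "t \<in> ball t0 \<tau>" for t
    using \<theta>[OF that] \<theta>_eq[OF that] k[OF that] by simp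
  then show ?thesis
    using r(1) \<tau>(1) by (intro exI[of _ k] exI[of _ "r / 2"] conjI exI[of _ \<tau>]) auto
qed

text \<open>The local constants are uniquely determined because \<open>\<psi>\<close> does not
  vanish near a point of \<open>K\<close>, so they form a locally constant function on
  \<open>K\<close>, which is constant by connectedness.\<close>

lemma constant_ratio_on_connected:
  assumes u: "u \<in> L2" and v: "form_dom v"
    and \<psi>: "\<And>t. AE x in lborel. \<psi> t x = U t u x" and G: "\<And>t. H1_gradient (\<psi> t) (G t)"
    and cont: "continuous_on UNIV (\<lambda>(x, t). \<psi> t x)"
    and dens: "\<And>t. AE x in lborel. cmod (U t v x) = cmod (\<psi> t x)"
    and cur: "\<And>t b. b \<in> Basis \<Longrightarrow> AE x in lborel. Im (cnj (U t v x) * grad (U t v) b x) = Im (cnj (\<psi> t x) * G t b x)"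
    and K: "connected K" "\<And>x t. (x, t) \<in> K \<Longrightarrow> \<psi> t x \<noteq> 0"
  shows "\<exists>k. \<forall>(x0, t0)\<in>K. \<exists>r>0. AE x in lborel. x \<in> ball x0 r \<longrightarrow> U t0 v x = k * \<psi> t0 x"
proof -
  \<comment> \<open>One \<open>k\<close> must serve a whole space-time neighbourhood, so that the
    property is inherited by all nearby points with smaller radii.\<close>
  define P where "P p k \<longleftrightarrow> (\<exists>r>0. \<exists>\<tau>>0. \<forall>t\<in>ball (snd p) \<tau>. AE x in lborel. x \<in> ball (fst p) r \<longrightarrow> U t v x = k * \<psi> t x)"
    for p :: "'a \<times> real" and k
  have ex: "\<exists>k. P p k" if "p \<in> K" for p
    using locally_constant_ratio[OF u v \<psi> G cont dens cur, of "snd p" "fst p"] K(2)[of "fst p" "snd p"] that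
    by (simp add: P_def)
  have \<psi>c: "continuous_on UNIV (\<psi> t)" for t
  proof -
    have "continuous_on UNIV (\<lambda>x. (\<lambda>(x, t). \<psi> t x) (x, t))"
      by (rule continuous_on_compose2[OF cont]) (auto intro!: continuous_intros)
    then show ?thesis
      by simp
  qed
  have unique: "k = k'" if p: "p \<in> K" and k: "P p k" "P p k'" for p k k'
  proof -
    obtain r where r: "0 < r" "AE x in lborel. x \<in> ball (fst p) r \<longrightarrow> U (snd p) v x = k * \<psi> (snd p) x"
      using k(1) unfolding P_def by (metis centre_in_ball)
    obtain r' where r': "0 < r'" "AE x in lborel. x \<in> ball (fst p) r' \<longrightarrow> U (snd p) v x = k' * \<psi> (snd p) x"
      using k(2) unfolding P_def by (metis centre_in_ball)
    define S where "S = ball (fst p) r \<inter> ball (fst p) r' \<inter> {x. \<psi> (snd p) x \<noteq> 0}"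
    have "open S"
      unfolding S_def by (intro open_Int open_ball open_Collect_neq \<psi>c continuous_on_const)
    moreover have "fst p \<in> S"
      using K(2)[of "fst p" "snd p"] p r(1) r'(1) by (simp add: S_def)
    moreover have "AE x in lborel. x \<in> S \<longrightarrow> k = k'"
      using r(2) r'(2) by eventually_elim (auto simp: S_def)
    ultimately show ?thesis
      using AE_ex_open[of S "\<lambda>x. x \<in> S \<longrightarrow> k = k'"] by blast
  qed
  have local: "\<forall>\<^sub>F q in at p within K. P q k" if k: "P p k" for p k
  proof -
    obtain r \<tau> where r: "0 < r" "0 < \<tau>" "\<And>t. t \<in> ball (snd p) \<tau> \<Longrightarrow> AE x in lborel. x \<in> ball (fst p) r \<longrightarrow> U t v x = k * \<psi> t x"
      using k unfolding P_def by blast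
    define N where "N = ball (fst p) (r / 2) \<times> ball (snd p) (\<tau> / 2)"
    have "open N" "p \<in> N"
      using r(1,2) by (auto simp: N_def mem_Times_iff intro!: open_Times)
    then have "\<forall>\<^sub>F q in at p within K. q \<in> N"
      by (auto simp: eventually_at_topological)
    then show ?thesis
    proof eventually_elim
      case (elim q)
      have b1: "x \<in> ball (fst p) r" if "x \<in> ball (fst q) (r / 2)" for x
        using that elim dist_triangle[of "fst p" x "fst q"] by (auto simp: N_def mem_Times_iff)
      have b2: "t \<in> ball (snd p) \<tau>" if "t \<in> ball (snd q) (\<tau> / 2)" for t
        using that elim dist_triangle[of "snd p" t "snd q"] by (auto simp: N_def mem_Times_iff)
      have "AE x in lborel. x \<in> ball (fst q) (r / 2) \<longrightarrow> U t v x = k * \<psi> t x" if "t \<in> ball (snd q) (\<tau> / 2)" for t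
        using r(3)[OF b2[OF that]] by eventually_elim (use b1 in blast)
      then show ?case
        unfolding P_def using r(1,2) by (intro exI[of _ "r / 2"] conjI exI[of _ "\<tau> / 2"]) auto
    qed
  qed
  define \<kappa> where "\<kappa> p = (SOME k. P p k)" for p
  have \<kappa>: "P p (\<kappa> p)" if "p \<in> K" for p
    unfolding \<kappa>_def by (rule someI_ex[OF ex[OF that]])
  have loc: "\<forall>\<^sub>F q in at p within K. \<kappa> p = \<kappa> q" if p: "p \<in> K" for p
  proof -
    have "\<forall>\<^sub>F q in at p within K. q \<in> K"
      by (simp add: eventually_at_filter)
    with local[OF \<kappa>[OF p]] show ?thesis
    proof eventually_elim
      case (elim q)
      then show ?case
        using unique[OF elim(2) elim(1) \<kappa>[OF elim(2)]] by simp
    qed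
  qed
  show ?thesis
  proof (cases "K = {}")
    case False
    then obtain p0 where p0: "p0 \<in> K"
      by blast
    have c: "\<kappa> p = \<kappa> p0" if "p \<in> K" for p
      using connected_local_const[OF K(1) that p0] loc by blast
    have "\<exists>r>0. AE x in lborel. x \<in> ball (fst p) r \<longrightarrow> U (snd p) v x = \<kappa> p0 * \<psi> (snd p) x" if p: "p \<in> K" for p
    proof -
      obtain r \<tau> where "0 < r" "0 < \<tau>" "\<forall>t\<in>ball (snd p) \<tau>. AE x in lborel. x \<in> ball (fst p) r \<longrightarrow> U t v x = \<kappa> p * \<psi> t x"
        using \<kappa>[OF p] unfolding P_def by blast
      then show ?thesis
        using c[OF p] by (intro exI[of _ r]) auto
    qed
    then show ?thesis
      by (intro exI[of _ "\<kappa> p0"]) fastforce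
  qed simp
qed

end

text \<open>The time slice \<open>C \<times> {T}\<close> of a component is connected and thus lies
  in one component of \<open>\<Omega>\<close>. This assignment cannot be injective, by the
  pigeonhole principle.\<close>

lemma components_merge:
  fixes \<Omega> :: "('a::euclidean_space \<times> real) set"
  assumes "finite (components \<Omega>)" "finite (components \<Lambda>) \<Longrightarrow> card (components \<Omega>) < card (components \<Lambda>)"
    and sub: "\<And>x. x \<in> \<Lambda> \<Longrightarrow> (x, T) \<in> \<Omega>"
  obtains C C' K where "C \<in> components \<Lambda>" "C' \<in> components \<Lambda>" "C \<noteq> C'" "K \<in> components \<Omega>"
    "C \<times> {T} \<subseteq> K" "C' \<times> {T} \<subseteq> K"
proof -
  have "\<exists>K. K \<in> components \<Omega> \<and> C \<times> {T} \<subseteq> K" if C: "C \<in> components \<Lambda>" for C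
  proof -
    have "C \<times> {T} \<subseteq> \<Omega>"
      using sub in_components_subset[OF C] by blast
    moreover have "connected (C \<times> {T})"
      by (intro connected_Times in_components_connected[OF C]) simp
    moreover have "C \<times> {T} \<noteq> {}"
      using in_components_nonempty[OF C] by simp
    ultimately show ?thesis
      using exists_component_superset[of "C \<times> {T}" \<Omega>] by blast
  qed
  then have "\<forall>C\<in>components \<Lambda>. \<exists>K. K \<in> components \<Omega> \<and> C \<times> {T} \<subseteq> K"
    by blast
  from bchoice[OF this] obtain f where f: "\<And>C. C \<in> components \<Lambda> \<Longrightarrow> f C \<in> components \<Omega>"
    "\<And>C. C \<in> components \<Lambda> \<Longrightarrow> C \<times> {T} \<subseteq> f C"
    by blast
  have "\<not> inj_on f (components \<Lambda>)"
  proof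
    assume i: "inj_on f (components \<Lambda>)"
    have s: "f ` components \<Lambda> \<subseteq> components \<Omega>"
      using f(1) by blast
    \<comment> \<open>Injectivity into a finite set excludes infinitely many components, and the
      conditional cardinality bound becomes available.\<close>
    have "finite (components \<Lambda>)"
      by (rule inj_on_finite[OF i s assms(1)])
    with assms(2) card_inj_on_le[OF i s assms(1)] show False
      by simp
  qed
  then obtain C C' where "C \<in> components \<Lambda>" "C' \<in> components \<Lambda>" "f C = f C'" "C \<noteq> C'"
    by (auto simp: inj_on_def)
  then show thesis
    using that[of C C' "f C"] f by metis
qed

text \<open>The inequality of the two numbers is encoded by finiteness of the components of
  \<open>\<Omega>\<close> and a cardinality bound conditional on finiteness of those of
  \<open>\<Lambda>\<close>, so infinitely many of the latter are allowed. The density is fixed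
  pointwise, since both sets depend on its values and not on its class.\<close>

theorem proposition4:
  fixes V :: "'a::euclidean_space \<Rightarrow> real"
    and \<psi> :: "real \<Rightarrow> 'a \<Rightarrow> complex"
    and \<rho> :: "real \<Rightarrow> 'a \<Rightarrow> real"
    and J :: "real \<Rightarrow> 'a \<Rightarrow> 'a"
    and T :: real
    and \<Omega> :: "('a \<times> real) set"
    and \<Lambda> :: "'a set"
  assumes "C11_loc V"
    and "bdd_below (range V)"
    and "essentially_self_adjoint (hamiltonian V)"
    and "qhd_trajectory_of V \<psi> \<rho> J"
    and "continuous_on UNIV (\<lambda>(x, t). \<psi> t x)"
    and "\<And>t x. \<rho> t x = (cmod (\<psi> t x))\<^sup>2"
    and "\<Omega> = {(x, t). \<rho> t x \<noteq> 0}"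
    and "\<Lambda> = {x. \<rho> T x \<noteq> 0}"
    and "finite (components \<Omega>)"
    and "finite (components \<Lambda>) \<Longrightarrow> card (components \<Omega>) < card (components \<Lambda>)"
    and "\<And>C. C \<in> components \<Omega> \<Longrightarrow> locally_finite_perimeter C"
    and "\<And>C. C \<in> components \<Lambda> \<Longrightarrow> locally_finite_perimeter C"
  shows "\<not> trajectory_unique V \<rho> J"
proof
  assume unique: "trajectory_unique V \<rho> J"
  obtain g where g: "\<And>x. GDERIV V x :> g x"
    using assms(1) by (auto simp: C11_loc_def)
  have V_cont: "continuous_on UNIV V"
    using has_derivative_continuous[OF g[unfolded gderiv_def]] by (simp add: continuous_at_imp_continuous_on)
  obtain l where l: "\<And>x. l \<le> V x"
    using assms(2) by (auto simp: bdd_below_def)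
  define c0 where "c0 = 1 - l"
  have V_ge: "1 \<le> V x + c0" for x
    using l[of x] by (simp add: c0_def)
  obtain U u0 where U: "unitary_group U" "generator U = op_closure (hamiltonian V)"
    and u0: "u0 \<in> L2" "finite_energy V u0" and \<psi>: "\<And>t. \<psi> t \<in> L2" "\<And>t. AE x in lborel. \<psi> t x = U t u0 x"
    using assms(4) unfolding qhd_trajectory_of_def bounded_energy_solution_def by blast
  interpret schroedinger_group V c0 U
    by unfold_locales (rule V_cont V_ge U)+
  have u0_dom: "form_dom u0"
    using u0(2) by (simp only: form_dom_iff)
  have "\<forall>t. \<exists>G. H1_gradient (\<psi> t) G \<and> (AE x in lborel. J t x = (\<Sum>b\<in>Basis. Im (cnj (\<psi> t x) * G b x) *\<^sub>R b))"
    using assms(4) unfolding qhd_trajectory_of_def is_current_def by blast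
  from choice[OF this] obtain G where G: "\<And>t. H1_gradient (\<psi> t) (G t)"
    and J: "\<And>t. AE x in lborel. J t x = (\<Sum>b\<in>Basis. Im (cnj (\<psi> t x) * G t b x) *\<^sub>R b)"
    by blast
  have \<Omega>_iff: "(x, t) \<in> \<Omega> \<longleftrightarrow> \<psi> t x \<noteq> 0" for x t
    by (simp add: assms(6,7))
  have \<Lambda>_iff: "x \<in> \<Lambda> \<longleftrightarrow> \<psi> T x \<noteq> 0" for x
    by (simp add: assms(6,8))
  obtain C C' K where C: "C \<in> components \<Lambda>" "C' \<in> components \<Lambda>" "C \<noteq> C'" and K: "K \<in> components \<Omega>"
    "C \<times> {T} \<subseteq> K" "C' \<times> {T} \<subseteq> K"
    by (rule components_merge[OF assms(9,10)]) (auto simp: \<Omega>_iff \<Lambda>_iff)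
  have \<psi>T_cont: "continuous_on UNIV (\<psi> T)"
  proof -
    have "continuous_on UNIV (\<lambda>x. (\<lambda>(x, t). \<psi> t x) (x, T))"
      by (rule continuous_on_compose2[OF assms(5)]) (auto intro!: continuous_intros)
    then show ?thesis
      by simp
  qed
  have \<Lambda>_eq: "\<Lambda> = {x. \<psi> T x \<noteq> 0}"
    using \<Lambda>_iff by blast
  have \<Lambda>_open: "open \<Lambda>"
    unfolding \<Lambda>_eq by (intro open_Collect_neq \<psi>T_cont continuous_on_const)
  \<comment> \<open>The remaining components together. They form an open set disjoint from
    \<open>C\<close>, which is the splitting that \<open>H1_indicator\<close> asks for.\<close>
  define D where "D = \<Union> (components \<Lambda> - {C})"
  have C_open: "open C" and D_open: "open D"
    using open_components[OF \<Lambda>_open] C(1) by (auto simp: D_def)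
  have CD: "C \<inter> D = {}" "{x. \<psi> T x \<noteq> 0} = C \<union> D"
  proof -
    have "C \<inter> B = {}" if "B \<in> components \<Lambda>" "B \<noteq> C" for B
      using components_nonoverlap[OF C(1) that(1)] that(2) by blast
    then show "C \<inter> D = {}"
      by (auto simp: D_def)
    have "\<Union> (components \<Lambda>) = C \<union> D"
      unfolding D_def using C(1) by blast
    then show "{x. \<psi> T x \<noteq> 0} = C \<union> D"
      unfolding \<Lambda>_eq[symmetric] by simp
  qed
  define w where "w x = indicator C x * \<psi> T x" for x
  have w: "H1_gradient w (\<lambda>b x. indicator C x * G T b x)"
    unfolding w_def[abs_def] by (rule H1_indicator[OF G \<psi>T_cont C_open D_open CD])
  \<comment> \<open>Finite energy at time \<open>T\<close> is inherited from the initial datum by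
    invariance of the form domain.\<close>
  have \<psi>T_dom: "form_dom (\<psi> T)"
    by (rule form_dom_cong_AE(1)[OF U_form_approx(1)[OF u0_dom] L2_D(1)[OF \<psi>(1)] \<psi>(2)])
  have "weight w = (\<lambda>x. indicator C x * weight (\<psi> T) x)"
    by (simp add: w_def[abs_def] weight_mult fun_eq_iff)
  moreover have "(\<lambda>x. indicator C x * weight (\<psi> T) x) \<in> L2"
  proof (rule L2_mult_bounded(1)[OF form_domD(2)[OF \<psi>T_dom], of _ 1])
    show "(indicator C :: 'a \<Rightarrow> complex) \<in> borel_measurable borel"
      by (intro borel_measurable_indicator borel_open C_open)
    show "cmod (indicator C x) \<le> 1" for x
      by (simp add: indicator_def)
  qed
  ultimately have w_dom: "form_dom w"
    using w by (auto simp: form_dom_def)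
  \<comment> \<open>The phase of \<open>\<psi>\<close> at time \<open>T\<close> is turned by \<open>\<pi>\<close> on the component \<open>C\<close> only.\<close>
  define vT where "vT x = (\<psi> T x - w x) - w x" for x
  have vT: "vT x = (if x \<in> C then - \<psi> T x else \<psi> T x)" for x
    by (simp add: vT_def w_def)
  have vT_dom: "form_dom vT"
    unfolding vT_def[abs_def] by (intro form_dom_diff \<psi>T_dom w_dom)
  have vT_grad: "H1_gradient vT (\<lambda>b x. (G T b x - indicator C x * G T b x) - indicator C x * G T b x)"
    unfolding vT_def[abs_def] by (rule H1_gradient_diff[OF H1_gradient_diff[OF G w] w])
  \<comment> \<open>The datum at time 0 whose evolution reaches \<open>vT\<close> at time
    \<open>T\<close>; backward invariance of the form domain gives it finite energy.\<close>
  define v where "v = U (- T) vT"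
  have v_dom: "form_dom v"
    unfolding v_def by (rule U_form_approx(1)[OF vT_dom])
  have vT_AE: "AE x in lborel. U T v x = vT x"
    unfolding v_def by (rule U_inverse(1)[OF form_domD(1)[OF vT_dom]])
  let ?\<sigma> = "\<lambda>t x. (cmod (U t v x))\<^sup>2" and ?I = "\<lambda>t. current (U t v)"
  have "qhd_trajectory V ?\<sigma> ?I"
    unfolding qhd_trajectory_def using trajectory[OF v_dom] by blast
  moreover have "same_state (\<rho> T) (J T) (?\<sigma> T) (?I T)"
    unfolding same_state_def
  proof
    show "AE x in lborel. \<rho> T x = ?\<sigma> T x"
      using vT_AE by eventually_elim (simp add: assms(6) vT)
    note d = U_form_approx(1)[OF v_dom, of T]
    have "H1_gradient (U T v) (\<lambda>b x. (G T b x - indicator C x * G T b x) - indicator C x * G T b x)"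
      by (rule H1_gradient_cong_AE[OF vT_grad L2_D(1)[OF form_domD(1)[OF d]] vT_AE])
    from H1_gradient_unique[OF form_domD(3)[OF d] this]
    have "AE x in lborel. \<forall>b\<in>Basis. grad (U T v) b x = (G T b x - indicator C x * G T b x) - indicator C x * G T b x"
      by (simp add: AE_finite_all)
    then show "AE x in lborel. J T x = ?I T x"
      using J[of T] vT_AE
    proof eventually_elim
      case (elim x)
      \<comment> \<open>On \<open>C\<close> both factors change sign, so their product is that of
        the original state.\<close>
      have "cnj (U T v x) * grad (U T v) b x = cnj (\<psi> T x) * G T b x" if "b \<in> Basis" for b
        using elim(1,3) that by (auto simp: vT)
      then show ?case
        unfolding elim(2) current_def by (intro sum.cong) auto
    qed
  qed
  ultimately have same: "same_state (\<rho> t) (J t) (?\<sigma> t) (?I t)" for t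
    using unique unfolding trajectory_unique_def by blast
  have dens: "AE x in lborel. cmod (U t v x) = cmod (\<psi> t x)" for t
  proof -
    have "AE x in lborel. \<rho> t x = ?\<sigma> t x"
      using same[of t] by (simp add: same_state_def)
    then show ?thesis
    proof eventually_elim
      case (elim x)
      then show ?case
        unfolding assms(6) by (simp add: power2_eq_iff_nonneg)
    qed
  qed
  have cur: "AE x in lborel. Im (cnj (U t v x) * grad (U t v) b x) = Im (cnj (\<psi> t x) * G t b x)"
    if b: "b \<in> Basis" for t b
  proof -
    have "AE x in lborel. J t x = ?I t x"
      using same[of t] by (simp add: same_state_def)
    then show ?thesis
      using J[of t]
    proof eventually_elim
      case (elim x)
      then have "?I t x \<bullet> b = (\<Sum>b\<in>Basis. Im (cnj (\<psi> t x) * G t b x) *\<^sub>R b) \<bullet> b"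
        by simp
      then show ?case
        using b by (simp only: current_def inner_sum_left_Basis)
    qed
  qed
  have K_nz: "\<psi> t x \<noteq> 0" if "(x, t) \<in> K" for x t
    using in_components_subset[OF K(1)] that \<Omega>_iff by blast
  obtain k where k: "\<forall>(x0, t0)\<in>K. \<exists>r>0. AE x in lborel. x \<in> ball x0 r \<longrightarrow> U t0 v x = k * \<psi> t0 x"
    using constant_ratio_on_connected[OF u0(1) v_dom \<psi>(2) G assms(5) dens cur in_components_connected[OF K(1)] K_nz]
    by blast
  \<comment> \<open>The ratio is known almost everywhere only, but \<open>B\<close> meets the ball
    in a nonempty open set, so some point of \<open>B\<close> satisfies it together with the
    explicit formula for \<open>vT\<close>.\<close>
  have ratio_at: "\<exists>x\<in>B. vT x = k * \<psi> T x \<and> \<psi> T x \<noteq> 0" if B: "B \<in> components \<Lambda>" "B \<times> {T} \<subseteq> K" for B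
  proof -
    obtain x0 where x0: "x0 \<in> B"
      using in_components_nonempty[OF B(1)] by blast
    then have "(x0, T) \<in> K"
      using B(2) by blast
    then obtain r where r: "0 < r" "AE x in lborel. x \<in> ball x0 r \<longrightarrow> U T v x = k * \<psi> T x"
      using k by blast
    have "open (B \<inter> ball x0 r)"
      using open_components[OF \<Lambda>_open B(1)] by auto
    moreover have "B \<inter> ball x0 r \<noteq> {}"
      using x0 r(1) by auto
    moreover have "AE x in lborel. x \<in> ball x0 r \<longrightarrow> vT x = k * \<psi> T x"
      using r(2) vT_AE by eventually_elim simp
    ultimately obtain x where "x \<in> B \<inter> ball x0 r" "x \<in> ball x0 r \<longrightarrow> vT x = k * \<psi> T x"
      using AE_ex_open by blast
    then show ?thesis
      using in_components_subset[OF B(1)] \<Lambda>_iff by blast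
  qed
  obtain x where "x \<in> C" "vT x = k * \<psi> T x" and nz: "\<psi> T x \<noteq> 0"
    using ratio_at[OF C(1) K(2)] by blast
  then have "k * \<psi> T x = -1 * \<psi> T x"
    by (simp add: vT)
  then have "k = -1"
    using mult_right_cancel[OF nz] by blast
  moreover obtain x' where "x' \<in> C'" "vT x' = k * \<psi> T x'" "\<psi> T x' \<noteq> 0"
    using ratio_at[OF C(2) K(3)] by blast
  moreover have "x' \<notin> C"
    using components_nonoverlap[OF C(1,2)] C(3) \<open>x' \<in> C'\<close> by blast
  ultimately show False
    by (simp add: vT)
qed

end
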